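(* Let $L$ be a free monoid, let $Q=\mathbb Z_{\mathrm{nil}}[L]$ be the corresponding monoid square ring, and let $R=Q^{\mathrm{ad}}=\mathbb Z[L]$. Then for any $R$-$R$-bimodule $B$ one has $$\mathrm{HML}^2(Q,B)=0=\mathrm{HML}^3(Q,B).$$
   Context: For a monoid $L$, the monoid square ring $Q=\mathbb Z_{\mathrm{nil}}[L]$ has $Q_e$ = free group of nilpotency class two generated by the set $L$, $Q_{ee}=\mathbb Z[L]\otimes\mathbb Z[L]$, $P(s\otimes t)=[t,s]$ (with $[x,y]=-x-y+x+y$), $H(s)=0$ and $(s\mid t)_H=H(s+t)-H(t)-H(s)=t\otimes s$ for $s,t\in L$, with multiplication on $Q_e$ extending that of $L$ and $\mathbb Z[L]\otimes\mathbb Z[L]\otimes\mathbb Z[L]^{\mathrm{op}}$-module structure on $Q_{ee}$ given by $(x\otimes y)(s\otimes t)z=xsz\otimes ytz$ for $x,y,z,s,t\in L$; $Q^{\mathrm{ad}}=\mathrm{Coker}(P)=\mathbb Z[L]$ is the ordinary monoid ring. The category $\mathbf{Mod}\text{-}Q$ of right $Q$-modules is (isomorphic to) the category of groups $G$ of nilpotency class two equipped with a right action of the monoid $L$ by group endomorphisms. $\mathbf{mod}\text{-}Q$ is the (small) category of finitely generated free right $Q$-modules, with objects natural numbers. There is a functor $q:\mathbf{mod}\text{-}Q\to\mathbf{mod}\text{-}R$ to the category of finitely generated free right $R$-modules, given by $X\mapsto X^{\mathrm{ad}}=X_{\mathrm{ab}}$ (abelianization). For an $R$-$R$-bimodule $B$,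 $D_B$ is the bifunctor $(X,Y)\mapsto\mathrm{Hom}_R(X,Y\otimes_RB)$ on $\mathbf{mod}\text{-}R$, and also denotes its pullback along $q$ to $\mathbf{mod}\text{-}Q$. Define $\mathrm{HML}^n(Q,B):=H^n(\mathbf{mod}\text{-}Q;D_B)$, where for a small category $\mathscr C$ and a bifunctor $D:\mathscr C^{\mathrm{op}}\times\mathscr C\to\mathsf{Ab}$ the Baues–Wirsching cohomology $H^*(\mathscr C;D)$ is the cohomology of the complex $F^n(\mathscr C,D)=\prod_{c_0\xleftarrow{\alpha_1}\cdots\xleftarrow{\alpha_n}c_n}D(c_n,c_0)$ with $(df)(\alpha_1,\dots,\alpha_{n+1})=(\alpha_1)_*f(\alpha_2,\dots,\alpha_{n+1})+\sum_{i=1}^n(-1)^if(\alpha_1,\dots,\alpha_i\alpha_{i+1},\dots,\alpha_{n+1})+(-1)^{n+1}(\alpha_{n+1})^*f(\alpha_1,\dots,\alpha_n)$. *)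

theory Defs
  imports "HOL-Algebra.Product_Groups" "HOL-Algebra.Free_Abelian_Groups" "HOL-Algebra.Elementary_Groups"
    "HOL-Algebra.Generated_Groups"
begin

section \<open>Groups with operators and modules over a ring\<close>

text \<open>
  A group together with a right action of a set of operators.  Both kinds of modules below are
  of this form: right modules over \<open>\<int>\<^sub>n\<^sub>i\<^sub>l[L]\<close> have the elements of the monoid \<open>L\<close> as operators, right
  modules over a ring have the elements of the ring as operators.  Groups are written
  multiplicatively, as in HOL-Algebra, also when they are abelian.
\<close>

record ('x, 's) op_group = "'x monoid" +
  ract :: "'x \<Rightarrow> 's \<Rightarrow> 'x" (infixl \<open>\<triangleleft>\<index>\<close> 75)

definition op_hom :: "('x, 's, 'm) op_group_scheme \<Rightarrow> ('y, 's, 'n) op_group_scheme \<Rightarrow> ('x \<Rightarrow> 'y) set"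
  where "op_hom M N =
    {f \<in> hom M N \<inter> extensional (carrier M). \<forall>x \<in> carrier M. \<forall>s. f (x \<triangleleft>\<^bsub>M\<^esub> s) = f x \<triangleleft>\<^bsub>N\<^esub> s}"

definition hom_group :: "('x, 's, 'm) op_group_scheme \<Rightarrow> ('y, 's, 'n) op_group_scheme \<Rightarrow> ('x \<Rightarrow> 'y) monoid"
  where "hom_group M N =
    \<lparr>carrier = op_hom M N,
     monoid.mult = (\<lambda>f g. \<lambda>x \<in> carrier M. f x \<otimes>\<^bsub>N\<^esub> g x),
     one = (\<lambda>x \<in> carrier M. \<one>\<^bsub>N\<^esub>)\<rparr>"

record ('b, 'r) bi_op_group = "('b, 'r) op_group" +
  lact :: "'r \<Rightarrow> 'b \<Rightarrow> 'b" (infixr \<open>\<triangleright>\<index>\<close> 76)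

locale bimodule = comm_group B for B :: "('b, 'r :: ring_1, 'm) bi_op_group_scheme" (structure) +
  assumes ract_closed: "x \<in> carrier B \<Longrightarrow> x \<triangleleft> r \<in> carrier B"
    and ract_mult: "\<lbrakk>x \<in> carrier B; y \<in> carrier B\<rbrakk> \<Longrightarrow> (x \<otimes> y) \<triangleleft> r = (x \<triangleleft> r) \<otimes> (y \<triangleleft> r)"
    and ract_add: "x \<in> carrier B \<Longrightarrow> x \<triangleleft> (r + s) = (x \<triangleleft> r) \<otimes> (x \<triangleleft> s)"
    and ract_times: "x \<in> carrier B \<Longrightarrow> x \<triangleleft> (r * s) = (x \<triangleleft> r) \<triangleleft> s"
    and ract_one: "x \<in> carrier B \<Longrightarrow> x \<triangleleft> 1 = x"
    and lact_closed: "x \<in> carrier B \<Longrightarrow> r \<triangleright> x \<in> carrier B"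
    and lact_mult: "\<lbrakk>x \<in> carrier B; y \<in> carrier B\<rbrakk> \<Longrightarrow> r \<triangleright> (x \<otimes> y) = (r \<triangleright> x) \<otimes> (r \<triangleright> y)"
    and lact_add: "x \<in> carrier B \<Longrightarrow> (r + s) \<triangleright> x = (r \<triangleright> x) \<otimes> (s \<triangleright> x)"
    and lact_times: "x \<in> carrier B \<Longrightarrow> (r * s) \<triangleright> x = r \<triangleright> (s \<triangleright> x)"
    and lact_one: "x \<in> carrier B \<Longrightarrow> 1 \<triangleright> x = x"
    and lact_ract: "x \<in> carrier B \<Longrightarrow> (r \<triangleright> x) \<triangleleft> s = r \<triangleright> (x \<triangleleft> s)"

text \<open>
  The tensor product \<open>N \<otimes>\<^sub>R B\<close> of a right module with a bimodule: the free abelian group on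
  \<open>N \<times> B\<close> modulo the usual relations.
\<close>

definition tensor_free ::
    "('y, 'r, 'm) op_group_scheme \<Rightarrow> ('b, 'r, 'n) bi_op_group_scheme \<Rightarrow> ('y \<times> 'b \<Rightarrow>\<^sub>0 int) monoid"
  where "tensor_free N B = free_Abelian_group (carrier N \<times> carrier B)"

definition tensor_rels ::
    "('y, 'r, 'm) op_group_scheme \<Rightarrow> ('b, 'r, 'n) bi_op_group_scheme \<Rightarrow> ('y \<times> 'b \<Rightarrow>\<^sub>0 int) set"
  where "tensor_rels N B = generate (tensor_free N B)
    ({frag_of (y \<otimes>\<^bsub>N\<^esub> y', b) - frag_of (y, b) - frag_of (y', b) | y y' b.
        y \<in> carrier N \<and> y' \<in> carrier N \<and> b \<in> carrier B}
     \<union> {frag_of (y, b \<otimes>\<^bsub>B\<^esub> b') - frag_of (y, b) - frag_of (y, b') | y b b'.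
        y \<in> carrier N \<and> b \<in> carrier B \<and> b' \<in> carrier B}
     \<union> {frag_of (y \<triangleleft>\<^bsub>N\<^esub> r, b) - frag_of (y, r \<triangleright>\<^bsub>B\<^esub> b) | y r b.
        y \<in> carrier N \<and> b \<in> carrier B})"

definition tensor ::
    "('y, 'r, 'm) op_group_scheme \<Rightarrow> ('b, 'r, 'n) bi_op_group_scheme \<Rightarrow> (('y \<times> 'b \<Rightarrow>\<^sub>0 int) set, 'r) op_group"
  where "tensor N B =
    \<lparr>carrier = carrier (tensor_free N B Mod tensor_rels N B),
     monoid.mult = (\<otimes>\<^bsub>tensor_free N B Mod tensor_rels N B\<^esub>),
     one = \<one>\<^bsub>tensor_free N B Mod tensor_rels N B\<^esub>,
     ract = (\<lambda>U r. \<Union>u \<in> U. tensor_rels N B #>\<^bsub>tensor_free N B\<^esub>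
               frag_extend (\<lambda>(y, b). frag_of (y, b \<triangleleft>\<^bsub>B\<^esub> r)) u)\<rparr>"

text \<open>The map \<open>f \<otimes> B\<close> induced by \<open>f\<close>; only the codomain \<open>N\<close> of \<open>f\<close> enters the formula.\<close>

definition tensor_map ::
    "('y, 'r, 'm) op_group_scheme \<Rightarrow> ('b, 'r, 'n) bi_op_group_scheme \<Rightarrow> ('x \<Rightarrow> 'y)
      \<Rightarrow> ('x \<times> 'b \<Rightarrow>\<^sub>0 int) set \<Rightarrow> ('y \<times> 'b \<Rightarrow>\<^sub>0 int) set"
  where "tensor_map N B f =
    (\<lambda>U. \<Union>u \<in> U. tensor_rels N B #>\<^bsub>tensor_free N B\<^esub> frag_extend (\<lambda>(x, b). frag_of (f x, b)) u)"

section \<open>Baues--Wirsching cohomology with coefficients in a bifunctor\<close>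

record ('o, 'a) cat =
  Ob :: "'o set"
  Ar :: "'a set"
  Dom :: "'a \<Rightarrow> 'o"
  Cod :: "'a \<Rightarrow> 'o"
  Comp :: "'a \<Rightarrow> 'a \<Rightarrow> 'a"

text \<open>
  A bifunctor to abelian groups, contravariant in the first and covariant in the second variable:
  \<open>push D M \<alpha> : D(M,N) \<rightarrow> D(M,N')\<close> for \<open>\<alpha> : N \<rightarrow> N'\<close>, and
  \<open>pull D \<alpha> N : D(M,N) \<rightarrow> D(M',N)\<close> for \<open>\<alpha> : M' \<rightarrow> M\<close>.
\<close>

record ('o, 'a, 'd) bifunctor =
  val :: "'o \<Rightarrow> 'o \<Rightarrow> 'd monoid"
  push :: "'o \<Rightarrow> 'a \<Rightarrow> 'd \<Rightarrow> 'd"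
  pull :: "'a \<Rightarrow> 'o \<Rightarrow> 'd \<Rightarrow> 'd"

definition pullback :: "('o \<Rightarrow> 'p) \<Rightarrow> ('a \<Rightarrow> 'b) \<Rightarrow> ('p, 'b, 'd) bifunctor \<Rightarrow> ('o, 'a, 'd) bifunctor"
  where "pullback q\<^sub>o q\<^sub>a D =
    \<lparr>val = (\<lambda>M N. val D (q\<^sub>o M) (q\<^sub>o N)),
     push = (\<lambda>M \<alpha>. push D (q\<^sub>o M) (q\<^sub>a \<alpha>)),
     pull = (\<lambda>\<alpha> N. pull D (q\<^sub>a \<alpha>) (q\<^sub>o N))\<rparr>"

text \<open>
  \<open>is_chain C c [\<alpha>\<^sub>1, \<dots>, \<alpha>\<^sub>n] c'\<close> means that \<open>c = c\<^sub>0 \<leftarrow> \<dots> \<leftarrow> c\<^sub>n = c'\<close> is a chain of composable arrows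
  \<open>\<alpha>\<^sub>i : c\<^sub>i \<rightarrow> c\<^sub>i\<^sub>-\<^sub>1\<close>.
\<close>

primrec is_chain :: "('o, 'a, 'm) cat_scheme \<Rightarrow> 'o \<Rightarrow> 'a list \<Rightarrow> 'o \<Rightarrow> bool"
  where
    "is_chain C c [] c' \<longleftrightarrow> c \<in> Ob C \<and> c' = c"
  | "is_chain C c (\<alpha> # \<alpha>s) c' \<longleftrightarrow> \<alpha> \<in> Ar C \<and> Cod C \<alpha> = c \<and> is_chain C (Dom C \<alpha>) \<alpha>s c'"

definition chains :: "('o, 'a, 'm) cat_scheme \<Rightarrow> nat \<Rightarrow> ('o \<times> 'a list \<times> 'o) set"
  where "chains C n = {(c, \<alpha>s, c'). length \<alpha>s = n \<and> is_chain C c \<alpha>s c'}"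

definition cochains ::
    "('o, 'a, 'm) cat_scheme \<Rightarrow> ('o, 'a, 'd) bifunctor \<Rightarrow> nat \<Rightarrow> ('o \<times> 'a list \<times> 'o \<Rightarrow> 'd) monoid"
  where "cochains C D n = product_group (chains C n) (\<lambda>(c, \<alpha>s, c'). val D c' c)"

definition comp_at :: "('o, 'a, 'm) cat_scheme \<Rightarrow> nat \<Rightarrow> 'a list \<Rightarrow> 'a list"
  where \<comment> \<open>positions are counted from 1: \<open>\<alpha>\<^sub>i\<close> and \<open>\<alpha>\<^sub>i\<^sub>+\<^sub>1\<close> are replaced by \<open>\<alpha>\<^sub>i \<alpha>\<^sub>i\<^sub>+\<^sub>1\<close>\<close>
    "comp_at C i \<alpha>s = take (i - 1) \<alpha>s @ [Comp C (\<alpha>s ! (i - 1)) (\<alpha>s ! i)] @ drop (i + 1) \<alpha>s"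

definition coboundary ::
    "('o, 'a, 'm) cat_scheme \<Rightarrow> ('o, 'a, 'd) bifunctor \<Rightarrow> nat
      \<Rightarrow> ('o \<times> 'a list \<times> 'o \<Rightarrow> 'd) \<Rightarrow> ('o \<times> 'a list \<times> 'o \<Rightarrow> 'd)"
  where "coboundary C D n f =
    (\<lambda>(c, \<alpha>s, c') \<in> chains C (Suc n).
        push D c' (hd \<alpha>s) (f (Dom C (hd \<alpha>s), tl \<alpha>s, c'))
        \<otimes>\<^bsub>val D c' c\<^esub>
        (\<Otimes>\<^bsub>val D c' c\<^esub>i \<in> {1..n}. f (c, comp_at C i \<alpha>s, c') [^]\<^bsub>val D c' c\<^esub> ((-1) ^ i :: int))
        \<otimes>\<^bsub>val D c' c\<^esub>
        pull D (last \<alpha>s) c (f (c, butlast \<alpha>s, Cod C (last \<alpha>s))) [^]\<^bsub>val D c' c\<^esub> ((-1) ^ (n + 1) :: int))"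

definition cocycles ::
    "('o, 'a, 'm) cat_scheme \<Rightarrow> ('o, 'a, 'd) bifunctor \<Rightarrow> nat \<Rightarrow> ('o \<times> 'a list \<times> 'o \<Rightarrow> 'd) set"
  where "cocycles C D n = kernel (cochains C D n) (cochains C D (Suc n)) (coboundary C D n)"

primrec coboundaries ::
    "('o, 'a, 'm) cat_scheme \<Rightarrow> ('o, 'a, 'd) bifunctor \<Rightarrow> nat \<Rightarrow> ('o \<times> 'a list \<times> 'o \<Rightarrow> 'd) set"
  where
    "coboundaries C D 0 = {\<one>\<^bsub>cochains C D 0\<^esub>}"
  | "coboundaries C D (Suc n) = coboundary C D n ` carrier (cochains C D n)"

definition cohomology ::
    "('o, 'a, 'm) cat_scheme \<Rightarrow> ('o, 'a, 'd) bifunctor \<Rightarrow> nat \<Rightarrow> ('o \<times> 'a list \<times> 'o \<Rightarrow> 'd) set monoid"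
  where "cohomology C D n =
    (cochains C D n)\<lparr>carrier := cocycles C D n\<rparr> Mod coboundaries C D n"

section \<open>The monoid square ring\<close>

text \<open>
  The monoid \<open>L\<close> is a type of class \<^class>\<open>monoid_add\<close> (not assumed commutative), written
  additively, so that the monoid ring \<open>\<int>[L]\<close> is the type of finitely supported functions
  \<open>L \<Rightarrow>\<^sub>0 int\<close> with the convolution product of \<^theory>\<open>HOL-Library.Poly_Mapping\<close>.
\<close>

type_synonym 'l monoid_ring = "'l \<Rightarrow>\<^sub>0 int"

definition free_monoid_on :: "'l::monoid_add set \<Rightarrow> bool"
  where "free_monoid_on S \<longleftrightarrow> bij_betw sum_list (lists S) (UNIV :: 'l set)"

text \<open>
  Right modules over the square ring \<open>\<int>\<^sub>n\<^sub>i\<^sub>l[L]\<close>: groups of nilpotency class (at most) two with a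
  right action of \<open>L\<close> by endomorphisms.
\<close>

locale nil_module = group M for M :: "('x, 'l :: monoid_add, 'm) op_group_scheme" (structure) +
  assumes commutator_central: "\<lbrakk>x \<in> carrier M; y \<in> carrier M; z \<in> carrier M\<rbrakk> \<Longrightarrow>
      (inv x \<otimes> inv y \<otimes> x \<otimes> y) \<otimes> z = z \<otimes> (inv x \<otimes> inv y \<otimes> x \<otimes> y)"
    and ract_closed: "x \<in> carrier M \<Longrightarrow> x \<triangleleft> s \<in> carrier M"
    and ract_mult: "\<lbrakk>x \<in> carrier M; y \<in> carrier M\<rbrakk> \<Longrightarrow> (x \<otimes> y) \<triangleleft> s = (x \<triangleleft> s) \<otimes> (y \<triangleleft> s)"
    and ract_add: "x \<in> carrier M \<Longrightarrow> x \<triangleleft> (s + t) = (x \<triangleleft> s) \<triangleleft> t"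
    and ract_zero: "x \<in> carrier M \<Longrightarrow> x \<triangleleft> 0 = x"

text \<open>
  The free group of nilpotency class two on a set \<open>S\<close>, as words in the letters \<open>x\<close> \<open>= (x, True)\<close>
  and \<open>x\<^sup>-\<^sup>1\<close> \<open>= (x, False)\<close> modulo free reduction and triviality of the triple commutators.
\<close>

type_synonym 'x word = "('x \<times> bool) list"

abbreviation words :: "'x set \<Rightarrow> 'x word set"
  where "words S \<equiv> lists (S \<times> UNIV)"

definition winv :: "'x word \<Rightarrow> 'x word"
  where "winv w = rev (map (\<lambda>(x, b). (x, \<not> b)) w)"

definition wcomm :: "'x word \<Rightarrow> 'x word \<Rightarrow> 'x word"
  where "wcomm u v = winv u @ winv v @ u @ v"

inductive nil2_eq :: "'x set \<Rightarrow> 'x word \<Rightarrow> 'x word \<Rightarrow> bool" for S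
  where
    refl: "u \<in> words S \<Longrightarrow> nil2_eq S u u"
  | sym: "nil2_eq S u v \<Longrightarrow> nil2_eq S v u"
  | trans: "nil2_eq S u v \<Longrightarrow> nil2_eq S v w \<Longrightarrow> nil2_eq S u w"
  | append: "nil2_eq S u u' \<Longrightarrow> nil2_eq S v v' \<Longrightarrow> nil2_eq S (u @ v) (u' @ v')"
  | cancel: "x \<in> S \<Longrightarrow> nil2_eq S [(x, b), (x, \<not> b)] []"
  | nil2: "u \<in> words S \<Longrightarrow> v \<in> words S \<Longrightarrow> w \<in> words S \<Longrightarrow> nil2_eq S (wcomm (wcomm u v) w) []"

definition nil2_rel :: "'x set \<Rightarrow> 'x word rel"
  where "nil2_rel S = {(u, v). nil2_eq S u v}"

text \<open>
  The free right \<open>\<int>\<^sub>n\<^sub>i\<^sub>l[L]\<close>-module of rank \<open>n\<close>: the free group of nilpotency class two on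
  \<open>{0, \<dots>, n - 1} \<times> L\<close>, where \<open>L\<close> acts by right translations on the second factor.  For \<open>n = 1\<close> this
  is \<open>\<int>\<^sub>n\<^sub>i\<^sub>l[L]\<^sub>e\<close>.
\<close>

definition free_nil_module :: "nat \<Rightarrow> ((nat \<times> 'l::monoid_add) word set, 'l) op_group"
  where "free_nil_module n =
    (let S = {..<n} \<times> UNIV in
    \<lparr>carrier = words S // nil2_rel S,
     monoid.mult = (\<lambda>U V. \<Union>u \<in> U. \<Union>v \<in> V. nil2_rel S `` {u @ v}),
     one = nil2_rel S `` {[]},
     ract = (\<lambda>U t. \<Union>u \<in> U. nil2_rel S `` {map (\<lambda>((i, s), b). ((i, s + t), b)) u})\<rparr>)"

definition free_nil_gen :: "nat \<Rightarrow> nat \<Rightarrow> (nat \<times> 'l::monoid_add) word set"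
  where "free_nil_gen n i = nil2_rel ({..<n} \<times> UNIV) `` {[((i, 0), True)]}"

lemma nil2_eq_words: "nil2_eq S u v \<Longrightarrow> u \<in> words S \<and> v \<in> words S"
  by (induction rule: nil2_eq.induct) (auto simp: wcomm_def winv_def)

lemma equiv_nil2_rel: "equiv (words S) (nil2_rel S)"
proof (rule equivI)
  show "nil2_rel S \<subseteq> words S \<times> words S"
    using nil2_eq_words by (fastforce simp: nil2_rel_def)
  show "refl_on (words S) (nil2_rel S)"
    by (auto simp: refl_on_def nil2_rel_def intro: nil2_eq.refl)
  show "sym_on UNIV (nil2_rel S)"
    by (auto simp: sym_on_def nil2_rel_def intro: nil2_eq.sym)
  show "trans (nil2_rel S)"
    by (auto simp: trans_def nil2_rel_def intro: nil2_eq.trans)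
qed

lemma nil2_class_eq_iff:
  assumes "u \<in> words S" "v \<in> words S"
  shows "nil2_rel S `` {u} = nil2_rel S `` {v} \<longleftrightarrow> nil2_eq S u v"
  using eq_equiv_class_iff[OF equiv_nil2_rel assms] by (simp add: nil2_rel_def)

lemma nil2_eq_map:
  assumes "nil2_eq S u v" "\<And>x. x \<in> S \<Longrightarrow> h x \<in> T"
  shows "nil2_eq T (map (\<lambda>(x, b). (h x, b)) u) (map (\<lambda>(x, b). (h x, b)) v)"
  using assms(1)
proof (induction rule: nil2_eq.induct)
  case (refl u)
  then show ?case using assms(2) by (intro nil2_eq.refl) fastforce
next
  case (cancel x b)
  then show ?case using assms(2) by (auto intro: nil2_eq.cancel)
next
  case (nil2 u v w)
  have winv: "map (\<lambda>(x, b). (h x, b)) (winv w) = winv (map (\<lambda>(x, b). (h x, b)) w)" for w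
    by (auto simp: winv_def rev_map)
  have "map (\<lambda>(x, b). (h x, b)) w \<in> words T" if "w \<in> words S" for w
    using that assms(2) by fastforce
  note mem = this[OF nil2(1)] this[OF nil2(2)] this[OF nil2(3)]
  have wcomm: "map (\<lambda>(x, b). (h x, b)) (wcomm v w)
      = wcomm (map (\<lambda>(x, b). (h x, b)) v) (map (\<lambda>(x, b). (h x, b)) w)" for v w
    unfolding wcomm_def map_append winv ..
  show ?case unfolding wcomm list.map(1) by (rule nil2_eq.nil2[OF mem])
next
  case (sym u v)
  show ?case by (rule nil2_eq.sym[OF sym.IH])
next
  case (trans u v w)
  show ?case by (rule nil2_eq.trans[OF trans.IH])
next
  case (append u u' v v')
  show ?case unfolding map_append by (rule nil2_eq.append[OF append.IH])
qed

lemma nil2_eq_winv: "u \<in> words S \<Longrightarrow> nil2_eq S (winv u @ u) []"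
proof (induction u)
  case Nil
  then show ?case by (auto simp: winv_def intro: nil2_eq.refl)
next
  case (Cons a u)
  obtain x b where a: "a = (x, b)" by force
  have x: "x \<in> S" and u: "u \<in> words S" using Cons.prems a by auto
  have iu: "winv u \<in> words S" using u by (auto simp: winv_def)
  have "nil2_eq S ([(x, \<not> b)] @ [(x, b)]) []" using nil2_eq.cancel[OF x, of "\<not> b"] by simp
  from nil2_eq.append[OF nil2_eq.append[OF nil2_eq.refl[OF iu] this] nil2_eq.refl[OF u]]
  have "nil2_eq S (winv (a # u) @ (a # u)) (winv u @ u)" by (simp add: winv_def a)
  then show ?case using Cons.IH[OF u] nil2_eq.trans by blast
qed

lemma free_nil_module_mult:
  fixes u v :: "(nat \<times> 'l::monoid_add) word"
  assumes "u \<in> words ({..<n} \<times> UNIV)" "v \<in> words ({..<n} \<times> UNIV)"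
  shows "nil2_rel ({..<n} \<times> UNIV) `` {u} \<otimes>\<^bsub>free_nil_module n\<^esub> nil2_rel ({..<n} \<times> UNIV) `` {v}
    = nil2_rel ({..<n} \<times> UNIV) `` {u @ v}"
proof -
  let ?S = "{..<n} \<times> (UNIV :: 'l set)"
  have "(\<lambda>u v. nil2_rel ?S `` {u @ v}) respects2 nil2_rel ?S"
    by (rule congruent2I'; (rule equiv_class_eq[OF equiv_nil2_rel])?)
      (auto simp: nil2_rel_def intro: nil2_eq.append)
  from UN_equiv_class2[OF equiv_nil2_rel equiv_nil2_rel this assms]
  show ?thesis by (simp add: free_nil_module_def Let_def)
qed

lemma free_nil_module_ract:
  fixes u :: "(nat \<times> 'l::monoid_add) word"
  assumes "u \<in> words ({..<n} \<times> UNIV)"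
  shows "nil2_rel ({..<n} \<times> UNIV) `` {u} \<triangleleft>\<^bsub>free_nil_module n\<^esub> t
    = nil2_rel ({..<n} \<times> UNIV) `` {map (\<lambda>((i, s), b). ((i, s + t), b)) u}"
proof -
  let ?S = "{..<n} \<times> (UNIV :: 'l set)"
  have eq: "(\<lambda>((i, s), b). ((i, s + t), b)) = (\<lambda>(x, b::bool). ((case x of (i, s) \<Rightarrow> (i, s + t)), b))"
    for t :: 'l by auto
  have "(\<lambda>u. nil2_rel ?S `` {map (\<lambda>((i, s), b). ((i, s + t), b)) u}) respects nil2_rel ?S"
    by (rule congruentI; rule equiv_class_eq[OF equiv_nil2_rel])
      (auto simp: nil2_rel_def eq intro!: nil2_eq_map)
  from UN_equiv_class[OF equiv_nil2_rel this assms]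
  show ?thesis by (simp add: free_nil_module_def Let_def)
qed

lemma free_nil_module_one: "\<one>\<^bsub>free_nil_module n\<^esub> = nil2_rel ({..<n} \<times> UNIV) `` {[]}"
  by (simp add: free_nil_module_def Let_def)

lemma free_nil_module_carrier:
  "carrier (free_nil_module n) = (\<lambda>u. nil2_rel ({..<n} \<times> UNIV) `` {u}) ` words ({..<n} \<times> UNIV)"
  by (auto simp: free_nil_module_def Let_def quotient_def)

lemma group_free_nil_module: "group (free_nil_module n :: ((nat \<times> 'l::monoid_add) word set, 'l) op_group)"
proof (rule groupI)
  let ?F = "free_nil_module n :: ((nat \<times> 'l) word set, 'l) op_group"
  note simps = free_nil_module_carrier free_nil_module_one free_nil_module_mult
  show "x \<otimes>\<^bsub>?F\<^esub> y \<in> carrier ?F" if "x \<in> carrier ?F" "y \<in> carrier ?F" for x y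
  proof -
    from that obtain u v where "u \<in> words ({..<n} \<times> UNIV)" "v \<in> words ({..<n} \<times> UNIV)"
      "x = nil2_rel ({..<n} \<times> UNIV) `` {u}" "y = nil2_rel ({..<n} \<times> UNIV) `` {v}"
      unfolding free_nil_module_carrier by blast
    then show ?thesis unfolding free_nil_module_carrier
      by (simp add: free_nil_module_mult append_in_lists_conv del: in_lists_conv_set)
  qed
  show "\<one>\<^bsub>?F\<^esub> \<in> carrier ?F" by (auto simp: simps)
  show "x \<otimes>\<^bsub>?F\<^esub> y \<otimes>\<^bsub>?F\<^esub> z = x \<otimes>\<^bsub>?F\<^esub> (y \<otimes>\<^bsub>?F\<^esub> z)"
    if "x \<in> carrier ?F" "y \<in> carrier ?F" "z \<in> carrier ?F" for x y z
  proof -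
    from that obtain u v w where "u \<in> words ({..<n} \<times> UNIV)" "v \<in> words ({..<n} \<times> UNIV)"
      "w \<in> words ({..<n} \<times> UNIV)" "x = nil2_rel ({..<n} \<times> UNIV) `` {u}"
      "y = nil2_rel ({..<n} \<times> UNIV) `` {v}" "z = nil2_rel ({..<n} \<times> UNIV) `` {w}"
      unfolding free_nil_module_carrier by blast
    then show ?thesis by (simp add: free_nil_module_mult append_in_lists_conv del: in_lists_conv_set)
  qed
  show "\<one>\<^bsub>?F\<^esub> \<otimes>\<^bsub>?F\<^esub> x = x" if "x \<in> carrier ?F" for x
  proof -
    from that obtain u where "u \<in> words ({..<n} \<times> UNIV)" "x = nil2_rel ({..<n} \<times> UNIV) `` {u}"
      unfolding free_nil_module_carrier by blast
    then show ?thesis by (simp add: free_nil_module_mult free_nil_module_one del: in_lists_conv_set)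
  qed
  show "\<exists>y\<in>carrier ?F. y \<otimes>\<^bsub>?F\<^esub> x = \<one>\<^bsub>?F\<^esub>" if "x \<in> carrier ?F" for x
  proof -
    from that obtain u where u: "u \<in> words ({..<n} \<times> UNIV)" "x = nil2_rel ({..<n} \<times> UNIV) `` {u}"
      unfolding free_nil_module_carrier by blast
    have iu: "winv u \<in> words ({..<n} \<times> UNIV)" using u(1) by (auto simp: winv_def)
    show ?thesis
    proof (rule bexI)
      show "nil2_rel ({..<n} \<times> UNIV) `` {winv u} \<otimes>\<^bsub>?F\<^esub> x = \<one>\<^bsub>?F\<^esub>"
        unfolding u(2) free_nil_module_mult[OF iu u(1)] free_nil_module_one
        by (rule equiv_class_eq[OF equiv_nil2_rel]) (use nil2_eq_winv[OF u(1)] in \<open>simp add: nil2_rel_def\<close>)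
    qed (use iu in \<open>auto simp: free_nil_module_carrier\<close>)
  qed
qed

lemma free_nil_module_inv:
  fixes u :: "(nat \<times> 'l::monoid_add) word"
  assumes "u \<in> words ({..<n} \<times> UNIV)"
  shows "inv\<^bsub>free_nil_module n\<^esub> (nil2_rel ({..<n} \<times> UNIV) `` {u}) = nil2_rel ({..<n} \<times> UNIV) `` {winv u}"
proof (rule group.inv_equality[OF group_free_nil_module])
  have iu: "winv u \<in> words ({..<n} \<times> UNIV)" using assms by (auto simp: winv_def)
  show "nil2_rel ({..<n} \<times> UNIV) `` {winv u} \<otimes>\<^bsub>free_nil_module n\<^esub> nil2_rel ({..<n} \<times> UNIV) `` {u}
     = \<one>\<^bsub>free_nil_module n\<^esub>"
    unfolding free_nil_module_mult[OF iu assms] free_nil_module_one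
    by (rule equiv_class_eq[OF equiv_nil2_rel]) (use nil2_eq_winv[OF assms] in \<open>simp add: nil2_rel_def\<close>)
qed (use assms in \<open>auto simp: free_nil_module_carrier winv_def intro!: imageI\<close>)

lemma (in group) commutator_one_iff:
  assumes "x \<in> carrier G" "y \<in> carrier G"
  shows "inv x \<otimes> inv y \<otimes> x \<otimes> y = \<one> \<longleftrightarrow> x \<otimes> y = y \<otimes> x"
proof -
  have "inv x \<otimes> inv y \<otimes> x \<otimes> y = inv (y \<otimes> x) \<otimes> (x \<otimes> y)"
    using assms by (simp add: inv_mult_group m_assoc)
  also have "\<dots> = \<one> \<longleftrightarrow> x \<otimes> y = (y \<otimes> x) \<otimes> \<one>"
    using assms by (intro inv_solve_left') simp_all
  finally show ?thesis using assms by simp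
qed

lemma nil_module_free_nil_module:
  "nil_module (free_nil_module n :: ((nat \<times> 'l::monoid_add) word set, 'l) op_group)"
proof -
  let ?F = "free_nil_module n :: ((nat \<times> 'l) word set, 'l) op_group"
  let ?W = "words ({..<n} \<times> (UNIV :: 'l set))"
  let ?c = "\<lambda>u. nil2_rel ({..<n} \<times> (UNIV :: 'l set)) `` {u}"
  let ?m = "\<lambda>t u. map (\<lambda>((i, s::'l), b::bool). ((i::nat, s + t), b)) u"
  interpret group ?F by (rule group_free_nil_module)
  have m: "?m t u \<in> ?W" if "u \<in> ?W" for t u using that by force
  have wc: "wcomm u v \<in> ?W" if "u \<in> ?W" "v \<in> ?W" for u v
    using that by (auto simp: wcomm_def winv_def)
  have wi: "winv u \<in> ?W" if "u \<in> ?W" for u using that by (auto simp: winv_def)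
  have c_in: "?c u \<in> carrier ?F" if "u \<in> ?W" for u using that by (auto simp: free_nil_module_carrier)
  have comm: "inv\<^bsub>?F\<^esub> ?c u \<otimes>\<^bsub>?F\<^esub> inv\<^bsub>?F\<^esub> ?c v \<otimes>\<^bsub>?F\<^esub> ?c u \<otimes>\<^bsub>?F\<^esub> ?c v = ?c (wcomm u v)"
    if "u \<in> ?W" "v \<in> ?W" for u v
    using that wi[OF that(1)] wi[OF that(2)]
    by (simp add: free_nil_module_inv free_nil_module_mult wcomm_def del: in_lists_conv_set)
  have rep: "\<exists>u\<in>?W. x = ?c u" if "x \<in> carrier ?F" for x
    using that by (auto simp: free_nil_module_carrier)
  show ?thesis
  proof unfold_locales
    fix x y z assume "x \<in> carrier ?F" "y \<in> carrier ?F" "z \<in> carrier ?F"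
    then obtain u v w where w: "u \<in> ?W" "v \<in> ?W" "w \<in> ?W" and "x = ?c u" "y = ?c v" "z = ?c w"
      using rep by meson
    have "?c (wcomm (wcomm u v) w) = \<one>\<^bsub>?F\<^esub>"
      unfolding free_nil_module_one
      by (rule equiv_class_eq[OF equiv_nil2_rel]) (use w nil2_eq.nil2[of u _ v w] in \<open>simp add: nil2_rel_def\<close>)
    then have "inv\<^bsub>?F\<^esub> ?c (wcomm u v) \<otimes>\<^bsub>?F\<^esub> inv\<^bsub>?F\<^esub> ?c w \<otimes>\<^bsub>?F\<^esub> ?c (wcomm u v) \<otimes>\<^bsub>?F\<^esub> ?c w = \<one>\<^bsub>?F\<^esub>"
      using comm[OF wc[OF w(1,2)] w(3)] by simp
    then have "?c (wcomm u v) \<otimes>\<^bsub>?F\<^esub> ?c w = ?c w \<otimes>\<^bsub>?F\<^esub> ?c (wcomm u v)"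
      using commutator_one_iff[OF c_in[OF wc[OF w(1,2)]] c_in[OF w(3)]] by blast
    then show "(inv\<^bsub>?F\<^esub> x \<otimes>\<^bsub>?F\<^esub> inv\<^bsub>?F\<^esub> y \<otimes>\<^bsub>?F\<^esub> x \<otimes>\<^bsub>?F\<^esub> y) \<otimes>\<^bsub>?F\<^esub> z
        = z \<otimes>\<^bsub>?F\<^esub> (inv\<^bsub>?F\<^esub> x \<otimes>\<^bsub>?F\<^esub> inv\<^bsub>?F\<^esub> y \<otimes>\<^bsub>?F\<^esub> x \<otimes>\<^bsub>?F\<^esub> y)"
      unfolding \<open>x = _\<close> \<open>y = _\<close> \<open>z = _\<close> comm[OF w(1,2)] .
  next
    fix x and s t :: 'l assume "x \<in> carrier ?F"
    then obtain u where u: "u \<in> ?W" and x: "x = ?c u" using rep by meson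
    show "x \<triangleleft>\<^bsub>?F\<^esub> s \<in> carrier ?F"
      unfolding x free_nil_module_ract[OF u] by (rule c_in[OF m[OF u]])
    have "?m (s + t) u = ?m t (?m s u)" by (auto simp: add.assoc)
    then show "x \<triangleleft>\<^bsub>?F\<^esub> (s + t) = (x \<triangleleft>\<^bsub>?F\<^esub> s) \<triangleleft>\<^bsub>?F\<^esub> t"
      unfolding x free_nil_module_ract[OF u] free_nil_module_ract[OF m[OF u]] by (rule arg_cong)
    have "?m 0 u = u" by (auto intro: map_idI)
    then show "x \<triangleleft>\<^bsub>?F\<^esub> 0 = x"
      unfolding x free_nil_module_ract[OF u] by simp
  next
    fix x y and s :: 'l assume "x \<in> carrier ?F" "y \<in> carrier ?F"
    then obtain u v where u: "u \<in> ?W" and x: "x = ?c u" and v: "v \<in> ?W" and y: "y = ?c v"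
      using rep by meson
    have uv: "u @ v \<in> ?W" using u v by auto
    show "(x \<otimes>\<^bsub>?F\<^esub> y) \<triangleleft>\<^bsub>?F\<^esub> s = (x \<triangleleft>\<^bsub>?F\<^esub> s) \<otimes>\<^bsub>?F\<^esub> (y \<triangleleft>\<^bsub>?F\<^esub> s)"
      unfolding x y free_nil_module_mult[OF u v] free_nil_module_ract[OF u] free_nil_module_ract[OF v]
        free_nil_module_ract[OF uv] free_nil_module_mult[OF m[OF u] m[OF v]] by simp
  qed
qed

text \<open>
  The universal property: homomorphisms from the free module of rank \<open>n\<close> correspond to
  \<open>n\<close>-tuples of elements.
\<close>

context nil_module
begin

primrec ev :: "(nat \<Rightarrow> 'x) \<Rightarrow> (nat \<times> 'l) word \<Rightarrow> 'x"
  where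
    "ev g [] = \<one>"
  | "ev g (a # w) =
      (if snd a then g (fst (fst a)) \<triangleleft> snd (fst a) else inv (g (fst (fst a)) \<triangleleft> snd (fst a))) \<otimes> ev g w"

lemma ev_closed:
  assumes "g \<in> {..<n} \<rightarrow> carrier M" "w \<in> words ({..<n} \<times> UNIV)"
  shows "ev g w \<in> carrier M"
  using assms(2)
proof (induction w rule: list.induct)
  case (Cons a w)
  have "g (fst (fst a)) \<in> carrier M" using Cons.prems assms(1) by (cases a) auto
  then show ?case using Cons by (auto intro!: m_closed ract_closed inv_closed)
qed simp

lemma ev_append:
  assumes "g \<in> {..<n} \<rightarrow> carrier M" "u \<in> words ({..<n} \<times> UNIV)" "v \<in> words ({..<n} \<times> UNIV)"
  shows "ev g (u @ v) = ev g u \<otimes> ev g v"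
  using assms(2)
proof (induction u rule: list.induct)
  case Nil
  then show ?case using ev_closed[OF assms(1,3)] by simp
next
  case (Cons a u)
  have "g (fst (fst a)) \<in> carrier M" using Cons.prems assms(1) by (cases a) auto
  moreover have "ev g u \<in> carrier M" using Cons.prems ev_closed[OF assms(1)] by auto
  ultimately show ?case using Cons ev_closed[OF assms(1,3)]
    by (auto simp: m_assoc ract_closed)
qed

lemma ev_winv:
  assumes "g \<in> {..<n} \<rightarrow> carrier M" "u \<in> words ({..<n} \<times> UNIV)"
  shows "ev g (winv u) = inv (ev g u)"
  using assms(2)
proof (induction u rule: list.induct)
  case Nil
  then show ?case by (simp add: winv_def)
next
  case (Cons a u)
  obtain i s b where a: "a = ((i, s), b)" by (metis surj_pair)
  have i: "g i \<triangleleft> s \<in> carrier M" and u: "u \<in> words ({..<n} \<times> UNIV)"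
    using Cons.prems assms(1) a by (auto intro!: ract_closed)
  have iu: "winv u \<in> words ({..<n} \<times> UNIV)" using u by (auto simp: winv_def)
  have l: "[((i, s), \<not> b)] \<in> words ({..<n} \<times> UNIV)" using Cons.prems a by auto
  have "ev g (winv (a # u)) = ev g (winv u) \<otimes> ev g [((i, s), \<not> b)]"
    using ev_append[OF assms(1) iu l] by (simp add: winv_def a)
  then show ?case using Cons.IH[OF u] i ev_closed[OF assms(1) u] by (simp add: a inv_mult_group)
qed

lemma ev_nil2_eq:
  assumes g: "g \<in> {..<n} \<rightarrow> carrier M" and "nil2_eq ({..<n} \<times> UNIV) u v"
  shows "ev g u = ev g v"
  using assms(2)
proof (induction rule: nil2_eq.induct)
  case (append u u' v v')
  then show ?case using nil2_eq_words[OF append.hyps(1)] nil2_eq_words[OF append.hyps(2)]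
    by (simp add: ev_append[OF g])
next
  case (cancel x b)
  then have "g (fst x) \<triangleleft> snd x \<in> carrier M" using g by (auto intro!: ract_closed)
  then show ?case by simp
next
  case (nil2 u v w)
  have wc: "wcomm u v \<in> words ({..<n} \<times> UNIV)" if "u \<in> words ({..<n} \<times> UNIV)" "v \<in> words ({..<n} \<times> UNIV)"
    for u v :: "(nat \<times> 'l) word" using that by (auto simp: wcomm_def winv_def)
  have c: "ev g (wcomm u v) = inv (ev g u) \<otimes> inv (ev g v) \<otimes> ev g u \<otimes> ev g v"
    if "u \<in> words ({..<n} \<times> UNIV)" "v \<in> words ({..<n} \<times> UNIV)" for u v
  proof -
    have "winv u \<in> words ({..<n} \<times> UNIV)" "winv v \<in> words ({..<n} \<times> UNIV)" using that by (auto simp: winv_def)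
    then have "ev g (wcomm u v) = ev g (winv u) \<otimes> (ev g (winv v) \<otimes> (ev g u \<otimes> ev g v))"
      using that unfolding wcomm_def
      by (simp add: ev_append[OF g] append_in_lists_conv del: in_lists_conv_set)
    then show ?thesis using ev_closed[OF g that(1)] ev_closed[OF g that(2)]
      by (simp add: ev_winv[OF g that(1)] ev_winv[OF g that(2)] m_assoc)
  qed
  let ?c = "ev g (wcomm u v)" and ?w = "ev g w"
  have cl: "?c \<in> carrier M" "?w \<in> carrier M"
    by (rule ev_closed[OF g wc[OF nil2(1,2)]], rule ev_closed[OF g nil2(3)])
  have "?c \<otimes> ?w = ?w \<otimes> ?c"
    unfolding c[OF nil2(1,2)]
    by (rule commutator_central[OF ev_closed[OF g nil2(1)] ev_closed[OF g nil2(2)] cl(2)])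
  then have "inv ?c \<otimes> inv ?w \<otimes> ?c \<otimes> ?w = \<one>"
    using commutator_one_iff[OF cl] by blast
  then show ?case using c[OF wc[OF nil2(1,2)] nil2(3)] by simp
next
  case (sym u v)
  show ?case by (rule HOL.sym[OF sym.IH])
next
  case (trans u v w)
  show ?case by (rule HOL.trans[OF trans.IH])
qed simp

lemma free_nil_module_universal:
  assumes g: "g \<in> {..<n} \<rightarrow> carrier M"
  shows "\<exists>!\<phi>. \<phi> \<in> op_hom (free_nil_module n) M \<and> (\<forall>i<n. \<phi> (free_nil_gen n i) = g i)"
proof -
  let ?F = "free_nil_module n :: ((nat \<times> 'l) word set, 'l) op_group"
  let ?W = "words ({..<n} \<times> (UNIV :: 'l set))"
  let ?c = "\<lambda>u. nil2_rel ({..<n} \<times> (UNIV :: 'l set)) `` {u}"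
  let ?m = "\<lambda>t u. map (\<lambda>((i, s::'l), b::bool). ((i::nat, s + t), b)) u"
  define \<phi> where "\<phi> = (\<lambda>U \<in> carrier ?F. ev g (SOME u. u \<in> ?W \<and> U = ?c u))"
  have m: "?m t u \<in> ?W" if "u \<in> ?W" for t u using that by force
  have c_in: "?c u \<in> carrier ?F" if "u \<in> ?W" for u using that by (auto simp: free_nil_module_carrier)
  have rep: "\<exists>u\<in>?W. x = ?c u" if "x \<in> carrier ?F" for x
    using that by (auto simp: free_nil_module_carrier)
  have \<phi>: "\<phi> (?c u) = ev g u" if u: "u \<in> ?W" for u
  proof -
    have "\<exists>v. v \<in> ?W \<and> ?c u = ?c v" using u by blast
    from someI_ex[OF this] have "nil2_eq ({..<n} \<times> UNIV) u (SOME v. v \<in> ?W \<and> ?c u = ?c v)"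
      using nil2_class_eq_iff[OF u] by blast
    from ev_nil2_eq[OF g this] have "ev g (SOME v. v \<in> ?W \<and> ?c u = ?c v) = ev g u" by (rule HOL.sym)
    then show ?thesis using c_in[OF u] by (simp add: \<phi>_def)
  qed
  have ev_ract: "ev g (?m t u) = ev g u \<triangleleft> t" if "u \<in> ?W" for t u
    using that
  proof (induction u rule: list.induct)
    case Nil
    have "(\<one> \<triangleleft> t) \<otimes> (\<one> \<triangleleft> t) = \<one> \<triangleleft> t" using ract_mult[of \<one> \<one> t] by simp
    then show ?case using ract_closed[OF one_closed, of t] by (simp add: l_cancel_one)
  next
    case (Cons a u)
    obtain i s b where a: "a = ((i, s), b)" by (metis surj_pair)
    have i: "g i \<in> carrier M" and u: "u \<in> ?W" using Cons.prems g a by auto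
    have "inv (x \<triangleleft> t) = inv x \<triangleleft> t" if "x \<in> carrier M" for x
    proof -
      have "(\<one> \<triangleleft> t) \<otimes> (\<one> \<triangleleft> t) = \<one> \<triangleleft> t" using ract_mult[of \<one> \<one> t] by simp
      then have "\<one> \<triangleleft> t = \<one>" using ract_closed[OF one_closed, of t] by (simp add: l_cancel_one)
      then have "(inv x \<triangleleft> t) \<otimes> (x \<triangleleft> t) = \<one>" using ract_mult[of "inv x" x t] that by simp
      then show ?thesis using that by (intro inv_equality) (auto intro: ract_closed)
    qed
    then show ?case using Cons.IH[OF u] i ev_closed[OF g u]
      by (simp add: a ract_mult ract_closed ract_add)
  qed
  have gen: "[((i, 0), True)] \<in> ?W" if "i < n" for i using that by auto
  have "\<phi> \<in> op_hom ?F M"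
    unfolding op_hom_def
  proof (intro CollectI conjI IntI ballI allI homI)
    show "\<phi> \<in> extensional (carrier ?F)" by (simp add: \<phi>_def)
    fix x assume "x \<in> carrier ?F"
    then obtain u where u: "u \<in> ?W" and x: "x = ?c u" using rep by meson
    show "\<phi> x \<in> carrier M" unfolding x \<phi>[OF u] by (rule ev_closed[OF g u])
    show "\<phi> (x \<triangleleft>\<^bsub>?F\<^esub> s) = \<phi> x \<triangleleft> s" for s
      unfolding x free_nil_module_ract[OF u] \<phi>[OF u] \<phi>[OF m[OF u]] by (rule ev_ract[OF u])
    fix y assume "y \<in> carrier ?F"
    then obtain v where v: "v \<in> ?W" and y: "y = ?c v" using rep by meson
    have uv: "u @ v \<in> ?W" using u v by auto
    show "\<phi> (x \<otimes>\<^bsub>?F\<^esub> y) = \<phi> x \<otimes> \<phi> y"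
      unfolding x y free_nil_module_mult[OF u v] \<phi>[OF u] \<phi>[OF v] \<phi>[OF uv] by (rule ev_append[OF g u v])
  qed
  moreover have "\<phi> (free_nil_gen n i) = g i" if "i < n" for i
  proof -
    have "g i \<in> carrier M" using g that by auto
    then show ?thesis using \<phi>[OF gen[OF that]] by (simp add: free_nil_gen_def ract_zero)
  qed
  moreover have "\<psi> = \<phi>" if \<psi>: "\<psi> \<in> op_hom ?F M" "\<forall>i<n. \<psi> (free_nil_gen n i) = g i" for \<psi>
  proof -
    have hom: "\<psi> \<in> hom ?F M" and ext: "\<psi> \<in> extensional (carrier ?F)"
      and equi: "\<And>x s. x \<in> carrier ?F \<Longrightarrow> \<psi> (x \<triangleleft>\<^bsub>?F\<^esub> s) = \<psi> x \<triangleleft> s"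
      using \<psi>(1) by (auto simp: op_hom_def)
    interpret h: group_hom ?F M \<psi>
      by (intro group_hom.intro group_free_nil_module group_axioms.intro is_group group_hom_axioms.intro hom)
    have \<psi>c: "\<psi> (?c u) = ev g u" if "u \<in> ?W" for u
      using that
    proof (induction u rule: list.induct)
      case Nil
      then show ?case using h.hom_one by (simp add: free_nil_module_one)
    next
      case (Cons a u)
      obtain i s b where a: "a = ((i, s), b)" by (metis surj_pair)
      have i: "i < n" and u: "u \<in> ?W" using Cons.prems a by auto
      have l: "[((i, s), c)] \<in> ?W" for c using i by auto
      have T: "\<psi> (?c [((i, s), True)]) = g i \<triangleleft> s"
        using equi[OF c_in[OF gen[OF i]], of s] \<psi>(2) i free_nil_module_ract[OF gen[OF i], of s]
        by (simp add: free_nil_gen_def)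
      have "?c [((i, s), False)] = inv\<^bsub>?F\<^esub> ?c [((i, s), True)]"
        unfolding free_nil_module_inv[OF l] by (simp add: winv_def)
      then have "\<psi> (?c [((i, s), False)]) = inv (g i \<triangleleft> s)"
        using h.hom_inv[OF c_in[OF l]] T by simp
      with T have "\<psi> (?c [a]) = (if b then g i \<triangleleft> s else inv (g i \<triangleleft> s))" by (simp add: a)
      moreover have "\<psi> (?c (a # u)) = \<psi> (?c [a]) \<otimes> \<psi> (?c u)"
        using h.hom_mult[OF c_in[OF l[of b]] c_in[OF u]] free_nil_module_mult[OF l[of b] u] by (simp add: a)
      ultimately show ?case using Cons.IH[OF u] by (simp add: a)
    qed
    show ?thesis
    proof (rule extensionalityI[OF ext])
      show "\<phi> \<in> extensional (carrier ?F)" by (simp add: \<phi>_def)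
      fix x assume "x \<in> carrier ?F"
      then obtain u where "u \<in> ?W" "x = ?c u" using rep by meson
      then show "\<psi> x = \<phi> x" using \<psi>c \<phi> by simp
    qed
  qed
  ultimately show ?thesis by blast
qed

end

text \<open>
  The category \<open>mod-Q\<close>; an arrow \<open>(m, \<phi>, n)\<close> is a homomorphism \<open>\<phi>\<close> from the free module of rank \<open>n\<close> to
  the one of rank \<open>m\<close>.
\<close>

type_synonym 'l mod_Q_arrow =
  "nat \<times> ((nat \<times> 'l) word set \<Rightarrow> (nat \<times> 'l) word set) \<times> nat"

definition mod_Q :: "(nat, 'l::monoid_add mod_Q_arrow) cat"
  where "mod_Q =
    \<lparr>Ob = UNIV,
     Ar = {(m, \<phi>, n). \<phi> \<in> op_hom (free_nil_module n) (free_nil_module m)},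
     Dom = (\<lambda>(m, \<phi>, n). n),
     Cod = (\<lambda>(m, \<phi>, n). m),
     Comp = (\<lambda>(m, \<phi>, n) (n', \<psi>, k).
        (m, compose (carrier (free_nil_module k)) \<phi> \<psi>, k))\<rparr>"

section \<open>Abelianization and Mac Lane cohomology\<close>

text \<open>
  The abelianization of a \<open>\<int>\<^sub>n\<^sub>i\<^sub>l[L]\<close>-module is a right module over \<open>\<int>[L]\<close>, by linear extension of the
  action of \<open>L\<close>.
\<close>

abbreviation commutator_subgroup :: "('x, 'm) monoid_scheme \<Rightarrow> 'x set"
  where "commutator_subgroup M \<equiv> derived M (carrier M)"

definition ad :: "('x, 'l, 'm) op_group_scheme \<Rightarrow> ('x set, 'l monoid_ring) op_group"
  where "ad M =
    (let A = M Mod commutator_subgroup M;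
         act = (\<lambda>U s. \<Union>x \<in> U. commutator_subgroup M #>\<^bsub>M\<^esub> (x \<triangleleft>\<^bsub>M\<^esub> s)) in
    \<lparr>carrier = carrier A,
     monoid.mult = (\<otimes>\<^bsub>A\<^esub>),
     one = \<one>\<^bsub>A\<^esub>,
     ract = (\<lambda>U r. \<Otimes>\<^bsub>A\<^esub>s \<in> Poly_Mapping.keys r. act U s [^]\<^bsub>A\<^esub> Poly_Mapping.lookup r s)\<rparr>)"

definition ad_map ::
    "('x, 'l, 'm) op_group_scheme \<Rightarrow> ('y, 'l, 'n) op_group_scheme \<Rightarrow> ('x \<Rightarrow> 'y) \<Rightarrow> 'x set \<Rightarrow> 'y set"
  where "ad_map M N \<phi> = (\<lambda>U \<in> carrier (ad M). \<Union>x \<in> U. commutator_subgroup N #>\<^bsub>N\<^esub> \<phi> x)"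

text \<open>
  The bifunctor \<open>D\<^sub>B(M, N) = Hom\<^sub>R(M, N \<otimes>\<^sub>R B)\<close> on right \<open>R\<close>-modules, where an arrow \<open>(N, f, M)\<close> is a
  homomorphism \<open>f\<close> from \<open>M\<close> to \<open>N\<close>.
\<close>

definition D_bifunctor :: "('b, 'r) bi_op_group \<Rightarrow>
    (('x, 'r) op_group, ('x, 'r) op_group \<times> ('x \<Rightarrow> 'x) \<times> ('x, 'r) op_group,
      'x \<Rightarrow> ('x \<times> 'b \<Rightarrow>\<^sub>0 int) set) bifunctor"
  where "D_bifunctor B =
    \<lparr>val = (\<lambda>M N. hom_group M (tensor N B)),
     push = (\<lambda>M (N', f, N) h. compose (carrier M) (tensor_map N' B f) h),
     pull = (\<lambda>(M, f, M') N h. compose (carrier M') h f)\<rparr>"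

definition q_ob :: "nat \<Rightarrow> ((nat \<times> 'l::monoid_add) word set set, 'l monoid_ring) op_group"
  where "q_ob n = ad (free_nil_module n)"

definition q_ar :: "'l::monoid_add mod_Q_arrow \<Rightarrow>
    ((nat \<times> 'l) word set set, 'l monoid_ring) op_group
      \<times> ((nat \<times> 'l) word set set \<Rightarrow> (nat \<times> 'l) word set set)
      \<times> ((nat \<times> 'l) word set set, 'l monoid_ring) op_group"
  where "q_ar = (\<lambda>(m, \<phi>, n).
    (q_ob m, ad_map (free_nil_module n) (free_nil_module m) \<phi>, q_ob n))"

text \<open>
  \<open>HML\<^sup>n(\<int>\<^sub>n\<^sub>i\<^sub>l[L], B)\<close>; the monoid \<open>L\<close> is determined by the type of the bimodule \<open>B\<close>.
\<close>

definition HML where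
  "HML n (B :: ('b, 'l::monoid_add monoid_ring) bi_op_group) =
     cohomology (mod_Q :: (nat, 'l mod_Q_arrow) cat) (pullback q_ob q_ar (D_bifunctor B)) n"

end

theory Submission
  imports Defs
begin

text \<open>
  Write \<open>F\<^sub>n\<close> for the free module of rank \<open>n\<close> and \<open>T\<close> for the functor \<open>X \<mapsto> X\<^sup>a\<^sup>d \<otimes>\<^sub>R B\<close>.  The arrows out of \<open>F\<^sub>k\<close>
  are the \<open>k\<close>-tuples of elements of the target, so a cocycle whose values are maps on \<open>F\<^sub>k\<close>, not
  required to be additive, is contracted by Yoneda's lemma.  The failure of additivity of the
  primitive lives on a partial resolution of the abelianization of \<open>F\<^sub>n\<close>, namely the bar construction with
  additional relators for commutators; it is exact because \<open>F\<^sub>n\<close> is free among the groups of class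
  two.  What remains to be killed is a transformation from the cycles of this resolution to \<open>T\<close>, natural
  in \<open>n\<close>.  Since \<open>T\<close> preserves direct sums, such a transformation splits into pieces depending on one
  variable, that is, on cyclic groups, where it vanishes because \<open>H\<^sup>3(\<int>) = 0\<close>.  This gives an additive
  primitive.  As \<open>L\<close> is free, its failure to commute with \<open>L\<close> may be prescribed on the generators
  of \<open>L\<close>, and recursion along words yields a cocycle by which the primitive becomes equivariant.
\<close>

section \<open>Free modules and their arrows\<close>

text \<open>Yoneda's contraction can be repeated because Z[F_n], P_1 and P_2 are sums of functors
  Z[F_n^k]: after the primitive itself, its failure of additivity is contracted, and then the values
  of the resulting cochain on boundaries of relators. Degree one takes one such contraction, degree
  two takes two, degree three takes three.

  For L free on S and a right R-module Y the sequence 0 -> Hom_R(F_n^ad, Y) -> Hom_Z(F_n^ad, Y) ->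
  prod_S Hom_Z(F_n^ad, Y) -> 0 is exact, its second map measuring the failure to commute with each s
  in S. So vanishing for Hom_R in degrees two and three rests on vanishing for additive cochains in
  degrees one, two and three.

  As a group F_n is free on all pairs (i, s) with s in L, whereas the splitting of T separates only
  the indices i. A cycle meets finitely many of these pairs and involves only the group structure,
  so each of them can be given a module generator of its own.\<close>

definition nil_basis :: "nat \<Rightarrow> nat \<Rightarrow> 'l::monoid_add \<Rightarrow> (nat \<times> 'l) word set"
  where "nil_basis n i s = nil2_rel ({..<n} \<times> UNIV) `` {[((i, s), True)]}"

lemma nil_basis_closed [simp]: "i < n \<Longrightarrow> nil_basis n i s \<in> carrier (free_nil_module n)"
  unfolding nil_basis_def free_nil_module_carrier by auto

lemma nil_basis_ract: "i < n \<Longrightarrow> nil_basis n i s \<triangleleft>\<^bsub>free_nil_module n\<^esub> t = nil_basis n i (s + t)"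
  unfolding nil_basis_def by (subst free_nil_module_ract) auto

lemma free_nil_gen_eq: "free_nil_gen n i = nil_basis n i 0"
  by (simp add: free_nil_gen_def nil_basis_def)

text \<open>A class is a product of letters and inverses of letters, so the first letter of a
  representing word is split off. The base case runs over all pairs (i, s) because the statements to
  be proved concern the underlying group, without the action of L.\<close>

lemma free_nil_module_induct [consumes 1, case_names one basis mult inv]:
  fixes x :: "(nat \<times> 'l::monoid_add) word set"
  assumes "x \<in> carrier (free_nil_module n)"
    and one: "P \<one>\<^bsub>free_nil_module n :: ((nat \<times> 'l) word set, 'l) op_group\<^esub>"
    and basis: "\<And>i s. i < n \<Longrightarrow> P (nil_basis n i s)"
    and mult: "\<And>x y. \<lbrakk>x \<in> carrier (free_nil_module n); y \<in> carrier (free_nil_module n); P x; P y\<rbrakk>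
        \<Longrightarrow> P (x \<otimes>\<^bsub>free_nil_module n\<^esub> y)"
    and inv: "\<And>x. \<lbrakk>x \<in> carrier (free_nil_module n); P x\<rbrakk> \<Longrightarrow> P (inv\<^bsub>free_nil_module n\<^esub> x)"
  shows "P x"
proof -
  let ?W = "words ({..<n} \<times> (UNIV :: 'l set))"
  let ?c = "\<lambda>u. nil2_rel ({..<n} \<times> (UNIV :: 'l set)) `` {u}"
  obtain u where u: "u \<in> ?W" "x = ?c u" using assms(1) unfolding free_nil_module_carrier by blast
  have "P (?c u)" using u(1)
  proof (induction u rule: list.induct)
    case Nil
    then show ?case using one by (simp add: free_nil_module_one)
  next
    case (Cons a w)
    obtain i s b where a: "a = ((i, s), b)" by (metis surj_pair)
    have i: "i < n" and w: "w \<in> ?W" using Cons.prems a by auto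
    have l: "[((i, s), d)] \<in> ?W" for d using i by auto
    have "?c [((i, s), False)] = inv\<^bsub>free_nil_module n\<^esub> (nil_basis n i s)"
      unfolding nil_basis_def free_nil_module_inv[OF l] by (simp add: winv_def)
    then have "P (?c [((i, s), b)])"
      using basis[OF i] inv[OF nil_basis_closed[OF i] basis[OF i]] by (cases b) (simp_all add: nil_basis_def)
    moreover have "?c [((i, s), b)] \<in> carrier (free_nil_module n)" "?c w \<in> carrier (free_nil_module n)"
      using l[of b] w unfolding free_nil_module_carrier by blast+
    ultimately have "P (?c [((i, s), b)] \<otimes>\<^bsub>free_nil_module n\<^esub> ?c w)" using Cons.IH[OF w] mult by blast
    then show ?case unfolding free_nil_module_mult[OF l w] by (simp add: a)
  qed
  then show ?thesis using u by simp
qed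

text \<open>For mere group homomorphisms agreement is needed on all translates of the generators;
  \<open>arrows_eqI\<close> is the analogue for equivariant maps, where s = 0 suffices.\<close>

lemma free_nil_module_hom_eqI:
  assumes "group G" "f \<in> hom (free_nil_module n) G" "g \<in> hom (free_nil_module n) G"
    and "\<And>i s. i < n \<Longrightarrow> f (nil_basis n i s) = g (nil_basis n i s)"
    and "x \<in> carrier (free_nil_module n)"
  shows "f x = g x"
proof -
  interpret f: group_hom "free_nil_module n" G f
    using assms group_free_nil_module by (auto simp: group_hom_def group_hom_axioms_def)
  interpret g: group_hom "free_nil_module n" G g
    using assms group_free_nil_module by (auto simp: group_hom_def group_hom_axioms_def)
  show ?thesis using assms(5)
    by (induction rule: free_nil_module_induct) (simp_all add: assms(4))
qed

text \<open>
  The underlying group of a free module is a free group of class two: apply the universal property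
  of the module to the coinduced module of functions from \<open>L\<close> to the group.
\<close>

lemma free_nil_module_group_hom:
  fixes b :: "nat \<Rightarrow> 'l::monoid_add \<Rightarrow> 'x"
  assumes "group G"
    and comm: "\<And>x y z. \<lbrakk>x \<in> carrier G; y \<in> carrier G; z \<in> carrier G\<rbrakk> \<Longrightarrow>
      (inv\<^bsub>G\<^esub> x \<otimes>\<^bsub>G\<^esub> inv\<^bsub>G\<^esub> y \<otimes>\<^bsub>G\<^esub> x \<otimes>\<^bsub>G\<^esub> y) \<otimes>\<^bsub>G\<^esub> z = z \<otimes>\<^bsub>G\<^esub> (inv\<^bsub>G\<^esub> x \<otimes>\<^bsub>G\<^esub> inv\<^bsub>G\<^esub> y \<otimes>\<^bsub>G\<^esub> x \<otimes>\<^bsub>G\<^esub> y)"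
    and b: "\<And>i s. i < n \<Longrightarrow> b i s \<in> carrier G"
  obtains r where "r \<in> hom (free_nil_module n) G" "\<And>i s. i < n \<Longrightarrow> r (nil_basis n i s) = b i s"
proof -
  interpret group G by fact
  define M :: "('l \<Rightarrow> 'x, 'l) op_group" where "M =
    \<lparr>carrier = {f. \<forall>s. f s \<in> carrier G}, monoid.mult = (\<lambda>f g s. f s \<otimes>\<^bsub>G\<^esub> g s), one = (\<lambda>_. \<one>\<^bsub>G\<^esub>),
     ract = (\<lambda>f t s. f (t + s))\<rparr>"
  have M: "carrier M = {f. \<forall>s. f s \<in> carrier G}" "\<And>f g. f \<otimes>\<^bsub>M\<^esub> g = (\<lambda>s. f s \<otimes>\<^bsub>G\<^esub> g s)"
    "\<one>\<^bsub>M\<^esub> = (\<lambda>_. \<one>\<^bsub>G\<^esub>)" "\<And>f t. f \<triangleleft>\<^bsub>M\<^esub> t = (\<lambda>s. f (t + s))"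
    by (simp_all add: M_def)
  interpret M: group M
  proof (rule groupI)
    show "\<exists>y\<in>carrier M. y \<otimes>\<^bsub>M\<^esub> x = \<one>\<^bsub>M\<^esub>" if "x \<in> carrier M" for x
      by (rule bexI[of _ "\<lambda>s. inv\<^bsub>G\<^esub> x s"]) (use that in \<open>auto simp: M\<close>)
  qed (auto simp: M m_assoc)
  have inv: "inv\<^bsub>M\<^esub> x = (\<lambda>s. inv\<^bsub>G\<^esub> x s)" if "x \<in> carrier M" for x
    by (rule M.inv_equality) (use that in \<open>auto simp: M\<close>)
  interpret M: nil_module M
    by unfold_locales (auto simp: inv M(1) M(2) M(4) comm add.assoc)
  from M.free_nil_module_universal[of "\<lambda>i. b i" n] b
  obtain \<phi> where \<phi>: "\<phi> \<in> op_hom (free_nil_module n) M" "\<And>i. i < n \<Longrightarrow> \<phi> (nil_basis n i 0) = b i"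
    by (fastforce simp: M(1) free_nil_gen_eq)
  show thesis
  proof
    \<comment> \<open>Evaluation at 0 is the counit of coinduction. By equivariance the value of
      \<phi> at \<open>nil_basis n i s\<close> is \<open>b i\<close> translated by s, and its value
      at 0 is \<open>b i s\<close>.\<close>
    show "(\<lambda>x. \<phi> x 0) \<in> hom (free_nil_module n) G"
      using \<phi>(1) by (auto simp: op_hom_def hom_def M)
    fix i and s :: 'l assume i: "i < n"
    have "nil_basis n i s = nil_basis n i 0 \<triangleleft>\<^bsub>free_nil_module n\<^esub> s" using i by (simp add: nil_basis_ract)
    then show "\<phi> (nil_basis n i s) 0 = b i s"
      using \<phi> i by (simp add: op_hom_def M)
  qed
qed

text \<open>Abelian groups are of class two, so additive maps out of F_n have arbitrary values on
  the basis. The target is a type, which matches the calculations with formal combinations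
  below.\<close>

lemma free_nil_module_additive:
  fixes b :: "nat \<Rightarrow> 'l::monoid_add \<Rightarrow> 'a::ab_group_add"
  obtains h where
    "\<And>x y. \<lbrakk>x \<in> carrier (free_nil_module n); y \<in> carrier (free_nil_module n)\<rbrakk>
      \<Longrightarrow> h (x \<otimes>\<^bsub>free_nil_module n\<^esub> y) = h x + h y"
    "\<And>i s. i < n \<Longrightarrow> h (nil_basis n i s) = b i s"
proof -
  define G :: "'a monoid" where "G = \<lparr>carrier = (UNIV :: 'a set), monoid.mult = (+), one = 0\<rparr>"
  interpret group G
    by (rule groupI) (auto simp: G_def add.assoc intro: exI[of _ "- x" for x])
  have "inv\<^bsub>G\<^esub> x = - x" for x by (rule inv_equality) (auto simp: G_def)
  then have *: "(inv\<^bsub>G\<^esub> x \<otimes>\<^bsub>G\<^esub> inv\<^bsub>G\<^esub> y \<otimes>\<^bsub>G\<^esub> x \<otimes>\<^bsub>G\<^esub> y) \<otimes>\<^bsub>G\<^esub> z = z \<otimes>\<^bsub>G\<^esub> (inv\<^bsub>G\<^esub> x \<otimes>\<^bsub>G\<^esub> inv\<^bsub>G\<^esub> y \<otimes>\<^bsub>G\<^esub> x \<otimes>\<^bsub>G\<^esub> y)" for x y z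
    by (simp add: G_def)
  obtain r where r: "r \<in> hom (free_nil_module n) G" "\<And>i s. i < n \<Longrightarrow> r (nil_basis n i s) = b i s"
    using free_nil_module_group_hom[of G n b] is_group * by (auto simp: G_def)
  show thesis
    by (rule that[of r]) (use r in \<open>auto simp: hom_def G_def\<close>)
qed

section \<open>Arrows of mod-Q as tuples of elements\<close>

definition arrows :: "nat \<Rightarrow> nat \<Rightarrow> 'l::monoid_add mod_Q_arrow set"
  where "arrows m n = {(m, \<phi>, n) | \<phi>. \<phi> \<in> op_hom (free_nil_module n) (free_nil_module m)}"

abbreviation app :: "'l::monoid_add mod_Q_arrow \<Rightarrow> (nat \<times> 'l) word set \<Rightarrow> (nat \<times> 'l) word set"
  where "app \<alpha> \<equiv> fst (snd \<alpha>)"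

abbreviation comp_Q (infixl \<open>\<odot>\<close> 70)
  where "\<alpha> \<odot> \<beta> \<equiv> Comp mod_Q \<alpha> \<beta>"

lemma arrows_iff:
  "\<alpha> \<in> arrows m n \<longleftrightarrow> \<alpha> \<in> Ar mod_Q \<and> Cod mod_Q \<alpha> = m \<and> Dom mod_Q \<alpha> = n"
  by (cases \<alpha>) (auto simp: arrows_def mod_Q_def)

lemma arrows_Cod [simp]: "\<alpha> \<in> arrows m n \<Longrightarrow> Cod mod_Q \<alpha> = m"
  and arrows_Dom [simp]: "\<alpha> \<in> arrows m n \<Longrightarrow> Dom mod_Q \<alpha> = n"
  by (auto simp: arrows_iff)

lemma app_op_hom: "\<alpha> \<in> arrows m n \<Longrightarrow> app \<alpha> \<in> op_hom (free_nil_module n) (free_nil_module m)"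
  by (auto simp: arrows_def)

lemma app_hom: "\<alpha> \<in> arrows m n \<Longrightarrow> app \<alpha> \<in> hom (free_nil_module n) (free_nil_module m)"
  using app_op_hom[of \<alpha> m n] by (auto simp: op_hom_def)

lemma app_closed: "\<lbrakk>\<alpha> \<in> arrows m n; x \<in> carrier (free_nil_module n)\<rbrakk> \<Longrightarrow> app \<alpha> x \<in> carrier (free_nil_module m)"
  using app_hom[of \<alpha> m n] by (auto simp: hom_def)

lemma app_mult: "\<lbrakk>\<alpha> \<in> arrows m n; x \<in> carrier (free_nil_module n); y \<in> carrier (free_nil_module n)\<rbrakk>
   \<Longrightarrow> app \<alpha> (x \<otimes>\<^bsub>free_nil_module n\<^esub> y) = app \<alpha> x \<otimes>\<^bsub>free_nil_module m\<^esub> app \<alpha> y"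
  using app_hom[of \<alpha> m n] by (auto simp: hom_def)

lemma app_ract: "\<lbrakk>\<alpha> \<in> arrows m n; x \<in> carrier (free_nil_module n)\<rbrakk>
   \<Longrightarrow> app \<alpha> (x \<triangleleft>\<^bsub>free_nil_module n\<^esub> s) = app \<alpha> x \<triangleleft>\<^bsub>free_nil_module m\<^esub> s"
  using app_op_hom[of \<alpha> m n] by (auto simp: op_hom_def)

lemma app_group_hom: "\<alpha> \<in> arrows m n \<Longrightarrow> group_hom (free_nil_module n) (free_nil_module m) (app \<alpha>)"
  by (simp add: group_hom_def group_hom_axioms_def group_free_nil_module app_hom)

lemma app_one: "\<alpha> \<in> arrows m n \<Longrightarrow> app \<alpha> \<one>\<^bsub>free_nil_module n\<^esub> = \<one>\<^bsub>free_nil_module m\<^esub>"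
  by (rule group_hom.hom_one[OF app_group_hom])

lemma comp_Q_arrows:
  assumes \<alpha>: "\<alpha> \<in> arrows m n" and \<beta>: "\<beta> \<in> arrows n k"
  shows "\<alpha> \<odot> \<beta> \<in> arrows m k"
proof -
  interpret nil_module "free_nil_module k" by (rule nil_module_free_nil_module)
  have "compose (carrier (free_nil_module k)) (app \<alpha>) (app \<beta>) \<in> op_hom (free_nil_module k) (free_nil_module m)"
    by (auto simp: op_hom_def compose_def ract_closed app_closed[OF \<beta>] app_closed[OF \<alpha>] app_mult[OF \<beta>]
        app_mult[OF \<alpha>] app_ract[OF \<beta>] app_ract[OF \<alpha>] intro!: homI)
  then show ?thesis using \<alpha> \<beta> by (auto simp: arrows_def mod_Q_def)
qed

lemma app_comp: "\<lbrakk>\<alpha> \<in> arrows m n; \<beta> \<in> arrows n k; x \<in> carrier (free_nil_module k)\<rbrakk>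
    \<Longrightarrow> app (\<alpha> \<odot> \<beta>) x = app \<alpha> (app \<beta> x)"
  by (auto simp: arrows_def mod_Q_def compose_def)

lemma nil_module_one_ract:
  fixes M (structure) assumes "nil_module M" shows "\<one>\<^bsub>M\<^esub> \<triangleleft>\<^bsub>M\<^esub> s = \<one>\<^bsub>M\<^esub>"
proof -
  interpret nil_module M by fact
  have "(\<one> \<triangleleft> s) \<otimes> (\<one> \<triangleleft> s) = \<one> \<triangleleft> s" using ract_mult[of \<one> \<one> s] by simp
  then show ?thesis using ract_closed[OF one_closed, of s] by (simp add: l_cancel_one)
qed

lemma arrows_eqI:
  assumes \<alpha>: "\<alpha> \<in> arrows m n" and \<beta>: "\<beta> \<in> arrows m n"
    and eq: "\<And>i. i < n \<Longrightarrow> app \<alpha> (nil_basis n i 0) = app \<beta> (nil_basis n i 0)"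
  shows "\<alpha> = \<beta>"
proof -
  interpret nil_module "free_nil_module m" by (rule nil_module_free_nil_module)
  have "(\<lambda>i. app \<alpha> (nil_basis n i 0)) \<in> {..<n} \<rightarrow> carrier (free_nil_module m)"
    using app_closed[OF \<alpha>] by auto
  from free_nil_module_universal[OF this]
  have "app \<alpha> = app \<beta>"
    using app_op_hom[OF \<alpha>] app_op_hom[OF \<beta>] eq by (fastforce simp: free_nil_gen_eq)
  then show ?thesis using \<alpha> \<beta> by (auto simp: arrows_def)
qed

text \<open>Yoneda's bijection from k-tuples of elements of F_m to arrows from F_k to F_m. By
  \<open>arrows_eqI\<close> there is only one arrow to choose.\<close>

definition tuple :: "nat \<Rightarrow> (nat \<times> 'l::monoid_add) word set list \<Rightarrow> 'l mod_Q_arrow"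
  where "tuple m ys = (SOME \<alpha>. \<alpha> \<in> arrows m (length ys) \<and>
    (\<forall>i < length ys. app \<alpha> (nil_basis (length ys) i 0) = ys ! i))"

lemma tuple_ex:
  assumes "set ys \<subseteq> carrier (free_nil_module m)"
  shows "\<exists>\<alpha>. \<alpha> \<in> arrows m (length ys) \<and> (\<forall>i < length ys. app \<alpha> (nil_basis (length ys) i 0) = ys ! i)"
proof -
  interpret nil_module "free_nil_module m" by (rule nil_module_free_nil_module)
  have "(\<lambda>i. ys ! i) \<in> {..<length ys} \<rightarrow> carrier (free_nil_module m)" using assms by auto
  from free_nil_module_universal[OF this]
  obtain \<phi> where "\<phi> \<in> op_hom (free_nil_module (length ys)) (free_nil_module m)"
    "\<forall>i<length ys. \<phi> (nil_basis (length ys) i 0) = ys ! i" by (auto simp: free_nil_gen_eq)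
  then have "(m, \<phi>, length ys) \<in> arrows m (length ys) \<and>
      (\<forall>i<length ys. app (m, \<phi>, length ys) (nil_basis (length ys) i 0) = ys ! i)"
    by (auto simp: arrows_def)
  then show ?thesis by blast
qed

lemma tuple_arrows: "set ys \<subseteq> carrier (free_nil_module m) \<Longrightarrow> k = length ys \<Longrightarrow> tuple m ys \<in> arrows m k"
  and app_tuple: "set ys \<subseteq> carrier (free_nil_module m) \<Longrightarrow> k = length ys \<Longrightarrow> i < k
    \<Longrightarrow> app (tuple m ys) (nil_basis k i 0) = ys ! i"
  using someI_ex[OF tuple_ex] unfolding tuple_def by blast+

text \<open>Naturality of the Yoneda bijection in the target. In a cocycle identity whose last arrow
  is a tuple it turns composition into application to the entries, and every primitive below arises
  in this way.\<close>

lemma comp_tuple: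
  assumes \<alpha>: "\<alpha> \<in> arrows m n" and ys: "set ys \<subseteq> carrier (free_nil_module n)"
  shows "\<alpha> \<odot> tuple n ys = tuple m (map (app \<alpha>) ys)"
proof -
  have ys': "set (map (app \<alpha>) ys) \<subseteq> carrier (free_nil_module m)" using ys app_closed[OF \<alpha>] by auto
  show ?thesis
  proof (rule arrows_eqI)
    show "\<alpha> \<odot> tuple n ys \<in> arrows m (length ys)"
      by (rule comp_Q_arrows[OF \<alpha> tuple_arrows[OF ys HOL.refl]])
    show "tuple m (map (app \<alpha>) ys) \<in> arrows m (length ys)" by (rule tuple_arrows[OF ys']) simp
    show "app (\<alpha> \<odot> tuple n ys) (nil_basis (length ys) i 0)
        = app (tuple m (map (app \<alpha>) ys)) (nil_basis (length ys) i 0)" if "i < length ys" for i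
      using that by (simp add: app_comp[OF \<alpha> tuple_arrows[OF ys HOL.refl]] app_tuple[OF ys]
         app_tuple[OF ys'])
  qed
qed

text \<open>The idempotent of F_n that projects to the j-th copy of F_1 and includes it again. A
  functor to abelian groups that preserves direct sums turns the identity into the sum of these
  idempotents, which is the form used in \<open>T_split\<close>.\<close>

definition proj_arrow :: "nat \<Rightarrow> nat \<Rightarrow> 'l::monoid_add mod_Q_arrow"
  where "proj_arrow n j = tuple n (map (\<lambda>i. if i = j then nil_basis n i 0 else \<one>\<^bsub>free_nil_module n :: ((nat \<times> 'l) word set, 'l) op_group\<^esub>) [0..<n])"

lemma one_in_nil [simp]: "\<one>\<^bsub>free_nil_module n\<^esub> \<in> carrier (free_nil_module n :: ((nat \<times> 'l::monoid_add) word set, 'l) op_group)"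
  by (rule monoid.one_closed[OF group.is_monoid[OF group_free_nil_module]])

lemma proj_arrow_set: "set (map (\<lambda>i. if i = j then nil_basis n i 0 else \<one>\<^bsub>free_nil_module n\<^esub>) [0..<n])
  \<subseteq> carrier (free_nil_module n)"
  by auto

lemma
  fixes s :: "'l::monoid_add"
  shows proj_arrow: "(proj_arrow n j :: 'l mod_Q_arrow) \<in> arrows n n"
    and app_proj_arrow: "i < n \<Longrightarrow> app (proj_arrow n j) (nil_basis n i s) =
    (if i = j then nil_basis n i s else \<one>\<^bsub>free_nil_module n\<^esub>)"
proof -
  show a: "(proj_arrow n j :: 'l mod_Q_arrow) \<in> arrows n n"
    unfolding proj_arrow_def by (rule tuple_arrows[OF proj_arrow_set]) simp
  assume i: "i < n"
  have "app (proj_arrow n j) (nil_basis n i 0) = (if i = j then nil_basis n i (0::'l) else \<one>\<^bsub>free_nil_module n\<^esub>)"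
    unfolding proj_arrow_def by (subst app_tuple[OF proj_arrow_set]) (use i in simp_all)
  moreover have "nil_basis n i s = nil_basis n i 0 \<triangleleft>\<^bsub>free_nil_module n\<^esub> s" using i by (simp add: nil_basis_ract)
  ultimately show "app (proj_arrow n j) (nil_basis n i s) = (if i = j then nil_basis n i s else \<one>\<^bsub>free_nil_module n\<^esub>)"
    using app_ract[OF a nil_basis_closed[OF i], of 0 s] i
    by (simp add: nil_basis_ract nil_module_one_ract[OF nil_module_free_nil_module] del: if_split split: if_split_asm)
qed

lemma tuple_comp_proj_arrow:
  assumes ys: "set ys \<subseteq> carrier (free_nil_module m)" and k: "k = length ys"
  shows "tuple m ys \<odot> proj_arrow k j
    = tuple m (map (\<lambda>i. if i = j then ys ! i else \<one>\<^bsub>free_nil_module m\<^esub>) [0..<k])"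
proof -
  have "tuple m ys \<odot> proj_arrow k j
      = tuple m (map (app (tuple m ys)) (map (\<lambda>i. if i = j then nil_basis k i 0 else \<one>\<^bsub>free_nil_module k\<^esub>) [0..<k]))"
    unfolding proj_arrow_def by (rule comp_tuple[OF tuple_arrows[OF ys k] proj_arrow_set])
  also have "map (app (tuple m ys)) (map (\<lambda>i. if i = j then nil_basis k i 0 else \<one>\<^bsub>free_nil_module k\<^esub>) [0..<k])
     = map (\<lambda>i. if i = j then ys ! i else \<one>\<^bsub>free_nil_module m\<^esub>) [0..<k]"
    by (auto simp: app_tuple[OF ys k] app_one[OF tuple_arrows[OF ys k]])
  finally show ?thesis .
qed

section \<open>A partial resolution of the abelianization\<close>

locale nil2_group = group +
  assumes central: "\<lbrakk>x \<in> carrier G; y \<in> carrier G; z \<in> carrier G\<rbrakk> \<Longrightarrow>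
      (inv x \<otimes> inv y \<otimes> x \<otimes> y) \<otimes> z = z \<otimes> (inv x \<otimes> inv y \<otimes> x \<otimes> y)"

lemma nil2_group_free_nil_module: "nil2_group (free_nil_module n)"
proof -
  interpret nil_module "free_nil_module n" by (rule nil_module_free_nil_module)
  show ?thesis by unfold_locales (rule commutator_central)
qed

section \<open>Formal integer combinations\<close>

definition frag_map :: "('a \<Rightarrow> 'b) \<Rightarrow> ('a \<Rightarrow>\<^sub>0 int) \<Rightarrow> 'b \<Rightarrow>\<^sub>0 int"
  where "frag_map f = frag_extend (frag_of \<circ> f)"

lemma frag_map_of [simp]: "frag_map f (frag_of x) = frag_of (f x)"
  and frag_map_0 [simp]: "frag_map f 0 = 0"
  and frag_map_add: "frag_map f (p + q) = frag_map f p + frag_map f q"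
  and frag_map_diff: "frag_map f (p - q) = frag_map f p - frag_map f q"
  by (simp_all add: frag_map_def frag_extend_add frag_extend_diff)

lemma keys_frag_map: "Poly_Mapping.keys (frag_map f p) \<subseteq> f ` Poly_Mapping.keys p"
  using keys_frag_extend[of "frag_of \<circ> f" p] by (auto simp: frag_map_def)

lemma keys_frag_map_subset:
  "Poly_Mapping.keys p \<subseteq> A \<Longrightarrow> f ` A \<subseteq> B \<Longrightarrow> Poly_Mapping.keys (frag_map f p) \<subseteq> B"
  using keys_frag_map[of f p] by blast

lemma frag_extend_frag_map: "frag_extend h (frag_map f p) = frag_extend (h \<circ> f) p"
  unfolding frag_map_def by (rule frag_extend_compose)

text \<open>Here \<open>K\<close> is a subgroup by which one divides: linear extensions of maps that
  agree modulo \<open>K\<close> on generators agree modulo \<open>K\<close>.\<close>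

lemma frag_extend_cong_diff:
  fixes h :: "'a \<Rightarrow> 'b \<Rightarrow>\<^sub>0 int"
  assumes "Poly_Mapping.keys p \<subseteq> A" "\<And>x. x \<in> A \<Longrightarrow> h x - h' x \<in> K"
    and "0 \<in> K" "\<And>a b. a \<in> K \<Longrightarrow> b \<in> K \<Longrightarrow> a - b \<in> K"
  shows "frag_extend h p - frag_extend h' p \<in> K"
  using assms(1)
proof (induction rule: frag_induction)
  case (diff a b)
  have "frag_extend h (a - b) - frag_extend h' (a - b)
    = (frag_extend h a - frag_extend h' a) - (frag_extend h b - frag_extend h' b)"
    by (simp add: frag_extend_diff)
  then show ?case using assms(4)[OF diff] by simp
qed (use assms in auto)

lemma keys_diff_subset:
  "Poly_Mapping.keys p \<subseteq> A \<Longrightarrow> Poly_Mapping.keys q \<subseteq> A \<Longrightarrow> Poly_Mapping.keys (p - q) \<subseteq> A"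
  for p q :: "'a \<Rightarrow>\<^sub>0 int"
  using keys_diff[of p q] by blast

lemma keys_add_subset:
  "Poly_Mapping.keys p \<subseteq> A \<Longrightarrow> Poly_Mapping.keys q \<subseteq> A \<Longrightarrow> Poly_Mapping.keys (p + q) \<subseteq> A"
  for p q :: "'a \<Rightarrow>\<^sub>0 int"
  using Poly_Mapping.keys_add[of p q] by blast

lemma keys_frag_extend_subset:
  assumes "Poly_Mapping.keys p \<subseteq> A" "\<And>x. x \<in> A \<Longrightarrow> Poly_Mapping.keys (h x) \<subseteq> B"
  shows "Poly_Mapping.keys (frag_extend h p) \<subseteq> B"
  using keys_frag_extend[of h p] assms by blast

text \<open>
  The functors \<open>P\<^sub>1 = \<int>[G\<^sup>2]\<close> and \<open>P\<^sub>2 = \<int>[G\<^sup>3] \<oplus> \<int>[G\<^sup>3]\<close>: besides the bar construction, \<open>P\<^sub>2\<close> has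
  generators expressing that a central extension of \<open>G\<close> is again of class two.
\<close>

datatype 'x relator = Assoc 'x 'x 'x | Central 'x 'x 'x

definition commutator :: "('x, 'm) monoid_scheme \<Rightarrow> 'x \<Rightarrow> 'x \<Rightarrow> 'x"
  where "commutator G x y = inv\<^bsub>G\<^esub> x \<otimes>\<^bsub>G\<^esub> inv\<^bsub>G\<^esub> y \<otimes>\<^bsub>G\<^esub> x \<otimes>\<^bsub>G\<^esub> y"

fun bd1_gen :: "('x, 'm) monoid_scheme \<Rightarrow> 'x \<times> 'x \<Rightarrow> 'x \<Rightarrow>\<^sub>0 int"
  where "bd1_gen G (x, y) = frag_of x + frag_of y - frag_of (x \<otimes>\<^bsub>G\<^esub> y)"

text \<open>The last two terms of \<open>Central\<close> make its boundary vanish when x and y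
  commute, so that such a relator is a cycle by itself; this is what is used on cyclic subgroups.
  Modulo boundaries of \<open>Assoc\<close> the two terms cancel, so the relation imposed is the
  symmetry of a pair that consists of a commutator and an arbitrary element.\<close>

primrec bd2_gen :: "('x, 'm) monoid_scheme \<Rightarrow> 'x relator \<Rightarrow> 'x \<times> 'x \<Rightarrow>\<^sub>0 int"
  where
    "bd2_gen G (Assoc x y z)
      = frag_of (y, z) - frag_of (x \<otimes>\<^bsub>G\<^esub> y, z) + frag_of (x, y \<otimes>\<^bsub>G\<^esub> z) - frag_of (x, y)"
  | "bd2_gen G (Central x y z)
      = frag_of (commutator G x y, z) - frag_of (z, commutator G x y)
        - frag_of (\<one>\<^bsub>G\<^esub>, z) + frag_of (z, \<one>\<^bsub>G\<^esub>)"

abbreviation "bd1 G \<equiv> frag_extend (bd1_gen G)"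
abbreviation "bd2 G \<equiv> frag_extend (bd2_gen G)"

definition chains1 :: "('x, 'm) monoid_scheme \<Rightarrow> ('x \<times> 'x \<Rightarrow>\<^sub>0 int) set"
  where "chains1 G = {p. Poly_Mapping.keys p \<subseteq> carrier G \<times> carrier G}"

definition chains2 :: "('x, 'm) monoid_scheme \<Rightarrow> ('x relator \<Rightarrow>\<^sub>0 int) set"
  where "chains2 G = {q. Poly_Mapping.keys q \<subseteq> {t. set_relator t \<subseteq> carrier G}}"

abbreviation "push1 r \<equiv> frag_map (map_prod r r)"
abbreviation "push2 r \<equiv> frag_map (map_relator r)"

lemma chains1_simps [simp]:
  "0 \<in> chains1 G" "frag_of (x, y) \<in> chains1 G \<longleftrightarrow> x \<in> carrier G \<and> y \<in> carrier G"
  by (auto simp: chains1_def)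

lemma chains1_add: "\<lbrakk>p \<in> chains1 G; q \<in> chains1 G\<rbrakk> \<Longrightarrow> p + q \<in> chains1 G"
  and chains1_diff: "\<lbrakk>p \<in> chains1 G; q \<in> chains1 G\<rbrakk> \<Longrightarrow> p - q \<in> chains1 G"
  unfolding chains1_def mem_Collect_eq by (rule keys_add_subset keys_diff_subset; assumption)+

lemma chains2_simps [simp]:
  "0 \<in> chains2 G" "frag_of t \<in> chains2 G \<longleftrightarrow> set_relator t \<subseteq> carrier G"
  by (auto simp: chains2_def)

lemma chains2_add: "\<lbrakk>p \<in> chains2 G; q \<in> chains2 G\<rbrakk> \<Longrightarrow> p + q \<in> chains2 G"
  and chains2_diff: "\<lbrakk>p \<in> chains2 G; q \<in> chains2 G\<rbrakk> \<Longrightarrow> p - q \<in> chains2 G"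
  unfolding chains2_def mem_Collect_eq by (rule keys_add_subset keys_diff_subset; assumption)+

lemma push2_chains2: "\<lbrakk>r \<in> hom G H; p \<in> chains2 G\<rbrakk> \<Longrightarrow> push2 r p \<in> chains2 H"
  unfolding chains2_def mem_Collect_eq
  by (rule keys_frag_map_subset, assumption) (auto simp: hom_def relator.set_map, blast)

lemma push2_comp: "push2 r (push2 s p) = push2 (r \<circ> s) p"
  unfolding frag_map_def[of "map_relator r"] frag_extend_frag_map
  by (simp add: frag_map_def o_def relator.map_comp)

lemma push2_cong:
  assumes "p \<in> chains2 G" "\<And>x. x \<in> carrier G \<Longrightarrow> r x = s x" shows "push2 r p = push2 s p"
  unfolding frag_map_def
  by (rule frag_extend_eq) (use assms in \<open>auto simp: chains2_def intro!: relator.map_cong0 arg_cong[of _ _ frag_of]\<close>)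

lemma (in group_hom) bd2_push2:
  assumes "q \<in> chains2 G" shows "bd2 H (push2 h q) = push1 h (bd2 G q)"
  using assms unfolding chains2_def mem_Collect_eq
proof (induction rule: frag_induction)
  case (one t)
  then show ?case by (cases t) (simp_all add: commutator_def frag_map_add frag_map_diff)
qed (simp_all add: frag_map_diff frag_extend_diff)

context nil2_group
begin

lemma commutator_closed [simp]: "\<lbrakk>x \<in> carrier G; y \<in> carrier G\<rbrakk> \<Longrightarrow> commutator G x y \<in> carrier G"
  by (simp add: commutator_def)

lemma bd2_gen_chains1: "set_relator t \<subseteq> carrier G \<Longrightarrow> bd2_gen G t \<in> chains1 G"
  by (cases t) (auto intro!: chains1_add chains1_diff)

lemma bd2_chains1: "q \<in> chains2 G \<Longrightarrow> bd2 G q \<in> chains1 G"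
  using bd2_gen_chains1 unfolding chains2_def chains1_def mem_Collect_eq
  by (rule_tac keys_frag_extend_subset) auto

text \<open>For \<open>Assoc\<close> this is associativity, for \<open>Central\<close> the
  centrality of commutators in a group of class two.\<close>

lemma bd1_bd2: "q \<in> chains2 G \<Longrightarrow> bd1 G (bd2 G q) = 0"
  unfolding chains2_def mem_Collect_eq
proof (induction rule: frag_induction)
  case (one t)
  then show ?case
    by (cases t) (simp_all add: frag_extend_add frag_extend_diff m_assoc
        central[folded commutator_def])
qed (simp_all add: frag_extend_diff)

end

text \<open>
  Exactness at \<open>P\<^sub>1\<close>: the universal extension of \<open>F\<^sub>n\<close> by \<open>P\<^sub>1\<close> modulo boundaries is a group of class
  two, hence it splits because \<open>F\<^sub>n\<close> is free of class two.
\<close>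

lemma bd1_exact:
  fixes n defines "F \<equiv> free_nil_module n :: ((nat \<times> 'l::monoid_add) word set, 'l) op_group"
  assumes p: "p \<in> chains1 F" "bd1 F p = 0"
  shows "\<exists>q \<in> chains2 F. bd2 F q = p"
proof -
  interpret nil2_group F unfolding F_def by (rule nil2_group_free_nil_module)
  define K where "K = bd2 F ` chains2 F"
  have K_diff: "a - b \<in> K" if "a \<in> K" "b \<in> K" for a b
  proof -
    from that obtain p q where "p \<in> chains2 F" "q \<in> chains2 F" "a = bd2 F p" "b = bd2 F q"
      by (auto simp: K_def)
    then show ?thesis unfolding K_def
      by (intro image_eqI[of _ _ "p - q"]) (simp_all add: frag_extend_diff chains2_diff)
  qed
  have K0: "0 \<in> K" unfolding K_def by (rule image_eqI[of _ _ 0]) simp_all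
  have K_neg: "- a \<in> K" if "a \<in> K" for a using K_diff[OF K0 that] by simp
  have K_add: "a + b \<in> K" if "a \<in> K" "b \<in> K" for a b using K_diff[OF that(1) K_neg[OF that(2)]] by simp
  have Kr: "bd2_gen F t \<in> K" if "set_relator t \<subseteq> carrier F" for t
    unfolding K_def by (rule image_eqI[of _ _ "frag_of t"]) (use that in simp_all)
  have KA: "frag_of (y, z) - frag_of (x \<otimes>\<^bsub>F\<^esub> y, z) + frag_of (x, y \<otimes>\<^bsub>F\<^esub> z) - frag_of (x, y) \<in> K"
    if "x \<in> carrier F" "y \<in> carrier F" "z \<in> carrier F" for x y z
    using Kr[of "Assoc x y z"] that by simp
  have K1: "frag_of (\<one>\<^bsub>F\<^esub>, z) - frag_of (\<one>\<^bsub>F\<^esub>, \<one>\<^bsub>F\<^esub>) \<in> K" "frag_of (\<one>\<^bsub>F\<^esub>, \<one>\<^bsub>F\<^esub>) - frag_of (z, \<one>\<^bsub>F\<^esub>) \<in> K"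
    if "z \<in> carrier F" for z
    using KA[of "\<one>\<^bsub>F\<^esub>" "\<one>\<^bsub>F\<^esub>" z] KA[of z "\<one>\<^bsub>F\<^esub>" "\<one>\<^bsub>F\<^esub>"] that by simp_all
  have KC: "frag_of (commutator F x y, z) - frag_of (z, commutator F x y) \<in> K"
    if "x \<in> carrier F" "y \<in> carrier F" "z \<in> carrier F" for x y z
    using K_add[OF K_add[OF Kr[of "Central x y z"] K1(1)[of z]] K1(2)[of z]] that
    by (simp add: algebra_simps)
  \<comment> \<open>All formal combinations are divided by \<open>K\<close>, not only those in
    \<open>chains1 F\<close>. This enlarges the kernel of the extension \<open>E\<close> without
    harm, since only membership in \<open>K\<close> is read off at the end.\<close>
  define cl where "cl p = {p'. p' - p \<in> K}" for p
  have cl_eq: "cl p = cl q \<longleftrightarrow> p - q \<in> K" for p q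
  proof
    assume "cl p = cl q"
    then have "p \<in> cl q" using K0 by (auto simp: cl_def)
    then show "p - q \<in> K" by (simp add: cl_def)
  next
    assume "p - q \<in> K"
    then have "p' - p \<in> K \<longleftrightarrow> p' - q \<in> K" for p'
      using K_add[of "p' - p" "p - q"] K_diff[of "p' - q" "p - q"] by auto
    then show "cl p = cl q" by (simp add: cl_def)
  qed
  \<comment> \<open>The extension by the universal cocycle that sends (x, y) to the class of
    \<open>frag_of (x, y)\<close>. The cocycle is not normalized, hence the term
    \<open>- frag_of (1, 1)\<close> in the unit.\<close>
  define E where "E = \<lparr>carrier = range cl \<times> carrier F,
    monoid.mult = (\<lambda>(U, x) (V, y). (\<Union>u\<in>U. \<Union>v\<in>V. cl (u + v + frag_of (x, y)), x \<otimes>\<^bsub>F\<^esub> y)),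
    one = (cl (- frag_of (\<one>\<^bsub>F\<^esub>, \<one>\<^bsub>F\<^esub>)), \<one>\<^bsub>F\<^esub>)\<rparr>"
  have Ec: "carrier E = range cl \<times> carrier F" and E1: "\<one>\<^bsub>E\<^esub> = (cl (- frag_of (\<one>\<^bsub>F\<^esub>, \<one>\<^bsub>F\<^esub>)), \<one>\<^bsub>F\<^esub>)"
    by (simp_all add: E_def)
  have Em: "(cl p, x) \<otimes>\<^bsub>E\<^esub> (cl q, y) = (cl (p + q + frag_of (x, y)), x \<otimes>\<^bsub>F\<^esub> y)" for p q x y
  proof -
    have "cl (u + v + frag_of (x, y)) = cl (p + q + frag_of (x, y))" if "u \<in> cl p" "v \<in> cl q" for u v
      using K_add[of "u - p" "v - q"] that unfolding cl_eq by (simp add: cl_def algebra_simps)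
    then have "(\<Union>u\<in>cl p. \<Union>v\<in>cl q. cl (u + v + frag_of (x, y)))
        = (\<Union>u\<in>cl p. \<Union>v\<in>cl q. cl (p + q + frag_of (x, y)))"
      by (intro SUP_cong HOL.refl)
    also have "\<dots> = cl (p + q + frag_of (x, y))"
    proof -
      have "p \<in> cl p" for p using K0 by (simp add: cl_def)
      then have "cl p \<noteq> {}" for p by blast
      then show ?thesis by simp
    qed
    finally show ?thesis by (simp add: E_def)
  qed
  interpret E: group E
  proof (rule groupI)
    fix X Y Z assume "X \<in> carrier E" "Y \<in> carrier E" "Z \<in> carrier E"
    then obtain p x q y r z where eq: "X = (cl p, x)" "Y = (cl q, y)" "Z = (cl r, z)"
      and m: "x \<in> carrier F" "y \<in> carrier F" "z \<in> carrier F" by (auto simp: Ec)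
    show "X \<otimes>\<^bsub>E\<^esub> Y \<in> carrier E" using m by (auto simp: eq Em Ec)
    show "X \<otimes>\<^bsub>E\<^esub> Y \<otimes>\<^bsub>E\<^esub> Z = X \<otimes>\<^bsub>E\<^esub> (Y \<otimes>\<^bsub>E\<^esub> Z)"
      using K_neg[OF KA[OF m]] m by (auto simp: eq Em cl_eq m_assoc algebra_simps)
  next
    fix X assume "X \<in> carrier E"
    then obtain p x where eq: "X = (cl p, x)" and m: "x \<in> carrier F" by (auto simp: Ec)
    show "\<one>\<^bsub>E\<^esub> \<otimes>\<^bsub>E\<^esub> X = X" using K1(1)[OF m] m by (auto simp: eq E1 Em cl_eq)
    show "\<exists>Y\<in>carrier E. Y \<otimes>\<^bsub>E\<^esub> X = \<one>\<^bsub>E\<^esub>"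
      by (rule bexI[of _ "(cl (- p - frag_of (inv\<^bsub>F\<^esub> x, x) - frag_of (\<one>\<^bsub>F\<^esub>, \<one>\<^bsub>F\<^esub>)), inv\<^bsub>F\<^esub> x)"])
        (use m in \<open>auto simp: eq E1 Em Ec\<close>)
  qed (simp add: E1 Ec)
  have snd_hom: "snd \<in> hom E F" by (auto simp: hom_def Ec Em)
  interpret snd: group_hom E F snd
    by (simp add: group_hom_def group_hom_axioms_def is_group E.is_group snd_hom)
  \<comment> \<open>A commutator of \<open>E\<close> lies over a commutator c of \<open>F\<close>.
    It commutes with an element over z as soon as c commutes with z and the cocycle is symmetric on
    (c, z), whatever the first components are; the symmetry is \<open>KC\<close>.\<close>
  have central_E: "(inv\<^bsub>E\<^esub> X \<otimes>\<^bsub>E\<^esub> inv\<^bsub>E\<^esub> Y \<otimes>\<^bsub>E\<^esub> X \<otimes>\<^bsub>E\<^esub> Y) \<otimes>\<^bsub>E\<^esub> Z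
      = Z \<otimes>\<^bsub>E\<^esub> (inv\<^bsub>E\<^esub> X \<otimes>\<^bsub>E\<^esub> inv\<^bsub>E\<^esub> Y \<otimes>\<^bsub>E\<^esub> X \<otimes>\<^bsub>E\<^esub> Y)"
    if XYZ: "X \<in> carrier E" "Y \<in> carrier E" "Z \<in> carrier E" for X Y Z
  proof -
    let ?C = "inv\<^bsub>E\<^esub> X \<otimes>\<^bsub>E\<^esub> inv\<^bsub>E\<^esub> Y \<otimes>\<^bsub>E\<^esub> X \<otimes>\<^bsub>E\<^esub> Y"
    have C: "?C \<in> carrier E" using XYZ by simp
    have "snd ?C = commutator F (snd X) (snd Y)" using XYZ by (simp add: commutator_def)
    then obtain d where d: "?C = (cl d, commutator F (snd X) (snd Y))" using C by (cases ?C) (auto simp: Ec)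
    obtain r where r: "Z = (cl r, snd Z)" using XYZ by (cases Z) (auto simp: Ec)
    have m: "snd X \<in> carrier F" "snd Y \<in> carrier F" "snd Z \<in> carrier F" using XYZ by auto
    have "(cl d, commutator F (snd X) (snd Y)) \<otimes>\<^bsub>E\<^esub> (cl r, snd Z)
      = (cl r, snd Z) \<otimes>\<^bsub>E\<^esub> (cl d, commutator F (snd X) (snd Y))"
      using KC[OF m] central[OF m] unfolding Em by (simp add: cl_eq commutator_def algebra_simps)
    then show ?thesis unfolding d r[symmetric] .
  qed
  \<comment> \<open>Freeness allows lifting the basis to \<open>E\<close> arbitrarily. The composite
    \<open>snd \<circ> r\<close> is the identity on the basis and therefore everywhere, so
    \<open>r\<close> is a section.\<close>
  obtain r where r: "r \<in> hom F E" "\<And>i s. i < n \<Longrightarrow> r (nil_basis n i s) = (cl 0, nil_basis n i s)"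
    using free_nil_module_group_hom[OF E.is_group central_E, of n "\<lambda>i s. (cl 0, nil_basis n i s)"]
    by (auto simp: Ec F_def)
  have "snd \<circ> r \<in> hom F F" using r(1) snd_hom by (rule Group.hom_compose)
  moreover have "(\<lambda>x. x) \<in> hom F F" by (simp add: hom_def)
  ultimately have "(snd \<circ> r) x = (\<lambda>x. x) x" if "x \<in> carrier F" for x
    using free_nil_module_hom_eqI[OF is_group, of "snd \<circ> r" n "\<lambda>x. x" x, folded F_def] that r(2)
    by simp
  then have "snd (r x) = x" if "x \<in> carrier F" for x using that by simp
  moreover have "r x \<in> range cl \<times> carrier F" if "x \<in> carrier F" for x
    using hom_in_carrier[OF r(1) that] by (simp add: Ec)
  ultimately have "\<exists>p. r x = (cl p, x)" if "x \<in> carrier F" for x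
    using that by (simp add: prod_eq_iff mem_Times_iff) blast
  then obtain u where u: "\<And>x. x \<in> carrier F \<Longrightarrow> r x = (cl (u x), x)" by metis
  have u2: "frag_of (x, y) + u x + u y - u (x \<otimes>\<^bsub>F\<^esub> y) \<in> K" if "x \<in> carrier F" "y \<in> carrier F" for x y
  proof -
    have "r (x \<otimes>\<^bsub>F\<^esub> y) = r x \<otimes>\<^bsub>E\<^esub> r y" using r(1) that by (simp add: hom_def)
    then have "u (x \<otimes>\<^bsub>F\<^esub> y) - (u x + u y + frag_of (x, y)) \<in> K" using that by (simp add: u Em cl_eq)
    from K_neg[OF this] show ?thesis by (simp add: algebra_simps)
  qed
  \<comment> \<open>The section exhibits the universal cocycle as a coboundary: by \<open>u2\<close>
    the pair (x, y) is congruent to minus the value of \<open>u\<close> on its boundary. For a cycle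
    this value is zero, which puts the cycle into \<open>K\<close>.\<close>
  have "p + frag_extend u (bd1 F p) \<in> K"
    using p(1) unfolding chains1_def mem_Collect_eq
  proof (induction rule: frag_induction)
    case (one xy)
    then show ?case using u2 by (auto simp: frag_extend_add frag_extend_diff algebra_simps)
  next
    case (diff a b)
    from K_diff[OF diff] show ?case by (simp add: frag_extend_diff algebra_simps)
  qed (simp add: K0)
  then show ?thesis using p(2) by (auto simp: K_def)
qed

text \<open>
  Since the abelianization of \<open>F\<^sub>n\<close> is free abelian, the image of \<open>bd1\<close> is a direct summand of \<open>\<int>[F\<^sub>n]\<close>.
\<close>

lemma bd1_section:
  fixes n defines "F \<equiv> free_nil_module n :: ((nat \<times> 'l::monoid_add) word set, 'l) op_group"
  obtains \<sigma> where "\<And>x. x \<in> carrier F \<Longrightarrow> \<sigma> x \<in> chains1 F"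
    and "\<And>x y. \<lbrakk>x \<in> carrier F; y \<in> carrier F\<rbrakk> \<Longrightarrow>
      bd1 F (frag_of (x, y) - \<sigma> x - \<sigma> y + \<sigma> (x \<otimes>\<^bsub>F\<^esub> y)) = 0"
proof -
  interpret group F unfolding F_def by (rule group_free_nil_module)
  \<comment> \<open>\<open>s x\<close> is the combination of basis elements with the same image as x
    in the abelianization, so \<open>frag_of x - s x\<close> is a boundary, as induction on x shows.
    With \<open>bd1 F (\<sigma> x) = frag_of x - s x\<close> the additivity of \<open>s\<close>
    gives the claim.\<close>
  obtain s where s_mult: "\<And>x y. \<lbrakk>x \<in> carrier F; y \<in> carrier F\<rbrakk> \<Longrightarrow> s (x \<otimes>\<^bsub>F\<^esub> y) = s x + s y"
    and s_basis: "\<And>i s'. i < n \<Longrightarrow> s (nil_basis n i s') = frag_of (nil_basis n i s')"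
    using free_nil_module_additive[of n "\<lambda>i s. frag_of (nil_basis n i s)"] unfolding F_def by metis
  have s1: "s \<one>\<^bsub>F\<^esub> = 0" using s_mult[of "\<one>\<^bsub>F\<^esub>" "\<one>\<^bsub>F\<^esub>"] by simp
  have "\<exists>p \<in> chains1 F. bd1 F p = frag_of x - s x" if "x \<in> carrier F" for x
    using that
  proof (induction rule: free_nil_module_induct[of "x :: (nat \<times> 'l) word set" n for x, folded F_def, consumes 1, case_names one basis mult inv])
    case one
    show ?case by (rule bexI[of _ "frag_of (\<one>\<^bsub>F\<^esub>, \<one>\<^bsub>F\<^esub>)"]) (simp_all add: s1)
  next
    case (basis i s')
    show ?case by (rule bexI[of _ 0]) (simp_all add: s_basis basis)
  next
    case (mult x y)
    then obtain p q where pq: "p \<in> chains1 F" "q \<in> chains1 F" "bd1 F p = frag_of x - s x" "bd1 F q = frag_of y - s y"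
      by blast
    show ?case
      by (rule bexI[of _ "p + q - frag_of (x, y)"])
        (use mult(1,2) pq in \<open>simp_all add: s_mult frag_extend_add frag_extend_diff chains1_add chains1_diff\<close>)
  next
    case (inv x)
    then obtain p where p: "p \<in> chains1 F" "bd1 F p = frag_of x - s x" by blast
    have "s x + s (inv\<^bsub>F\<^esub> x) = 0" using s_mult[of x "inv\<^bsub>F\<^esub> x"] inv(1) s1 by simp
    then have "s (inv\<^bsub>F\<^esub> x) = - s x" by (simp add: eq_neg_iff_add_eq_0 add.commute)
    \<comment> \<open>\<open>bd1 F\<close> maps (x, inv x) + (1, 1) to the formal sum of x and inv
      x; subtracting \<open>p\<close> replaces x by \<open>s x\<close>, which is
      \<open>- s (inv x)\<close>.\<close>
    then show ?case
      by (intro bexI[of _ "frag_of (x, inv\<^bsub>F\<^esub> x) + frag_of (\<one>\<^bsub>F\<^esub>, \<one>\<^bsub>F\<^esub>) - p"])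
        (use inv(1) p in \<open>simp_all add: frag_extend_add frag_extend_diff chains1_add chains1_diff\<close>)
  qed
  then obtain \<sigma> where \<sigma>: "\<And>x. x \<in> carrier F \<Longrightarrow> \<sigma> x \<in> chains1 F"
    "\<And>x. x \<in> carrier F \<Longrightarrow> bd1 F (\<sigma> x) = frag_of x - s x" by metis
  show thesis
    by (rule that[of \<sigma>]) (simp_all add: \<sigma> s_mult frag_extend_add frag_extend_diff)
qed

section \<open>Natural cochains\<close>

interpretation nil_free: nil2_group "free_nil_module n" for n
  by (rule nil2_group_free_nil_module)

text \<open>
  An additive functor from \<open>mod-Q\<close> to abelian groups, presented by the quotients of a fixed free
  abelian group by subgroups \<open>R n\<close>, which allows one to calculate in a type of class
  \<^class>\<open>ab_group_add\<close>.  The last assumption says that the functor preserves direct sums.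
\<close>

locale additive_functor =
  fixes R :: "nat \<Rightarrow> ('q \<Rightarrow>\<^sub>0 int) set"
    and T :: "'l::monoid_add mod_Q_arrow \<Rightarrow> ('q \<Rightarrow>\<^sub>0 int) \<Rightarrow> 'q \<Rightarrow>\<^sub>0 int"
  assumes R_0 [simp]: "0 \<in> R n"
    and R_diff: "\<lbrakk>a \<in> R n; b \<in> R n\<rbrakk> \<Longrightarrow> a - b \<in> R n"
    and T_diff: "T \<alpha> (a - b) = T \<alpha> a - T \<alpha> b"
    and T_R: "\<lbrakk>\<alpha> \<in> arrows m n; a \<in> R n\<rbrakk> \<Longrightarrow> T \<alpha> a \<in> R m"
    and T_comp: "\<lbrakk>\<alpha> \<in> arrows m n; \<beta> \<in> arrows n k\<rbrakk> \<Longrightarrow> T (\<alpha> \<odot> \<beta>) a = T \<alpha> (T \<beta> a)"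
    and T_split: "\<alpha> \<in> arrows m k \<Longrightarrow> T \<alpha> a - (\<Sum>j<k. T (\<alpha> \<odot> proj_arrow k j) a) \<in> R m"
begin

abbreviation F :: "nat \<Rightarrow> ((nat \<times> 'l) word set, 'l) op_group"
  where "F \<equiv> free_nil_module"

lemma R_minus: "a \<in> R n \<Longrightarrow> - a \<in> R n"
  using R_diff[OF R_0, of a n] by simp

lemma R_minus_iff [simp]: "- a \<in> R n \<longleftrightarrow> a \<in> R n"
  using R_minus[of a n] R_minus[of "- a" n] by auto

lemma R_add: "\<lbrakk>a \<in> R n; b \<in> R n\<rbrakk> \<Longrightarrow> a + b \<in> R n"
  using R_diff[OF _ R_minus, of a n b] by simp

lemma R_sum: "(\<And>i. i \<in> I \<Longrightarrow> f i \<in> R n) \<Longrightarrow> sum f I \<in> R n"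
  by (induction I rule: infinite_finite_induct) (auto intro: R_add)

lemma R_diff_swap: "a - b \<in> R n \<longleftrightarrow> b - a \<in> R n"
  using R_minus_iff[of "a - b" n] by simp

lemma R_cong: "a - b \<in> R n \<Longrightarrow> a \<in> R n \<longleftrightarrow> b \<in> R n"
  using R_add[of "a - b" n b] R_diff[of a n "a - b"] by auto

lemma T_0 [simp]: "T \<alpha> 0 = 0"
  using T_diff[of \<alpha> 0 0] by simp

lemma T_minus: "T \<alpha> (- a) = - T \<alpha> a"
  using T_diff[of \<alpha> 0 a] by simp

lemma T_add: "T \<alpha> (a + b) = T \<alpha> a + T \<alpha> b"
  using T_diff[of \<alpha> a "- b"] by (simp add: T_minus)

lemma T_frag_extend: "T \<alpha> (frag_extend g p) = frag_extend (\<lambda>t. T \<alpha> (g t)) p"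
proof -
  have "Poly_Mapping.keys p \<subseteq> UNIV" by simp
  then show ?thesis
    by (induction rule: frag_induction) (simp_all add: frag_extend_diff T_diff)
qed

text \<open>A transformation to T from the functor represented by F_k, that is, from k-tuples of
  elements. Equality in T(F_m) is membership of the difference in \<open>R m\<close>; additivity in
  the entries is not part of the notion.\<close>

definition natural :: "nat \<Rightarrow> (nat \<Rightarrow> (nat \<times> 'l) word set list \<Rightarrow> 'q \<Rightarrow>\<^sub>0 int) \<Rightarrow> bool"
  where "natural k \<psi> \<longleftrightarrow> (\<forall>m n \<alpha> ys. \<alpha> \<in> arrows m n \<longrightarrow> length ys = k \<longrightarrow> set ys \<subseteq> carrier (F n) \<longrightarrow>
     T \<alpha> (\<psi> n ys) - \<psi> m (map (app \<alpha>) ys) \<in> R m)"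

lemma naturalI:
  assumes "\<And>m n \<alpha> ys. \<lbrakk>\<alpha> \<in> arrows m n; length ys = k; set ys \<subseteq> carrier (F n)\<rbrakk>
    \<Longrightarrow> T \<alpha> (\<psi> n ys) - \<psi> m (map (app \<alpha>) ys) \<in> R m"
  shows "natural k \<psi>"
  using assms by (simp add: natural_def)

text \<open>
  A natural transformation in \<open>k\<close> variables with values in an additive functor is the sum of its
  restrictions to the single variables.
\<close>

lemma natural_split:
  assumes \<psi>: "natural k \<psi>" and ys: "set ys \<subseteq> carrier (F c)" "length ys = k"
  shows "\<psi> c ys - (\<Sum>j<k. \<psi> c (map (\<lambda>i. if i = j then ys ! i else \<one>\<^bsub>F c\<^esub>) [0..<k])) \<in> R c"
proof -
  \<comment> \<open>\<open>?E\<close> is the generic tuple. By naturality each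
    \<open>\<psi> c zs\<close> is the image of the one element \<open>\<psi> k ?E\<close> under
    \<open>T (tuple c zs)\<close>, so the claim is \<open>T_split\<close> for
    \<open>tuple c ys\<close>.\<close>
  let ?E = "map (\<lambda>i. nil_basis k i 0) [0..<k] :: (nat \<times> 'l) word set list"
  let ?y = "\<lambda>j. map (\<lambda>i. if i = j then ys ! i else \<one>\<^bsub>F c\<^esub>) [0..<k]"
  have E: "set ?E \<subseteq> carrier (F k)" "length ?E = k" by auto
  have tup: "T (tuple c zs) (\<psi> k ?E) - \<psi> c zs \<in> R c" if "set zs \<subseteq> carrier (F c)" "length zs = k" for zs
  proof -
    have "map (app (tuple c zs)) ?E = zs"
      using that by (auto simp: app_tuple intro: nth_equalityI)
    moreover have "T (tuple c zs) (\<psi> k ?E) - \<psi> c (map (app (tuple c zs)) ?E) \<in> R c"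
      using \<psi> E tuple_arrows[OF that(1) that(2)[symmetric]] unfolding natural_def by blast
    ultimately show ?thesis by simp
  qed
  have y: "set (?y j) \<subseteq> carrier (F c)" for j using ys by auto
  have "T (tuple c ys) (\<psi> k ?E) - (\<Sum>j<k. T (tuple c (?y j)) (\<psi> k ?E)) \<in> R c"
    using T_split[OF tuple_arrows[OF ys(1) ys(2)[symmetric]]] ys by (simp add: tuple_comp_proj_arrow)
  moreover have "(\<Sum>j<k. T (tuple c (?y j)) (\<psi> k ?E) - \<psi> c (?y j)) \<in> R c"
    by (intro R_sum tup y) simp
  ultimately have "T (tuple c ys) (\<psi> k ?E) - (\<Sum>j<k. \<psi> c (?y j)) \<in> R c"
    using R_add by (fastforce simp: sum_subtractf)
  from R_diff[OF this tup[OF ys]] show ?thesis by simp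
qed

text \<open>For k = 0 the sum in \<open>natural_split\<close> is empty, so a natural constant is
  zero. This case disposes of values at trivial elements.\<close>

lemma natural_vanish:
  assumes "natural k \<psi>" "set ys \<subseteq> carrier (F c)" "length ys = k"
    and "\<And>j. j < k \<Longrightarrow> \<psi> c (map (\<lambda>i. if i = j then ys ! i else \<one>\<^bsub>F c\<^esub>) [0..<k]) \<in> R c"
  shows "\<psi> c ys \<in> R c"
  using R_cong[OF natural_split[OF assms(1-3)]] R_sum[of "{..<k}", OF assms(4)] by simp

lemma natural_vanish_2:
  assumes "natural 2 \<psi>" "x \<in> carrier (F c)" "y \<in> carrier (F c)"
    and "\<psi> c [x, \<one>\<^bsub>F c\<^esub>] \<in> R c" "\<psi> c [\<one>\<^bsub>F c\<^esub>, y] \<in> R c"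
  shows "\<psi> c [x, y] \<in> R c"
proof (rule natural_vanish[OF assms(1)])
  fix j :: nat assume "j < 2"
  then consider "j = 0" | "j = 1" by linarith
  then show "\<psi> c (map (\<lambda>i. if i = j then [x, y] ! i else \<one>\<^bsub>F c\<^esub>) [0..<2]) \<in> R c"
    by cases (use assms in \<open>simp_all add: numeral_eq_Suc\<close>)
qed (use assms in simp_all)

lemma natural_vanish_3:
  assumes "natural 3 \<psi>" "x \<in> carrier (F c)" "y \<in> carrier (F c)" "z \<in> carrier (F c)"
    and "\<psi> c [x, \<one>\<^bsub>F c\<^esub>, \<one>\<^bsub>F c\<^esub>] \<in> R c" "\<psi> c [\<one>\<^bsub>F c\<^esub>, y, \<one>\<^bsub>F c\<^esub>] \<in> R c"
      "\<psi> c [\<one>\<^bsub>F c\<^esub>, \<one>\<^bsub>F c\<^esub>, z] \<in> R c"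
  shows "\<psi> c [x, y, z] \<in> R c"
proof (rule natural_vanish[OF assms(1)])
  fix j :: nat assume "j < 3"
  then consider "j = 0" | "j = 1" | "j = 2" by linarith
  then show "\<psi> c (map (\<lambda>i. if i = j then [x, y, z] ! i else \<one>\<^bsub>F c\<^esub>) [0..<3]) \<in> R c"
    by cases (use assms in \<open>simp_all add: numeral_eq_Suc\<close>)
qed (use assms in simp_all)

lemma natural_vanish_4:
  assumes "natural 4 \<psi>" "x \<in> carrier (F c)" "y \<in> carrier (F c)" "z \<in> carrier (F c)" "w \<in> carrier (F c)"
    and "\<psi> c [x, \<one>\<^bsub>F c\<^esub>, \<one>\<^bsub>F c\<^esub>, \<one>\<^bsub>F c\<^esub>] \<in> R c" "\<psi> c [\<one>\<^bsub>F c\<^esub>, y, \<one>\<^bsub>F c\<^esub>, \<one>\<^bsub>F c\<^esub>] \<in> R c"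
      "\<psi> c [\<one>\<^bsub>F c\<^esub>, \<one>\<^bsub>F c\<^esub>, z, \<one>\<^bsub>F c\<^esub>] \<in> R c" "\<psi> c [\<one>\<^bsub>F c\<^esub>, \<one>\<^bsub>F c\<^esub>, \<one>\<^bsub>F c\<^esub>, w] \<in> R c"
  shows "\<psi> c [x, y, z, w] \<in> R c"
proof (rule natural_vanish[OF assms(1)])
  fix j :: nat assume "j < 4"
  then consider "j = 0" | "j = 1" | "j = 2" | "j = 3" by linarith
  then show "\<psi> c (map (\<lambda>i. if i = j then [x, y, z, w] ! i else \<one>\<^bsub>F c\<^esub>) [0..<4]) \<in> R c"
    by cases (use assms in \<open>simp_all add: numeral_eq_Suc\<close>)
qed (use assms in simp_all)

lemma frag_extend_R:
  assumes "Poly_Mapping.keys p \<subseteq> A" "\<And>t. t \<in> A \<Longrightarrow> h t \<in> R c"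
  shows "frag_extend h p \<in> R c"
  using frag_extend_cong_diff[of p A h "\<lambda>_. 0" "R c"] assms R_diff
  by (simp add: frag_extend_eq_0)

end

section \<open>Finite supports and auxiliary functions\<close>

text \<open>Phrased by endomorphisms, so that no normal form of words has to be chosen. This is the
  form in which supports are used: a map that fixes finitely many basis elements fixes x.\<close>

definition supported_by :: "nat \<Rightarrow> (nat \<times> 'l::monoid_add) set \<Rightarrow> (nat \<times> 'l) word set \<Rightarrow> bool"
  where "supported_by n J x \<longleftrightarrow> (\<forall>f \<in> hom (free_nil_module n) (free_nil_module n).
    (\<forall>(i, s) \<in> J. f (nil_basis n i s) = nil_basis n i s) \<longrightarrow> f x = x)"

lemma supported_byD:
  assumes "supported_by n J x" "f \<in> hom (free_nil_module n) (free_nil_module n)"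
    and "\<And>i s. (i, s) \<in> J \<Longrightarrow> f (nil_basis n i s) = nil_basis n i s"
  shows "f x = x"
  using assms by (auto simp: supported_by_def)

lemma supported_byI:
  assumes "\<And>f. \<lbrakk>f \<in> hom (free_nil_module n) (free_nil_module n);
    \<And>i s. (i, s) \<in> J \<Longrightarrow> f (nil_basis n i s) = nil_basis n i s\<rbrakk> \<Longrightarrow> f x = x"
  shows "supported_by n J x"
  unfolding supported_by_def by (intro ballI impI assms) auto

lemma free_nil_module_support:
  fixes x :: "(nat \<times> 'l::monoid_add) word set"
  assumes "x \<in> carrier (free_nil_module n)"
  shows "\<exists>J. finite J \<and> J \<subseteq> {..<n} \<times> UNIV \<and> supported_by n J x"
  using assms
proof (induction rule: free_nil_module_induct)
  case one
  show ?case
    by (rule exI[of _ "{}"])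
      (simp add: supported_by_def hom_one[OF _ group_free_nil_module group_free_nil_module])
next
  case (basis i s)
  then show ?case by (intro exI[of _ "{(i, s)}"]) (simp add: supported_by_def)
next
  case (mult x y)
  from mult(3) obtain J where J: "finite J" "J \<subseteq> {..<n} \<times> UNIV" "supported_by n J x" by blast
  from mult(4) obtain K where K: "finite K" "K \<subseteq> {..<n} \<times> UNIV" "supported_by n K y" by blast
  have "supported_by n (J \<union> K) (x \<otimes>\<^bsub>free_nil_module n\<^esub> y)"
  proof (rule supported_byI)
    fix f :: "(nat \<times> 'l) word set \<Rightarrow> (nat \<times> 'l) word set"
    assume f: "f \<in> hom (free_nil_module n) (free_nil_module n)"
      "\<And>i s. (i, s) \<in> J \<union> K \<Longrightarrow> f (nil_basis n i s) = nil_basis n i s"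
    have "f x = x" by (rule supported_byD[OF J(3) f(1)]) (simp add: f(2))
    moreover have "f y = y" by (rule supported_byD[OF K(3) f(1)]) (simp add: f(2))
    ultimately show "f (x \<otimes>\<^bsub>free_nil_module n\<^esub> y) = x \<otimes>\<^bsub>free_nil_module n\<^esub> y"
      using hom_mult[OF f(1) mult(1,2)] by simp
  qed
  then show ?case using J K by (intro exI[of _ "J \<union> K"]) simp
next
  case (inv x)
  from inv(2) obtain J where J: "finite J" "J \<subseteq> {..<n} \<times> UNIV" "supported_by n J x" by blast
  have "supported_by n J (inv\<^bsub>free_nil_module n\<^esub> x)"
  proof (rule supported_byI)
    fix f :: "(nat \<times> 'l) word set \<Rightarrow> (nat \<times> 'l) word set"
    assume f: "f \<in> hom (free_nil_module n) (free_nil_module n)"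
      "\<And>i s. (i, s) \<in> J \<Longrightarrow> f (nil_basis n i s) = nil_basis n i s"
    have "group_hom (free_nil_module n) (free_nil_module n) f"
      by (simp add: group_hom_def group_hom_axioms_def group_free_nil_module f(1))
    from group_hom.hom_inv[OF this inv(1)]
    show "f (inv\<^bsub>free_nil_module n\<^esub> x) = inv\<^bsub>free_nil_module n\<^esub> x"
      using supported_byD[OF J(3) f] by simp
  qed
  then show ?case using J by (intro exI[of _ J]) simp
qed

lemma free_nil_module_additive_ex:
  fixes b :: "nat \<Rightarrow> 'l::monoid_add \<Rightarrow> 'a::ab_group_add"
  shows "\<exists>h. (\<forall>x \<in> carrier (free_nil_module n). \<forall>y \<in> carrier (free_nil_module n).
      h (x \<otimes>\<^bsub>free_nil_module n\<^esub> y) = h x + h y) \<and> (\<forall>i<n. \<forall>s. h (nil_basis n i s) = b i s)"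
  by (rule free_nil_module_additive[of n b]) blast

text \<open>Discrete integration in both directions from the base point 1; to its left the sum
  enters with a minus sign. The base point is the argument at which a cocycle on the integers is
  normalized in \<open>vanish_cyclic\<close>.\<close>

lemma int_function_with_differences:
  fixes h :: "int \<Rightarrow> 'a::ab_group_add"
  obtains U where "U 1 = 0" "\<And>k. U (k + 1) = U k + h k"
proof -
  let ?U = "\<lambda>k. if k \<ge> 1 then sum h {1..<k} else - sum h {k..<1}"
  have "?U (k + 1) = ?U k + h k" for k :: int
  proof (cases "k \<ge> 1")
    case True
    then have "{1..<k + 1} = insert k {1..<k}" by auto
    then show ?thesis using True by (simp add: add.commute)
  next
    case False
    then have "{k..<1} = insert k {k + 1..<1}" by auto
    then show ?thesis using False by (auto simp: algebra_simps)
  qed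
  then show thesis by (intro that[of ?U]) simp_all
qed

text \<open>
  A cochain \<open>g2\<close> on \<open>P\<^sub>2\<close> which is natural up to \<open>g1 \<circ> bd2\<close>, hence natural on cycles.
\<close>

locale natural_on_cycles = additive_functor R T
  for R :: "nat \<Rightarrow> ('q \<Rightarrow>\<^sub>0 int) set" and T :: "'l::monoid_add mod_Q_arrow \<Rightarrow> ('q \<Rightarrow>\<^sub>0 int) \<Rightarrow> 'q \<Rightarrow>\<^sub>0 int" +
  fixes g2 :: "nat \<Rightarrow> (nat \<times> 'l) word set relator \<Rightarrow> 'q \<Rightarrow>\<^sub>0 int"
    and g1 :: "'l mod_Q_arrow \<Rightarrow> ((nat \<times> 'l) word set \<times> (nat \<times> 'l) word set \<Rightarrow>\<^sub>0 int) \<Rightarrow> 'q \<Rightarrow>\<^sub>0 int"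
  assumes g1_0: "g1 \<alpha> 0 = 0"
    and g2_natural: "\<lbrakk>\<alpha> \<in> arrows m n; q \<in> chains2 (free_nil_module n)\<rbrakk> \<Longrightarrow>
      T \<alpha> (frag_extend (g2 n) q) - frag_extend (g2 m) (push2 (app \<alpha>) q)
        + g1 \<alpha> (bd2 (free_nil_module n) q) \<in> R m"
begin

lemma natural_cycle:
  assumes "\<alpha> \<in> arrows m n" "q \<in> chains2 (F n)" "bd2 (F n) q = 0"
  shows "T \<alpha> (frag_extend (g2 n) q) - frag_extend (g2 m) (push2 (app \<alpha>) q) \<in> R m"
  using g2_natural[OF assms(1,2)] by (simp add: assms(3) g1_0)

text \<open>\<open>g2\<close> is natural on cycles only. A cycle given by a formula in k elements
  therefore yields a natural transformation in k variables, which can be tested one variable at a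
  time.\<close>

lemma natural_cycle_family:
  assumes "\<And>n ys. \<lbrakk>length ys = k; set ys \<subseteq> carrier (F n)\<rbrakk> \<Longrightarrow> Q n ys \<in> chains2 (F n) \<and> bd2 (F n) (Q n ys) = 0"
    and "\<And>m n \<alpha> ys. \<lbrakk>\<alpha> \<in> arrows m n; length ys = k; set ys \<subseteq> carrier (F n)\<rbrakk>
      \<Longrightarrow> push2 (app \<alpha>) (Q n ys) = Q m (map (app \<alpha>) ys)"
  shows "natural k (\<lambda>n ys. frag_extend (g2 n) (Q n ys))"
proof (rule naturalI)
  fix m n ys and \<alpha> :: "'l mod_Q_arrow" assume *: "\<alpha> \<in> arrows m n" "length ys = k" "set ys \<subseteq> carrier (F n)"
  show "T \<alpha> (frag_extend (g2 n) (Q n ys)) - frag_extend (g2 m) (Q m (map (app \<alpha>) ys)) \<in> R m"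
    using natural_cycle[OF *(1), of "Q n ys"] assms(1)[OF *(2,3)] assms(2)[OF *] by simp
qed

end

lemma length_eq_2: "length xs = 2 \<longleftrightarrow> (\<exists>x y. xs = [x, y])"
  and length_eq_3: "length xs = 3 \<longleftrightarrow> (\<exists>x y z. xs = [x, y, z])"
  and length_eq_4: "length xs = 4 \<longleftrightarrow> (\<exists>x y z w. xs = [x, y, z, w])"
  by (auto simp: numeral_eq_Suc length_Suc_conv)

lemma app_commutator:
  assumes "\<alpha> \<in> arrows m n" "x \<in> carrier (free_nil_module n)" "y \<in> carrier (free_nil_module n)"
  shows "app \<alpha> (commutator (free_nil_module n) x y) = commutator (free_nil_module m) (app \<alpha> x) (app \<alpha> y)"
proof -
  interpret group_hom "free_nil_module n" "free_nil_module m" "app \<alpha>" by (rule app_group_hom[OF assms(1)])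
  show ?thesis using assms by (simp add: commutator_def)
qed

lemma app_int_pow:
  assumes "\<alpha> \<in> arrows m n" "x \<in> carrier (free_nil_module n)"
  shows "app \<alpha> (x [^]\<^bsub>free_nil_module n\<^esub> (i::int)) = app \<alpha> x [^]\<^bsub>free_nil_module m\<^esub> i"
  using assms by (intro group_hom.hom_int_pow[OF app_group_hom])

lemma (in group) commutator_one [simp]:
  "x \<in> carrier G \<Longrightarrow> commutator G x \<one> = \<one>" "x \<in> carrier G \<Longrightarrow> commutator G \<one> x = \<one>"
  by (simp_all add: commutator_def)

text \<open>These relators have at most one nontrivial entry and zero boundary; their values are
  what remains when the identities below are tested one variable at a time.
  \<open>Assoc x 1 1\<close> and \<open>Assoc 1 1 x\<close> are absent because in general they are
  not cycles.\<close>

locale normalized_on_cycles = natural_on_cycles R T g2 g1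
  for R :: "nat \<Rightarrow> ('q \<Rightarrow>\<^sub>0 int) set" and T :: "'l::monoid_add mod_Q_arrow \<Rightarrow> ('q \<Rightarrow>\<^sub>0 int) \<Rightarrow> 'q \<Rightarrow>\<^sub>0 int"
    and g2 g1 +
  assumes Assoc_1: "y \<in> carrier (free_nil_module n) \<Longrightarrow> g2 n (Assoc \<one>\<^bsub>free_nil_module n\<^esub> y \<one>\<^bsub>free_nil_module n\<^esub>) \<in> R n"
    and Central_1: "x \<in> carrier (free_nil_module n) \<Longrightarrow> g2 n (Central x \<one>\<^bsub>free_nil_module n\<^esub> \<one>\<^bsub>free_nil_module n\<^esub>) \<in> R n"
    and Central_2: "x \<in> carrier (free_nil_module n) \<Longrightarrow> g2 n (Central \<one>\<^bsub>free_nil_module n\<^esub> x \<one>\<^bsub>free_nil_module n\<^esub>) \<in> R n"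
    and Central_3: "x \<in> carrier (free_nil_module n) \<Longrightarrow> g2 n (Central \<one>\<^bsub>free_nil_module n\<^esub> \<one>\<^bsub>free_nil_module n\<^esub> x) \<in> R n"
begin

text \<open>The boundary of a generator of the next bar module is a cycle, natural in four
  variables. If only one variable is nontrivial, all terms cancel except a single value
  \<open>Assoc 1 t 1\<close>, which \<open>Assoc_1\<close> kills.\<close>

lemma Assoc_cocycle:
  assumes m: "x \<in> carrier (F n)" "y \<in> carrier (F n)" "z \<in> carrier (F n)" "w \<in> carrier (F n)"
  shows "g2 n (Assoc y z w) - g2 n (Assoc (x \<otimes>\<^bsub>F n\<^esub> y) z w) + g2 n (Assoc x (y \<otimes>\<^bsub>F n\<^esub> z) w)
    - g2 n (Assoc x y (z \<otimes>\<^bsub>F n\<^esub> w)) + g2 n (Assoc x y z) \<in> R n"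
proof -
  define Q where "Q n ys = (case ys of [x, y, z, w] \<Rightarrow> frag_of (Assoc y z w)
      - frag_of (Assoc (x \<otimes>\<^bsub>F n\<^esub> y) z w) + frag_of (Assoc x (y \<otimes>\<^bsub>F n\<^esub> z) w)
      - frag_of (Assoc x y (z \<otimes>\<^bsub>F n\<^esub> w)) + frag_of (Assoc x y z))" for n and ys :: "(nat \<times> 'l) word set list"
  have "natural 4 (\<lambda>n ys. frag_extend (g2 n) (Q n ys))"
  proof (rule natural_cycle_family)
    fix n ys assume "length ys = (4::nat)" "set ys \<subseteq> carrier (F n)"
    then obtain x y z w where "ys = [x, y, z, w]"
      "x \<in> carrier (F n)" "y \<in> carrier (F n)" "z \<in> carrier (F n)" "w \<in> carrier (F n)"
      by (auto simp: length_eq_4)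
    then show "Q n ys \<in> chains2 (F n) \<and> bd2 (F n) (Q n ys) = 0"
      by (auto simp: Q_def frag_extend_add frag_extend_diff nil_free.m_assoc intro!: chains2_add chains2_diff)
  next
    fix m n ys and \<alpha> :: "'l mod_Q_arrow" assume "\<alpha> \<in> arrows m n" "length ys = (4::nat)" "set ys \<subseteq> carrier (F n)"
    then show "push2 (app \<alpha>) (Q n ys) = Q m (map (app \<alpha>) ys)"
      by (auto simp: Q_def length_eq_4 frag_map_add frag_map_diff app_mult)
  qed
  from natural_vanish_4[OF this m]
  have "frag_extend (g2 n) (Q n [x, y, z, w]) \<in> R n"
    using m Assoc_1[of y n] Assoc_1[of z n] Assoc_1[of "\<one>\<^bsub>F n\<^esub>" n]
    by (simp add: Q_def frag_extend_add frag_extend_diff)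
  then show ?thesis by (simp add: Q_def frag_extend_add frag_extend_diff)
qed

text \<open>Commuting pairs do not form a family to which naturality applies, so a cycle defined for
  all pairs is needed. The boundary of \<open>Central x y 1\<close> is (c, 1) - (1, c), where c is
  the commutator, and \<open>Assoc c 1 1\<close> and \<open>Assoc 1 1 c\<close> compensate it. When
  c is trivial the two added terms lie in \<open>R n\<close> and can be removed.\<close>

lemma Central_commuting:
  assumes m: "x \<in> carrier (F n)" "y \<in> carrier (F n)" and c: "commutator (F n) x y = \<one>\<^bsub>F n\<^esub>"
  shows "g2 n (Central x y \<one>\<^bsub>F n\<^esub>) \<in> R n"
proof -
  define Q where "Q n ys = (case ys of [x, y] \<Rightarrow> frag_of (Central x y \<one>\<^bsub>F n\<^esub>)
      + frag_of (Assoc (commutator (F n) x y) \<one>\<^bsub>F n\<^esub> \<one>\<^bsub>F n\<^esub>)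
      + frag_of (Assoc \<one>\<^bsub>F n\<^esub> \<one>\<^bsub>F n\<^esub> (commutator (F n) x y)))" for n and ys :: "(nat \<times> 'l) word set list"
  have "natural 2 (\<lambda>n ys. frag_extend (g2 n) (Q n ys))"
  proof (rule natural_cycle_family)
    fix n ys assume "length ys = (2::nat)" "set ys \<subseteq> carrier (F n)"
    then obtain x y where "ys = [x, y]" "x \<in> carrier (F n)" "y \<in> carrier (F n)"
      by (auto simp: length_eq_2)
    then show "Q n ys \<in> chains2 (F n) \<and> bd2 (F n) (Q n ys) = 0"
      by (auto simp: Q_def frag_extend_add frag_extend_diff intro!: chains2_add chains2_diff)
  next
    fix m n ys and \<alpha> :: "'l mod_Q_arrow" assume "\<alpha> \<in> arrows m n" "length ys = (2::nat)" "set ys \<subseteq> carrier (F n)"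
    then show "push2 (app \<alpha>) (Q n ys) = Q m (map (app \<alpha>) ys)"
      by (auto simp: Q_def length_eq_2 frag_map_add frag_map_diff app_commutator app_one)
  qed
  from natural_vanish_2[OF this m]
  have "frag_extend (g2 n) (Q n [x, y]) \<in> R n"
    using m Assoc_1[of "\<one>\<^bsub>F n\<^esub>" n] Central_1[of x n] Central_2[of y n]
    by (simp add: Q_def frag_extend_add R_add)
  from R_diff[OF R_diff[OF this Assoc_1[of "\<one>\<^bsub>F n\<^esub>" n]] Assoc_1[of "\<one>\<^bsub>F n\<^esub>" n]]
  show ?thesis by (simp add: Q_def frag_extend_add c)
qed

lemma int_pow_commutator: "w \<in> carrier (F n) \<Longrightarrow>
    commutator (F n) (w [^]\<^bsub>F n\<^esub> (i::int)) (w [^]\<^bsub>F n\<^esub> (j::int)) = \<one>\<^bsub>F n\<^esub>"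
  unfolding commutator_def
  by (subst nil_free.commutator_one_iff) (simp_all flip: nil_free.int_pow_mult add: add.commute)

text \<open>Powers of one element commute, so this relator is a cycle for all w and z. Testing one
  variable at a time leaves z = 1, which is \<open>Central_commuting\<close>, and w = 1, which is
  \<open>Central_3\<close>.\<close>

lemma Central_int_pow:
  assumes m: "w \<in> carrier (F n)" "z \<in> carrier (F n)"
  shows "g2 n (Central (w [^]\<^bsub>F n\<^esub> (i::int)) (w [^]\<^bsub>F n\<^esub> (j::int)) z) \<in> R n"
proof -
  define Q where "Q n ys = (case ys of [w, z] \<Rightarrow>
     frag_of (Central (w [^]\<^bsub>F n\<^esub> i) (w [^]\<^bsub>F n\<^esub> j) z))" for n and ys :: "(nat \<times> 'l) word set list"
  have "natural 2 (\<lambda>n ys. frag_extend (g2 n) (Q n ys))"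
  proof (rule natural_cycle_family)
    fix n ys assume "length ys = (2::nat)" "set ys \<subseteq> carrier (F n)"
    then show "Q n ys \<in> chains2 (F n) \<and> bd2 (F n) (Q n ys) = 0"
      by (auto simp: Q_def length_eq_2 int_pow_commutator)
  next
    fix m n ys and \<alpha> :: "'l mod_Q_arrow" assume "\<alpha> \<in> arrows m n" "length ys = (2::nat)" "set ys \<subseteq> carrier (F n)"
    then show "push2 (app \<alpha>) (Q n ys) = Q m (map (app \<alpha>) ys)"
      by (auto simp: Q_def length_eq_2 app_int_pow)
  qed
  from natural_vanish_2[OF this m]
  have "frag_extend (g2 n) (Q n [w, z]) \<in> R n"
    using m Central_commuting[of "w [^]\<^bsub>F n\<^esub> i" n "w [^]\<^bsub>F n\<^esub> j"] Central_3[of z n]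
    by (simp add: Q_def int_pow_commutator)
  then show ?thesis by (simp add: Q_def)
qed

text \<open>On a cyclic group the associativity part of \<open>g2\<close> is a 3-cocycle, and \<open>H\<^sup>3(\<int>) = 0\<close>.\<close>

lemma vanish_cyclic:
  fixes h :: "'x \<Rightarrow> int"
  assumes G: "nil2_group G" and h: "\<And>x y. \<lbrakk>x \<in> carrier G; y \<in> carrier G\<rbrakk> \<Longrightarrow> h (x \<otimes>\<^bsub>G\<^esub> y) = h x + h y"
    and w: "w \<in> carrier (F c)" and q: "q \<in> chains2 G" "bd2 G q = 0"
  shows "frag_extend (g2 c) (push2 (\<lambda>x. w [^]\<^bsub>F c\<^esub> h x) q) \<in> R c"
proof -
  interpret nil2_group G by fact
  define a where "a i j k = g2 c (Assoc (w [^]\<^bsub>F c\<^esub> i) (w [^]\<^bsub>F c\<^esub> j) (w [^]\<^bsub>F c\<^esub> k))" for i j k :: int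
  \<comment> \<open>\<open>u\<close> is found by integrating \<open>a i k 1\<close> over k.
    Subtracting its coboundary from \<open>a\<close> leaves the cocycle \<open>b\<close> with
    \<open>b i j 1 = 0\<close>.\<close>
  have "\<exists>U. U 1 = 0 \<and> (\<forall>k. U (k + 1) = U k + a i k 1)" for i
    using int_function_with_differences[of "\<lambda>k. a i k 1"] by metis
  then obtain u where u1: "\<And>i. u i 1 = 0" and u2: "\<And>i k. u i (k + 1) = u i k + a i k 1" by metis
  define b where "b i j k = a i j k - (u j k - u (i + j) k + u i (j + k) - u i j)" for i j k
  have b1: "b i j 1 = 0" for i j by (simp add: b_def u1 u2)
  have a: "a j k l - a (i + j) k l + a i (j + k) l - a i j (k + l) + a i j k \<in> R c" for i j k l
    using Assoc_cocycle[of "w [^]\<^bsub>F c\<^esub> i" c "w [^]\<^bsub>F c\<^esub> j" "w [^]\<^bsub>F c\<^esub> k" "w [^]\<^bsub>F c\<^esub> l"] w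
    by (simp add: a_def nil_free.int_pow_mult)
  \<comment> \<open>\<open>b\<close> satisfies the same cocycle identity as \<open>a\<close>. With
    last argument 1 all but two of its terms vanish, so \<open>b i j k\<close> does not depend on k
    modulo \<open>R c\<close>.\<close>
  have step: "b i j k - b i j (k + 1) \<in> R c" for i j k
  proof -
    have "b j k 1 - b (i + j) k 1 + b i (j + k) 1 - b i j (k + 1) + b i j k
       = a j k 1 - a (i + j) k 1 + a i (j + k) 1 - a i j (k + 1) + a i j k"
      by (simp add: b_def add.assoc)
    then show ?thesis using a[of j k 1 i] by (simp add: b1)
  qed
  have b: "b i j k \<in> R c" for i j k
  proof (induction k rule: int_induct[where k = 1])
    case (step1 k)
    then show ?case using R_cong[OF step[of i j k]] by simp
  next
    case (step2 k)
    then show ?case using R_cong[OF step[of i j "k - 1"]] by simp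
  qed (simp add: b1)
  have h1: "h \<one>\<^bsub>G\<^esub> = 0" using h[of "\<one>\<^bsub>G\<^esub>" "\<one>\<^bsub>G\<^esub>"] by simp
  have hinv: "h (inv\<^bsub>G\<^esub> x) = - h x" if "x \<in> carrier G" for x using h[of x "inv\<^bsub>G\<^esub> x"] that h1 by simp
  \<comment> \<open>The pullback of \<open>u\<close> along h. On \<open>Assoc\<close> its coboundary
    differs from the value of \<open>g2\<close> by a value of \<open>b\<close>; on
    \<open>Central\<close> both vanish modulo \<open>R c\<close>, because h kills commutators. Hence
    \<open>g2\<close> is a coboundary on the pushed relators and vanishes on cycles.\<close>
  let ?U = "\<lambda>(x, y). u (h x) (h y)"
  have "g2 c (map_relator (\<lambda>x. w [^]\<^bsub>F c\<^esub> h x) t) - frag_extend ?U (bd2_gen G t) \<in> R c"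
    if "set_relator t \<subseteq> carrier G" for t
  proof (cases t)
    case (Assoc x y z)
    then show ?thesis using b[of "h x" "h y" "h z"] that
      by (simp add: b_def a_def h frag_extend_add frag_extend_diff algebra_simps)
  next
    case (Central x y z)
    then show ?thesis using Central_int_pow[OF w, of "w [^]\<^bsub>F c\<^esub> h z" "h x" "h y"] that w
      by (simp add: h hinv h1 commutator_def frag_extend_add frag_extend_diff)
  qed
  then have "frag_extend (\<lambda>t. g2 c (map_relator (\<lambda>x. w [^]\<^bsub>F c\<^esub> h x) t)) q
     - frag_extend (\<lambda>t. frag_extend ?U (bd2_gen G t)) q \<in> R c"
    using q(1) unfolding chains2_def mem_Collect_eq
    by (intro frag_extend_cong_diff[of q]) (auto intro: R_diff)
  moreover have "frag_extend (\<lambda>t. frag_extend ?U (bd2_gen G t)) q = frag_extend ?U (bd2 G q)"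
    using q(1) unfolding chains2_def mem_Collect_eq
    by (induction rule: frag_induction) (simp_all add: frag_extend_diff)
  ultimately show ?thesis by (simp add: q(2) frag_extend_frag_map o_def)
qed

text \<open>
  A cycle involves only finitely many basis elements of the group.  They come from the generators
  of a free module whose rank is their number, and there the single summands of the functor only
  see cyclic subgroups.
\<close>

lemma vanish_on_cycles:
  assumes q: "q \<in> chains2 (F c)" "bd2 (F c) q = 0"
  shows "frag_extend (g2 c) q \<in> R c"
proof -
  have "\<forall>x \<in> (\<Union>t\<in>Poly_Mapping.keys q. set_relator t). \<exists>J. finite J \<and> J \<subseteq> {..<c} \<times> UNIV \<and> supported_by c J x"
    using q(1) by (intro ballI free_nil_module_support) (auto simp: chains2_def)
  then obtain J where J: "\<And>x. x \<in> (\<Union>t\<in>Poly_Mapping.keys q. set_relator t) \<Longrightarrow> finite (J x) \<and> J x \<subseteq> {..<c} \<times> UNIV \<and> supported_by c (J x) x"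
    by metis
  have "finite (set_relator t)" for t :: "(nat \<times> 'l) word set relator" by (cases t) auto
  then have "finite (\<Union>x \<in> (\<Union>t\<in>Poly_Mapping.keys q. set_relator t). J x)"
    using J by (intro finite_UN_I finite_keys) blast+
  from finite_distinct_list[OF this]
  obtain js where js: "set js = (\<Union>x \<in> (\<Union>t\<in>Poly_Mapping.keys q. set_relator t). J x)" "distinct js"
    by (elim exE conjE)
  have js_c: "set js \<subseteq> {..<c} \<times> UNIV" unfolding js(1) by (intro UN_least) (use J in blast)
  define N where "N = length js"
  define bs where "bs = map (\<lambda>(i, s). nil_basis c i s) js"
  have bs: "set bs \<subseteq> carrier (F c)" "length bs = N" using js_c by (auto simp: bs_def N_def)
  \<comment> \<open>The module generators of F_N are sent to the finitely many basis elements of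
    F_c, numbered by \<open>js\<close>, that occur in q.\<close>
  define \<iota> where "\<iota> = tuple c bs"
  have \<iota>: "\<iota> \<in> arrows c N" unfolding \<iota>_def using bs by (intro tuple_arrows) auto
  \<comment> \<open>Values for a map \<open>r\<close> back to F_N: the j-th listed basis element
    goes to the j-th generator, every other one to the unit. Since \<open>r\<close> is a group
    homomorphism but not equivariant, it is not an arrow and T cannot be applied to it; it only
    transports the cycle, and \<iota> carries the result back to q.\<close>
  have "\<exists>y \<in> carrier (F N). (\<forall>j<N. js ! j = (i, s) \<longrightarrow> y = nil_basis N j 0) \<and>
      ((\<forall>j<N. js ! j \<noteq> (i, s)) \<longrightarrow> y = \<one>\<^bsub>F N\<^esub>)" for i s
  proof (cases "\<exists>j<N. js ! j = (i, s)")
    case True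
    then obtain j where j: "j < N" "js ! j = (i, s)" by blast
    then have *: "j' = j" if "j' < N" "js ! j' = (i, s)" for j'
      using js(2) that by (simp add: nth_eq_iff_index_eq N_def flip: j(2))
    show ?thesis
    proof (intro bexI[of _ "nil_basis N j 0"] conjI allI impI)
      show "nil_basis N j 0 = nil_basis N j' 0" if "j' < N" "js ! j' = (i, s)" for j'
        by (simp only: *[OF that])
      show "nil_basis N j 0 = \<one>\<^bsub>F N\<^esub>" if "\<forall>j<N. js ! j \<noteq> (i, s)" using that j by blast
    qed (use j in simp)
  next
    case False
    then show ?thesis by (intro bexI[of _ "\<one>\<^bsub>F N\<^esub>"]) simp_all
  qed
  then have "\<exists>b. \<forall>i s. b i s \<in> carrier (F N) \<and> (\<forall>j<N. js ! j = (i, s) \<longrightarrow> b i s = nil_basis N j 0) \<and>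
      ((\<forall>j<N. js ! j \<noteq> (i, s)) \<longrightarrow> b i s = \<one>\<^bsub>F N\<^esub>)"
    by (intro choice allI) (simp only: Bex_def)
  then obtain b where b0: "\<forall>i s. b i s \<in> carrier (F N) \<and> (\<forall>j<N. js ! j = (i, s) \<longrightarrow> b i s = nil_basis N j 0) \<and>
      ((\<forall>j<N. js ! j \<noteq> (i, s)) \<longrightarrow> b i s = \<one>\<^bsub>F N\<^esub>)" ..
  have b: "b i s \<in> carrier (F N)" "\<And>j. j < N \<Longrightarrow> js ! j = (i, s) \<Longrightarrow> b i s = nil_basis N j 0"
    "(\<And>j. j < N \<Longrightarrow> js ! j \<noteq> (i, s)) \<Longrightarrow> b i s = \<one>\<^bsub>F N\<^esub>" for i s
    using b0 by simp_all
  obtain r where r: "r \<in> hom (F c) (F N)" "\<And>i s. i < c \<Longrightarrow> r (nil_basis c i s) = b i s"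
    by (rule free_nil_module_group_hom[of "F N" c b, OF group_free_nil_module nil_free.central b(1)]) (assumption | simp)+
  interpret r: group_hom "F c" "F N" r
    by (simp add: group_hom_def group_hom_axioms_def group_free_nil_module r(1))
  define q' where "q' = push2 r q"
  have q': "q' \<in> chains2 (F N)" "bd2 (F N) q' = 0"
    unfolding q'_def using push2_chains2[OF r(1) q(1)] r.bd2_push2[OF q(1)] q(2) by simp_all
  have \<iota>r: "app \<iota> (r x) = x" if x: "x \<in> (\<Union>t\<in>Poly_Mapping.keys q. set_relator t)" for x
  proof -
    have "app \<iota> \<circ> r \<in> hom (F c) (F c)" by (rule Group.hom_compose[OF r(1) app_hom[OF \<iota>]])
    moreover have "(app \<iota> \<circ> r) (nil_basis c i s) = nil_basis c i s" if mem: "(i, s) \<in> J x" for i s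
    proof -
      have "(i, s) \<in> set js" using mem x js(1) by blast
      then obtain j where j: "j < N" "js ! j = (i, s)" by (auto simp: in_set_conv_nth N_def)
      then have "i < c" using js_c nth_mem[of j js] by (auto simp: N_def)
      then have "r (nil_basis c i s) = nil_basis N j 0" using r(2)[of i s] b(2)[OF j] by simp
      then show ?thesis using app_tuple[OF bs(1), of N j] bs(2) j by (simp add: \<iota>_def bs_def)
    qed
    ultimately have "(app \<iota> \<circ> r) x = x" using J[OF x] supported_byD by blast
    then show ?thesis by simp
  qed
  have "map_relator (app \<iota> \<circ> r) t = t" if "t \<in> Poly_Mapping.keys q" for t
  proof (rule relator.map_ident_strong)
    fix x assume "x \<in> set_relator t"
    then show "(app \<iota> \<circ> r) x = x" using \<iota>r[of x] that by auto
  qed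
  then have "push2 (app \<iota>) q' = frag_extend frag_of q"
    unfolding q'_def push2_comp unfolding frag_map_def by (intro frag_extend_eq) simp
  also have "\<dots> = q" by (rule frag_expansion[symmetric])
  finally have push: "push2 (app \<iota>) q' = q" .
  \<comment> \<open>\<open>\<iota> \<odot> proj_arrow N j\<close> after \<open>r\<close> sends x to
    the power of the j-th listed basis element with exponent \<open>h x\<close>, where h reads off
    the exponent sum of that basis element. It factors through a cyclic group, and
    \<open>vanish_cyclic\<close> applies.\<close>
  have "T (\<iota> \<odot> proj_arrow N j) (frag_extend (g2 N) q') \<in> R c" if j: "j < N" for j
  proof -
    let ?\<alpha> = "\<iota> \<odot> proj_arrow N j"
    have \<alpha>: "?\<alpha> \<in> arrows c N" by (rule comp_Q_arrows[OF \<iota> proj_arrow])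
    define b1 where "b1 i s = (if js ! j = (i, s) then 1 else 0 :: int)" for i s
    from free_nil_module_additive_ex[of c b1] obtain h where h0:
      "\<forall>x \<in> carrier (F c). \<forall>y \<in> carrier (F c). h (x \<otimes>\<^bsub>F c\<^esub> y) = h x + h y"
      "\<forall>i<c. \<forall>s. h (nil_basis c i s) = b1 i s" by blast
    have h: "\<And>x y. \<lbrakk>x \<in> carrier (F c); y \<in> carrier (F c)\<rbrakk> \<Longrightarrow> h (x \<otimes>\<^bsub>F c\<^esub> y) = h x + h y"
      "\<And>i s. i < c \<Longrightarrow> h (nil_basis c i s) = b1 i s" using h0 by blast+
    let ?w = "bs ! j"
    have w: "?w \<in> carrier (F c)" using bs j by auto
    have hom1: "app ?\<alpha> \<circ> r \<in> hom (F c) (F c)" by (rule Group.hom_compose[OF r(1) app_hom[OF \<alpha>]])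
    have hom2: "(\<lambda>x. ?w [^]\<^bsub>F c\<^esub> h x) \<in> hom (F c) (F c)"
      by (rule homI) (use w in \<open>simp_all add: h(1) nil_free.int_pow_mult\<close>)
    have "(app ?\<alpha> \<circ> r) (nil_basis c i s) = ?w [^]\<^bsub>F c\<^esub> h (nil_basis c i s)" if i: "i < c" for i s
    proof (cases "\<exists>j'<N. js ! j' = (i, s)")
      case True
      then obtain j' where j': "j' < N" "js ! j' = (i, s)" by blast
      then have "r (nil_basis c i s) = nil_basis N j' 0" using r(2)[OF i, of s] b(2)[OF j'] by simp
      moreover have "js ! j = (i, s) \<longleftrightarrow> j' = j"
        using js(2) j j' by (auto simp: nth_eq_iff_index_eq N_def simp flip: j'(2))
      moreover have "app \<iota> (nil_basis N j' 0) = bs ! j'" unfolding \<iota>_def using app_tuple[OF bs(1)] bs(2) j'(1) by simp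
      ultimately show ?thesis using j j' i w
        by (cases "j' = j") (simp_all add: app_comp[OF \<iota> proj_arrow] app_proj_arrow app_one[OF \<iota>] h(2) b1_def)
    next
      case False
      then have "r (nil_basis c i s) = \<one>\<^bsub>F N\<^esub>" using r(2)[OF i, of s] b(3)[of i s] by auto
      moreover have "js ! j \<noteq> (i, s)" using False j by blast
      ultimately show ?thesis using i by (simp add: app_one[OF \<alpha>] h(2) b1_def)
    qed
    then have eq: "(app ?\<alpha> \<circ> r) x = ?w [^]\<^bsub>F c\<^esub> h x" if "x \<in> carrier (F c)" for x
      by (intro free_nil_module_hom_eqI[OF group_free_nil_module hom1 hom2 _ that])
    have "T ?\<alpha> (frag_extend (g2 N) q') - frag_extend (g2 c) (push2 (app ?\<alpha>) q') \<in> R c"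
      by (rule natural_cycle[OF \<alpha> q'])
    moreover have "push2 (app ?\<alpha>) q' = push2 (\<lambda>x. ?w [^]\<^bsub>F c\<^esub> h x) q"
      unfolding q'_def push2_comp by (rule push2_cong[OF q(1) eq])
    moreover have "frag_extend (g2 c) (push2 (\<lambda>x. ?w [^]\<^bsub>F c\<^esub> h x) q) \<in> R c"
      by (rule vanish_cyclic[OF nil2_group_free_nil_module h(1) w q])
    ultimately show ?thesis using R_cong by metis
  qed
  then have "(\<Sum>j<N. T (\<iota> \<odot> proj_arrow N j) (frag_extend (g2 N) q')) \<in> R c" by (intro R_sum) auto
  then have "T \<iota> (frag_extend (g2 N) q') \<in> R c" using R_cong[OF T_split[OF \<iota>]] by metis
  then show ?thesis using R_cong[OF natural_cycle[OF \<iota> q']] push by simp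
qed

end

section \<open>Vanishing for additive cochains\<close>

lemma frag_extend_diff_fun: "frag_extend (\<lambda>t. a t - b t) q = frag_extend a q - frag_extend b q"
proof -
  have "Poly_Mapping.keys q \<subseteq> UNIV" by simp
  then show ?thesis by (induction rule: frag_induction) (simp_all add: frag_extend_diff)
qed

lemma frag_extend_frag_extend:
  "frag_extend a (frag_extend b q) = frag_extend (\<lambda>t. frag_extend a (b t)) q"
proof -
  have "Poly_Mapping.keys q \<subseteq> UNIV" by simp
  then show ?thesis by (induction rule: frag_induction) (simp_all add: frag_extend_diff)
qed

context additive_functor
begin

lemma frag_extend_R_cong:
  assumes "Poly_Mapping.keys p \<subseteq> A" "\<And>t. t \<in> A \<Longrightarrow> h t - h' t \<in> R c"
  shows "frag_extend h p - frag_extend h' p \<in> R c"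
  using assms by (rule frag_extend_cong_diff) (auto intro: R_diff)

lemma natural_extend:
  assumes "\<And>t. t \<in> A \<Longrightarrow> T \<alpha> (a t) - b (\<phi> t) \<in> R m" "Poly_Mapping.keys p \<subseteq> A"
  shows "T \<alpha> (frag_extend a p) - frag_extend b (frag_map \<phi> p) \<in> R m"
  unfolding T_frag_extend frag_extend_frag_map
  by (rule frag_extend_R_cong[OF assms(2)]) (use assms(1) in simp)

end

text \<open>Relators with a single nontrivial entry in the positions treated by \<open>corr\<close>
  are cycles, so \<open>g2\<close> is natural on them. Read as functions of that entry they extend
  to a natural \<open>corr\<close> on all relators, and subtracting it preserves the naturality
  condition with the same \<open>g1\<close>.\<close>

lemma (in natural_on_cycles) normalization:
  "\<exists>g2'. natural_on_cycles R T g2' g1 \<and>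
    (\<forall>n. \<forall>q \<in> chains2 (F n). bd2 (F n) q = 0 \<longrightarrow> frag_extend (g2' n) q \<in> R n)"
proof -
  define corr where "corr n t = (case t of
      Assoc x y z \<Rightarrow> g2 n (Assoc \<one>\<^bsub>F n\<^esub> y \<one>\<^bsub>F n\<^esub>)
    | Central x y z \<Rightarrow> g2 n (Central x \<one>\<^bsub>F n\<^esub> \<one>\<^bsub>F n\<^esub>) + g2 n (Central \<one>\<^bsub>F n\<^esub> y \<one>\<^bsub>F n\<^esub>)
        + g2 n (Central \<one>\<^bsub>F n\<^esub> \<one>\<^bsub>F n\<^esub> z))" for n t
  define g2' where "g2' n t = g2 n t - corr n t" for n t
  have corr: "T \<alpha> (corr n t) - corr m (map_relator (app \<alpha>) t) \<in> R m"
    if \<alpha>: "\<alpha> \<in> arrows m n" and t: "set_relator t \<subseteq> carrier (F n)" for \<alpha> m n t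
  proof (cases t)
    case (Assoc x y z)
    then show ?thesis
      using natural_cycle[OF \<alpha>, of "frag_of (Assoc \<one>\<^bsub>F n\<^esub> y \<one>\<^bsub>F n\<^esub>)"] t by (simp add: corr_def app_one[OF \<alpha>])
  next
    case (Central x y z)
    have "T \<alpha> (corr n t) - corr m (map_relator (app \<alpha>) t)
      = (T \<alpha> (g2 n (Central x \<one>\<^bsub>F n\<^esub> \<one>\<^bsub>F n\<^esub>)) - g2 m (Central (app \<alpha> x) \<one>\<^bsub>F m\<^esub> \<one>\<^bsub>F m\<^esub>))
      + (T \<alpha> (g2 n (Central \<one>\<^bsub>F n\<^esub> y \<one>\<^bsub>F n\<^esub>)) - g2 m (Central \<one>\<^bsub>F m\<^esub> (app \<alpha> y) \<one>\<^bsub>F m\<^esub>))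
      + (T \<alpha> (g2 n (Central \<one>\<^bsub>F n\<^esub> \<one>\<^bsub>F n\<^esub> z)) - g2 m (Central \<one>\<^bsub>F m\<^esub> \<one>\<^bsub>F m\<^esub> (app \<alpha> z)))"
      by (simp add: Central corr_def T_add)
    moreover have "T \<alpha> (g2 n (Central x \<one>\<^bsub>F n\<^esub> \<one>\<^bsub>F n\<^esub>)) - g2 m (Central (app \<alpha> x) \<one>\<^bsub>F m\<^esub> \<one>\<^bsub>F m\<^esub>) \<in> R m"
      using natural_cycle[OF \<alpha>, of "frag_of (Central x \<one>\<^bsub>F n\<^esub> \<one>\<^bsub>F n\<^esub>)"] t by (simp add: Central app_one[OF \<alpha>])
    moreover have "T \<alpha> (g2 n (Central \<one>\<^bsub>F n\<^esub> y \<one>\<^bsub>F n\<^esub>)) - g2 m (Central \<one>\<^bsub>F m\<^esub> (app \<alpha> y) \<one>\<^bsub>F m\<^esub>) \<in> R m"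
      using natural_cycle[OF \<alpha>, of "frag_of (Central \<one>\<^bsub>F n\<^esub> y \<one>\<^bsub>F n\<^esub>)"] t by (simp add: Central app_one[OF \<alpha>])
    moreover have "T \<alpha> (g2 n (Central \<one>\<^bsub>F n\<^esub> \<one>\<^bsub>F n\<^esub> z)) - g2 m (Central \<one>\<^bsub>F m\<^esub> \<one>\<^bsub>F m\<^esub> (app \<alpha> z)) \<in> R m"
      using natural_cycle[OF \<alpha>, of "frag_of (Central \<one>\<^bsub>F n\<^esub> \<one>\<^bsub>F n\<^esub> z)"] t by (simp add: Central app_one[OF \<alpha>])
    ultimately show ?thesis by (simp only: R_add)
  qed
  have rel: "natural_on_cycles R T g2' g1"
  proof (unfold_locales, rule g1_0)
    fix \<alpha> :: "'l mod_Q_arrow" and m n q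
    assume \<alpha>: "\<alpha> \<in> arrows m n" and q: "q \<in> chains2 (F n)"
    have "T \<alpha> (frag_extend (corr n) q) - frag_extend (corr m) (push2 (app \<alpha>) q) \<in> R m"
      by (rule natural_extend[of "{t. set_relator t \<subseteq> carrier (F n)}"])
        (use corr[OF \<alpha>] q in \<open>simp_all add: chains2_def\<close>)
    from R_diff[OF g2_natural[OF \<alpha> q] this]
    show "T \<alpha> (frag_extend (g2' n) q) - frag_extend (g2' m) (push2 (app \<alpha>) q) + g1 \<alpha> (bd2 (F n) q) \<in> R m"
      by (simp add: g2'_def[abs_def] frag_extend_diff_fun T_diff algebra_simps)
  qed
  \<comment> \<open>A \<open>Central\<close> relator with at most one nontrivial entry is
    overcorrected by twice the value at \<open>Central 1 1 1\<close>. That value is a natural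
    constant and therefore zero.\<close>
  have "natural 0 (\<lambda>n ys. frag_extend (g2 n) (frag_of (Central \<one>\<^bsub>F n\<^esub> \<one>\<^bsub>F n\<^esub> \<one>\<^bsub>F n\<^esub>)))"
    by (rule natural_cycle_family) (simp_all add: app_one)
  from natural_vanish[OF this, of "[]"] have C1: "g2 n (Central \<one>\<^bsub>F n\<^esub> \<one>\<^bsub>F n\<^esub> \<one>\<^bsub>F n\<^esub>) \<in> R n" for n by simp
  interpret N: normalized_on_cycles R T g2' g1
  proof (rule normalized_on_cycles.intro[OF rel], unfold_locales)
    fix n x
    show "g2' n (Assoc \<one>\<^bsub>F n\<^esub> x \<one>\<^bsub>F n\<^esub>) \<in> R n" by (simp add: g2'_def corr_def)
    show "g2' n (Central x \<one>\<^bsub>F n\<^esub> \<one>\<^bsub>F n\<^esub>) \<in> R n" "g2' n (Central \<one>\<^bsub>F n\<^esub> x \<one>\<^bsub>F n\<^esub>) \<in> R n"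
      "g2' n (Central \<one>\<^bsub>F n\<^esub> \<one>\<^bsub>F n\<^esub> x) \<in> R n"
      using R_diff[OF R_minus[OF C1] C1, of n] by (simp_all add: g2'_def corr_def)
  qed
  show ?thesis using rel N.vanish_on_cycles by blast
qed

section \<open>Cochains on pairs that are natural on cycles\<close>

locale natural_on_cycles1 = additive_functor R T
  for R :: "nat \<Rightarrow> ('q \<Rightarrow>\<^sub>0 int) set" and T :: "'l::monoid_add mod_Q_arrow \<Rightarrow> ('q \<Rightarrow>\<^sub>0 int) \<Rightarrow> 'q \<Rightarrow>\<^sub>0 int" +
  fixes g1 :: "nat \<Rightarrow> (nat \<times> 'l) word set \<times> (nat \<times> 'l) word set \<Rightarrow> 'q \<Rightarrow>\<^sub>0 int"
    and g0 :: "'l mod_Q_arrow \<Rightarrow> ((nat \<times> 'l) word set \<Rightarrow>\<^sub>0 int) \<Rightarrow> 'q \<Rightarrow>\<^sub>0 int"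
  assumes g0_0: "g0 \<alpha> 0 = 0"
    and g1_natural: "\<lbrakk>\<alpha> \<in> arrows m n; p \<in> chains1 (free_nil_module n)\<rbrakk> \<Longrightarrow>
      T \<alpha> (frag_extend (g1 n) p) - frag_extend (g1 m) (push1 (app \<alpha>) p)
        + g0 \<alpha> (bd1 (free_nil_module n) p) \<in> R m"
begin

lemma natural_cycle:
  assumes "\<alpha> \<in> arrows m n" "p \<in> chains1 (F n)" "bd1 (F n) p = 0"
  shows "T \<alpha> (frag_extend (g1 n) p) - frag_extend (g1 m) (push1 (app \<alpha>) p) \<in> R m"
  using g1_natural[OF assms(1,2)] by (simp add: assms(3) g0_0)

text \<open>Boundaries of relators are cycles, so \<open>g1\<close> is natural on them although it
  need not be natural on pairs.\<close>

lemma natural_relator_family: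
  assumes "\<And>n ys. \<lbrakk>length ys = k; set ys \<subseteq> carrier (F n)\<rbrakk> \<Longrightarrow> set_relator (t ys) \<subseteq> carrier (F n)"
    and "\<And>m n \<alpha> ys. \<lbrakk>\<alpha> \<in> arrows m n; length ys = k; set ys \<subseteq> carrier (F n)\<rbrakk>
      \<Longrightarrow> map_relator (app \<alpha>) (t ys) = t (map (app \<alpha>) ys)"
  shows "natural k (\<lambda>n ys. frag_extend (g1 n) (bd2_gen (F n) (t ys)))"
proof (rule naturalI)
  fix m n ys and \<alpha> :: "'l mod_Q_arrow" assume *: "\<alpha> \<in> arrows m n" "length ys = k" "set ys \<subseteq> carrier (F n)"
  have t: "set_relator (t ys) \<subseteq> carrier (F n)" by (rule assms(1)[OF *(2,3)])
  have "push1 (app \<alpha>) (bd2_gen (F n) (t ys)) = bd2_gen (F m) (t (map (app \<alpha>) ys))"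
    using group_hom.bd2_push2[OF app_group_hom[OF *(1)], of "frag_of (t ys)"] t assms(2)[OF *] by simp
  moreover have "bd1 (F n) (bd2_gen (F n) (t ys)) = 0"
    using nil_free.bd1_bd2[of "frag_of (t ys)" n] t by simp
  ultimately show "T \<alpha> (frag_extend (g1 n) (bd2_gen (F n) (t ys)))
      - frag_extend (g1 m) (bd2_gen (F m) (t (map (app \<alpha>) ys))) \<in> R m"
    using natural_cycle[OF *(1) nil_free.bd2_gen_chains1[OF t]] by simp
qed

text \<open>The pairs (x, 1) and (1, y) all have boundary \<open>frag_of 1\<close>, so their
  differences from (1, 1) are cycles and \<open>corr\<close> is natural. Afterwards
  \<open>g1'\<close> takes on all these pairs the value at (1, 1), which makes it vanish on
  boundaries of relators with one nontrivial entry. By naturality in three variables it vanishes on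
  all boundaries, and these are all cycles by \<open>bd1_exact\<close>.\<close>

lemma normalization:
  "\<exists>g1'. natural_on_cycles1 R T g1' g0 \<and>
    (\<forall>n. \<forall>p \<in> chains1 (F n). bd1 (F n) p = 0 \<longrightarrow> frag_extend (g1' n) p \<in> R n)"
proof -
  define corr where "corr n = (\<lambda>(x, y). frag_extend (g1 n)
     (frag_of (x, \<one>\<^bsub>F n\<^esub>) - frag_of (\<one>\<^bsub>F n\<^esub>, \<one>\<^bsub>F n\<^esub>) + frag_of (\<one>\<^bsub>F n\<^esub>, y) - frag_of (\<one>\<^bsub>F n\<^esub>, \<one>\<^bsub>F n\<^esub>)))" for n
  define g1' where "g1' n xy = g1 n xy - corr n xy" for n xy
  have corr: "T \<alpha> (corr n xy) - corr m (map_prod (app \<alpha>) (app \<alpha>) xy) \<in> R m"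
    if \<alpha>: "\<alpha> \<in> arrows m n" and xy: "xy \<in> carrier (F n) \<times> carrier (F n)" for \<alpha> m n xy
  proof -
    obtain x y where [simp]: "xy = (x, y)" and xy': "x \<in> carrier (F n)" "y \<in> carrier (F n)" using xy by auto
    show ?thesis
      using natural_cycle[OF \<alpha>, of "frag_of (x, \<one>\<^bsub>F n\<^esub>) - frag_of (\<one>\<^bsub>F n\<^esub>, \<one>\<^bsub>F n\<^esub>) + frag_of (\<one>\<^bsub>F n\<^esub>, y) - frag_of (\<one>\<^bsub>F n\<^esub>, \<one>\<^bsub>F n\<^esub>)"] xy'
      by (simp add: corr_def app_one[OF \<alpha>] frag_map_add frag_map_diff frag_extend_add frag_extend_diff
          chains1_add chains1_diff)
  qed
  have rel: "natural_on_cycles1 R T g1' g0"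
  proof (unfold_locales, rule g0_0)
    fix \<alpha> :: "'l mod_Q_arrow" and m n p
    assume \<alpha>: "\<alpha> \<in> arrows m n" and p: "p \<in> chains1 (F n)"
    have "T \<alpha> (frag_extend (corr n) p) - frag_extend (corr m) (push1 (app \<alpha>) p) \<in> R m"
      by (rule natural_extend[of "carrier (F n) \<times> carrier (F n)"])
        (use corr[OF \<alpha>] p in \<open>simp_all add: chains1_def\<close>)
    from R_diff[OF g1_natural[OF \<alpha> p] this]
    show "T \<alpha> (frag_extend (g1' n) p) - frag_extend (g1' m) (push1 (app \<alpha>) p) + g0 \<alpha> (bd1 (F n) p) \<in> R m"
      by (simp add: g1'_def[abs_def] frag_extend_diff_fun T_diff algebra_simps)
  qed
  interpret N: natural_on_cycles1 R T g1' g0 by (rule rel)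
  have A: "natural 3 (\<lambda>n ys. frag_extend (g1' n) (bd2_gen (F n) (case ys of [x, y, z] \<Rightarrow> Assoc x y z)))"
    and C: "natural 3 (\<lambda>n ys. frag_extend (g1' n) (bd2_gen (F n) (case ys of [x, y, z] \<Rightarrow> Central x y z)))"
    by (rule N.natural_relator_family; auto simp: length_eq_3)+
  have "frag_extend (g1' n) (bd2_gen (F n) t) \<in> R n" if "set_relator t \<subseteq> carrier (F n)" for n t
  proof (cases t)
    case (Assoc x y z)
    have m: "x \<in> carrier (F n)" "y \<in> carrier (F n)" "z \<in> carrier (F n)" using that Assoc by auto
    from natural_vanish_3[OF A m] m show ?thesis
      by (simp add: Assoc frag_extend_add frag_extend_diff g1'_def corr_def)
  next
    case (Central x y z)
    have m: "x \<in> carrier (F n)" "y \<in> carrier (F n)" "z \<in> carrier (F n)" using that Central by auto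
    from natural_vanish_3[OF C m] m show ?thesis
      by (simp add: Central frag_extend_add frag_extend_diff)
  qed
  then have "frag_extend (g1' n) (bd2 (F n) q) \<in> R n" if "q \<in> chains2 (F n)" for n q
    unfolding frag_extend_frag_extend using that
    by (intro frag_extend_R[of q "{t. set_relator t \<subseteq> carrier (F n)}"]) (auto simp: chains2_def)
  then have "frag_extend (g1' n) p \<in> R n" if "p \<in> chains1 (F n)" "bd1 (F n) p = 0" for n p
    using bd1_exact[OF that] by blast
  then show ?thesis using rel by blast
qed

end

section \<open>Additive cochains in degrees one and two\<close>

context additive_functor
begin

definition additive_on :: "nat \<Rightarrow> nat \<Rightarrow> ((nat \<times> 'l) word set \<Rightarrow> 'q \<Rightarrow>\<^sub>0 int) \<Rightarrow> bool"
  where "additive_on n c \<phi> \<longleftrightarrow>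
    (\<forall>x \<in> carrier (F n). \<forall>y \<in> carrier (F n). \<phi> (x \<otimes>\<^bsub>F n\<^esub> y) - \<phi> x - \<phi> y \<in> R c)"

lemma additive_onD: "\<lbrakk>additive_on n c \<phi>; x \<in> carrier (F n); y \<in> carrier (F n)\<rbrakk>
    \<Longrightarrow> \<phi> (x \<otimes>\<^bsub>F n\<^esub> y) - \<phi> x - \<phi> y \<in> R c"
  by (simp add: additive_on_def)

lemma additive_on_one: "additive_on n c \<phi> \<Longrightarrow> \<phi> \<one>\<^bsub>F n\<^esub> \<in> R c"
  using additive_onD[of n c \<phi> "\<one>\<^bsub>F n\<^esub>" "\<one>\<^bsub>F n\<^esub>"] by simp

text \<open>Written as a composite with \<open>bd1\<close> so that it extends linearly to chains;
  hence the sign opposite to that of the expression in \<open>additive_on\<close>.\<close>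

definition defect :: "nat \<Rightarrow> ((nat \<times> 'l) word set \<Rightarrow> 'q \<Rightarrow>\<^sub>0 int) \<Rightarrow> (nat \<times> 'l) word set \<times> (nat \<times> 'l) word set \<Rightarrow> 'q \<Rightarrow>\<^sub>0 int"
  where "defect n \<phi> xy = frag_extend \<phi> (bd1_gen (F n) xy)"

lemma defect: "defect n \<phi> (x, y) = \<phi> x + \<phi> y - \<phi> (x \<otimes>\<^bsub>F n\<^esub> y)"
  by (simp add: defect_def frag_extend_add frag_extend_diff)

lemma additive_on_defect: "additive_on n c \<phi> \<longleftrightarrow> (\<forall>xy \<in> carrier (F n) \<times> carrier (F n). defect n \<phi> xy \<in> R c)"
  unfolding additive_on_def by (auto simp: defect R_diff_swap[of _ "_ + _"] diff_diff_eq)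

text \<open>The cocycle identity for \<alpha> and \<open>tuple n [x]\<close>, evaluated at the
  generator of F_1, shows that \<open>g\<close> is a primitive. As f is additive, the defect of
  \<open>g\<close> is natural in two variables; at (x, 1) and (1, y) it reduces to the value of
  \<open>g\<close> at the unit, a natural constant.\<close>

lemma vanishing_1:
  assumes add: "\<And>\<alpha> m n. \<alpha> \<in> arrows m n \<Longrightarrow> additive_on n m (f \<alpha>)"
    and coc: "\<And>\<alpha> \<beta> m n k x. \<lbrakk>\<alpha> \<in> arrows m n; \<beta> \<in> arrows n k; x \<in> carrier (F k)\<rbrakk> \<Longrightarrow>
      T \<alpha> (f \<beta> x) - f (\<alpha> \<odot> \<beta>) x + f \<alpha> (app \<beta> x) \<in> R m"
  shows "\<exists>g. (\<forall>n. additive_on n n (g n)) \<and> (\<forall>\<alpha> m n x. \<alpha> \<in> arrows m n \<longrightarrow> x \<in> carrier (F n) \<longrightarrow>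
    T \<alpha> (g n x) - g m (app \<alpha> x) - f \<alpha> x \<in> R m)"
proof -
  define g where "g n x = - f (tuple n [x]) (nil_basis 1 0 0)" for n x
  have d: "T \<alpha> (g n x) - g m (app \<alpha> x) - f \<alpha> x \<in> R m" if \<alpha>: "\<alpha> \<in> arrows m n" and x: "x \<in> carrier (F n)" for \<alpha> m n x
  proof -
    have xs: "set [x] \<subseteq> carrier (F n)" using x by simp
    have t: "tuple n [x] \<in> arrows n 1" using xs by (rule tuple_arrows) simp
    have "app (tuple n [x]) (nil_basis 1 0 0) = x" using app_tuple[OF xs, of 1 0] by simp
    then show ?thesis
      using R_minus[OF coc[OF \<alpha> t, of "nil_basis 1 0 0"]] comp_tuple[OF \<alpha> xs]
      by (simp add: g_def T_minus)
  qed
  have g1: "g n \<one>\<^bsub>F n\<^esub> \<in> R n" for n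
  proof -
    have "natural 0 (\<lambda>n ys. g n \<one>\<^bsub>F n\<^esub>)"
    proof (rule naturalI)
      fix m n and \<alpha> :: "'l mod_Q_arrow" assume \<alpha>: "\<alpha> \<in> arrows m n"
      show "T \<alpha> (g n \<one>\<^bsub>F n\<^esub>) - g m \<one>\<^bsub>F m\<^esub> \<in> R m"
        using R_add[OF d[OF \<alpha> one_in_nil] additive_on_one[OF add[OF \<alpha>]]] by (simp add: app_one[OF \<alpha>])
    qed
    from natural_vanish[OF this, of "[]" n] show ?thesis by simp
  qed
  have nat: "natural 2 (\<lambda>n ys. defect n (g n) (ys ! 0, ys ! 1))"
  proof (rule naturalI)
    fix m n ys and \<alpha> :: "'l mod_Q_arrow"
    assume \<alpha>: "\<alpha> \<in> arrows m n" and "length ys = (2::nat)" "set ys \<subseteq> carrier (F n)"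
    then obtain x y where ys: "ys = [x, y]" and xy: "x \<in> carrier (F n)" "y \<in> carrier (F n)" by (auto simp: length_eq_2)
    have xy': "x \<otimes>\<^bsub>F n\<^esub> y \<in> carrier (F n)" using xy by simp
    have "T \<alpha> (defect n (g n) (x, y)) - defect m (g m) (app \<alpha> x, app \<alpha> y)
      = (T \<alpha> (g n x) - g m (app \<alpha> x) - f \<alpha> x) + (T \<alpha> (g n y) - g m (app \<alpha> y) - f \<alpha> y)
        - (T \<alpha> (g n (x \<otimes>\<^bsub>F n\<^esub> y)) - g m (app \<alpha> (x \<otimes>\<^bsub>F n\<^esub> y)) - f \<alpha> (x \<otimes>\<^bsub>F n\<^esub> y))
        - (f \<alpha> (x \<otimes>\<^bsub>F n\<^esub> y) - f \<alpha> x - f \<alpha> y)"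
      by (simp add: defect T_add T_diff app_mult[OF \<alpha> xy])
    also have "\<dots> \<in> R m"
      by (intro R_add R_diff d[OF \<alpha>] xy xy' additive_onD[OF add[OF \<alpha>]])
    finally show "T \<alpha> (defect n (g n) (ys ! 0, ys ! 1)) - defect m (g m) (map (app \<alpha>) ys ! 0, map (app \<alpha>) ys ! 1) \<in> R m"
      by (simp add: ys)
  qed
  have "defect n (g n) (x, y) \<in> R n" if xy: "x \<in> carrier (F n)" "y \<in> carrier (F n)" for n x y
    using natural_vanish_2[OF nat xy] g1[of n] xy by (simp add: defect)
  then show ?thesis using d by (intro exI[of _ g]) (auto simp: additive_on_defect)
qed

text \<open>Contracting f gives a primitive \<open>g0\<close> that need not be additive, and
  contracting the cocycle of its defects gives \<open>g1\<close> on pairs. Since \<open>g1\<close>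
  is natural up to the defect of \<open>g0\<close>, it is natural on cycles, where normalization
  makes it zero. It is then the defect of a function \<open>u\<close>, and changing
  \<open>g0\<close> by the coboundary of \<open>u\<close> restores additivity.\<close>

lemma vanishing_2:
  assumes add: "\<And>\<alpha> \<beta> m n k. \<lbrakk>\<alpha> \<in> arrows m n; \<beta> \<in> arrows n k\<rbrakk> \<Longrightarrow> additive_on k m (f \<alpha> \<beta>)"
    and coc: "\<And>\<alpha> \<beta> \<gamma> m n k l x. \<lbrakk>\<alpha> \<in> arrows m n; \<beta> \<in> arrows n k; \<gamma> \<in> arrows k l; x \<in> carrier (F l)\<rbrakk> \<Longrightarrow>
      T \<alpha> (f \<beta> \<gamma> x) - f (\<alpha> \<odot> \<beta>) \<gamma> x + f \<alpha> (\<beta> \<odot> \<gamma>) x - f \<alpha> \<beta> (app \<gamma> x) \<in> R m"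
  shows "\<exists>g. (\<forall>\<alpha> m n. \<alpha> \<in> arrows m n \<longrightarrow> additive_on n m (g \<alpha>)) \<and>
    (\<forall>\<alpha> \<beta> m n k x. \<alpha> \<in> arrows m n \<longrightarrow> \<beta> \<in> arrows n k \<longrightarrow> x \<in> carrier (F k) \<longrightarrow>
      T \<alpha> (g \<beta> x) - g (\<alpha> \<odot> \<beta>) x + g \<alpha> (app \<beta> x) - f \<alpha> \<beta> x \<in> R m)"
proof -
  define g0 where "g0 \<alpha> x = f \<alpha> (tuple (Dom mod_Q \<alpha>) [x]) (nil_basis 1 0 0)" for \<alpha> x
  have d: "T \<alpha> (g0 \<beta> x) - g0 (\<alpha> \<odot> \<beta>) x + g0 \<alpha> (app \<beta> x) - f \<alpha> \<beta> x \<in> R m"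
    if \<alpha>: "\<alpha> \<in> arrows m n" and \<beta>: "\<beta> \<in> arrows n k" and x: "x \<in> carrier (F k)" for \<alpha> \<beta> m n k x
  proof -
    have xs: "set [x] \<subseteq> carrier (F k)" using x by simp
    have t: "tuple k [x] \<in> arrows k 1" using xs by (rule tuple_arrows) simp
    have "app (tuple k [x]) (nil_basis 1 0 0) = x" using app_tuple[OF xs, of 1 0] by simp
    then show ?thesis
      using coc[OF \<alpha> \<beta> t, of "nil_basis 1 0 0"] comp_tuple[OF \<beta> xs] \<alpha> \<beta> comp_Q_arrows[OF \<alpha> \<beta>]
      by (simp add: g0_def)
  qed
  define G1 where "G1 \<alpha> = defect (Dom mod_Q \<alpha>) (g0 \<alpha>)" for \<alpha>
  have dG1: "T \<alpha> (G1 \<beta> (x, y)) - G1 (\<alpha> \<odot> \<beta>) (x, y) + G1 \<alpha> (app \<beta> x, app \<beta> y) \<in> R m"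
    if \<alpha>: "\<alpha> \<in> arrows m n" and \<beta>: "\<beta> \<in> arrows n k" and xy: "x \<in> carrier (F k)" "y \<in> carrier (F k)" for \<alpha> \<beta> m n k x y
  proof -
    have xy': "x \<otimes>\<^bsub>F k\<^esub> y \<in> carrier (F k)" using xy by simp
    have "T \<alpha> (G1 \<beta> (x, y)) - G1 (\<alpha> \<odot> \<beta>) (x, y) + G1 \<alpha> (app \<beta> x, app \<beta> y)
      = (T \<alpha> (g0 \<beta> x) - g0 (\<alpha> \<odot> \<beta>) x + g0 \<alpha> (app \<beta> x) - f \<alpha> \<beta> x)
        + (T \<alpha> (g0 \<beta> y) - g0 (\<alpha> \<odot> \<beta>) y + g0 \<alpha> (app \<beta> y) - f \<alpha> \<beta> y)
        - (T \<alpha> (g0 \<beta> (x \<otimes>\<^bsub>F k\<^esub> y)) - g0 (\<alpha> \<odot> \<beta>) (x \<otimes>\<^bsub>F k\<^esub> y) + g0 \<alpha> (app \<beta> (x \<otimes>\<^bsub>F k\<^esub> y)) - f \<alpha> \<beta> (x \<otimes>\<^bsub>F k\<^esub> y))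
        - (f \<alpha> \<beta> (x \<otimes>\<^bsub>F k\<^esub> y) - f \<alpha> \<beta> x - f \<alpha> \<beta> y)"
      using \<alpha> \<beta> comp_Q_arrows[OF \<alpha> \<beta>] by (simp add: G1_def defect T_add T_diff app_mult[OF \<beta> xy])
    also have "\<dots> \<in> R m"
      by (intro R_add R_diff d[OF \<alpha> \<beta>] xy xy' additive_onD[OF add[OF \<alpha> \<beta>]])
    finally show ?thesis .
  qed
  \<comment> \<open>By \<open>dG1\<close> the defects form a cocycle on pairs, so Yoneda applies
    again, now with the two generators of F_2 as the generic pair.\<close>
  define g1 where "g1 n = (\<lambda>(x, y). G1 (tuple n [x, y]) (nil_basis 2 0 0, nil_basis 2 1 0))" for n
  have g1: "T \<alpha> (g1 n (x, y)) - g1 m (app \<alpha> x, app \<alpha> y) + defect n (g0 \<alpha>) (x, y) \<in> R m"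
    if \<alpha>: "\<alpha> \<in> arrows m n" and xy: "x \<in> carrier (F n)" "y \<in> carrier (F n)" for \<alpha> m n x y
  proof -
    have xs: "set [x, y] \<subseteq> carrier (F n)" using xy by simp
    have t: "tuple n [x, y] \<in> arrows n 2" using xs by (rule tuple_arrows) simp
    have "app (tuple n [x, y]) (nil_basis 2 0 0) = x" "app (tuple n [x, y]) (nil_basis 2 1 0) = y"
      using app_tuple[OF xs, of 2 0] app_tuple[OF xs, of 2 1] by simp_all
    then show ?thesis
      using dG1[OF \<alpha> t, of "nil_basis 2 0 0" "nil_basis 2 1 0"] \<alpha>
      by (simp add: g1_def comp_tuple[OF \<alpha> xs] G1_def[of \<alpha>])
  qed
  have "natural_on_cycles1 R T g1 (\<lambda>\<alpha>. frag_extend (g0 \<alpha>))"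
  proof (unfold_locales, simp)
    fix \<alpha> :: "'l mod_Q_arrow" and m n p
    assume \<alpha>: "\<alpha> \<in> arrows m n" and p: "p \<in> chains1 (F n)"
    have "frag_extend (\<lambda>xy. T \<alpha> (g1 n xy)) p
        - frag_extend (\<lambda>xy. g1 m (map_prod (app \<alpha>) (app \<alpha>) xy) - defect n (g0 \<alpha>) xy) p \<in> R m"
      by (rule frag_extend_R_cong[of p "carrier (F n) \<times> carrier (F n)"])
        (use p g1[OF \<alpha>] in \<open>auto simp: chains1_def algebra_simps\<close>)
    then show "T \<alpha> (frag_extend (g1 n) p) - frag_extend (g1 m) (push1 (app \<alpha>) p)
        + frag_extend (g0 \<alpha>) (bd1 (F n) p) \<in> R m"
      by (simp add: frag_extend_diff_fun T_frag_extend frag_extend_frag_map o_def frag_extend_frag_extend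
          defect_def[abs_def] algebra_simps)
  qed
  then interpret N0: natural_on_cycles1 R T g1 "\<lambda>\<alpha>. frag_extend (g0 \<alpha>)" .
  from N0.normalization obtain g1' where rel: "natural_on_cycles1 R T g1' (\<lambda>\<alpha>. frag_extend (g0 \<alpha>))"
    and van: "\<forall>n. \<forall>p \<in> chains1 (F n). bd1 (F n) p = 0 \<longrightarrow> frag_extend (g1' n) p \<in> R n" by blast
  interpret N: natural_on_cycles1 R T g1' "\<lambda>\<alpha>. frag_extend (g0 \<alpha>)" by (rule rel)
  have "\<exists>\<sigma>. (\<forall>x \<in> carrier (F n). \<sigma> x \<in> chains1 (F n)) \<and> (\<forall>x \<in> carrier (F n). \<forall>y \<in> carrier (F n).
      bd1 (F n) (frag_of (x, y) - \<sigma> x - \<sigma> y + \<sigma> (x \<otimes>\<^bsub>F n\<^esub> y)) = 0)" for n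
    by (rule bd1_section[of n]) blast
  then obtain \<sigma> where \<sigma>: "\<And>n x. x \<in> carrier (F n) \<Longrightarrow> \<sigma> n x \<in> chains1 (F n)"
    "\<And>n x y. \<lbrakk>x \<in> carrier (F n); y \<in> carrier (F n)\<rbrakk> \<Longrightarrow>
      bd1 (F n) (frag_of (x, y) - \<sigma> n x - \<sigma> n y + \<sigma> n (x \<otimes>\<^bsub>F n\<^esub> y)) = 0" by metis
  \<comment> \<open>\<open>g1'\<close> vanishes on the cycles supplied by
    \<open>bd1_section\<close>; spelled out, this says that \<open>g1'\<close> is the defect of
    \<open>u\<close>.\<close>
  define u where "u n x = frag_extend (g1' n) (\<sigma> n x)" for n x
  have u: "g1' n (x, y) - defect n (u n) (x, y) \<in> R n" if xy: "x \<in> carrier (F n)" "y \<in> carrier (F n)" for n x y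
    using van[rule_format, OF _ \<sigma>(2)[OF xy]] \<sigma>(1) xy
    by (simp add: chains1_add chains1_diff frag_extend_add frag_extend_diff u_def defect algebra_simps)
  \<comment> \<open>The correction is a coboundary, so it leaves the coboundary of \<open>g0\<close>
    unchanged, while its defect cancels that of \<open>g0\<close> modulo \<open>R\<close>.\<close>
  define g where "g \<alpha> x = g0 \<alpha> x + T \<alpha> (u (Dom mod_Q \<alpha>) x) - u (Cod mod_Q \<alpha>) (app \<alpha> x)" for \<alpha> x
  have "additive_on n m (g \<alpha>)" if \<alpha>: "\<alpha> \<in> arrows m n" for \<alpha> m n
    unfolding additive_on_defect
  proof (clarify)
    fix x y assume xy: "x \<in> carrier (F n)" "y \<in> carrier (F n)"
    have axy: "app \<alpha> x \<in> carrier (F m)" "app \<alpha> y \<in> carrier (F m)" using xy app_closed[OF \<alpha>] by auto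
    have "T \<alpha> (g1' n (x, y)) - g1' m (app \<alpha> x, app \<alpha> y) + defect n (g0 \<alpha>) (x, y) \<in> R m"
      using N.g1_natural[OF \<alpha>, of "frag_of (x, y)"] xy by (simp add: defect_def)
    moreover have "defect n (g \<alpha>) (x, y)
      = (T \<alpha> (g1' n (x, y)) - g1' m (app \<alpha> x, app \<alpha> y) + defect n (g0 \<alpha>) (x, y))
        - T \<alpha> (g1' n (x, y) - defect n (u n) (x, y)) + (g1' m (app \<alpha> x, app \<alpha> y) - defect m (u m) (app \<alpha> x, app \<alpha> y))"
      using \<alpha> by (simp add: g_def defect T_add T_diff app_mult[OF \<alpha> xy])
    ultimately show "defect n (g \<alpha>) (x, y) \<in> R m"
      using T_R[OF \<alpha> u[OF xy]] u[OF axy] R_add R_diff by metis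
  qed
  moreover have "T \<alpha> (g \<beta> x) - g (\<alpha> \<odot> \<beta>) x + g \<alpha> (app \<beta> x) - f \<alpha> \<beta> x \<in> R m"
    if \<alpha>: "\<alpha> \<in> arrows m n" and \<beta>: "\<beta> \<in> arrows n k" and x: "x \<in> carrier (F k)" for \<alpha> \<beta> m n k x
    using d[OF \<alpha> \<beta> x] \<alpha> \<beta> comp_Q_arrows[OF \<alpha> \<beta>]
    by (simp add: g_def T_add T_diff T_comp[OF \<alpha> \<beta>] app_comp[OF \<alpha> \<beta> x])
  ultimately show ?thesis by (intro exI[of _ g]) blast
qed

end

lemma comp_Q_assoc:
  assumes \<alpha>: "\<alpha> \<in> arrows m n" and \<beta>: "\<beta> \<in> arrows n k" and \<gamma>: "\<gamma> \<in> arrows k l"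
  shows "\<alpha> \<odot> \<beta> \<odot> \<gamma> = \<alpha> \<odot> (\<beta> \<odot> \<gamma>)"
proof (rule arrows_eqI)
  note [simp] = app_comp[OF \<alpha> \<beta>] app_comp[OF \<beta> \<gamma>] app_comp[OF \<alpha> comp_Q_arrows[OF \<beta> \<gamma>]]
    app_comp[OF comp_Q_arrows[OF \<alpha> \<beta>] \<gamma>] app_closed[OF \<gamma>]
  show "app (\<alpha> \<odot> \<beta> \<odot> \<gamma>) (nil_basis l i 0) = app (\<alpha> \<odot> (\<beta> \<odot> \<gamma>)) (nil_basis l i 0)" if "i < l" for i
    using that by simp
qed (rule comp_Q_arrows \<alpha> \<beta> \<gamma>)+

context additive_functor
begin

lemma frag_map_bd2_gen:
  assumes \<alpha>: "\<alpha> \<in> arrows m n" and t: "set_relator t \<subseteq> carrier (F n)"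
  shows "push1 (app \<alpha>) (bd2_gen (F n) t) = bd2_gen (F m) (map_relator (app \<alpha>) t)"
  using group_hom.bd2_push2[OF app_group_hom[OF \<alpha>], of "frag_of t"] t by simp

primrec relator_args :: "'x relator \<Rightarrow> 'x list"
  where "relator_args (Assoc x y z) = [x, y, z]" | "relator_args (Central x y z) = [x, y, z]"

text \<open>Every relator of F_n is the image of a generic one of the same shape under the arrow
  given by its three entries (\<open>map_generic_relator\<close>). Thus P_2 is a sum of two functors
  Z[F_n^3], and Yoneda applies to it.\<close>

primrec generic_relator :: "'x relator \<Rightarrow> (nat \<times> 'l) word set relator"
  where
    "generic_relator (Assoc x y z) = Assoc (nil_basis 3 0 0) (nil_basis 3 1 0) (nil_basis 3 2 0)"
  | "generic_relator (Central x y z) = Central (nil_basis 3 0 0) (nil_basis 3 1 0) (nil_basis 3 2 0)"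

lemma relator_args_simps [simp]:
  "length (relator_args t) = 3" "set (relator_args t) = set_relator t"
  "relator_args (map_relator f t) = map f (relator_args t)"
  "generic_relator (map_relator f t) = generic_relator t"
  by (cases t; simp)+

lemma generic_relator_closed: "set_relator (generic_relator t) \<subseteq> carrier (F 3)"
  by (cases t) simp_all

lemma map_generic_relator:
  assumes "set_relator t \<subseteq> carrier (F n)"
  shows "map_relator (app (tuple n (relator_args t))) (generic_relator t) = t"
  using assms app_tuple[of "relator_args t" n 3 0] app_tuple[of "relator_args t" n 3 1]
    app_tuple[of "relator_args t" n 3 2]
  by (cases t) simp_all

text \<open>One stage more than in degree two: contraction on elements, pairs and relators gives
  \<open>g0\<close>, \<open>g1\<close> and \<open>g2\<close>. After normalization \<open>g2'\<close>
  kills cycles and is the coboundary of a function \<open>u1\<close> on pairs; \<open>g1\<close>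
  corrected by \<open>u1\<close> kills cycles and is the defect of \<open>u\<close>;
  \<open>g0\<close> corrected by \<open>u\<close> is additive.\<close>

lemma vanishing_3:
  assumes add: "\<And>\<alpha> \<beta> \<gamma> m n k l. \<lbrakk>\<alpha> \<in> arrows m n; \<beta> \<in> arrows n k; \<gamma> \<in> arrows k l\<rbrakk> \<Longrightarrow> additive_on l m (f \<alpha> \<beta> \<gamma>)"
    and coc: "\<And>\<alpha> \<beta> \<gamma> \<delta> m n k l j x. \<lbrakk>\<alpha> \<in> arrows m n; \<beta> \<in> arrows n k; \<gamma> \<in> arrows k l; \<delta> \<in> arrows l j; x \<in> carrier (F j)\<rbrakk> \<Longrightarrow>
      T \<alpha> (f \<beta> \<gamma> \<delta> x) - f (\<alpha> \<odot> \<beta>) \<gamma> \<delta> x + f \<alpha> (\<beta> \<odot> \<gamma>) \<delta> x - f \<alpha> \<beta> (\<gamma> \<odot> \<delta>) x + f \<alpha> \<beta> \<gamma> (app \<delta> x) \<in> R m"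
  shows "\<exists>g. (\<forall>\<alpha> \<beta> m n k. \<alpha> \<in> arrows m n \<longrightarrow> \<beta> \<in> arrows n k \<longrightarrow> additive_on k m (g \<alpha> \<beta>)) \<and>
    (\<forall>\<alpha> \<beta> \<gamma> m n k l x. \<alpha> \<in> arrows m n \<longrightarrow> \<beta> \<in> arrows n k \<longrightarrow> \<gamma> \<in> arrows k l \<longrightarrow> x \<in> carrier (F l) \<longrightarrow>
      T \<alpha> (g \<beta> \<gamma> x) - g (\<alpha> \<odot> \<beta>) \<gamma> x + g \<alpha> (\<beta> \<odot> \<gamma>) x - g \<alpha> \<beta> (app \<gamma> x) - f \<alpha> \<beta> \<gamma> x \<in> R m)"
proof -
  define g0 where "g0 \<alpha> \<beta> x = - f \<alpha> \<beta> (tuple (Dom mod_Q \<beta>) [x]) (nil_basis 1 0 0)" for \<alpha> \<beta> x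
  have d: "T \<alpha> (g0 \<beta> \<gamma> x) - g0 (\<alpha> \<odot> \<beta>) \<gamma> x + g0 \<alpha> (\<beta> \<odot> \<gamma>) x - g0 \<alpha> \<beta> (app \<gamma> x) - f \<alpha> \<beta> \<gamma> x \<in> R m"
    if \<alpha>: "\<alpha> \<in> arrows m n" and \<beta>: "\<beta> \<in> arrows n k" and \<gamma>: "\<gamma> \<in> arrows k l" and x: "x \<in> carrier (F l)"
    for \<alpha> \<beta> \<gamma> m n k l x
  proof -
    have xs: "set [x] \<subseteq> carrier (F l)" using x by simp
    have t: "tuple l [x] \<in> arrows l 1" using xs by (rule tuple_arrows) simp
    have "app (tuple l [x]) (nil_basis 1 0 0) = x" using app_tuple[OF xs, of 1 0] by simp
    then show ?thesis
      using R_minus[OF coc[OF \<alpha> \<beta> \<gamma> t, of "nil_basis 1 0 0"]] comp_tuple[OF \<gamma> xs] \<alpha> \<beta> \<gamma>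
        comp_Q_arrows[OF \<beta> \<gamma>]
      by (simp add: g0_def T_minus algebra_simps)
  qed
  define G1 where "G1 \<alpha> \<beta> = defect (Dom mod_Q \<beta>) (g0 \<alpha> \<beta>)" for \<alpha> \<beta>
  have dG1: "T \<alpha> (G1 \<beta> \<gamma> (x, y)) - G1 (\<alpha> \<odot> \<beta>) \<gamma> (x, y) + G1 \<alpha> (\<beta> \<odot> \<gamma>) (x, y) - G1 \<alpha> \<beta> (app \<gamma> x, app \<gamma> y) \<in> R m"
    if \<alpha>: "\<alpha> \<in> arrows m n" and \<beta>: "\<beta> \<in> arrows n k" and \<gamma>: "\<gamma> \<in> arrows k l"
      and xy: "x \<in> carrier (F l)" "y \<in> carrier (F l)" for \<alpha> \<beta> \<gamma> m n k l x y
  proof -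
    let ?d = "\<lambda>x. T \<alpha> (g0 \<beta> \<gamma> x) - g0 (\<alpha> \<odot> \<beta>) \<gamma> x + g0 \<alpha> (\<beta> \<odot> \<gamma>) x - g0 \<alpha> \<beta> (app \<gamma> x) - f \<alpha> \<beta> \<gamma> x"
    have xy': "x \<otimes>\<^bsub>F l\<^esub> y \<in> carrier (F l)" using xy by simp
    have "T \<alpha> (G1 \<beta> \<gamma> (x, y)) - G1 (\<alpha> \<odot> \<beta>) \<gamma> (x, y) + G1 \<alpha> (\<beta> \<odot> \<gamma>) (x, y) - G1 \<alpha> \<beta> (app \<gamma> x, app \<gamma> y)
      = ?d x + ?d y - ?d (x \<otimes>\<^bsub>F l\<^esub> y)
        - (f \<alpha> \<beta> \<gamma> (x \<otimes>\<^bsub>F l\<^esub> y) - f \<alpha> \<beta> \<gamma> x - f \<alpha> \<beta> \<gamma> y)"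
      using \<alpha> \<beta> \<gamma> comp_Q_arrows[OF \<beta> \<gamma>] by (simp add: G1_def defect T_add T_diff app_mult[OF \<gamma> xy])
    also have "\<dots> \<in> R m"
      by (intro R_add R_diff[of "_ + _"] d[OF \<alpha> \<beta> \<gamma>] xy xy' additive_onD[OF add[OF \<alpha> \<beta> \<gamma>]]
          R_diff[of "?d x + ?d y"] R_diff[of "?d x + ?d y - ?d (x \<otimes>\<^bsub>F l\<^esub> y)"])
    finally show ?thesis .
  qed
  define g1 where "g1 \<alpha> = (\<lambda>(x, y). G1 \<alpha> (tuple (Dom mod_Q \<alpha>) [x, y]) (nil_basis 2 0 0, nil_basis 2 1 0))" for \<alpha>
  have g1: "T \<alpha> (g1 \<beta> xy) - g1 (\<alpha> \<odot> \<beta>) xy + g1 \<alpha> (map_prod (app \<beta>) (app \<beta>) xy) - defect k (g0 \<alpha> \<beta>) xy \<in> R m"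
    if \<alpha>: "\<alpha> \<in> arrows m n" and \<beta>: "\<beta> \<in> arrows n k" and xy: "xy \<in> carrier (F k) \<times> carrier (F k)" for \<alpha> \<beta> m n k xy
  proof -
    obtain x y where [simp]: "xy = (x, y)" by fastforce
    have xs: "set [x, y] \<subseteq> carrier (F k)" using xy by simp
    have t: "tuple k [x, y] \<in> arrows k 2" using xs by (rule tuple_arrows) simp
    have "app (tuple k [x, y]) (nil_basis 2 0 0) = x" "app (tuple k [x, y]) (nil_basis 2 1 0) = y"
      using app_tuple[OF xs, of 2 0] app_tuple[OF xs, of 2 1] by simp_all
    then show ?thesis
      using dG1[OF \<alpha> \<beta> t, of "nil_basis 2 0 0" "nil_basis 2 1 0"] \<alpha> \<beta> comp_Q_arrows[OF \<alpha> \<beta>]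
      by (simp add: g1_def comp_tuple[OF \<beta> xs] G1_def[of \<alpha> \<beta>])
  qed
  let ?g1 = "\<lambda>\<alpha>. frag_extend (g1 \<alpha>)"
  have g1_chain: "T \<alpha> (?g1 \<beta> p) - ?g1 (\<alpha> \<odot> \<beta>) p + ?g1 \<alpha> (push1 (app \<beta>) p) - frag_extend (g0 \<alpha> \<beta>) (bd1 (F k) p) \<in> R m"
    if \<alpha>: "\<alpha> \<in> arrows m n" and \<beta>: "\<beta> \<in> arrows n k" and p: "p \<in> chains1 (F k)" for \<alpha> \<beta> m n k p
  proof -
    have "frag_extend (\<lambda>xy. T \<alpha> (g1 \<beta> xy) - g1 (\<alpha> \<odot> \<beta>) xy) p
      - frag_extend (\<lambda>xy. defect k (g0 \<alpha> \<beta>) xy - g1 \<alpha> (map_prod (app \<beta>) (app \<beta>) xy)) p \<in> R m"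
      by (rule frag_extend_R_cong[of p "carrier (F k) \<times> carrier (F k)"])
        (use p g1[OF \<alpha> \<beta>] in \<open>simp_all add: chains1_def algebra_simps\<close>)
    then show ?thesis
      by (simp add: frag_extend_diff_fun T_frag_extend frag_extend_frag_map o_def frag_extend_frag_extend
          defect_def[abs_def] algebra_simps)
  qed
  \<comment> \<open>The boundary of the generic relator is a cycle, on which the term with
    \<open>g0\<close> in \<open>g1_chain\<close> disappears. What is left is a cocycle identity for
    \<open>g1\<close>, contracted once more with F_3.\<close>
  define g2 where "g2 n t = ?g1 (tuple n (relator_args t)) (bd2_gen (F 3) (generic_relator t))" for n t
  have g2: "T \<alpha> (g2 n t) - g2 m (map_relator (app \<alpha>) t) + ?g1 \<alpha> (bd2_gen (F n) t) \<in> R m"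
    if \<alpha>: "\<alpha> \<in> arrows m n" and t: "set_relator t \<subseteq> carrier (F n)" for \<alpha> m n t
  proof -
    let ?\<beta> = "tuple n (relator_args t)" and ?p = "bd2_gen (F 3) (generic_relator t)"
    have xs: "set (relator_args t) \<subseteq> carrier (F n)" using t by simp
    have \<beta>: "?\<beta> \<in> arrows n 3" using xs by (rule tuple_arrows) simp
    have "bd1 (F 3) ?p = 0"
      using nil_free.bd1_bd2[of "frag_of (generic_relator t)" 3] generic_relator_closed[of t] by simp
    moreover have "push1 (app ?\<beta>) ?p = bd2_gen (F n) t"
      using frag_map_bd2_gen[OF \<beta> generic_relator_closed[of t]] map_generic_relator[OF t] by simp
    ultimately show ?thesis
      using g1_chain[OF \<alpha> \<beta> nil_free.bd2_gen_chains1[OF generic_relator_closed[of t]]]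
      by (simp add: g2_def comp_tuple[OF \<alpha> xs])
  qed
  have "natural_on_cycles R T g2 ?g1"
  proof (unfold_locales, simp)
    fix \<alpha> :: "'l mod_Q_arrow" and m n q
    assume \<alpha>: "\<alpha> \<in> arrows m n" and q: "q \<in> chains2 (F n)"
    have "frag_extend (\<lambda>t. T \<alpha> (g2 n t)) q
        - frag_extend (\<lambda>t. g2 m (map_relator (app \<alpha>) t) - ?g1 \<alpha> (bd2_gen (F n) t)) q \<in> R m"
      by (rule frag_extend_R_cong[of q "{t. set_relator t \<subseteq> carrier (F n)}"])
        (use q g2[OF \<alpha>] in \<open>simp_all add: chains2_def algebra_simps\<close>)
    then show "T \<alpha> (frag_extend (g2 n) q) - frag_extend (g2 m) (push2 (app \<alpha>) q)
        + ?g1 \<alpha> (bd2 (F n) q) \<in> R m"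
      by (simp add: frag_extend_diff_fun T_frag_extend frag_extend_frag_map o_def frag_extend_frag_extend
          algebra_simps)
  qed
  then interpret N0: natural_on_cycles R T g2 ?g1 .
  from N0.normalization obtain g2' where rel: "natural_on_cycles R T g2' ?g1"
    and van: "\<forall>n. \<forall>q \<in> chains2 (F n). bd2 (F n) q = 0 \<longrightarrow> frag_extend (g2' n) q \<in> R n" by blast
  interpret N: natural_on_cycles R T g2' ?g1 by (rule rel)
  have "\<exists>\<sigma>. (\<forall>x \<in> carrier (F n). \<sigma> x \<in> chains1 (F n)) \<and> (\<forall>x \<in> carrier (F n). \<forall>y \<in> carrier (F n).
      bd1 (F n) (frag_of (x, y) - \<sigma> x - \<sigma> y + \<sigma> (x \<otimes>\<^bsub>F n\<^esub> y)) = 0)" for n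
    by (rule bd1_section[of n]) blast
  then obtain \<sigma> where \<sigma>: "\<And>n x. x \<in> carrier (F n) \<Longrightarrow> \<sigma> n x \<in> chains1 (F n)"
    "\<And>n x y. \<lbrakk>x \<in> carrier (F n); y \<in> carrier (F n)\<rbrakk> \<Longrightarrow>
      bd1 (F n) (frag_of (x, y) - \<sigma> n x - \<sigma> n y + \<sigma> n (x \<otimes>\<^bsub>F n\<^esub> y)) = 0" by metis
  \<comment> \<open>Linearly extended, \<open>\<tau> n\<close> projects pairs onto cycles, and
    \<open>\<rho> n\<close> lifts this projection through \<open>bd2\<close> by exactness. So
    \<open>u1\<close> extends to all pairs the function that \<open>g2'\<close> induces on
    boundaries.\<close>
  define \<tau> where "\<tau> n xy = frag_of xy - frag_extend (\<sigma> n) (bd1_gen (F n) xy)" for n xy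
  have \<tau>_eq: "\<tau> n (x, y) = frag_of (x, y) - \<sigma> n x - \<sigma> n y + \<sigma> n (x \<otimes>\<^bsub>F n\<^esub> y)" for n x y
    by (simp add: \<tau>_def frag_extend_add frag_extend_diff)
  have \<tau>: "\<tau> n xy \<in> chains1 (F n)" "bd1 (F n) (\<tau> n xy) = 0" if "xy \<in> carrier (F n) \<times> carrier (F n)" for n xy
    using that \<sigma> by (auto simp: \<tau>_eq intro!: chains1_add chains1_diff)
  have "\<exists>q \<in> chains2 (F n). bd2 (F n) q = \<tau> n xy" if "xy \<in> carrier (F n) \<times> carrier (F n)" for n xy
    by (rule bd1_exact[OF \<tau>[OF that]])
  then have ex: "\<exists>q. q \<in> chains2 (F n) \<and> bd2 (F n) q = \<tau> n xy" if "xy \<in> carrier (F n) \<times> carrier (F n)" for n xy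
    using that by blast
  define \<rho> where "\<rho> n xy = (SOME q. q \<in> chains2 (F n) \<and> bd2 (F n) q = \<tau> n xy)" for n xy
  have \<rho>: "\<rho> n xy \<in> chains2 (F n) \<and> bd2 (F n) (\<rho> n xy) = \<tau> n xy" if "xy \<in> carrier (F n) \<times> carrier (F n)" for n xy
    unfolding \<rho>_def by (rule someI_ex[OF ex[OF that]])
  define u1 where "u1 n xy = frag_extend (g2' n) (\<rho> n xy)" for n xy
  have u1: "frag_extend (u1 n) (bd2 (F n) q) - frag_extend (g2' n) q \<in> R n" if q: "q \<in> chains2 (F n)" for n q
  proof -
    let ?p = "bd2 (F n) q"
    have p: "?p \<in> chains1 (F n)" by (rule nil_free.bd2_chains1[OF q])
    have \<rho>c: "frag_extend (\<rho> n) ?p \<in> chains2 (F n)"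
      unfolding chains2_def mem_Collect_eq
    proof (rule keys_frag_extend_subset)
      show "Poly_Mapping.keys ?p \<subseteq> carrier (F n) \<times> carrier (F n)" using p by (simp only: chains1_def mem_Collect_eq)
      show "Poly_Mapping.keys (\<rho> n xy) \<subseteq> {t. set_relator t \<subseteq> carrier (F n)}"
        if "xy \<in> carrier (F n) \<times> carrier (F n)" for xy
        using \<rho>[OF that] by (simp only: chains2_def mem_Collect_eq)
    qed
    have "bd2 (F n) (frag_extend (\<rho> n) ?p) = frag_extend (\<tau> n) ?p"
      unfolding frag_extend_frag_extend[of "bd2_gen _"]
      by (rule frag_extend_eq) (use p \<rho> in \<open>auto simp: chains1_def\<close>)
    also have "\<dots> = ?p - frag_extend (\<sigma> n) (bd1 (F n) ?p)"
      by (simp add: \<tau>_def[abs_def] frag_extend_diff_fun frag_extend_frag_extend flip: frag_expansion)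
    also have "\<dots> = ?p" by (simp add: nil_free.bd1_bd2[OF q])
    finally have "bd2 (F n) (frag_extend (\<rho> n) ?p - q) = 0" by (simp add: frag_extend_diff)
    from van[rule_format, OF chains2_diff[OF \<rho>c q] this]
    show ?thesis by (simp add: frag_extend_diff frag_extend_frag_extend u1_def[abs_def])
  qed
  let ?u1 = "\<lambda>n. frag_extend (u1 n)"
  \<comment> \<open>\<open>g1\<close> changed by the coboundary of \<open>u1\<close>. On a cycle
    \<open>bd2 (F n) q\<close> the function \<open>u1\<close> may be replaced by \<open>g2'\<close>
    on q, and the sum becomes the naturality condition for \<open>g2'\<close>.\<close>
  define k1 where "k1 \<alpha> p = ?g1 \<alpha> p + T \<alpha> (?u1 (Dom mod_Q \<alpha>) p) - ?u1 (Cod mod_Q \<alpha>) (push1 (app \<alpha>) p)" for \<alpha> p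
  have k1_add: "k1 \<alpha> (p + p') = k1 \<alpha> p + k1 \<alpha> p'" and k1_diff: "k1 \<alpha> (p - p') = k1 \<alpha> p - k1 \<alpha> p'" for \<alpha> p p'
    by (simp_all add: k1_def frag_extend_add frag_extend_diff frag_map_add frag_map_diff T_add T_diff)
  have k1_cycle: "k1 \<alpha> p \<in> R m" if \<alpha>: "\<alpha> \<in> arrows m n" and p: "p \<in> chains1 (F n)" "bd1 (F n) p = 0" for \<alpha> m n p
  proof -
    obtain q where q: "q \<in> chains2 (F n)" "p = bd2 (F n) q" using bd1_exact[OF p] by blast
    have push: "push1 (app \<alpha>) p = bd2 (F m) (push2 (app \<alpha>) q)"
      unfolding q(2) by (rule group_hom.bd2_push2[OF app_group_hom[OF \<alpha>] q(1), symmetric])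
    let ?q = "push2 (app \<alpha>) q"
    have q': "?q \<in> chains2 (F m)" by (rule push2_chains2[OF app_hom[OF \<alpha>] q(1)])
    have "k1 \<alpha> p = (T \<alpha> (frag_extend (g2' n) q) - frag_extend (g2' m) ?q + ?g1 \<alpha> (bd2 (F n) q))
       + T \<alpha> (?u1 n (bd2 (F n) q) - frag_extend (g2' n) q) - (?u1 m (bd2 (F m) ?q) - frag_extend (g2' m) ?q)"
      using \<alpha> by (simp add: k1_def push T_diff) (simp add: q(2))
    also have "\<dots> \<in> R m"
      by (rule R_diff[OF R_add[OF N.g2_natural[OF \<alpha> q(1)] T_R[OF \<alpha> u1[OF q(1)]]] u1[OF q']])
    finally show ?thesis .
  qed
  have k1_chain: "T \<alpha> (k1 \<beta> (frag_of xy)) - k1 (\<alpha> \<odot> \<beta>) (frag_of xy) + k1 \<alpha> (frag_of (map_prod (app \<beta>) (app \<beta>) xy)) - G1 \<alpha> \<beta> xy \<in> R m"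
    if \<alpha>: "\<alpha> \<in> arrows m n" and \<beta>: "\<beta> \<in> arrows n k" and xy: "xy \<in> carrier (F k) \<times> carrier (F k)" for \<alpha> \<beta> m n k xy
  proof -
    have "map_prod (app (\<alpha> \<odot> \<beta>)) (app (\<alpha> \<odot> \<beta>)) xy = map_prod (app \<alpha>) (app \<alpha>) (map_prod (app \<beta>) (app \<beta>) xy)"
      using xy by (auto simp: app_comp[OF \<alpha> \<beta>])
    then show ?thesis
      using g1[OF \<alpha> \<beta> xy] \<alpha> \<beta> comp_Q_arrows[OF \<alpha> \<beta>]
      by (simp add: k1_def G1_def T_add T_diff T_comp[OF \<alpha> \<beta>] algebra_simps)
  qed
  \<comment> \<open>\<open>k1\<close> vanishes on the cycles \<open>\<tau> n (x, y)\<close>, which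
    says that on pairs it is the defect of \<open>u\<close>.\<close>
  define u where "u \<alpha> x = k1 \<alpha> (\<sigma> (Dom mod_Q \<alpha>) x)" for \<alpha> x
  have u: "k1 \<alpha> (frag_of (x, y)) - defect n (u \<alpha>) (x, y) \<in> R m"
    if \<alpha>: "\<alpha> \<in> arrows m n" and xy: "x \<in> carrier (F n)" "y \<in> carrier (F n)" for \<alpha> m n x y
    using k1_cycle[OF \<alpha> \<tau>, of "(x, y)"] \<alpha> xy
    by (simp add: u_def defect \<tau>_eq k1_add k1_diff algebra_simps)
  define g where "g \<alpha> \<beta> x = g0 \<alpha> \<beta> x - (T \<alpha> (u \<beta> x) - u (\<alpha> \<odot> \<beta>) x + u \<alpha> (app \<beta> x))" for \<alpha> \<beta> x
  have "additive_on k m (g \<alpha> \<beta>)" if \<alpha>: "\<alpha> \<in> arrows m n" and \<beta>: "\<beta> \<in> arrows n k" for \<alpha> \<beta> m n k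
    unfolding additive_on_defect
  proof (clarify)
    fix x y assume xy: "x \<in> carrier (F k)" "y \<in> carrier (F k)"
    let ?x = "app \<beta> x" and ?y = "app \<beta> y"
    have bxy: "?x \<in> carrier (F n)" "?y \<in> carrier (F n)" using xy app_closed[OF \<beta>] by auto
    have "defect k (g \<alpha> \<beta>) (x, y) = T \<alpha> (k1 \<beta> (frag_of (x, y)) - defect k (u \<beta>) (x, y))
        - (k1 (\<alpha> \<odot> \<beta>) (frag_of (x, y)) - defect k (u (\<alpha> \<odot> \<beta>)) (x, y))
        + (k1 \<alpha> (frag_of (?x, ?y)) - defect n (u \<alpha>) (?x, ?y))
        - (T \<alpha> (k1 \<beta> (frag_of (x, y))) - k1 (\<alpha> \<odot> \<beta>) (frag_of (x, y)) + k1 \<alpha> (frag_of (?x, ?y)) - G1 \<alpha> \<beta> (x, y))"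
      using \<beta> by (simp add: g_def G1_def defect T_add T_diff app_mult[OF \<beta> xy] algebra_simps)
    also have "\<dots> \<in> R m"
      using k1_chain[OF \<alpha> \<beta>, of "(x, y)"] xy
      by (intro R_diff[OF R_add[OF R_diff[OF T_R[OF \<alpha> u[OF \<beta> xy]] u[OF comp_Q_arrows[OF \<alpha> \<beta>] xy]]
            u[OF \<alpha> bxy]]]) simp
    finally show "defect k (g \<alpha> \<beta>) (x, y) \<in> R m" .
  qed
  moreover have "T \<alpha> (g \<beta> \<gamma> x) - g (\<alpha> \<odot> \<beta>) \<gamma> x + g \<alpha> (\<beta> \<odot> \<gamma>) x - g \<alpha> \<beta> (app \<gamma> x) - f \<alpha> \<beta> \<gamma> x \<in> R m"
    if \<alpha>: "\<alpha> \<in> arrows m n" and \<beta>: "\<beta> \<in> arrows n k" and \<gamma>: "\<gamma> \<in> arrows k l" and x: "x \<in> carrier (F l)"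
    for \<alpha> \<beta> \<gamma> m n k l x
    using d[OF \<alpha> \<beta> \<gamma> x]
    by (simp add: g_def T_add T_diff T_comp[OF \<alpha> \<beta>] app_comp[OF \<beta> \<gamma> x] comp_Q_assoc[OF \<alpha> \<beta> \<gamma>])
  ultimately show ?thesis by (intro exI[of _ g]) blast
qed

end

section \<open>Equivariance over a free monoid\<close>

text \<open>Letters are split off at the right end because L acts from the right: the value at w + s
  is to be computed from the value at w.\<close>

lemma free_monoid_decomposition:
  assumes "free_monoid_on S"
  obtains d where "\<And>w. d w \<in> lists S" "\<And>w. sum_list (d w) = w" "d 0 = []"
    "\<And>w s. s \<in> S \<Longrightarrow> d (w + s) = d w @ [s]"
proof -
  have bij: "bij_betw sum_list (lists S) UNIV" using assms by (simp add: free_monoid_on_def)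
  define d where "d = the_inv_into (lists S) sum_list"
  have d: "d w \<in> lists S" "sum_list (d w) = w" for w
    using bij the_inv_into_into[of sum_list "lists S" w "lists S"] f_the_inv_into_f[of sum_list "lists S" w]
    by (auto simp: bij_betw_def d_def)
  have eq: "d (sum_list ss) = ss" if "ss \<in> lists S" for ss
    using bij that by (simp add: d_def bij_betw_def the_inv_into_f_f)
  show thesis
  proof (rule that[of d])
    show "d 0 = []" using eq[of "[]"] by simp
    show "d (w + s) = d w @ [s]" if "s \<in> S" for w s
      using eq[of "d w @ [s]"] d[of w] that by simp
  qed (rule d)+
qed

locale additive_functor_with_action = additive_functor R T
  for R :: "nat \<Rightarrow> ('q \<Rightarrow>\<^sub>0 int) set" and T :: "'l::monoid_add mod_Q_arrow \<Rightarrow> ('q \<Rightarrow>\<^sub>0 int) \<Rightarrow> 'q \<Rightarrow>\<^sub>0 int" +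
  fixes act :: "'l \<Rightarrow> ('q \<Rightarrow>\<^sub>0 int) \<Rightarrow> 'q \<Rightarrow>\<^sub>0 int" and S :: "'l set"
  assumes act_diff: "act s (a - b) = act s a - act s b"
    and act_R: "a \<in> R n \<Longrightarrow> act s a \<in> R n"
    and T_act: "\<alpha> \<in> arrows m n \<Longrightarrow> T \<alpha> (act s a) = act s (T \<alpha> a)"
    and free: "free_monoid_on S"
begin

lemma act_0 [simp]: "act s 0 = 0"
  using act_diff[of s 0 0] by simp

lemma act_add: "act s (a + b) = act s a + act s b"
  using act_diff[of s a "- b"] act_diff[of s 0 b] by simp

lemma ract_closed [simp]: "x \<in> carrier (F n) \<Longrightarrow> x \<triangleleft>\<^bsub>F n\<^esub> s \<in> carrier (F n)"
  by (rule nil_module.ract_closed[OF nil_module_free_nil_module])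

lemma ract_mult: "\<lbrakk>x \<in> carrier (F n); y \<in> carrier (F n)\<rbrakk>
    \<Longrightarrow> (x \<otimes>\<^bsub>F n\<^esub> y) \<triangleleft>\<^bsub>F n\<^esub> s = (x \<triangleleft>\<^bsub>F n\<^esub> s) \<otimes>\<^bsub>F n\<^esub> (y \<triangleleft>\<^bsub>F n\<^esub> s)"
  by (rule nil_module.ract_mult[OF nil_module_free_nil_module])

lemma additive_on_vanish:
  assumes "additive_on n c \<phi>" "\<And>i s. i < n \<Longrightarrow> \<phi> (nil_basis n i s) \<in> R c" "x \<in> carrier (F n)"
  shows "\<phi> x \<in> R c"
  using assms(3)
proof (induction rule: free_nil_module_induct)
  case (mult x y)
  then show ?case using R_add[OF R_add[OF additive_onD[OF assms(1) mult(1,2)] mult(3)] mult(4)] by simp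
next
  case (inv x)
  have "\<phi> \<one>\<^bsub>F n\<^esub> - \<phi> x - \<phi> (inv\<^bsub>F n\<^esub> x) \<in> R c" using additive_onD[OF assms(1), of x "inv\<^bsub>F n\<^esub> x"] inv(1) by simp
  from R_diff[OF R_diff[OF additive_on_one[OF assms(1)] this] inv(2)] show ?case by simp
qed (use assms additive_on_one in auto)

lemma additive_on_defect_of_action:
  assumes \<phi>: "additive_on n c \<phi>"
  shows "additive_on n c (\<lambda>x. \<phi> (x \<triangleleft>\<^bsub>F n\<^esub> s) - act s (\<phi> x))"
  unfolding additive_on_def
proof (intro ballI)
  fix x y assume xy: "x \<in> carrier (F n)" "y \<in> carrier (F n)"
  let ?\<psi> = "\<lambda>x. \<phi> (x \<triangleleft>\<^bsub>F n\<^esub> s) - act s (\<phi> x)"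
  have "?\<psi> (x \<otimes>\<^bsub>F n\<^esub> y) - ?\<psi> x - ?\<psi> y
    = (\<phi> ((x \<triangleleft>\<^bsub>F n\<^esub> s) \<otimes>\<^bsub>F n\<^esub> (y \<triangleleft>\<^bsub>F n\<^esub> s)) - \<phi> (x \<triangleleft>\<^bsub>F n\<^esub> s) - \<phi> (y \<triangleleft>\<^bsub>F n\<^esub> s))
      - act s (\<phi> (x \<otimes>\<^bsub>F n\<^esub> y) - \<phi> x - \<phi> y)"
    by (simp add: ract_mult[OF xy] act_diff)
  also have "\<dots> \<in> R c" using xy by (intro R_diff[OF additive_onD[OF \<phi>] act_R[OF additive_onD[OF \<phi>]]]) simp_all
  finally show "?\<psi> (x \<otimes>\<^bsub>F n\<^esub> y) - ?\<psi> x - ?\<psi> y \<in> R c" .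
qed

lemma additive_on_diff: "\<lbrakk>additive_on n c \<phi>; additive_on n c \<psi>\<rbrakk> \<Longrightarrow> additive_on n c (\<lambda>x. \<phi> x - \<psi> x)"
  unfolding additive_on_def
proof (intro ballI)
  fix x y assume *: "\<forall>x\<in>carrier (F n). \<forall>y\<in>carrier (F n). \<phi> (x \<otimes>\<^bsub>F n\<^esub> y) - \<phi> x - \<phi> y \<in> R c"
    "\<forall>x\<in>carrier (F n). \<forall>y\<in>carrier (F n). \<psi> (x \<otimes>\<^bsub>F n\<^esub> y) - \<psi> x - \<psi> y \<in> R c"
    "x \<in> carrier (F n)" "y \<in> carrier (F n)"
  then have "(\<phi> (x \<otimes>\<^bsub>F n\<^esub> y) - \<phi> x - \<phi> y) - (\<psi> (x \<otimes>\<^bsub>F n\<^esub> y) - \<psi> x - \<psi> y) \<in> R c"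
    by (rule_tac R_diff) blast+
  then show "\<phi> (x \<otimes>\<^bsub>F n\<^esub> y) - \<psi> (x \<otimes>\<^bsub>F n\<^esub> y) - (\<phi> x - \<psi> x) - (\<phi> y - \<psi> y) \<in> R c"
    by (simp add: algebra_simps)
qed

lemma additive_on_T: "\<lbrakk>\<alpha> \<in> arrows m c; additive_on n c \<phi>\<rbrakk> \<Longrightarrow> additive_on n m (\<lambda>x. T \<alpha> (\<phi> x))"
  unfolding additive_on_def by (metis T_R T_diff)

lemma additive_on_app: "\<lbrakk>\<alpha> \<in> arrows m n; additive_on m c \<phi>\<rbrakk> \<Longrightarrow> additive_on n c (\<lambda>x. \<phi> (app \<alpha> x))"
  unfolding additive_on_def by (simp add: app_mult app_closed)

text \<open>Surjectivity in the exact sequence that measures the failure of equivariance. Additive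
  maps have arbitrary values on the basis elements (i, w), and as words are unique, each nontrivial
  w arises as w' + s with s in S in exactly one way; so the condition for s determines the value at
  w from that at w' without conflict.\<close>

lemma twisted_extension:
  assumes k: "\<And>s. s \<in> S \<Longrightarrow> additive_on n c (k s)"
  shows "\<exists>h. additive_on n c h \<and> (\<forall>s \<in> S. \<forall>x \<in> carrier (F n). h (x \<triangleleft>\<^bsub>F n\<^esub> s) - act s (h x) - k s x \<in> R c)"
proof -
  obtain d where d: "\<And>w. sum_list (d w) = w" "d 0 = []" "\<And>w s. s \<in> S \<Longrightarrow> d (w + s) = d w @ [s]"
    by (rule free_monoid_decomposition[OF free]) blast
  \<comment> \<open>Reversal puts the last letter of the word at the head of the list, where
    \<open>rec_list\<close> can split it off. The value at the empty word is arbitrary and taken to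
    be 0.\<close>
  define e where "e i = rec_list 0 (\<lambda>s ss a. act s a + k s (nil_basis n i (sum_list (rev ss))))" for i
  define b where "b i w = e i (rev (d w))" for i w
  have b: "b i (w + s) = act s (b i w) + k s (nil_basis n i w)" if "s \<in> S" for i w s
    using that by (simp add: b_def e_def d)
  obtain h where h: "\<forall>x \<in> carrier (F n). \<forall>y \<in> carrier (F n). h (x \<otimes>\<^bsub>F n\<^esub> y) = h x + h y"
    "\<forall>i<n. \<forall>s. h (nil_basis n i s) = b i s"
    using free_nil_module_additive_ex[of n b] by blast
  have add: "additive_on n c h" using h(1) by (simp add: additive_on_def)
  moreover have "h (x \<triangleleft>\<^bsub>F n\<^esub> s) - act s (h x) - k s x \<in> R c" if s: "s \<in> S" and x: "x \<in> carrier (F n)" for s x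
    by (rule additive_on_vanish[OF additive_on_diff[OF additive_on_defect_of_action[OF add] k[OF s]] _ x])
      (use h(2) s in \<open>simp add: nil_basis_ract b\<close>)
  ultimately show ?thesis by blast
qed

text \<open>Required for the free generators only, which is what \<open>twisted_extension\<close>
  can provide. Equivariance for all of L follows in \<open>equivariant_on_all\<close>.\<close>

definition equivariant_on :: "nat \<Rightarrow> nat \<Rightarrow> ((nat \<times> 'l) word set \<Rightarrow> 'q \<Rightarrow>\<^sub>0 int) \<Rightarrow> bool"
  where "equivariant_on n c \<phi> \<longleftrightarrow> additive_on n c \<phi> \<and>
    (\<forall>s \<in> S. \<forall>x \<in> carrier (F n). \<phi> (x \<triangleleft>\<^bsub>F n\<^esub> s) - act s (\<phi> x) \<in> R c)"

lemma equivariant_onD: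
  assumes "equivariant_on n c \<phi>"
  shows "additive_on n c \<phi>" "\<lbrakk>s \<in> S; x \<in> carrier (F n)\<rbrakk> \<Longrightarrow> \<phi> (x \<triangleleft>\<^bsub>F n\<^esub> s) - act s (\<phi> x) \<in> R c"
  using assms by (simp_all add: equivariant_on_def)

text \<open>Let \<open>gs s\<close> be the failure of the additive primitive to commute with s. It
  is a 1-cocycle because f commutes with s, so \<open>vanishing_1\<close> makes it the coboundary of
  some \<open>hs s\<close>. \<open>twisted_extension\<close> realizes all the \<open>hs s\<close> at
  once as the failures of one additive \<open>h\<close>, and removing the coboundary of
  \<open>h\<close> makes the primitive equivariant.\<close>

lemma equivariant_vanishing_2:
  assumes eqv: "\<And>\<alpha> \<beta> m n k. \<lbrakk>\<alpha> \<in> arrows m n; \<beta> \<in> arrows n k\<rbrakk> \<Longrightarrow> equivariant_on k m (f \<alpha> \<beta>)"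
    and coc: "\<And>\<alpha> \<beta> \<gamma> m n k l x. \<lbrakk>\<alpha> \<in> arrows m n; \<beta> \<in> arrows n k; \<gamma> \<in> arrows k l; x \<in> carrier (F l)\<rbrakk> \<Longrightarrow>
      T \<alpha> (f \<beta> \<gamma> x) - f (\<alpha> \<odot> \<beta>) \<gamma> x + f \<alpha> (\<beta> \<odot> \<gamma>) x - f \<alpha> \<beta> (app \<gamma> x) \<in> R m"
  shows "\<exists>g. (\<forall>\<alpha> m n. \<alpha> \<in> arrows m n \<longrightarrow> equivariant_on n m (g \<alpha>)) \<and>
    (\<forall>\<alpha> \<beta> m n k x. \<alpha> \<in> arrows m n \<longrightarrow> \<beta> \<in> arrows n k \<longrightarrow> x \<in> carrier (F k) \<longrightarrow>
      T \<alpha> (g \<beta> x) - g (\<alpha> \<odot> \<beta>) x + g \<alpha> (app \<beta> x) - f \<alpha> \<beta> x \<in> R m)"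
proof -
  have "\<exists>g. (\<forall>\<alpha> m n. \<alpha> \<in> arrows m n \<longrightarrow> additive_on n m (g \<alpha>)) \<and>
    (\<forall>\<alpha> \<beta> m n k x. \<alpha> \<in> arrows m n \<longrightarrow> \<beta> \<in> arrows n k \<longrightarrow> x \<in> carrier (F k) \<longrightarrow>
      T \<alpha> (g \<beta> x) - g (\<alpha> \<odot> \<beta>) x + g \<alpha> (app \<beta> x) - f \<alpha> \<beta> x \<in> R m)"
    by (rule vanishing_2; (rule equivariant_onD(1)[OF eqv] coc; assumption))
  then obtain g where "(\<forall>\<alpha> m n. \<alpha> \<in> arrows m n \<longrightarrow> additive_on n m (g \<alpha>)) \<and>
    (\<forall>\<alpha> \<beta> m n k x. \<alpha> \<in> arrows m n \<longrightarrow> \<beta> \<in> arrows n k \<longrightarrow> x \<in> carrier (F k) \<longrightarrow>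
      T \<alpha> (g \<beta> x) - g (\<alpha> \<odot> \<beta>) x + g \<alpha> (app \<beta> x) - f \<alpha> \<beta> x \<in> R m)" .. 
  then have g_add: "\<And>\<alpha> m n. \<alpha> \<in> arrows m n \<Longrightarrow> additive_on n m (g \<alpha>)"
    and g: "\<And>\<alpha> \<beta> m n k x. \<lbrakk>\<alpha> \<in> arrows m n; \<beta> \<in> arrows n k; x \<in> carrier (F k)\<rbrakk> \<Longrightarrow>
      T \<alpha> (g \<beta> x) - g (\<alpha> \<odot> \<beta>) x + g \<alpha> (app \<beta> x) - f \<alpha> \<beta> x \<in> R m" by blast+
  define gs where "gs s \<alpha> x = g \<alpha> (x \<triangleleft>\<^bsub>F (Dom mod_Q \<alpha>)\<^esub> s) - act s (g \<alpha> x)" for s \<alpha> x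
  have gs_add: "additive_on n m (gs s \<alpha>)" if \<alpha>: "\<alpha> \<in> arrows m n" for s \<alpha> m n
    using additive_on_defect_of_action[OF g_add[OF \<alpha>], of s] \<alpha> by (simp add: gs_def[abs_def])
  have gs_coc: "T \<alpha> (gs s \<beta> x) - gs s (\<alpha> \<odot> \<beta>) x + gs s \<alpha> (app \<beta> x) \<in> R m"
    if s: "s \<in> S" and \<alpha>: "\<alpha> \<in> arrows m n" and \<beta>: "\<beta> \<in> arrows n k" and x: "x \<in> carrier (F k)" for s \<alpha> \<beta> m n k x
  proof -
    let ?d = "\<lambda>x. T \<alpha> (g \<beta> x) - g (\<alpha> \<odot> \<beta>) x + g \<alpha> (app \<beta> x) - f \<alpha> \<beta> x"
    have xs: "x \<triangleleft>\<^bsub>F k\<^esub> s \<in> carrier (F k)" using x by simp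
    have "T \<alpha> (gs s \<beta> x) - gs s (\<alpha> \<odot> \<beta>) x + gs s \<alpha> (app \<beta> x)
       = ?d (x \<triangleleft>\<^bsub>F k\<^esub> s) - act s (?d x) + (f \<alpha> \<beta> (x \<triangleleft>\<^bsub>F k\<^esub> s) - act s (f \<alpha> \<beta> x))"
      using \<alpha> \<beta> comp_Q_arrows[OF \<alpha> \<beta>]
      by (simp add: gs_def app_ract[OF \<beta> x] T_diff T_act[OF \<alpha>] act_diff act_add)
    also have "\<dots> \<in> R m"
      by (intro R_add[OF R_diff[OF g[OF \<alpha> \<beta> xs] act_R[OF g[OF \<alpha> \<beta> x]]]] equivariant_onD(2)[OF eqv[OF \<alpha> \<beta>] s x])
    finally show ?thesis .
  qed
  have "\<forall>s \<in> S. \<exists>h. (\<forall>n. additive_on n n (h n)) \<and> (\<forall>\<alpha> m n x. \<alpha> \<in> arrows m n \<longrightarrow> x \<in> carrier (F n) \<longrightarrow>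
     T \<alpha> (h n x) - h m (app \<alpha> x) - gs s \<alpha> x \<in> R m)" (is "\<forall>s \<in> S. \<exists>h. ?P s h")
    by (intro ballI vanishing_1 gs_add gs_coc)
  from bchoice[OF this] obtain hs where "\<forall>s \<in> S. ?P s (hs s)" ..
  then have hs_add: "\<And>s n. s \<in> S \<Longrightarrow> additive_on n n (hs s n)"
    and hs: "\<And>s \<alpha> m n x. \<lbrakk>s \<in> S; \<alpha> \<in> arrows m n; x \<in> carrier (F n)\<rbrakk> \<Longrightarrow>
      T \<alpha> (hs s n x) - hs s m (app \<alpha> x) - gs s \<alpha> x \<in> R m" by blast+
  have "\<forall>n. \<exists>h. additive_on n n h \<and> (\<forall>s \<in> S. \<forall>x \<in> carrier (F n). h (x \<triangleleft>\<^bsub>F n\<^esub> s) - act s (h x) - hs s n x \<in> R n)"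
    (is "\<forall>n. \<exists>h. ?H n h")
    by (intro allI twisted_extension hs_add)
  from choice[OF this] obtain h where "\<forall>n. ?H n (h n)" ..
  then have h_add: "\<And>n. additive_on n n (h n)"
    and h: "\<And>n s x. \<lbrakk>s \<in> S; x \<in> carrier (F n)\<rbrakk> \<Longrightarrow> h n (x \<triangleleft>\<^bsub>F n\<^esub> s) - act s (h n x) - hs s n x \<in> R n" by blast+
  define g' where "g' \<alpha> x = g \<alpha> x - (T \<alpha> (h (Dom mod_Q \<alpha>) x) - h (Cod mod_Q \<alpha>) (app \<alpha> x))" for \<alpha> x
  have "equivariant_on n m (g' \<alpha>)" if \<alpha>: "\<alpha> \<in> arrows m n" for \<alpha> m n
    unfolding equivariant_on_def
  proof (intro conjI ballI)
    show "additive_on n m (g' \<alpha>)"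
      using additive_on_diff[OF g_add[OF \<alpha>] additive_on_diff[OF additive_on_T[OF \<alpha> h_add] additive_on_app[OF \<alpha> h_add]]] \<alpha>
      by (simp add: g'_def[abs_def])
    fix s x assume s: "s \<in> S" and x: "x \<in> carrier (F n)"
    have "g' \<alpha> (x \<triangleleft>\<^bsub>F n\<^esub> s) - act s (g' \<alpha> x)
      = - (T \<alpha> (h n (x \<triangleleft>\<^bsub>F n\<^esub> s) - act s (h n x) - hs s n x))
        + (h m (app \<alpha> x \<triangleleft>\<^bsub>F m\<^esub> s) - act s (h m (app \<alpha> x)) - hs s m (app \<alpha> x))
        - (T \<alpha> (hs s n x) - hs s m (app \<alpha> x) - gs s \<alpha> x)"
      using \<alpha> by (simp add: g'_def gs_def app_ract[OF \<alpha> x] T_diff T_act[OF \<alpha>] act_diff)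
    also have "\<dots> \<in> R m"
      by (intro R_diff[OF R_add[OF R_minus[OF T_R[OF \<alpha> h[OF s x]]] h[OF s app_closed[OF \<alpha> x]]] hs[OF s \<alpha> x]])
    finally show "g' \<alpha> (x \<triangleleft>\<^bsub>F n\<^esub> s) - act s (g' \<alpha> x) \<in> R m" .
  qed
  moreover have "T \<alpha> (g' \<beta> x) - g' (\<alpha> \<odot> \<beta>) x + g' \<alpha> (app \<beta> x) - f \<alpha> \<beta> x \<in> R m"
    if \<alpha>: "\<alpha> \<in> arrows m n" and \<beta>: "\<beta> \<in> arrows n k" and x: "x \<in> carrier (F k)" for \<alpha> \<beta> m n k x
    using g[OF \<alpha> \<beta> x] \<alpha> \<beta> comp_Q_arrows[OF \<alpha> \<beta>]
    by (simp add: g'_def T_diff T_comp[OF \<alpha> \<beta>] app_comp[OF \<alpha> \<beta> x])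
  ultimately show ?thesis by (intro exI[of _ g']) blast
qed

text \<open>The same argument one degree higher: \<open>gs s\<close> is a 2-cocycle, killed by
  \<open>vanishing_2\<close>, and the correcting \<open>h\<close> now depends on an arrow.\<close>

lemma equivariant_vanishing_3:
  assumes eqv: "\<And>\<alpha> \<beta> \<gamma> m n k l. \<lbrakk>\<alpha> \<in> arrows m n; \<beta> \<in> arrows n k; \<gamma> \<in> arrows k l\<rbrakk> \<Longrightarrow> equivariant_on l m (f \<alpha> \<beta> \<gamma>)"
    and coc: "\<And>\<alpha> \<beta> \<gamma> \<delta> m n k l j x. \<lbrakk>\<alpha> \<in> arrows m n; \<beta> \<in> arrows n k; \<gamma> \<in> arrows k l; \<delta> \<in> arrows l j; x \<in> carrier (F j)\<rbrakk> \<Longrightarrow>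
      T \<alpha> (f \<beta> \<gamma> \<delta> x) - f (\<alpha> \<odot> \<beta>) \<gamma> \<delta> x + f \<alpha> (\<beta> \<odot> \<gamma>) \<delta> x - f \<alpha> \<beta> (\<gamma> \<odot> \<delta>) x + f \<alpha> \<beta> \<gamma> (app \<delta> x) \<in> R m"
  shows "\<exists>g. (\<forall>\<alpha> \<beta> m n k. \<alpha> \<in> arrows m n \<longrightarrow> \<beta> \<in> arrows n k \<longrightarrow> equivariant_on k m (g \<alpha> \<beta>)) \<and>
    (\<forall>\<alpha> \<beta> \<gamma> m n k l x. \<alpha> \<in> arrows m n \<longrightarrow> \<beta> \<in> arrows n k \<longrightarrow> \<gamma> \<in> arrows k l \<longrightarrow> x \<in> carrier (F l) \<longrightarrow>
      T \<alpha> (g \<beta> \<gamma> x) - g (\<alpha> \<odot> \<beta>) \<gamma> x + g \<alpha> (\<beta> \<odot> \<gamma>) x - g \<alpha> \<beta> (app \<gamma> x) - f \<alpha> \<beta> \<gamma> x \<in> R m)"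
proof -
  have "\<exists>g. (\<forall>\<alpha> \<beta> m n k. \<alpha> \<in> arrows m n \<longrightarrow> \<beta> \<in> arrows n k \<longrightarrow> additive_on k m (g \<alpha> \<beta>)) \<and>
    (\<forall>\<alpha> \<beta> \<gamma> m n k l x. \<alpha> \<in> arrows m n \<longrightarrow> \<beta> \<in> arrows n k \<longrightarrow> \<gamma> \<in> arrows k l \<longrightarrow> x \<in> carrier (F l) \<longrightarrow>
      T \<alpha> (g \<beta> \<gamma> x) - g (\<alpha> \<odot> \<beta>) \<gamma> x + g \<alpha> (\<beta> \<odot> \<gamma>) x - g \<alpha> \<beta> (app \<gamma> x) - f \<alpha> \<beta> \<gamma> x \<in> R m)"
    by (rule vanishing_3; (rule equivariant_onD(1)[OF eqv] coc; assumption))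
  then obtain g where "(\<forall>\<alpha> \<beta> m n k. \<alpha> \<in> arrows m n \<longrightarrow> \<beta> \<in> arrows n k \<longrightarrow> additive_on k m (g \<alpha> \<beta>)) \<and>
    (\<forall>\<alpha> \<beta> \<gamma> m n k l x. \<alpha> \<in> arrows m n \<longrightarrow> \<beta> \<in> arrows n k \<longrightarrow> \<gamma> \<in> arrows k l \<longrightarrow> x \<in> carrier (F l) \<longrightarrow>
      T \<alpha> (g \<beta> \<gamma> x) - g (\<alpha> \<odot> \<beta>) \<gamma> x + g \<alpha> (\<beta> \<odot> \<gamma>) x - g \<alpha> \<beta> (app \<gamma> x) - f \<alpha> \<beta> \<gamma> x \<in> R m)" ..
  then have g_add: "\<And>\<alpha> \<beta> m n k. \<lbrakk>\<alpha> \<in> arrows m n; \<beta> \<in> arrows n k\<rbrakk> \<Longrightarrow> additive_on k m (g \<alpha> \<beta>)"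
    and g: "\<And>\<alpha> \<beta> \<gamma> m n k l x. \<lbrakk>\<alpha> \<in> arrows m n; \<beta> \<in> arrows n k; \<gamma> \<in> arrows k l; x \<in> carrier (F l)\<rbrakk> \<Longrightarrow>
      T \<alpha> (g \<beta> \<gamma> x) - g (\<alpha> \<odot> \<beta>) \<gamma> x + g \<alpha> (\<beta> \<odot> \<gamma>) x - g \<alpha> \<beta> (app \<gamma> x) - f \<alpha> \<beta> \<gamma> x \<in> R m" by blast+
  define gs where "gs s \<alpha> \<beta> x = g \<alpha> \<beta> (x \<triangleleft>\<^bsub>F (Dom mod_Q \<beta>)\<^esub> s) - act s (g \<alpha> \<beta> x)" for s \<alpha> \<beta> x
  have gs_add: "additive_on k m (gs s \<alpha> \<beta>)" if \<alpha>: "\<alpha> \<in> arrows m n" and \<beta>: "\<beta> \<in> arrows n k" for s \<alpha> \<beta> m n k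
    using additive_on_defect_of_action[OF g_add[OF \<alpha> \<beta>], of s] \<beta> by (simp add: gs_def[abs_def])
  have gs_coc: "T \<alpha> (gs s \<beta> \<gamma> x) - gs s (\<alpha> \<odot> \<beta>) \<gamma> x + gs s \<alpha> (\<beta> \<odot> \<gamma>) x - gs s \<alpha> \<beta> (app \<gamma> x) \<in> R m"
    if s: "s \<in> S" and \<alpha>: "\<alpha> \<in> arrows m n" and \<beta>: "\<beta> \<in> arrows n k" and \<gamma>: "\<gamma> \<in> arrows k l"
      and x: "x \<in> carrier (F l)" for s \<alpha> \<beta> \<gamma> m n k l x
  proof -
    let ?d = "\<lambda>x. T \<alpha> (g \<beta> \<gamma> x) - g (\<alpha> \<odot> \<beta>) \<gamma> x + g \<alpha> (\<beta> \<odot> \<gamma>) x - g \<alpha> \<beta> (app \<gamma> x) - f \<alpha> \<beta> \<gamma> x"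
    have xs: "x \<triangleleft>\<^bsub>F l\<^esub> s \<in> carrier (F l)" using x by simp
    have "T \<alpha> (gs s \<beta> \<gamma> x) - gs s (\<alpha> \<odot> \<beta>) \<gamma> x + gs s \<alpha> (\<beta> \<odot> \<gamma>) x - gs s \<alpha> \<beta> (app \<gamma> x)
       = ?d (x \<triangleleft>\<^bsub>F l\<^esub> s) - act s (?d x) + (f \<alpha> \<beta> \<gamma> (x \<triangleleft>\<^bsub>F l\<^esub> s) - act s (f \<alpha> \<beta> \<gamma> x))"
      using \<alpha> \<beta> \<gamma> comp_Q_arrows[OF \<beta> \<gamma>]
      by (simp add: gs_def app_ract[OF \<gamma> x] T_diff T_act[OF \<alpha>] act_diff act_add)
    also have "\<dots> \<in> R m"
      by (intro R_add[OF R_diff[OF g[OF \<alpha> \<beta> \<gamma> xs] act_R[OF g[OF \<alpha> \<beta> \<gamma> x]]]]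
          equivariant_onD(2)[OF eqv[OF \<alpha> \<beta> \<gamma>] s x])
    finally show ?thesis .
  qed
  have "\<forall>s \<in> S. \<exists>h. (\<forall>\<alpha> m n. \<alpha> \<in> arrows m n \<longrightarrow> additive_on n m (h \<alpha>)) \<and>
    (\<forall>\<alpha> \<beta> m n k x. \<alpha> \<in> arrows m n \<longrightarrow> \<beta> \<in> arrows n k \<longrightarrow> x \<in> carrier (F k) \<longrightarrow>
      T \<alpha> (h \<beta> x) - h (\<alpha> \<odot> \<beta>) x + h \<alpha> (app \<beta> x) - gs s \<alpha> \<beta> x \<in> R m)" (is "\<forall>s \<in> S. \<exists>h. ?P s h")
    by (intro ballI vanishing_2 gs_add gs_coc)
  from bchoice[OF this] obtain hs where "\<forall>s \<in> S. ?P s (hs s)" ..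
  then have hs_add: "\<And>s \<alpha> m n. \<lbrakk>s \<in> S; \<alpha> \<in> arrows m n\<rbrakk> \<Longrightarrow> additive_on n m (hs s \<alpha>)"
    and hs: "\<And>s \<alpha> \<beta> m n k x. \<lbrakk>s \<in> S; \<alpha> \<in> arrows m n; \<beta> \<in> arrows n k; x \<in> carrier (F k)\<rbrakk> \<Longrightarrow>
      T \<alpha> (hs s \<beta> x) - hs s (\<alpha> \<odot> \<beta>) x + hs s \<alpha> (app \<beta> x) - gs s \<alpha> \<beta> x \<in> R m" by blast+
  have "\<exists>h. additive_on n m h \<and> (\<forall>s \<in> S. \<forall>x \<in> carrier (F n). h (x \<triangleleft>\<^bsub>F n\<^esub> s) - act s (h x) - hs s \<alpha> x \<in> R m)"
    if "\<alpha> \<in> arrows m n" for \<alpha> m n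
    using that by (intro twisted_extension hs_add)
  \<comment> \<open>Ranks are determined by the arrow, so one choice for each \<alpha> serves all m
    and n.\<close>
  then have "\<forall>\<alpha>. \<exists>h. \<forall>m n. \<alpha> \<in> arrows m n \<longrightarrow>
     additive_on n m h \<and> (\<forall>s \<in> S. \<forall>x \<in> carrier (F n). h (x \<triangleleft>\<^bsub>F n\<^esub> s) - act s (h x) - hs s \<alpha> x \<in> R m)"
    (is "\<forall>\<alpha>. \<exists>h. ?H \<alpha> h")
    by (metis arrows_Cod arrows_Dom)
  from choice[OF this] obtain h where "\<forall>\<alpha>. ?H \<alpha> (h \<alpha>)" ..
  then have h_add: "\<And>\<alpha> m n. \<alpha> \<in> arrows m n \<Longrightarrow> additive_on n m (h \<alpha>)"
    and h: "\<And>\<alpha> m n s x. \<lbrakk>\<alpha> \<in> arrows m n; s \<in> S; x \<in> carrier (F n)\<rbrakk> \<Longrightarrow>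
      h \<alpha> (x \<triangleleft>\<^bsub>F n\<^esub> s) - act s (h \<alpha> x) - hs s \<alpha> x \<in> R m" by blast+
  define g' where "g' \<alpha> \<beta> x = g \<alpha> \<beta> x - (T \<alpha> (h \<beta> x) - (h (\<alpha> \<odot> \<beta>) x - h \<alpha> (app \<beta> x)))" for \<alpha> \<beta> x
  have "equivariant_on k m (g' \<alpha> \<beta>)" if \<alpha>: "\<alpha> \<in> arrows m n" and \<beta>: "\<beta> \<in> arrows n k" for \<alpha> \<beta> m n k
    unfolding equivariant_on_def
  proof (intro conjI ballI)
    have \<alpha>\<beta>: "\<alpha> \<odot> \<beta> \<in> arrows m k" by (rule comp_Q_arrows[OF \<alpha> \<beta>])
    show "additive_on k m (g' \<alpha> \<beta>)"
      unfolding g'_def[abs_def]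
      by (intro additive_on_diff g_add[OF \<alpha> \<beta>] additive_on_T[OF \<alpha>] h_add[OF \<beta>] h_add[OF \<alpha>\<beta>]
          additive_on_app[OF \<beta>] h_add[OF \<alpha>])
    fix s x assume s: "s \<in> S" and x: "x \<in> carrier (F k)"
    have "g' \<alpha> \<beta> (x \<triangleleft>\<^bsub>F k\<^esub> s) - act s (g' \<alpha> \<beta> x)
      = - (T \<alpha> (h \<beta> (x \<triangleleft>\<^bsub>F k\<^esub> s) - act s (h \<beta> x) - hs s \<beta> x))
        + (h (\<alpha> \<odot> \<beta>) (x \<triangleleft>\<^bsub>F k\<^esub> s) - act s (h (\<alpha> \<odot> \<beta>) x) - hs s (\<alpha> \<odot> \<beta>) x)
        - (h \<alpha> (app \<beta> x \<triangleleft>\<^bsub>F n\<^esub> s) - act s (h \<alpha> (app \<beta> x)) - hs s \<alpha> (app \<beta> x))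
        - (T \<alpha> (hs s \<beta> x) - hs s (\<alpha> \<odot> \<beta>) x + hs s \<alpha> (app \<beta> x) - gs s \<alpha> \<beta> x)"
      using \<beta> by (simp add: g'_def gs_def app_ract[OF \<beta> x] T_diff T_act[OF \<alpha>] act_diff act_add)
    also have "\<dots> \<in> R m"
      by (intro R_diff[OF R_diff[OF R_add[OF R_minus[OF T_R[OF \<alpha> h[OF \<beta> s x]]] h[OF \<alpha>\<beta> s x]]
            h[OF \<alpha> s app_closed[OF \<beta> x]]] hs[OF s \<alpha> \<beta> x]])
    finally show "g' \<alpha> \<beta> (x \<triangleleft>\<^bsub>F k\<^esub> s) - act s (g' \<alpha> \<beta> x) \<in> R m" .
  qed
  moreover have "T \<alpha> (g' \<beta> \<gamma> x) - g' (\<alpha> \<odot> \<beta>) \<gamma> x + g' \<alpha> (\<beta> \<odot> \<gamma>) x - g' \<alpha> \<beta> (app \<gamma> x) - f \<alpha> \<beta> \<gamma> x \<in> R m"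
    if \<alpha>: "\<alpha> \<in> arrows m n" and \<beta>: "\<beta> \<in> arrows n k" and \<gamma>: "\<gamma> \<in> arrows k l" and x: "x \<in> carrier (F l)"
    for \<alpha> \<beta> \<gamma> m n k l x
    using g[OF \<alpha> \<beta> \<gamma> x]
    by (simp add: g'_def T_diff T_comp[OF \<alpha> \<beta>] app_comp[OF \<beta> \<gamma> x] comp_Q_assoc[OF \<alpha> \<beta> \<gamma>])
  ultimately show ?thesis by (intro exI[of _ g']) blast
qed

end

section \<open>Abelianizations and tensor products\<close>

text \<open>Maps and actions on abelianizations and tensor products are defined as unions of cosets
  over all representatives; here such a union is evaluated on one representative.\<close>

lemma quotient_map_coset:
  assumes f: "group_hom G H f" and N: "N \<lhd> G" and K: "K \<lhd> H" and NK: "f ` N \<subseteq> K" and x: "x \<in> carrier G"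
  shows "(\<Union>z \<in> N #>\<^bsub>G\<^esub> x. K #>\<^bsub>H\<^esub> f z) = K #>\<^bsub>H\<^esub> f x"
proof -
  interpret group_hom G H f by fact
  interpret N: normal N G by fact
  interpret K: normal K H by fact
  have *: "K #>\<^bsub>H\<^esub> f z = K #>\<^bsub>H\<^esub> f x" if "z \<in> N #>\<^bsub>G\<^esub> x" for z
  proof -
    from that obtain n where n: "n \<in> N" "z = n \<otimes>\<^bsub>G\<^esub> x" by (auto simp: r_coset_def)
    have fn: "f n \<in> K" "n \<in> carrier G" using n NK N.subset by auto
    have "K #>\<^bsub>H\<^esub> f z = (K #>\<^bsub>H\<^esub> f n) #>\<^bsub>H\<^esub> f x"
      using n fn x K.subset by (simp add: H.coset_mult_assoc)
    also have "K #>\<^bsub>H\<^esub> f n = K" using fn(1) by (intro K.rcos_const H.is_group)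
    finally show ?thesis .
  qed
  have "x \<in> N #>\<^bsub>G\<^esub> x" using x N.subgroup_axioms by (rule G.rcos_self)
  then show ?thesis using * by blast
qed

lemma hom_free_Abelian_eqI:
  assumes "group G" "f \<in> hom (free_Abelian_group UNIV) G" "g \<in> hom (free_Abelian_group UNIV) G"
    and "\<And>s. f (frag_of s) = g (frag_of s)"
  shows "f r = g r"
proof -
  interpret G: group G by fact
  interpret f: group_hom "free_Abelian_group UNIV" G f
    by (simp add: group_hom_def group_hom_axioms_def assms)
  interpret g: group_hom "free_Abelian_group UNIV" G g
    by (simp add: group_hom_def group_hom_axioms_def assms)
  have hom_diff: "h (a - b) = h a \<otimes>\<^bsub>G\<^esub> inv\<^bsub>G\<^esub> h b" if "group_hom (free_Abelian_group UNIV) G h" for h a b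
  proof -
    interpret h: group_hom "free_Abelian_group UNIV" G h by fact
    show ?thesis using h.hom_mult[of a "- b"] h.hom_inv[of b] by simp
  qed
  have "Poly_Mapping.keys r \<subseteq> UNIV" by simp
  then show ?thesis
  proof (induction rule: frag_induction)
    case zero
    show ?case using f.hom_one g.hom_one by simp
  next
    case (diff a b)
    then show ?case by (simp add: hom_diff[OF f.group_hom_axioms] hom_diff[OF g.group_hom_axioms])
  qed (rule assms(4))
qed

text \<open>The linear extension of a function from L to a homomorphism on Z[L], in the form in
  which \<open>ad\<close> defines its scalar action. It allows statements about all scalars r to be
  checked on r = \<open>frag_of s\<close>.\<close>

lemma (in comm_group) finprod_int_pow_hom:
  assumes g: "\<And>s. g s \<in> carrier G"
  shows "(\<lambda>r. \<Otimes>s\<in>Poly_Mapping.keys r. g s [^] (Poly_Mapping.lookup r s :: int)) \<in> hom (free_Abelian_group UNIV) G"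
proof (rule homI)
  have ext: "(\<Otimes>s\<in>Poly_Mapping.keys r. g s [^] Poly_Mapping.lookup r s) = (\<Otimes>s\<in>A. g s [^] Poly_Mapping.lookup r s)"
    if "finite A" "Poly_Mapping.keys r \<subseteq> A" for r :: "'c \<Rightarrow>\<^sub>0 int" and A
    by (rule finprod_mono_neutral_cong_left) (use that g in \<open>auto simp: in_keys_iff\<close>)
  show "(\<Otimes>s\<in>Poly_Mapping.keys r. g s [^] Poly_Mapping.lookup r s) \<in> carrier G" for r :: "'c \<Rightarrow>\<^sub>0 int"
    using g by (intro finprod_closed Pi_I int_pow_closed)
  fix r r' :: "'c \<Rightarrow>\<^sub>0 int"
  let ?A = "Poly_Mapping.keys r \<union> Poly_Mapping.keys r'"
  have "(\<Otimes>s\<in>Poly_Mapping.keys (r + r'). g s [^] Poly_Mapping.lookup (r + r') s)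
     = (\<Otimes>s\<in>?A. g s [^] Poly_Mapping.lookup r s \<otimes> g s [^] Poly_Mapping.lookup r' s)"
    by (subst ext[of ?A]) (use g Poly_Mapping.keys_add[of r r'] in \<open>auto simp: lookup_add int_pow_mult\<close>)
  also have "\<dots> = (\<Otimes>s\<in>?A. g s [^] Poly_Mapping.lookup r s) \<otimes> (\<Otimes>s\<in>?A. g s [^] Poly_Mapping.lookup r' s)"
    using g by (intro finprod_multf) auto
  finally show "(\<Otimes>s\<in>Poly_Mapping.keys (r \<otimes>\<^bsub>free_Abelian_group UNIV\<^esub> r'). g s [^] Poly_Mapping.lookup (r \<otimes>\<^bsub>free_Abelian_group UNIV\<^esub> r') s)
      = (\<Otimes>s\<in>Poly_Mapping.keys r. g s [^] Poly_Mapping.lookup r s) \<otimes> (\<Otimes>s\<in>Poly_Mapping.keys r'. g s [^] Poly_Mapping.lookup r' s)"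
    using ext[of ?A r] ext[of ?A r'] by simp
qed

lemma comm_group_cong:
  fixes G (structure)
  assumes "comm_group G" "carrier H = carrier G" "monoid.mult H = monoid.mult G" "one H = one G"
  shows "comm_group H"
proof -
  interpret comm_group G by fact
  show ?thesis
  proof (rule comm_groupI)
    show "\<exists>y\<in>carrier H. y \<otimes>\<^bsub>H\<^esub> x = \<one>\<^bsub>H\<^esub>" if "x \<in> carrier H" for x
      using that by (intro bexI[of _ "inv x"]) (auto simp: assms(2-4))
    show "x \<otimes>\<^bsub>H\<^esub> y = y \<otimes>\<^bsub>H\<^esub> x" if "x \<in> carrier H" "y \<in> carrier H" for x y
      using that unfolding assms(2-4) by (rule m_comm)
  qed (simp_all add: assms(2-4) m_assoc)
qed

section \<open>Abelianization of a module over the square ring\<close>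

context nil_module
begin

abbreviation "K \<equiv> commutator_subgroup M"
abbreviation "ab x \<equiv> K #> x"

lemma K_normal: "K \<lhd> M"
  by (rule derived_self_is_normal)

lemma group_hom_ract: "group_hom M M (\<lambda>x. x \<triangleleft> s)"
  by unfold_locales (auto simp: hom_def ract_closed ract_mult)

lemma ad_simps:
  "carrier (ad M) = carrier (M Mod K)" "monoid.mult (ad M) = monoid.mult (M Mod K)" "one (ad M) = one (M Mod K)"
  by (simp_all add: ad_def Let_def)

lemma comm_group_ad: "comm_group (ad M)"
  by (rule comm_group_cong[OF derived_quot_is_comm_group]) (simp_all add: ad_def Let_def)

lemma carrier_ad: "carrier (ad M) = ab ` carrier M"
  by (simp add: ad_simps carrier_FactGroup)

lemma ab_closed: "x \<in> carrier M \<Longrightarrow> ab x \<in> carrier (ad M)"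
  by (auto simp: carrier_ad)

lemma ab_mult: "\<lbrakk>x \<in> carrier M; y \<in> carrier M\<rbrakk> \<Longrightarrow> ab x \<otimes>\<^bsub>ad M\<^esub> ab y = ab (x \<otimes> y)"
  using normal.rcos_sum[OF K_normal] by (simp add: ad_simps)

lemma ad_ract:
  assumes x: "x \<in> carrier M"
  shows "ab x \<triangleleft>\<^bsub>ad M\<^esub> r = (\<Otimes>\<^bsub>M Mod K\<^esub>s\<in>Poly_Mapping.keys r. ab (x \<triangleleft> s) [^]\<^bsub>M Mod K\<^esub> Poly_Mapping.lookup r s)"
proof -
  have "(\<lambda>x. x \<triangleleft> s) ` K \<subseteq> K" for s
  proof -
    interpret group_hom M M "\<lambda>x. x \<triangleleft> s" by (rule group_hom_ract)
    have "derived M ((\<lambda>x. x \<triangleleft> s) ` carrier M) = (\<lambda>x. x \<triangleleft> s) ` K" by (rule derived_img) simp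
    moreover have "derived M ((\<lambda>x. x \<triangleleft> s) ` carrier M) \<subseteq> K" by (rule mono_derived) (auto simp: ract_closed)
    ultimately show ?thesis by simp
  qed
  then have "(\<Union>z\<in>ab x. ab (z \<triangleleft> s)) = ab (x \<triangleleft> s)" for s
    by (intro quotient_map_coset[OF group_hom_ract K_normal K_normal] x)
  then show ?thesis by (simp add: ad_def Let_def)
qed

lemma ad_ract_hom:
  assumes x: "x \<in> carrier M"
  shows "(\<lambda>r. ab x \<triangleleft>\<^bsub>ad M\<^esub> r) \<in> hom (free_Abelian_group UNIV) (ad M)"
proof -
  have "ab (x \<triangleleft> s) \<in> carrier (M Mod K)" for s using ab_closed[OF ract_closed[OF x]] by (simp add: ad_simps)
  from comm_group.finprod_int_pow_hom[OF derived_quot_is_comm_group this]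
  show ?thesis by (simp add: ad_ract[OF x] hom_def ad_simps)
qed

lemma ad_ract_of:
  assumes x: "x \<in> carrier M"
  shows "ab x \<triangleleft>\<^bsub>ad M\<^esub> frag_of s = ab (x \<triangleleft> s)"
proof -
  interpret A: comm_group "M Mod K" by (rule derived_quot_is_comm_group)
  have "ab (x \<triangleleft> s) \<in> carrier (M Mod K)" using ab_closed[OF ract_closed[OF x]] by (simp add: ad_simps)
  then show ?thesis by (simp add: ad_ract[OF x] del: mult_FactGroup one_FactGroup)
qed

lemma ad_ract_closed: "U \<in> carrier (ad M) \<Longrightarrow> U \<triangleleft>\<^bsub>ad M\<^esub> r \<in> carrier (ad M)"
  using ad_ract_hom by (auto simp: carrier_ad hom_def Pi_iff)

text \<open>Both sides are homomorphisms in r, so it is enough to compare them on elements of the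
  monoid. Linearity over Z[L] is always obtained from the action of L in this way.\<close>

lemma ad_hom_ract:
  assumes H: "group H" and h: "h \<in> hom (ad M) H" and x: "x \<in> carrier M"
    and k: "k \<in> hom (free_Abelian_group UNIV) H" and eq: "\<And>s. h (ab (x \<triangleleft> s)) = k (frag_of s)"
  shows "h (ab x \<triangleleft>\<^bsub>ad M\<^esub> r) = k r"
proof -
  have "(h \<circ> (\<lambda>r. ab x \<triangleleft>\<^bsub>ad M\<^esub> r)) r = k r"
    by (rule hom_free_Abelian_eqI[OF H Group.hom_compose[OF ad_ract_hom[OF x] h] k])
      (simp add: ad_ract_of[OF x] eq)
  then show ?thesis by simp
qed

end

lemma ad_map:
  assumes M: "nil_module M" and N: "nil_module N" and \<phi>: "\<phi> \<in> op_hom M N"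
  shows "x \<in> carrier M \<Longrightarrow> ad_map M N \<phi> (commutator_subgroup M #>\<^bsub>M\<^esub> x) = commutator_subgroup N #>\<^bsub>N\<^esub> \<phi> x"
    and "ad_map M N \<phi> \<in> op_hom (ad M) (ad N)"
proof -
  interpret M: nil_module M by fact
  interpret N: nil_module N by fact
  have \<phi>': "\<phi> \<in> hom M N" "\<And>x s. x \<in> carrier M \<Longrightarrow> \<phi> (x \<triangleleft>\<^bsub>M\<^esub> s) = \<phi> x \<triangleleft>\<^bsub>N\<^esub> s"
    using \<phi> by (auto simp: op_hom_def)
  interpret \<phi>: group_hom M N \<phi> by unfold_locales (rule \<phi>'(1))
  have "derived N (\<phi> ` carrier M) = \<phi> ` M.K" by (rule \<phi>.derived_img) simp
  moreover have "derived N (\<phi> ` carrier M) \<subseteq> N.K" by (rule N.mono_derived) auto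
  ultimately have "\<phi> ` M.K \<subseteq> N.K" by simp
  from quotient_map_coset[OF \<phi>.group_hom_axioms M.K_normal N.K_normal this]
  have eq: "ad_map M N \<phi> (M.ab x) = N.ab (\<phi> x)" if "x \<in> carrier M" for x
    using that M.ab_closed by (simp add: ad_map_def)
  then show "x \<in> carrier M \<Longrightarrow> ad_map M N \<phi> (M.ab x) = N.ab (\<phi> x)" .
  have hom: "ad_map M N \<phi> \<in> hom (ad M) (ad N)"
    by (rule homI) (auto simp: M.carrier_ad eq N.ab_closed M.ab_mult N.ab_mult)
  have ract: "ad_map M N \<phi> (U \<triangleleft>\<^bsub>ad M\<^esub> r) = ad_map M N \<phi> U \<triangleleft>\<^bsub>ad N\<^esub> r" if U: "U \<in> carrier (ad M)" for U r
  proof -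
    obtain x where x: "U = M.ab x" "x \<in> carrier M" using U unfolding M.carrier_ad by (elim imageE)
    have gN: "group (ad N)" using N.comm_group_ad by (simp add: comm_group_def)
    have "ad_map M N \<phi> (M.ab x \<triangleleft>\<^bsub>ad M\<^esub> r) = N.ab (\<phi> x) \<triangleleft>\<^bsub>ad N\<^esub> r"
      by (rule M.ad_hom_ract[OF gN hom x(2) N.ad_ract_hom])
        (simp_all add: x eq M.ract_closed \<phi>' N.ad_ract_of)
    then show ?thesis by (simp add: x eq)
  qed
  show "ad_map M N \<phi> \<in> op_hom (ad M) (ad N)"
    using hom ract by (simp add: op_hom_def) (simp add: ad_map_def)
qed

section \<open>Tensor products over the ring\<close>

locale tensor_factors = bimodule B + N: comm_group N
  for B :: "('b, 'r :: ring_1) bi_op_group" (structure) and N :: "('y, 'r) op_group" +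
  assumes N_ract_closed: "U \<in> carrier N \<Longrightarrow> U \<triangleleft>\<^bsub>N\<^esub> r \<in> carrier N"
begin

abbreviation "Z \<equiv> tensor_free N B"
abbreviation "rels \<equiv> tensor_rels N B"
abbreviation "cl z \<equiv> rels #>\<^bsub>Z\<^esub> z"

lemma Z_simps [simp]:
  "z \<in> carrier Z \<longleftrightarrow> Poly_Mapping.keys z \<subseteq> carrier N \<times> carrier B"
  "x \<otimes>\<^bsub>Z\<^esub> y = x + y" "\<one>\<^bsub>Z\<^esub> = 0"
  by (simp_all add: tensor_free_def)

lemma Z_comm_group: "comm_group Z"
  by (simp add: tensor_free_def abelian_free_Abelian_group)

lemma Z_inv: "z \<in> carrier Z \<Longrightarrow> inv\<^bsub>Z\<^esub> z = - z"
  by (simp add: tensor_free_def)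

definition gens where "gens =
    {frag_of (y \<otimes>\<^bsub>N\<^esub> y', b) - frag_of (y, b) - frag_of (y', b) | y y' b.
        y \<in> carrier N \<and> y' \<in> carrier N \<and> b \<in> carrier B}
     \<union> {frag_of (y, b \<otimes> b') - frag_of (y, b) - frag_of (y, b') | y b b'.
        y \<in> carrier N \<and> b \<in> carrier B \<and> b' \<in> carrier B}
     \<union> {frag_of (y \<triangleleft>\<^bsub>N\<^esub> r, b) - frag_of (y, r \<triangleright> b) | y r b.
        y \<in> carrier N \<and> b \<in> carrier B}"

lemma rels_eq: "rels = generate Z gens"
  by (simp add: tensor_rels_def gens_def)

lemma frag_of_Z: "y \<in> carrier N \<Longrightarrow> b \<in> carrier B \<Longrightarrow> Poly_Mapping.keys (frag_of (y, b)) \<subseteq> carrier N \<times> carrier B"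
  by simp

lemma gens_Z: "gens \<subseteq> carrier Z"
  unfolding gens_def
  by (intro Un_least subsetI; clarify; unfold Z_simps(1); intro keys_diff_subset frag_of_Z)
    (simp_all add: N_ract_closed lact_closed)

lemma rels_subgroup: "subgroup rels Z"
  unfolding rels_eq by (rule group.generate_is_subgroup[OF comm_group.axioms(2)[OF Z_comm_group] gens_Z])

lemma rels_Z: "z \<in> rels \<Longrightarrow> Poly_Mapping.keys z \<subseteq> carrier N \<times> carrier B"
  using subgroup.mem_carrier[OF rels_subgroup] by simp

lemma rels_0: "0 \<in> rels"
  using subgroup.one_closed[OF rels_subgroup] by simp

lemma rels_diff: "a \<in> rels \<Longrightarrow> b \<in> rels \<Longrightarrow> a - b \<in> rels"
  using subgroup.m_closed[OF rels_subgroup, of a "- b"] subgroup.m_inv_closed[OF rels_subgroup, of b]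
    Z_inv[OF subgroup.mem_carrier[OF rels_subgroup, of b]] by simp

lemma rels_1: "\<lbrakk>y \<in> carrier N; y' \<in> carrier N; b \<in> carrier B\<rbrakk>
    \<Longrightarrow> frag_of (y \<otimes>\<^bsub>N\<^esub> y', b) - frag_of (y, b) - frag_of (y', b) \<in> rels"
  and rels_2: "\<lbrakk>y \<in> carrier N; b \<in> carrier B; b' \<in> carrier B\<rbrakk>
    \<Longrightarrow> frag_of (y, b \<otimes> b') - frag_of (y, b) - frag_of (y, b') \<in> rels"
  and rels_3: "\<lbrakk>y \<in> carrier N; b \<in> carrier B\<rbrakk> \<Longrightarrow> frag_of (y \<triangleleft>\<^bsub>N\<^esub> r, b) - frag_of (y, r \<triangleright> b) \<in> rels"
  unfolding rels_eq by (rule generate.incl; unfold gens_def; blast)+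

text \<open>Additive maps on formal combinations descend to tensor products when they respect the
  three kinds of generating relations. It is applied to the scalar action and to the maps induced
  between tensor products.\<close>

lemma rels_image:
  assumes "z \<in> rels" and diff: "\<And>a b. \<phi> (a - b) = \<phi> a - (\<phi> b :: 'z::ab_group_add)"
    and K: "0 \<in> K" "\<And>a b. a \<in> K \<Longrightarrow> b \<in> K \<Longrightarrow> a - b \<in> K"
    and 1: "\<And>y y' b. \<lbrakk>y \<in> carrier N; y' \<in> carrier N; b \<in> carrier B\<rbrakk>
      \<Longrightarrow> \<phi> (frag_of (y \<otimes>\<^bsub>N\<^esub> y', b)) - \<phi> (frag_of (y, b)) - \<phi> (frag_of (y', b)) \<in> K"
    and 2: "\<And>y b b'. \<lbrakk>y \<in> carrier N; b \<in> carrier B; b' \<in> carrier B\<rbrakk>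
      \<Longrightarrow> \<phi> (frag_of (y, b \<otimes> b')) - \<phi> (frag_of (y, b)) - \<phi> (frag_of (y, b')) \<in> K"
    and 3: "\<And>y r b. \<lbrakk>y \<in> carrier N; b \<in> carrier B\<rbrakk> \<Longrightarrow> \<phi> (frag_of (y \<triangleleft>\<^bsub>N\<^esub> r, b)) - \<phi> (frag_of (y, r \<triangleright> b)) \<in> K"
  shows "\<phi> z \<in> K"
proof -
  have \<phi>0: "\<phi> 0 = 0" using diff[of 0 0] by simp
  have \<phi>m: "\<phi> (- a) = - \<phi> a" for a using diff[of 0 a] \<phi>0 by simp
  have \<phi>p: "\<phi> (a + b) = \<phi> a + \<phi> b" for a b using diff[of a "- b"] \<phi>m by simp
  have Km: "- a \<in> K" if "a \<in> K" for a using K(2)[OF K(1) that] by simp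
  have g: "\<phi> a \<in> K" if "a \<in> gens" for a
    using that 1 2 3 unfolding gens_def by (auto simp: diff)
  show ?thesis
    using assms(1) unfolding rels_eq
  proof (induction rule: generate.induct)
    case one
    then show ?case by (simp add: \<phi>0 K)
  next
    case (incl h)
    then show ?case by (rule g)
  next
    case (inv h)
    then have "inv\<^bsub>Z\<^esub> h = - h" using gens_Z by (intro Z_inv) blast
    then show ?case using Km[OF g[OF inv]] by (simp add: \<phi>m)
  next
    case (eng a b)
    then show ?case using K(2)[OF eng.IH(1) Km[OF eng.IH(2)]] by (simp add: \<phi>p)
  qed
qed

lemma rels_normal: "rels \<lhd> Z"
  using rels_subgroup comm_group.normal_iff_subgroup[OF Z_comm_group] by simp

lemma cl_def: "cl z = {h + z | h. h \<in> rels}"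
  by (auto simp: r_coset_def)

lemma cl_eq: "cl z = cl w \<longleftrightarrow> z - w \<in> rels"
proof
  assume "cl z = cl w"
  moreover have "z \<in> cl z" using rels_0 by (force simp: cl_def)
  ultimately have "z \<in> cl w" by simp
  then show "z - w \<in> rels" by (auto simp: cl_def)
next
  assume zw: "z - w \<in> rels"
  have "h + z \<in> cl w" if "h \<in> rels" for h
    using rels_diff[OF that rels_diff[OF rels_0 zw]] unfolding cl_def by (force simp: algebra_simps)
  moreover have "h + w \<in> cl z" if "h \<in> rels" for h
    using rels_diff[OF that zw] unfolding cl_def by (force simp: algebra_simps)
  ultimately show "cl z = cl w" by (auto simp: cl_def[of z] cl_def[of w])
qed

lemma tensor_simps:
  "carrier (tensor N B) = carrier (Z Mod rels)" "monoid.mult (tensor N B) = monoid.mult (Z Mod rels)"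
  "one (tensor N B) = one (Z Mod rels)"
  by (simp_all add: tensor_def)

lemma comm_group_tensor: "comm_group (tensor N B)"
  by (rule comm_group_cong[OF comm_group.abelian_FactGroup[OF Z_comm_group rels_subgroup]])
    (simp_all add: tensor_def)

lemma carrier_tensor: "carrier (tensor N B) = cl ` carrier Z"
  by (simp add: tensor_simps carrier_FactGroup)

lemma cl_closed: "Poly_Mapping.keys z \<subseteq> carrier N \<times> carrier B \<Longrightarrow> cl z \<in> carrier (tensor N B)"
  by (auto simp: carrier_tensor)

lemma cl_mult: "\<lbrakk>Poly_Mapping.keys z \<subseteq> carrier N \<times> carrier B; Poly_Mapping.keys w \<subseteq> carrier N \<times> carrier B\<rbrakk>
    \<Longrightarrow> cl z \<otimes>\<^bsub>tensor N B\<^esub> cl w = cl (z + w)"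
  using normal.rcos_sum[OF rels_normal, of z w] by (simp add: tensor_simps)

lemma cl_0: "\<one>\<^bsub>tensor N B\<^esub> = cl 0"
  by (simp add: tensor_simps cl_def)

lemma cl_inv: "Poly_Mapping.keys z \<subseteq> carrier N \<times> carrier B \<Longrightarrow> inv\<^bsub>tensor N B\<^esub> cl z = cl (- z)"
  by (rule group.inv_equality[OF comm_group.axioms(2)[OF comm_group_tensor]])
    (simp_all add: cl_mult cl_closed cl_0)

definition tact where "tact r = frag_extend (\<lambda>(y, b). frag_of (y, b \<triangleleft> r))"

lemma tact_diff: "tact r (a - b) = tact r a - tact r b"
  by (simp add: tact_def frag_extend_diff)

lemma tact_keys: "Poly_Mapping.keys z \<subseteq> carrier N \<times> carrier B \<Longrightarrow> Poly_Mapping.keys (tact r z) \<subseteq> carrier N \<times> carrier B"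
  unfolding tact_def by (rule keys_frag_extend_subset) (auto simp: ract_closed)

lemma tact_rels: "z \<in> rels \<Longrightarrow> tact r z \<in> rels"
  by (rule rels_image[OF _ tact_diff rels_0 rels_diff])
    (simp_all add: tact_def ract_mult ract_closed lact_closed lact_ract rels_1 rels_2 rels_3)

lemma tact_add:
  assumes "Poly_Mapping.keys z \<subseteq> carrier N \<times> carrier B"
  shows "tact (r + s) z - (tact r z + tact s z) \<in> rels"
proof -
  let ?d = "\<lambda>z. tact (r + s) z - (tact r z + tact s z)"
  show ?thesis using assms
  proof (induction rule: frag_induction)
    case (one yb)
    then show ?case by (auto simp: tact_def ract_add ract_closed rels_2 diff_diff_eq[symmetric])
  next
    case (diff a b)
    have "?d (a - b) = ?d a - ?d b" by (simp add: tact_diff)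
    then show ?case using rels_diff[OF diff] by simp
  qed (simp add: tact_def rels_0)
qed

lemma group_hom_tact: "group_hom Z Z (tact r)"
  unfolding group_hom_def group_hom_axioms_def
  using comm_group.axioms(2)[OF Z_comm_group] tact_keys
  by (auto simp: hom_def tact_def frag_extend_add)

lemma cl_ract:
  assumes z: "Poly_Mapping.keys z \<subseteq> carrier N \<times> carrier B"
  shows "cl z \<triangleleft>\<^bsub>tensor N B\<^esub> r = cl (tact r z)"
proof -
  have "(\<Union>w\<in>cl z. cl (tact r w)) = cl (tact r z)"
    by (rule quotient_map_coset[OF group_hom_tact rels_normal rels_normal]) (use z tact_rels in auto)
  then show ?thesis by (simp add: tensor_def tact_def)
qed

end

lemma tensor_map_cl:
  assumes "tensor_factors B N" "tensor_factors B N'"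
    and f: "f \<in> op_hom N N'" and z: "Poly_Mapping.keys z \<subseteq> carrier N \<times> carrier B"
  shows "tensor_map N' B f (tensor_rels N B #>\<^bsub>tensor_free N B\<^esub> z)
    = tensor_rels N' B #>\<^bsub>tensor_free N' B\<^esub> frag_extend (\<lambda>(x, b). frag_of (f x, b)) z"
    and "\<And>w. w \<in> tensor_rels N B \<Longrightarrow> frag_extend (\<lambda>(x, b). frag_of (f x, b)) w \<in> tensor_rels N' B"
    and "Poly_Mapping.keys (frag_extend (\<lambda>(x, b). frag_of (f x, b)) z) \<subseteq> carrier N' \<times> carrier B"
proof -
  interpret N: tensor_factors B N by fact
  interpret N': tensor_factors B N' by fact
  have f': "\<And>x y. \<lbrakk>x \<in> carrier N; y \<in> carrier N\<rbrakk> \<Longrightarrow> f (x \<otimes>\<^bsub>N\<^esub> y) = f x \<otimes>\<^bsub>N'\<^esub> f y"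
    "\<And>x. x \<in> carrier N \<Longrightarrow> f x \<in> carrier N'"
    "\<And>x r. x \<in> carrier N \<Longrightarrow> f (x \<triangleleft>\<^bsub>N\<^esub> r) = f x \<triangleleft>\<^bsub>N'\<^esub> r"
    using f by (auto simp: op_hom_def hom_def)
  let ?t = "frag_extend (\<lambda>(x, b). frag_of (f x, b)) :: _ \<Rightarrow> _ \<Rightarrow>\<^sub>0 int"
  show rels: "?t w \<in> N'.rels" if "w \<in> N.rels" for w
    by (rule N.rels_image[OF that frag_extend_diff N'.rels_0 N'.rels_diff])
      (simp_all add: f' N'.rels_1 N'.rels_2 N'.rels_3)
  have keys: "Poly_Mapping.keys (?t z) \<subseteq> carrier N' \<times> carrier B" if "Poly_Mapping.keys z \<subseteq> carrier N \<times> carrier B" for z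
    by (rule keys_frag_extend_subset[OF that]) (auto simp: f')
  show "Poly_Mapping.keys (?t z) \<subseteq> carrier N' \<times> carrier B" by (rule keys[OF z])
  have "group_hom N.Z N'.Z ?t"
    unfolding group_hom_def group_hom_axioms_def
    using comm_group.axioms(2)[OF N.Z_comm_group] comm_group.axioms(2)[OF N'.Z_comm_group] keys
    by (auto simp: hom_def frag_extend_add)
  from quotient_map_coset[OF this N.rels_normal N'.rels_normal, of z] rels z
  show "tensor_map N' B f (N.cl z) = N'.cl (?t z)" by (auto simp: tensor_map_def)
qed

section \<open>The cochain complex\<close>

locale cochain_complex =
  fixes C :: "('o, 'a, 'm) cat_scheme" and D :: "('o, 'a, 'd) bifunctor"
  assumes Dom_Ob: "\<alpha> \<in> Ar C \<Longrightarrow> Dom C \<alpha> \<in> Ob C"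
    and Cod_Ob: "\<alpha> \<in> Ar C \<Longrightarrow> Cod C \<alpha> \<in> Ob C"
    and Comp_Ar: "\<lbrakk>\<alpha> \<in> Ar C; \<beta> \<in> Ar C; Cod C \<beta> = Dom C \<alpha>\<rbrakk> \<Longrightarrow>
      Comp C \<alpha> \<beta> \<in> Ar C \<and> Dom C (Comp C \<alpha> \<beta>) = Dom C \<beta> \<and> Cod C (Comp C \<alpha> \<beta>) = Cod C \<alpha>"
    and val_comm_group: "\<lbrakk>M \<in> Ob C; N \<in> Ob C\<rbrakk> \<Longrightarrow> comm_group (val D M N)"
    and push_hom: "\<lbrakk>\<alpha> \<in> Ar C; M \<in> Ob C\<rbrakk> \<Longrightarrow> push D M \<alpha> \<in> hom (val D M (Dom C \<alpha>)) (val D M (Cod C \<alpha>))"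
    and pull_hom: "\<lbrakk>\<alpha> \<in> Ar C; N \<in> Ob C\<rbrakk> \<Longrightarrow> pull D \<alpha> N \<in> hom (val D (Cod C \<alpha>) N) (val D (Dom C \<alpha>) N)"
begin

lemma is_chain_Ob: "is_chain C c \<alpha>s c' \<Longrightarrow> c \<in> Ob C \<and> c' \<in> Ob C"
  by (induction \<alpha>s arbitrary: c) (auto simp: Cod_Ob)

lemma is_chain_append:
  "is_chain C c (xs @ ys) c' \<longleftrightarrow> (\<exists>d. is_chain C c xs d \<and> is_chain C d ys c')"
  by (induction xs arbitrary: c) (auto dest: is_chain_Ob)

lemma comp_at_chain:
  assumes "is_chain C c \<alpha>s c'" "length \<alpha>s = Suc n" "i \<in> {1..n}"
  shows "is_chain C c (comp_at C i \<alpha>s) c' \<and> length (comp_at C i \<alpha>s) = n"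
proof -
  \<comment> \<open>Positions in a chain count from 1, so the composed arrows are the list entries
    \<open>i - 1\<close> and \<open>i\<close>.\<close>
  have "\<alpha>s = take (i - 1) \<alpha>s @ drop (i - 1) \<alpha>s" by simp
  also have "drop (i - 1) \<alpha>s = \<alpha>s ! (i - 1) # drop i \<alpha>s"
    using assms(2,3) Cons_nth_drop_Suc[of "i - 1" \<alpha>s] by (cases i) auto
  also have "drop i \<alpha>s = \<alpha>s ! i # drop (i + 1) \<alpha>s"
    using assms(2,3) Cons_nth_drop_Suc[of i \<alpha>s] by simp
  finally have eq: "\<alpha>s = take (i - 1) \<alpha>s @ \<alpha>s ! (i - 1) # \<alpha>s ! i # drop (i + 1) \<alpha>s" .
  obtain d where "is_chain C c (take (i - 1) \<alpha>s) d"
      "is_chain C d (\<alpha>s ! (i - 1) # \<alpha>s ! i # drop (i + 1) \<alpha>s) c'"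
    using assms(1) unfolding eq[THEN arg_cong, of "\<lambda>xs. is_chain C c xs c'"] is_chain_append by blast
  then have "is_chain C c (comp_at C i \<alpha>s) c'"
    unfolding comp_at_def is_chain_append using Comp_Ar[of "\<alpha>s ! (i - 1)" "\<alpha>s ! i"] by (auto simp: Dom_Ob)
  then show ?thesis using assms(2,3) by (auto simp: comp_at_def)
qed

definition term_at :: "nat \<Rightarrow> ('o \<times> 'a list \<times> 'o \<Rightarrow> 'd) \<Rightarrow> 'o \<Rightarrow> 'a list \<Rightarrow> 'o \<Rightarrow> 'd"
  where "term_at n f c \<alpha>s c' =
        push D c' (hd \<alpha>s) (f (Dom C (hd \<alpha>s), tl \<alpha>s, c'))
        \<otimes>\<^bsub>val D c' c\<^esub>
        (\<Otimes>\<^bsub>val D c' c\<^esub>i \<in> {1..n}. f (c, comp_at C i \<alpha>s, c') [^]\<^bsub>val D c' c\<^esub> ((-1) ^ i :: int))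
        \<otimes>\<^bsub>val D c' c\<^esub>
        pull D (last \<alpha>s) c (f (c, butlast \<alpha>s, Cod C (last \<alpha>s))) [^]\<^bsub>val D c' c\<^esub> ((-1) ^ (n + 1) :: int)"

lemma coboundary_eq: "coboundary C D n f = (\<lambda>(c, \<alpha>s, c') \<in> chains C (Suc n). term_at n f c \<alpha>s c')"
  by (simp add: coboundary_def term_at_def)

lemma chain_parts:
  assumes ch: "is_chain C c \<alpha>s c'" "length \<alpha>s = Suc n" and f: "f \<in> carrier (cochains C D n)"
  shows "push D c' (hd \<alpha>s) (f (Dom C (hd \<alpha>s), tl \<alpha>s, c')) \<in> carrier (val D c' c)"
    and "i \<in> {1..n} \<Longrightarrow> f (c, comp_at C i \<alpha>s, c') \<in> carrier (val D c' c)"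
    and "pull D (last \<alpha>s) c (f (c, butlast \<alpha>s, Cod C (last \<alpha>s))) \<in> carrier (val D c' c)"
    and "f (Dom C (hd \<alpha>s), tl \<alpha>s, c') \<in> carrier (val D c' (Dom C (hd \<alpha>s)))"
    and "f (c, butlast \<alpha>s, Cod C (last \<alpha>s)) \<in> carrier (val D (Cod C (last \<alpha>s)) c)"
    and "hd \<alpha>s \<in> Ar C" "Cod C (hd \<alpha>s) = c" "last \<alpha>s \<in> Ar C" "Dom C (last \<alpha>s) = c'" "c \<in> Ob C" "c' \<in> Ob C"
proof -
  have fc: "f (d, \<beta>s, d') \<in> carrier (val D d' d)" if "is_chain C d \<beta>s d'" "length \<beta>s = n" for d \<beta>s d'
    using f that by (auto simp: cochains_def chains_def PiE_iff)
  have ne: "\<alpha>s \<noteq> []" using ch(2) by auto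
  have hd: "hd \<alpha>s \<in> Ar C" "Cod C (hd \<alpha>s) = c" "is_chain C (Dom C (hd \<alpha>s)) (tl \<alpha>s) c'"
    using ch(1) ne by (cases \<alpha>s; simp)+
  have "is_chain C c (butlast \<alpha>s @ [last \<alpha>s]) c'" using ch(1) ne by simp
  then have last: "last \<alpha>s \<in> Ar C" "Dom C (last \<alpha>s) = c'" "is_chain C c (butlast \<alpha>s) (Cod C (last \<alpha>s))"
    unfolding is_chain_append by auto
  show "hd \<alpha>s \<in> Ar C" "Cod C (hd \<alpha>s) = c" "last \<alpha>s \<in> Ar C" "Dom C (last \<alpha>s) = c'" by (fact hd last)+
  show Ob: "c \<in> Ob C" "c' \<in> Ob C" using is_chain_Ob[OF ch(1)] by auto
  show f1: "f (Dom C (hd \<alpha>s), tl \<alpha>s, c') \<in> carrier (val D c' (Dom C (hd \<alpha>s)))"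
    by (rule fc[OF hd(3)]) (use ch(2) in simp)
  show f2: "f (c, butlast \<alpha>s, Cod C (last \<alpha>s)) \<in> carrier (val D (Cod C (last \<alpha>s)) c)"
    by (rule fc[OF last(3)]) (use ch(2) in simp)
  show "push D c' (hd \<alpha>s) (f (Dom C (hd \<alpha>s), tl \<alpha>s, c')) \<in> carrier (val D c' c)"
    using hom_in_carrier[OF push_hom[OF hd(1) Ob(2)] f1] hd(2) by simp
  show "pull D (last \<alpha>s) c (f (c, butlast \<alpha>s, Cod C (last \<alpha>s))) \<in> carrier (val D c' c)"
    using hom_in_carrier[OF pull_hom[OF last(1) Ob(1)] f2] last(2) by simp
  show "f (c, comp_at C i \<alpha>s, c') \<in> carrier (val D c' c)" if "i \<in> {1..n}"
    using comp_at_chain[OF ch that] by (intro fc) auto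
qed

lemma term_at_closed:
  assumes ch: "is_chain C c \<alpha>s c'" "length \<alpha>s = Suc n" and f: "f \<in> carrier (cochains C D n)"
  shows "term_at n f c \<alpha>s c' \<in> carrier (val D c' c)"
proof -
  note parts = chain_parts[OF ch f]
  interpret V: comm_group "val D c' c" by (rule val_comm_group[OF parts(11,10)])
  show ?thesis unfolding term_at_def using parts(1-3)
    by (intro V.m_closed V.finprod_closed V.int_pow_closed Pi_I) auto
qed

lemma cochains_group: "group (cochains C D n)"
  unfolding cochains_def
proof (rule product_group, clarify)
  fix c \<alpha>s c' assume "(c, \<alpha>s, c') \<in> chains C n"
  then have "c \<in> Ob C" "c' \<in> Ob C" using is_chain_Ob by (auto simp: chains_def)
  then show "group (val D c' c)" using val_comm_group by (simp add: comm_group_def)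
qed

text \<open>The coboundary is a product of homomorphisms, which in an abelian group is one again.
  Cocycles, being its kernel, therefore form a subgroup, so that cohomology is a quotient of
  groups.\<close>

lemma coboundary_hom: "coboundary C D n \<in> hom (cochains C D n) (cochains C D (Suc n))"
proof (rule homI)
  fix f assume f: "f \<in> carrier (cochains C D n)"
  then show "coboundary C D n f \<in> carrier (cochains C D (Suc n))"
    by (auto simp: coboundary_eq cochains_def[of _ _ "Suc n"] chains_def term_at_closed)
next
  fix f g assume f: "f \<in> carrier (cochains C D n)" and g: "g \<in> carrier (cochains C D n)"
  let ?fg = "f \<otimes>\<^bsub>cochains C D n\<^esub> g"
  have fg: "?fg \<in> carrier (cochains C D n)"
    using f g by (rule monoid.m_closed[OF group.is_monoid[OF cochains_group]])
  have fg_at: "?fg (c, \<alpha>s, c') = f (c, \<alpha>s, c') \<otimes>\<^bsub>val D c' c\<^esub> g (c, \<alpha>s, c')"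
    if "is_chain C c \<alpha>s c'" "length \<alpha>s = n" for c \<alpha>s c'
    using that by (simp add: cochains_def chains_def)
  have "term_at n ?fg c \<alpha>s c' = term_at n f c \<alpha>s c' \<otimes>\<^bsub>val D c' c\<^esub> term_at n g c \<alpha>s c'"
    if ch: "is_chain C c \<alpha>s c'" "length \<alpha>s = Suc n" for c \<alpha>s c'
  proof -
    note pf = chain_parts[OF ch f] and pg = chain_parts[OF ch g]
    interpret V: comm_group "val D c' c" by (rule val_comm_group[OF pf(11,10)])
    have ne: "\<alpha>s \<noteq> []" using ch(2) by auto
    have "is_chain C (Dom C (hd \<alpha>s)) (tl \<alpha>s) c'" using ch(1) ne by (cases \<alpha>s) auto
    then have "?fg (Dom C (hd \<alpha>s), tl \<alpha>s, c') = f (Dom C (hd \<alpha>s), tl \<alpha>s, c') \<otimes>\<^bsub>val D c' (Dom C (hd \<alpha>s))\<^esub> g (Dom C (hd \<alpha>s), tl \<alpha>s, c')"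
      using ch(2) by (intro fg_at) auto
    then have 1: "push D c' (hd \<alpha>s) (?fg (Dom C (hd \<alpha>s), tl \<alpha>s, c'))
      = push D c' (hd \<alpha>s) (f (Dom C (hd \<alpha>s), tl \<alpha>s, c')) \<otimes>\<^bsub>val D c' c\<^esub> push D c' (hd \<alpha>s) (g (Dom C (hd \<alpha>s), tl \<alpha>s, c'))"
      using hom_mult[OF push_hom[OF pf(6,11)] pf(4) pg(4)] pf(7) by simp
    have "is_chain C c (butlast \<alpha>s @ [last \<alpha>s]) c'" using ch(1) ne by simp
    then have "is_chain C c (butlast \<alpha>s) (Cod C (last \<alpha>s))" unfolding is_chain_append by auto
    then have "?fg (c, butlast \<alpha>s, Cod C (last \<alpha>s)) = f (c, butlast \<alpha>s, Cod C (last \<alpha>s)) \<otimes>\<^bsub>val D (Cod C (last \<alpha>s)) c\<^esub> g (c, butlast \<alpha>s, Cod C (last \<alpha>s))"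
      using ch(2) by (intro fg_at) auto
    then have 3: "pull D (last \<alpha>s) c (?fg (c, butlast \<alpha>s, Cod C (last \<alpha>s)))
      = pull D (last \<alpha>s) c (f (c, butlast \<alpha>s, Cod C (last \<alpha>s))) \<otimes>\<^bsub>val D c' c\<^esub> pull D (last \<alpha>s) c (g (c, butlast \<alpha>s, Cod C (last \<alpha>s)))"
      using hom_mult[OF pull_hom[OF pf(8,10)] pf(5) pg(5)] pf(9) by simp
    have "(\<Otimes>\<^bsub>val D c' c\<^esub>i \<in> {1..n}. ?fg (c, comp_at C i \<alpha>s, c') [^]\<^bsub>val D c' c\<^esub> ((-1) ^ i :: int))
      = (\<Otimes>\<^bsub>val D c' c\<^esub>i \<in> {1..n}. f (c, comp_at C i \<alpha>s, c') [^]\<^bsub>val D c' c\<^esub> ((-1) ^ i :: int)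
          \<otimes>\<^bsub>val D c' c\<^esub> g (c, comp_at C i \<alpha>s, c') [^]\<^bsub>val D c' c\<^esub> ((-1) ^ i :: int))"
    proof (rule V.finprod_cong')
      fix i assume i: "i \<in> {1..n}"
      show "?fg (c, comp_at C i \<alpha>s, c') [^]\<^bsub>val D c' c\<^esub> ((-1) ^ i :: int)
        = f (c, comp_at C i \<alpha>s, c') [^]\<^bsub>val D c' c\<^esub> ((-1) ^ i :: int)
          \<otimes>\<^bsub>val D c' c\<^esub> g (c, comp_at C i \<alpha>s, c') [^]\<^bsub>val D c' c\<^esub> ((-1) ^ i :: int)"
        using fg_at[of c "comp_at C i \<alpha>s" c'] comp_at_chain[OF ch i] pf(2)[OF i] pg(2)[OF i]
        by (simp add: V.int_pow_distrib)
    qed (use pf(2) pg(2) in \<open>auto intro!: V.m_closed V.int_pow_closed\<close>)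
    also have "\<dots> = (\<Otimes>\<^bsub>val D c' c\<^esub>i \<in> {1..n}. f (c, comp_at C i \<alpha>s, c') [^]\<^bsub>val D c' c\<^esub> ((-1) ^ i :: int))
      \<otimes>\<^bsub>val D c' c\<^esub> (\<Otimes>\<^bsub>val D c' c\<^esub>i \<in> {1..n}. g (c, comp_at C i \<alpha>s, c') [^]\<^bsub>val D c' c\<^esub> ((-1) ^ i :: int))"
      using pf(2) pg(2) by (intro V.finprod_multf) auto
    finally have 2: "(\<Otimes>\<^bsub>val D c' c\<^esub>i \<in> {1..n}. ?fg (c, comp_at C i \<alpha>s, c') [^]\<^bsub>val D c' c\<^esub> ((-1) ^ i :: int))
      = (\<Otimes>\<^bsub>val D c' c\<^esub>i \<in> {1..n}. f (c, comp_at C i \<alpha>s, c') [^]\<^bsub>val D c' c\<^esub> ((-1) ^ i :: int))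
      \<otimes>\<^bsub>val D c' c\<^esub> (\<Otimes>\<^bsub>val D c' c\<^esub>i \<in> {1..n}. g (c, comp_at C i \<alpha>s, c') [^]\<^bsub>val D c' c\<^esub> ((-1) ^ i :: int))" .
    have fin: "(\<Otimes>\<^bsub>val D c' c\<^esub>i \<in> {1..n}. f (c, comp_at C i \<alpha>s, c') [^]\<^bsub>val D c' c\<^esub> ((-1) ^ i :: int)) \<in> carrier (val D c' c)"
      "(\<Otimes>\<^bsub>val D c' c\<^esub>i \<in> {1..n}. g (c, comp_at C i \<alpha>s, c') [^]\<^bsub>val D c' c\<^esub> ((-1) ^ i :: int)) \<in> carrier (val D c' c)"
      using pf(2) pg(2) by (intro V.finprod_closed; auto)+
    show ?thesis
      unfolding term_at_def 1 2 3 V.int_pow_distrib[OF pf(3) pg(3)]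
      using pf(1,3) pg(1,3) fin by (simp add: V.m_ac)
  qed
  then show "coboundary C D n ?fg = coboundary C D n f \<otimes>\<^bsub>cochains C D (Suc n)\<^esub> coboundary C D n g"
    by (auto simp: coboundary_eq cochains_def[of _ _ "Suc n"] chains_def intro!: restrict_ext)
qed

lemma trivial_cohomology:
  assumes "coboundaries C D n = cocycles C D n"
  shows "trivial_group (cohomology C D n)"
proof -
  interpret d: group_hom "cochains C D n" "cochains C D (Suc n)" "coboundary C D n"
    by (simp add: group_hom_def group_hom_axioms_def cochains_group coboundary_hom)
  let ?G = "(cochains C D n)\<lparr>carrier := cocycles C D n\<rparr>"
  have "subgroup (cocycles C D n) (cochains C D n)"
    unfolding cocycles_def by (rule d.subgroup_kernel)
  then interpret G: group ?G by (rule group.subgroup_imp_group[OF cochains_group])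
  have n: "carrier ?G \<lhd> ?G" by (rule G.normal_self)
  have eq: "cohomology C D n = ?G Mod carrier ?G" by (simp add: cohomology_def assms)
  interpret Q: group "?G Mod carrier ?G" by (rule normal.factorgroup_is_group[OF n])
  have "carrier ?G #>\<^bsub>?G\<^esub> x = carrier ?G" if "x \<in> carrier ?G" for x
    by (rule subgroup.rcos_const[OF G.subgroup_self G.is_group that])
  then have "carrier (?G Mod carrier ?G) \<subseteq> {\<one>\<^bsub>?G Mod carrier ?G\<^esub>}"
    unfolding carrier_FactGroup one_FactGroup by blast
  then show ?thesis unfolding eq by (simp only: Q.trivial_group_subset)
qed

end

section \<open>The coefficient bifunctor\<close>

interpretation nil_mod: nil_module "free_nil_module n" for n
  by (rule nil_module_free_nil_module)

abbreviation ab_class :: "nat \<Rightarrow> (nat \<times> 'l::monoid_add) word set \<Rightarrow> (nat \<times> 'l) word set set"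
  where "ab_class n x \<equiv> commutator_subgroup (free_nil_module n) #>\<^bsub>free_nil_module n\<^esub> x"

lemma carrier_q_ob: "carrier (q_ob n) = ab_class n ` carrier (free_nil_module n)"
  unfolding q_ob_def by (rule nil_mod.carrier_ad)

lemma ab_class_q_ob [simp]: "x \<in> carrier (free_nil_module n) \<Longrightarrow> ab_class n x \<in> carrier (q_ob n)"
  by (auto simp: carrier_q_ob)

lemma ab_class_mult: "\<lbrakk>x \<in> carrier (free_nil_module n); y \<in> carrier (free_nil_module n)\<rbrakk> \<Longrightarrow>
    ab_class n (x \<otimes>\<^bsub>free_nil_module n\<^esub> y) = ab_class n x \<otimes>\<^bsub>q_ob n\<^esub> ab_class n y"
  unfolding q_ob_def by (rule nil_mod.ab_mult[symmetric])

abbreviation ad_arrow :: "'l::monoid_add mod_Q_arrow \<Rightarrow> (nat \<times> 'l) word set set \<Rightarrow> (nat \<times> 'l) word set set"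
  where "ad_arrow \<alpha> \<equiv> ad_map (free_nil_module (Dom mod_Q \<alpha>)) (free_nil_module (Cod mod_Q \<alpha>)) (app \<alpha>)"

lemma ad_arrow_class: "\<lbrakk>\<alpha> \<in> arrows m n; x \<in> carrier (free_nil_module n)\<rbrakk> \<Longrightarrow> ad_arrow \<alpha> (ab_class n x) = ab_class m (app \<alpha> x)"
  using ad_map(1)[OF nil_module_free_nil_module nil_module_free_nil_module app_op_hom] by simp

lemma ad_arrow_op_hom: "\<alpha> \<in> arrows m n \<Longrightarrow> ad_arrow \<alpha> \<in> op_hom (q_ob n) (q_ob m)"
  using ad_map(2)[OF nil_module_free_nil_module nil_module_free_nil_module app_op_hom] by (simp add: q_ob_def)

lemma ad_arrow_closed: "\<lbrakk>\<alpha> \<in> arrows m n; U \<in> carrier (q_ob n)\<rbrakk> \<Longrightarrow> ad_arrow \<alpha> U \<in> carrier (q_ob m)"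
  using ad_arrow_op_hom by (fastforce simp: op_hom_def hom_def)

lemma ad_arrow_comp:
  assumes "\<alpha> \<in> arrows m n" "\<beta> \<in> arrows n k" "U \<in> carrier (q_ob k)"
  shows "ad_arrow (\<alpha> \<odot> \<beta>) U = ad_arrow \<alpha> (ad_arrow \<beta> U)"
proof -
  obtain x where x: "U = ab_class k x" "x \<in> carrier (free_nil_module k)"
    using assms(3) unfolding carrier_q_ob by (elim imageE)
  show ?thesis unfolding x(1)
    by (simp only: ad_arrow_class[OF comp_Q_arrows[OF assms(1,2)] x(2)] ad_arrow_class[OF assms(2) x(2)]
        ad_arrow_class[OF assms(1) app_closed[OF assms(2) x(2)]] app_comp[OF assms(1,2) x(2)])
qed

locale mac_lane_coefficients =
  fixes B :: "('b, 'l::monoid_add monoid_ring) bi_op_group" and S :: "'l set"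
  assumes bimodule: "bimodule B" and free_S: "free_monoid_on S"
begin

sublocale Q: tensor_factors B "q_ob n" for n
proof -
  interpret bimodule B by (rule bimodule)
  interpret N: comm_group "q_ob n :: ((nat \<times> 'l) word set set, 'l monoid_ring) op_group"
    unfolding q_ob_def by (rule nil_mod.comm_group_ad)
  show "tensor_factors B (q_ob n)"
    by unfold_locales (simp add: q_ob_def nil_mod.ad_ract_closed)
qed

abbreviation supp :: "nat \<Rightarrow> ((nat \<times> 'l) word set set \<times> 'b) set"
  where "supp n \<equiv> carrier (q_ob n) \<times> carrier B"

text \<open>Extended by zero outside the support, so that additivity and functoriality hold on the
  whole type of formal combinations, as \<open>additive_functor\<close> demands.\<close>

definition T :: "'l mod_Q_arrow \<Rightarrow> ((nat \<times> 'l) word set set \<times> 'b \<Rightarrow>\<^sub>0 int) \<Rightarrow> (nat \<times> 'l) word set set \<times> 'b \<Rightarrow>\<^sub>0 int"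
  where "T \<alpha> = frag_extend (\<lambda>(U, b). if U \<in> carrier (q_ob (Dom mod_Q \<alpha>)) \<and> b \<in> carrier B
    then frag_of (ad_arrow \<alpha> U, b) else 0)"

text \<open>Only the second component is tested, since \<open>act s\<close> has to be the same
  function for all ranks n.\<close>

definition act :: "'l \<Rightarrow> ((nat \<times> 'l) word set set \<times> 'b \<Rightarrow>\<^sub>0 int) \<Rightarrow> (nat \<times> 'l) word set set \<times> 'b \<Rightarrow>\<^sub>0 int"
  where "act s = frag_extend (\<lambda>(U, b). if b \<in> carrier B then frag_of (U, b \<triangleleft>\<^bsub>B\<^esub> frag_of s) else 0)"

lemma T_on_supp:
  "\<lbrakk>\<alpha> \<in> arrows m n; Poly_Mapping.keys z \<subseteq> supp n\<rbrakk> \<Longrightarrow> T \<alpha> z = frag_extend (\<lambda>(U, b). frag_of (ad_arrow \<alpha> U, b)) z"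
  unfolding T_def by (rule frag_extend_eq) auto

lemma act_on_supp: "Poly_Mapping.keys z \<subseteq> supp n \<Longrightarrow> act s z = Q.tact (frag_of s) z"
  unfolding act_def Q.tact_def by (rule frag_extend_eq) auto

lemma T_supp:
  assumes "\<alpha> \<in> arrows m n" shows "Poly_Mapping.keys (T \<alpha> z) \<subseteq> supp m"
  unfolding T_def
  by (rule keys_frag_extend_subset[of _ UNIV]) (use ad_arrow_closed[OF assms] assms in \<open>auto split: if_splits\<close>)

lemma frag_univ_induct:
  assumes "P 0" "\<And>x. P (frag_of x)" "\<And>a b. \<lbrakk>P a; P b\<rbrakk> \<Longrightarrow> P (a - b)" shows "P (z :: 'z \<Rightarrow>\<^sub>0 int)"
proof -
  have "Poly_Mapping.keys z \<subseteq> UNIV" by simp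
  then show ?thesis by (induction rule: frag_induction) (use assms in auto)
qed

lemma class_additive:
  assumes x: "x \<in> carrier (free_nil_module n)" "y \<in> carrier (free_nil_module n)" and b: "b \<in> carrier B"
  shows "frag_of (ab_class n (x \<otimes>\<^bsub>free_nil_module n\<^esub> y), b) - frag_of (ab_class n x, b) - frag_of (ab_class n y, b)
    \<in> tensor_rels (q_ob n) B"
  using Q.rels_1[of "ab_class n x" n "ab_class n y" b] x b by (simp add: ab_class_mult)

text \<open>The difference \<psi> is additive in x modulo the relations, so basis elements suffice.
  On the basis element (i, s) the summand for j = i is everything, and the others are the class of
  the unit tensored with b, which is zero.\<close>

lemma T_splits_class:
  fixes m k :: nat
  assumes \<alpha>: "\<alpha> \<in> arrows m k" and x: "x \<in> carrier (free_nil_module k)" and b: "b \<in> carrier B"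
  shows "frag_of (ab_class m (app \<alpha> x), b) - (\<Sum>j<k. frag_of (ab_class m (app (\<alpha> \<odot> proj_arrow k j) x), b))
    \<in> tensor_rels (q_ob m) B"
proof -
  let ?R = "tensor_rels (q_ob m) B :: ((nat \<times> 'l) word set set \<times> 'b \<Rightarrow>\<^sub>0 int) set"
  let ?p = "\<lambda>y. frag_of (ab_class m y, b) :: (nat \<times> 'l) word set set \<times> 'b \<Rightarrow>\<^sub>0 int"
  let ?\<alpha> = "\<lambda>j. \<alpha> \<odot> proj_arrow k j"
  have \<alpha>j: "?\<alpha> j \<in> arrows m k" for j by (rule comp_Q_arrows[OF \<alpha> proj_arrow])
  define \<psi> where "\<psi> x = ?p (app \<alpha> x) - (\<Sum>j<k. ?p (app (?\<alpha> j) x))" for x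
  have R_add: "a + c \<in> ?R" if "a \<in> ?R" "c \<in> ?R" for a c
    using Q.rels_diff[OF that(1) Q.rels_diff[OF Q.rels_0 that(2)]] by simp
  have R_sum: "sum f I \<in> ?R" if "\<And>j. j \<in> I \<Longrightarrow> f j \<in> ?R" for f and I :: "nat set"
    using that by (induction I rule: infinite_finite_induct) (auto intro: R_add Q.rels_0)
  have \<psi>_mult: "\<psi> (x \<otimes>\<^bsub>free_nil_module k\<^esub> y) - \<psi> x - \<psi> y \<in> ?R"
    if xy: "x \<in> carrier (free_nil_module k)" "y \<in> carrier (free_nil_module k)" for x y
  proof -
    have *: "?p (app \<beta> (x \<otimes>\<^bsub>free_nil_module k\<^esub> y)) - ?p (app \<beta> x) - ?p (app \<beta> y) \<in> ?R" if "\<beta> \<in> arrows m k" for \<beta>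
      using class_additive[OF app_closed[OF that xy(1)] app_closed[OF that xy(2)] b] by (simp add: app_mult[OF that xy])
    have "(?p (app \<alpha> (x \<otimes>\<^bsub>free_nil_module k\<^esub> y)) - ?p (app \<alpha> x) - ?p (app \<alpha> y))
      - (\<Sum>j<k. ?p (app (?\<alpha> j) (x \<otimes>\<^bsub>free_nil_module k\<^esub> y)) - ?p (app (?\<alpha> j) x) - ?p (app (?\<alpha> j) y)) \<in> ?R"
      by (intro Q.rels_diff * \<alpha> R_sum \<alpha>j)
    then show ?thesis by (simp add: \<psi>_def sum_subtractf sum.distrib algebra_simps)
  qed
  have \<psi>_one: "\<psi> \<one>\<^bsub>free_nil_module k\<^esub> \<in> ?R"
    using Q.rels_diff[OF Q.rels_0 \<psi>_mult[of "\<one>\<^bsub>free_nil_module k\<^esub>" "\<one>\<^bsub>free_nil_module k\<^esub>"]] by simp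
  have p1: "?p \<one>\<^bsub>free_nil_module m\<^esub> \<in> ?R"
    using Q.rels_diff[OF Q.rels_0 class_additive[of "\<one>\<^bsub>free_nil_module m\<^esub>" m "\<one>\<^bsub>free_nil_module m\<^esub>", OF _ _ b]] by simp
  have "\<psi> x \<in> ?R" using x
  proof (induction rule: free_nil_module_induct)
    case one
    show ?case by (rule \<psi>_one)
  next
    case (basis i s)
    have \<alpha>j_basis: "app (?\<alpha> j) (nil_basis k i s) = (if i = j then app \<alpha> (nil_basis k i s) else \<one>\<^bsub>free_nil_module m\<^esub>)" for j
      using basis by (simp add: app_comp[OF \<alpha> proj_arrow] app_proj_arrow app_one[OF \<alpha>])
    then have "(\<Sum>j<k. ?p (app (?\<alpha> j) (nil_basis k i s)))
       = ?p (app \<alpha> (nil_basis k i s)) + (\<Sum>j\<in>{..<k} - {i}. ?p (app (?\<alpha> j) (nil_basis k i s)))"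
      using basis by (subst sum.remove[of _ i]) simp_all
    moreover have "(\<Sum>j\<in>{..<k} - {i}. ?p (app (?\<alpha> j) (nil_basis k i s))) \<in> ?R"
      using \<alpha>j_basis p1 by (intro R_sum) simp
    ultimately show ?case using Q.rels_diff[OF Q.rels_0] by (simp add: \<psi>_def)
  next
    case (mult x y)
    then show ?case using R_add[OF R_add[OF \<psi>_mult[OF mult(1,2)] mult(3)] mult(4)] by simp
  next
    case (inv x)
    have "\<psi> \<one>\<^bsub>free_nil_module k\<^esub> - \<psi> x - \<psi> (inv\<^bsub>free_nil_module k\<^esub> x) \<in> ?R"
      using \<psi>_mult[of x "inv\<^bsub>free_nil_module k\<^esub> x"] inv(1) by simp
    from Q.rels_diff[OF Q.rels_diff[OF \<psi>_one this] inv(2)] show ?case by simp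
  qed
  then show ?thesis by (simp add: \<psi>_def)
qed

sublocale additive_functor_with_action "\<lambda>n. tensor_rels (q_ob n) B" T act S
proof unfold_locales
  fix \<alpha> \<beta> :: "'l mod_Q_arrow" and m n k :: nat and s :: 'l and a b :: "(nat \<times> 'l) word set set \<times> 'b \<Rightarrow>\<^sub>0 int"
  show "0 \<in> tensor_rels (q_ob n) B" by (rule Q.rels_0)
  show "a - b \<in> tensor_rels (q_ob n) B" if "a \<in> tensor_rels (q_ob n) B" "b \<in> tensor_rels (q_ob n) B"
    using that by (rule Q.rels_diff)
  show "T \<alpha> (a - b) = T \<alpha> a - T \<alpha> b" by (simp add: T_def frag_extend_diff)
  show "act s (a - b) = act s a - act s b" by (simp add: act_def frag_extend_diff)
  show "T \<alpha> a \<in> tensor_rels (q_ob m) B" if \<alpha>: "\<alpha> \<in> arrows m n" and a: "a \<in> tensor_rels (q_ob n) B"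
    using tensor_map_cl(2)[OF Q.tensor_factors_axioms Q.tensor_factors_axioms ad_arrow_op_hom[OF \<alpha>] Q.rels_Z[OF a] a]
    by (simp add: T_on_supp[OF \<alpha> Q.rels_Z[OF a]])
  show "act s a \<in> tensor_rels (q_ob n) B" if a: "a \<in> tensor_rels (q_ob n) B"
    using Q.tact_rels[OF a] by (simp add: act_on_supp[OF Q.rels_Z[OF a]])
  show "T (\<alpha> \<odot> \<beta>) a = T \<alpha> (T \<beta> a)" if \<alpha>: "\<alpha> \<in> arrows m n" and \<beta>: "\<beta> \<in> arrows n k"
  proof (induction a rule: frag_univ_induct)
    case (2 x)
    show ?case using \<alpha> \<beta> comp_Q_arrows[OF \<alpha> \<beta>] ad_arrow_comp[OF \<alpha> \<beta>] ad_arrow_closed[OF \<beta>]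
      by (cases x) (simp add: T_def)
  qed (simp_all add: T_def frag_extend_diff)
  show "T \<alpha> (act s a) = act s (T \<alpha> a)" if \<alpha>: "\<alpha> \<in> arrows m n"
  proof (induction a rule: frag_univ_induct)
    case (2 x)
    then show ?case by (cases x) (simp add: T_def act_def Q.ract_closed)
  qed (simp_all add: T_def act_def frag_extend_diff)
  show "T \<alpha> a - (\<Sum>j<k. T (\<alpha> \<odot> proj_arrow k j) a) \<in> tensor_rels (q_ob m) B" if \<alpha>: "\<alpha> \<in> arrows m k"
  proof (induction a rule: frag_univ_induct)
    case 1
    show ?case by (simp add: T_def Q.rels_0)
  next
    case (2 x)
    have \<alpha>j: "\<alpha> \<odot> proj_arrow k j \<in> arrows m k" for j by (rule comp_Q_arrows[OF \<alpha> proj_arrow])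
    obtain U b where x: "x = (U, b)" by fastforce
    show ?case
    proof (cases "U \<in> carrier (q_ob k) \<and> b \<in> carrier B")
      case True
      then obtain y where y: "U = ab_class k y" "y \<in> carrier (free_nil_module k)" unfolding carrier_q_ob by (elim conjE imageE)
      have "T \<beta> (frag_of x) = frag_of (ab_class m (app \<beta> y), b)" if "\<beta> \<in> arrows m k" for \<beta>
        using True ad_arrow_class[OF that y(2)] that by (simp add: T_def x y(1))
      then show ?thesis using T_splits_class[OF \<alpha> y(2)] True \<alpha> \<alpha>j by simp
    next
      case False
      have "T \<beta> (frag_of x) = 0" if "\<beta> \<in> arrows m k" for \<beta>
        using False that by (auto simp: T_def x)
      then show ?thesis using \<alpha> \<alpha>j by (simp add: Q.rels_0)
    qed
  next
    case (3 a b)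
    have "T \<alpha> (a - b) - (\<Sum>j<k. T (\<alpha> \<odot> proj_arrow k j) (a - b))
      = (T \<alpha> a - (\<Sum>j<k. T (\<alpha> \<odot> proj_arrow k j) a)) - (T \<alpha> b - (\<Sum>j<k. T (\<alpha> \<odot> proj_arrow k j) b))"
      by (simp add: T_def frag_extend_diff sum_subtractf)
    then show ?case using Q.rels_diff[OF 3] by simp
  qed
  show "free_monoid_on S" by (rule free_S)
qed

end

lemma op_homI:
  assumes "f \<in> extensional (carrier M)" "\<And>x. x \<in> carrier M \<Longrightarrow> f x \<in> carrier N"
    and "\<And>x y. \<lbrakk>x \<in> carrier M; y \<in> carrier M\<rbrakk> \<Longrightarrow> f (x \<otimes>\<^bsub>M\<^esub> y) = f x \<otimes>\<^bsub>N\<^esub> f y"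
    and "\<And>x s. x \<in> carrier M \<Longrightarrow> f (x \<triangleleft>\<^bsub>M\<^esub> s) = f x \<triangleleft>\<^bsub>N\<^esub> s"
  shows "f \<in> op_hom M N"
  using assms by (auto simp: op_hom_def hom_def)

lemma op_homD:
  assumes "f \<in> op_hom M N"
  shows "f \<in> extensional (carrier M)" "x \<in> carrier M \<Longrightarrow> f x \<in> carrier N"
    and "\<lbrakk>x \<in> carrier M; y \<in> carrier M\<rbrakk> \<Longrightarrow> f (x \<otimes>\<^bsub>M\<^esub> y) = f x \<otimes>\<^bsub>N\<^esub> f y"
    and "x \<in> carrier M \<Longrightarrow> f (x \<triangleleft>\<^bsub>M\<^esub> s) = f x \<triangleleft>\<^bsub>N\<^esub> s"
  using assms by (auto simp: op_hom_def hom_def)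

lemma hom_group_simps [simp]:
  "carrier (hom_group M N) = op_hom M N"
  "f \<otimes>\<^bsub>hom_group M N\<^esub> g = (\<lambda>x \<in> carrier M. f x \<otimes>\<^bsub>N\<^esub> g x)"
  "\<one>\<^bsub>hom_group M N\<^esub> = (\<lambda>x \<in> carrier M. \<one>\<^bsub>N\<^esub>)"
  by (simp_all add: hom_group_def)

text \<open>Pointwise products and inverses remain equivariant because each scalar acts on the
  abelian group N by an endomorphism.\<close>

lemma hom_group_comm_group:
  assumes M: "group M" "\<And>x r. x \<in> carrier M \<Longrightarrow> x \<triangleleft>\<^bsub>M\<^esub> r \<in> carrier M"
    and N: "comm_group N" and ract: "\<And>r. (\<lambda>u. u \<triangleleft>\<^bsub>N\<^esub> r) \<in> hom N N"
  shows "comm_group (hom_group M N)"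
proof -
  interpret M: group M by fact
  interpret N: comm_group N by fact
  have r: "group_hom N N (\<lambda>u. u \<triangleleft>\<^bsub>N\<^esub> r)" for r
    by unfold_locales (rule ract)
  note [simp] = hom_mult[OF ract] group_hom.hom_one[OF r] group_hom.hom_inv[OF r] M(2)
  show ?thesis
  proof (rule comm_groupI)
    fix f g h assume fgh: "f \<in> carrier (hom_group M N)" "g \<in> carrier (hom_group M N)" "h \<in> carrier (hom_group M N)"
    note D = op_homD[OF fgh(1)[unfolded hom_group_simps]] op_homD[OF fgh(2)[unfolded hom_group_simps]]
      op_homD[OF fgh(3)[unfolded hom_group_simps]]
    show "f \<otimes>\<^bsub>hom_group M N\<^esub> g \<in> carrier (hom_group M N)"
      unfolding hom_group_simps by (rule op_homI) (simp_all add: D N.m_ac)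
    show "f \<otimes>\<^bsub>hom_group M N\<^esub> g \<otimes>\<^bsub>hom_group M N\<^esub> h = f \<otimes>\<^bsub>hom_group M N\<^esub> (g \<otimes>\<^bsub>hom_group M N\<^esub> h)"
      by (auto simp: D N.m_assoc intro!: restrict_ext)
    show "f \<otimes>\<^bsub>hom_group M N\<^esub> g = g \<otimes>\<^bsub>hom_group M N\<^esub> f"
      by (auto simp: D N.m_comm intro!: restrict_ext)
    show "\<one>\<^bsub>hom_group M N\<^esub> \<otimes>\<^bsub>hom_group M N\<^esub> f = f"
      by (rule extensionalityI[of _ "carrier M"]) (simp_all add: D)
    have "(\<lambda>x\<in>carrier M. inv\<^bsub>N\<^esub> f x) \<in> op_hom M N"
      by (rule op_homI) (simp_all add: D N.inv_mult)
    then show "\<exists>k\<in>carrier (hom_group M N). k \<otimes>\<^bsub>hom_group M N\<^esub> f = \<one>\<^bsub>hom_group M N\<^esub>"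
      by (intro bexI[of _ "\<lambda>x\<in>carrier M. inv\<^bsub>N\<^esub> f x"]) (auto simp: D intro!: restrict_ext)
  next
    show "\<one>\<^bsub>hom_group M N\<^esub> \<in> carrier (hom_group M N)"
      unfolding hom_group_simps by (rule op_homI) simp_all
  qed
qed

context mac_lane_coefficients
begin

abbreviation "tens n \<equiv> tensor (q_ob n) B"
abbreviation "R n \<equiv> tensor_rels (q_ob n) B"
abbreviation "D \<equiv> pullback q_ob q_ar (D_bifunctor B)"

lemma tens_cases:
  assumes "u \<in> carrier (tens n)"
  obtains z where "Poly_Mapping.keys z \<subseteq> supp n" "u = Q.cl n z"
  using assms unfolding Q.carrier_tensor by (auto elim!: imageE)

lemma tens_ract_hom: "(\<lambda>u. u \<triangleleft>\<^bsub>tens n\<^esub> r) \<in> hom (tens n) (tens n)"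
proof (rule homI)
  fix u assume "u \<in> carrier (tens n)"
  then obtain z where z: "Poly_Mapping.keys z \<subseteq> supp n" "u = Q.cl n z" by (rule tens_cases)
  show "u \<triangleleft>\<^bsub>tens n\<^esub> r \<in> carrier (tens n)" by (simp add: z Q.cl_ract Q.cl_closed Q.tact_keys)
  fix v assume "v \<in> carrier (tens n)"
  then obtain w where w: "Poly_Mapping.keys w \<subseteq> supp n" "v = Q.cl n w" by (rule tens_cases)
  have "Q.tact r (z + w) = Q.tact r z + Q.tact r w" by (simp add: Q.tact_def frag_extend_add)
  then show "(u \<otimes>\<^bsub>tens n\<^esub> v) \<triangleleft>\<^bsub>tens n\<^esub> r = (u \<triangleleft>\<^bsub>tens n\<^esub> r) \<otimes>\<^bsub>tens n\<^esub> (v \<triangleleft>\<^bsub>tens n\<^esub> r)"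
    by (simp add: z w Q.cl_ract Q.cl_mult Q.tact_keys keys_add_subset)
qed

lemma D_simps:
  "val D k m = hom_group (q_ob k) (tens m)"
  "\<alpha> \<in> arrows m n \<Longrightarrow> push D k \<alpha> h = compose (carrier (q_ob k)) (tensor_map (q_ob m) B (ad_arrow \<alpha>)) h"
  "\<beta> \<in> arrows n k \<Longrightarrow> pull D \<beta> m h = compose (carrier (q_ob k)) h (ad_arrow \<beta>)"
  by (auto simp: pullback_def D_bifunctor_def q_ar_def mod_Q_def arrows_def)

lemma val_group: "comm_group (hom_group (q_ob k) (tens m))"
  by (rule hom_group_comm_group)
    (use Q.N.is_group in \<open>simp_all add: Q.N_ract_closed Q.comm_group_tensor tens_ract_hom\<close>)

section \<open>Homomorphisms to tensor products and their representatives\<close>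

text \<open>The function \<phi> lifts h twice: from the abelianization to F_k in the source, and
  from the quotient to formal combinations in the target. It is determined only modulo
  \<open>R m\<close>, and the properties of h hold for it only modulo \<open>R m\<close>.\<close>

definition represents :: "nat \<Rightarrow> nat \<Rightarrow> ((nat \<times> 'l) word set set \<Rightarrow> ((nat \<times> 'l) word set set \<times> 'b \<Rightarrow>\<^sub>0 int) set)
    \<Rightarrow> ((nat \<times> 'l) word set \<Rightarrow> (nat \<times> 'l) word set set \<times> 'b \<Rightarrow>\<^sub>0 int) \<Rightarrow> bool"
  where "represents k m h \<phi> \<longleftrightarrow> (\<forall>x \<in> carrier (F k). Poly_Mapping.keys (\<phi> x) \<subseteq> supp m \<and> h (ab_class k x) = Q.cl m (\<phi> x))"

lemma representsD:
  assumes "represents k m h \<phi>" "x \<in> carrier (F k)"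
  shows "Poly_Mapping.keys (\<phi> x) \<subseteq> supp m" "h (ab_class k x) = Q.cl m (\<phi> x)"
  using assms by (auto simp: represents_def)

lemma represents_ex:
  assumes "h \<in> op_hom (q_ob k) (tens m)" shows "\<exists>\<phi>. represents k m h \<phi>"
proof -
  have "\<forall>x \<in> carrier (F k). \<exists>z. Poly_Mapping.keys z \<subseteq> supp m \<and> h (ab_class k x) = Q.cl m z"
  proof
    fix x assume "x \<in> carrier (F k)"
    then have "h (ab_class k x) \<in> carrier (tens m)" using op_homD(2)[OF assms] by simp
    then show "\<exists>z. Poly_Mapping.keys z \<subseteq> supp m \<and> h (ab_class k x) = Q.cl m z" by (rule tens_cases) blast
  qed
  from bchoice[OF this] show ?thesis by (simp add: represents_def)
qed

lemma represents_unique: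
  "\<lbrakk>represents k m h \<phi>; represents k m h \<psi>; x \<in> carrier (F k)\<rbrakk> \<Longrightarrow> \<phi> x - \<psi> x \<in> R m"
  by (simp add: represents_def flip: Q.cl_eq)

lemma represents_eqI:
  assumes "h \<in> op_hom (q_ob k) (tens m)" "g \<in> op_hom (q_ob k) (tens m)"
    and "represents k m h \<phi>" "represents k m g \<psi>" "\<And>x. x \<in> carrier (F k) \<Longrightarrow> \<phi> x - \<psi> x \<in> R m"
  shows "h = g"
proof (rule extensionalityI[OF op_homD(1)[OF assms(1)] op_homD(1)[OF assms(2)]])
  fix U assume "U \<in> carrier (q_ob k :: ((nat \<times> 'l) word set set, 'l monoid_ring) op_group)"
  then obtain x where x: "U = ab_class k x" "x \<in> carrier (F k)" unfolding carrier_q_ob by (elim imageE)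
  show "h U = g U" using assms(5)[OF x(2)] representsD(2)[OF assms(3) x(2)] representsD(2)[OF assms(4) x(2)]
    by (simp add: x(1) flip: Q.cl_eq)
qed

lemma represents_mult:
  assumes "represents k m h \<phi>" "represents k m g \<psi>"
  shows "represents k m (h \<otimes>\<^bsub>hom_group (q_ob k) (tens m)\<^esub> g) (\<lambda>x. \<phi> x + \<psi> x)"
  using assms by (simp add: represents_def Q.cl_mult keys_add_subset)

lemma represents_one: "represents k m \<one>\<^bsub>hom_group (q_ob k) (tens m)\<^esub> (\<lambda>x. 0)"
  by (simp add: represents_def Q.cl_0)

lemma represents_inv:
  assumes h: "h \<in> op_hom (q_ob k) (tens m)" "represents k m h \<phi>"
  shows "represents k m (inv\<^bsub>hom_group (q_ob k) (tens m)\<^esub> h) (\<lambda>x. - \<phi> x)"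
proof -
  interpret V: comm_group "hom_group (q_ob k) (tens m)" by (rule val_group)
  interpret t: comm_group "tens m" by (rule Q.comm_group_tensor)
  have h': "inv\<^bsub>hom_group (q_ob k) (tens m)\<^esub> h \<in> op_hom (q_ob k) (tens m)"
    using V.inv_closed h by simp
  have "(inv\<^bsub>hom_group (q_ob k) (tens m)\<^esub> h) U = inv\<^bsub>tens m\<^esub> h U" if U: "U \<in> carrier (q_ob k)" for U
  proof -
    have "(inv\<^bsub>hom_group (q_ob k) (tens m)\<^esub> h \<otimes>\<^bsub>hom_group (q_ob k) (tens m)\<^esub> h) U = \<one>\<^bsub>tens m\<^esub>"
      using V.l_inv[of h] h U by simp
    then show ?thesis using U op_homD(2)[OF h(1) U] op_homD(2)[OF h' U] t.inv_equality by simp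
  qed
  then show ?thesis using h(2) by (simp add: represents_def Q.cl_inv keys_minus)
qed

lemma represents_push:
  assumes \<alpha>: "\<alpha> \<in> arrows m n" and h: "represents k n h \<phi>"
  shows "represents k m (push D k \<alpha> h) (\<lambda>x. T \<alpha> (\<phi> x))"
  unfolding represents_def
proof (intro ballI conjI)
  fix x :: "(nat \<times> 'l) word set" assume x: "x \<in> carrier (F k)"
  note \<phi> = representsD[OF h x]
  show "Poly_Mapping.keys (T \<alpha> (\<phi> x)) \<subseteq> supp m" by (rule T_supp[OF \<alpha>])
  have "push D k \<alpha> h (ab_class k x) = tensor_map (q_ob m) B (ad_arrow \<alpha>) (Q.cl n (\<phi> x))"
    using x by (simp only: D_simps(2)[OF \<alpha>] compose_eq[OF ab_class_q_ob[OF x]] \<phi>(2))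
  then show "push D k \<alpha> h (ab_class k x) = Q.cl m (T \<alpha> (\<phi> x))"
    unfolding T_on_supp[OF \<alpha> \<phi>(1)]
      tensor_map_cl(1)[OF Q.tensor_factors_axioms Q.tensor_factors_axioms ad_arrow_op_hom[OF \<alpha>] \<phi>(1)] .
qed

lemma represents_pull:
  assumes \<beta>: "\<beta> \<in> arrows n k" and h: "represents n m h \<phi>"
  shows "represents k m (pull D \<beta> m h) (\<lambda>x. \<phi> (app \<beta> x))"
  using h ad_arrow_class[OF \<beta>] app_closed[OF \<beta>]
  by (simp add: represents_def D_simps(3)[OF \<beta>] compose_def)

lemma push_closed:
  assumes \<alpha>: "\<alpha> \<in> arrows m n" and h: "h \<in> op_hom (q_ob k) (tens n)"
  shows "push D k \<alpha> h \<in> op_hom (q_ob k) (tens m)"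
proof -
  note cl = tensor_map_cl[OF Q.tensor_factors_axioms Q.tensor_factors_axioms ad_arrow_op_hom[OF \<alpha>]]
  let ?t = "tensor_map (q_ob m) B (ad_arrow \<alpha>)"
  let ?f = "frag_extend (\<lambda>(x, b). frag_of (ad_arrow \<alpha> x, b)) :: _ \<Rightarrow> (nat \<times> 'l) word set set \<times> 'b \<Rightarrow>\<^sub>0 int"
  have t_closed: "?t u \<in> carrier (tens m)" if u: "u \<in> carrier (tens n)" for u
  proof -
    obtain z where z: "Poly_Mapping.keys z \<subseteq> supp n" "u = Q.cl n z" by (rule tens_cases[OF u])
    show ?thesis unfolding z(2) cl(1)[OF z(1)] by (rule Q.cl_closed[OF cl(3)[OF z(1)]])
  qed
  have t_mult: "?t (u \<otimes>\<^bsub>tens n\<^esub> v) = ?t u \<otimes>\<^bsub>tens m\<^esub> ?t v" if u: "u \<in> carrier (tens n)" and v: "v \<in> carrier (tens n)" for u v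
  proof -
    obtain z where z: "Poly_Mapping.keys z \<subseteq> supp n" "u = Q.cl n z" by (rule tens_cases[OF u])
    obtain w where w: "Poly_Mapping.keys w \<subseteq> supp n" "v = Q.cl n w" by (rule tens_cases[OF v])
    show ?thesis unfolding z(2) w(2) Q.cl_mult[OF z(1) w(1)] cl(1)[OF z(1)] cl(1)[OF w(1)]
        cl(1)[OF keys_add_subset[OF z(1) w(1)]] Q.cl_mult[OF cl(3)[OF z(1)] cl(3)[OF w(1)]]
      by (simp add: frag_extend_add)
  qed
  have t_ract: "?t (u \<triangleleft>\<^bsub>tens n\<^esub> r) = ?t u \<triangleleft>\<^bsub>tens m\<^esub> r" if u: "u \<in> carrier (tens n)" for u r
  proof -
    obtain z where z: "Poly_Mapping.keys z \<subseteq> supp n" "u = Q.cl n z" by (rule tens_cases[OF u])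
    have "?f (Q.tact r z) = Q.tact r (?f z)"
      unfolding Q.tact_def frag_extend_frag_extend by (rule arg_cong2[of _ _ _ _ frag_extend]) auto
    then show ?thesis unfolding z(2) Q.cl_ract[OF z(1)] cl(1)[OF z(1)] cl(1)[OF Q.tact_keys[OF z(1)]]
        Q.cl_ract[OF cl(3)[OF z(1)]] by simp
  qed
  show ?thesis unfolding D_simps(2)[OF \<alpha>]
    by (rule op_homI)
      (simp_all add: compose_def op_homD[OF h] t_closed t_mult t_ract Q.N_ract_closed)
qed

lemma pull_closed:
  assumes \<beta>: "\<beta> \<in> arrows n k" and h: "h \<in> op_hom (q_ob n) (tens m)"
  shows "pull D \<beta> m h \<in> op_hom (q_ob k) (tens m)"
  unfolding D_simps(3)[OF \<beta>]
  by (rule op_homI)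
    (simp_all add: compose_def op_homD[OF h] op_homD[OF ad_arrow_op_hom[OF \<beta>]] Q.N_ract_closed del: arrows_Cod arrows_Dom)

sublocale cochain_complex "mod_Q :: (nat, 'l mod_Q_arrow) cat" D
proof (rule cochain_complex.intro)
  fix \<alpha> \<beta> :: "'l mod_Q_arrow" and M N :: nat
  show "Dom mod_Q \<alpha> \<in> Ob (mod_Q :: (nat, 'l mod_Q_arrow) cat)"
    "Cod mod_Q \<alpha> \<in> Ob (mod_Q :: (nat, 'l mod_Q_arrow) cat)" by (simp_all add: mod_Q_def)
  show "comm_group (val D M N)" unfolding D_simps by (rule val_group)
  show "Comp mod_Q \<alpha> \<beta> \<in> Ar mod_Q \<and> Dom mod_Q (Comp mod_Q \<alpha> \<beta>) = Dom mod_Q \<beta> \<and> Cod mod_Q (Comp mod_Q \<alpha> \<beta>) = Cod mod_Q \<alpha>"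
    if "\<alpha> \<in> Ar mod_Q" "\<beta> \<in> Ar mod_Q" "Cod mod_Q \<beta> = Dom mod_Q \<alpha>"
    using comp_Q_arrows[of \<alpha> "Cod mod_Q \<alpha>" "Dom mod_Q \<alpha>" \<beta> "Dom mod_Q \<beta>", unfolded arrows_iff] that by blast
  assume "\<alpha> \<in> Ar mod_Q"
  then obtain m n where \<alpha>: "\<alpha> \<in> arrows m n" unfolding arrows_iff by blast
  show "push D M \<alpha> \<in> hom (val D M (Dom mod_Q \<alpha>)) (val D M (Cod mod_Q \<alpha>))"
  proof (rule homI, unfold D_simps hom_group_simps(1) arrows_Dom[OF \<alpha>] arrows_Cod[OF \<alpha>])
    fix g h assume g: "g \<in> op_hom (q_ob M) (tens n)" and h: "h \<in> op_hom (q_ob M) (tens n)"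
    interpret V: comm_group "hom_group (q_ob M) (tens m)" by (rule val_group)
    interpret W: comm_group "hom_group (q_ob M) (tens n)" by (rule val_group)
    show pg: "push D M \<alpha> g \<in> op_hom (q_ob M) (tens m)" by (rule push_closed[OF \<alpha> g])
    have ph: "push D M \<alpha> h \<in> op_hom (q_ob M) (tens m)" by (rule push_closed[OF \<alpha> h])
    have gh: "g \<otimes>\<^bsub>hom_group (q_ob M) (tens n)\<^esub> h \<in> op_hom (q_ob M) (tens n)"
      using W.m_closed[of g h] g h by (simp only: hom_group_simps(1))
    have pgh: "push D M \<alpha> g \<otimes>\<^bsub>hom_group (q_ob M) (tens m)\<^esub> push D M \<alpha> h \<in> op_hom (q_ob M) (tens m)"
      using V.m_closed pg ph by (simp only: hom_group_simps(1))
    from represents_ex[OF g] obtain \<phi> where \<phi>: "represents M n g \<phi>" ..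
    from represents_ex[OF h] obtain \<psi> where \<psi>: "represents M n h \<psi>" ..
    show "push D M \<alpha> (g \<otimes>\<^bsub>hom_group (q_ob M) (tens n)\<^esub> h)
       = push D M \<alpha> g \<otimes>\<^bsub>hom_group (q_ob M) (tens m)\<^esub> push D M \<alpha> h"
      by (rule represents_eqI[OF push_closed[OF \<alpha> gh] pgh
            represents_push[OF \<alpha> represents_mult[OF \<phi> \<psi>]]
            represents_mult[OF represents_push[OF \<alpha> \<phi>] represents_push[OF \<alpha> \<psi>]]])
        (simp add: T_add)
  qed
  show "pull D \<alpha> N \<in> hom (val D (Cod mod_Q \<alpha>) N) (val D (Dom mod_Q \<alpha>) N)"
  proof (rule homI, unfold D_simps hom_group_simps(1) arrows_Dom[OF \<alpha>] arrows_Cod[OF \<alpha>])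
    fix g h assume g: "g \<in> op_hom (q_ob m) (tens N)" and h: "h \<in> op_hom (q_ob m) (tens N)"
    show "pull D \<alpha> N g \<in> op_hom (q_ob n) (tens N)" by (rule pull_closed[OF \<alpha> g])
    show "pull D \<alpha> N (g \<otimes>\<^bsub>hom_group (q_ob m) (tens N)\<^esub> h)
       = pull D \<alpha> N g \<otimes>\<^bsub>hom_group (q_ob n) (tens N)\<^esub> pull D \<alpha> N h"
      using ad_arrow_closed[OF \<alpha>] by (auto simp: D_simps(3)[OF \<alpha>] compose_def \<alpha> intro!: restrict_ext)
  qed
qed

end

lemma (in comm_group) finprod_upto:
  fixes f :: "nat \<Rightarrow> 'a"
  shows "f 1 \<in> carrier G \<Longrightarrow> finprod G f {1..1} = f 1"
    and "\<lbrakk>f 1 \<in> carrier G; f 2 \<in> carrier G\<rbrakk> \<Longrightarrow> finprod G f {1..2} = f 1 \<otimes> f 2"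
    and "\<lbrakk>f 1 \<in> carrier G; f 2 \<in> carrier G; f 3 \<in> carrier G\<rbrakk> \<Longrightarrow> finprod G f {1..3} = f 1 \<otimes> f 2 \<otimes> f 3"
proof -
  have "{1..1} = {1::nat}" "{1..2} = {1, 2::nat}" "{1..3} = {1, 2, 3::nat}" by auto
  then show "f 1 \<in> carrier G \<Longrightarrow> finprod G f {1..1} = f 1"
    and "\<lbrakk>f 1 \<in> carrier G; f 2 \<in> carrier G\<rbrakk> \<Longrightarrow> finprod G f {1..2} = f 1 \<otimes> f 2"
    and "\<lbrakk>f 1 \<in> carrier G; f 2 \<in> carrier G; f 3 \<in> carrier G\<rbrakk> \<Longrightarrow> finprod G f {1..3} = f 1 \<otimes> f 2 \<otimes> f 3"
    by (simp_all add: Pi_def m_assoc)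
qed

lemma (in group) int_pow_minus_one: "x \<in> carrier G \<Longrightarrow> x [^] (- 1 :: int) = inv x"
  using int_pow_neg[of x 1] by simp

lemma frag_of_times: "frag_of (a + b) = frag_of a * frag_of b"
  and frag_of_zero: "frag_of 0 = 1"
  by (simp_all add: mult_single)

context mac_lane_coefficients
begin

lemma represents_equivariant:
  assumes h: "h \<in> op_hom (q_ob k) (tens m)" and \<phi>: "represents k m h \<phi>"
  shows "equivariant_on k m \<phi>"
  unfolding equivariant_on_def additive_on_def
proof (intro conjI ballI)
  fix x y assume x: "x \<in> carrier (F k)" and y: "y \<in> carrier (F k)"
  note rx = representsD[OF \<phi> x] and ry = representsD[OF \<phi> y]
  have xy: "x \<otimes>\<^bsub>F k\<^esub> y \<in> carrier (F k)" using x y by simp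
  have "Q.cl m (\<phi> (x \<otimes>\<^bsub>F k\<^esub> y)) = Q.cl m (\<phi> x + \<phi> y)"
    unfolding representsD(2)[OF \<phi> xy, symmetric] ab_class_mult[OF x y]
      op_homD(3)[OF h ab_class_q_ob[OF x] ab_class_q_ob[OF y]] rx(2) ry(2)
    by (rule Q.cl_mult[OF rx(1) ry(1)])
  then show "\<phi> (x \<otimes>\<^bsub>F k\<^esub> y) - \<phi> x - \<phi> y \<in> R m" unfolding Q.cl_eq by (simp add: diff_diff_eq)
next
  fix s x assume x: "x \<in> carrier (F k)"
  have xs: "x \<triangleleft>\<^bsub>F k\<^esub> s \<in> carrier (F k)" using x by simp
  note rx = representsD[OF \<phi> x]
  have "ab_class k (x \<triangleleft>\<^bsub>F k\<^esub> s) = ab_class k x \<triangleleft>\<^bsub>q_ob k\<^esub> frag_of s"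
    unfolding q_ob_def by (rule nil_mod.ad_ract_of[OF x, symmetric])
  then have "Q.cl m (\<phi> (x \<triangleleft>\<^bsub>F k\<^esub> s)) = Q.cl m (act s (\<phi> x))"
    using representsD(2)[OF \<phi> xs] op_homD(4)[OF h ab_class_q_ob[OF x]] rx
    by (simp add: Q.cl_ract act_on_supp)
  then show "\<phi> (x \<triangleleft>\<^bsub>F k\<^esub> s) - act s (\<phi> x) \<in> R m" unfolding Q.cl_eq .
qed

lemma act_sum:
  assumes "Poly_Mapping.keys z \<subseteq> supp m"
  shows "act 0 z = z" and "act (s + t) z = act t (act s z)" and "Poly_Mapping.keys (act s z) \<subseteq> supp m"
proof -
  show "Poly_Mapping.keys (act s z) \<subseteq> supp m"
    unfolding act_on_supp[OF assms] by (rule Q.tact_keys[OF assms])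
  show "act (s + t) z = act t (act s z)"
    unfolding act_def frag_extend_frag_extend
    by (rule arg_cong2[of _ _ _ _ frag_extend]) (auto simp: frag_of_times Q.ract_times Q.ract_closed)
  have "act 0 z = frag_extend frag_of z"
    unfolding act_def by (rule frag_extend_eq) (use assms in \<open>auto simp: frag_of_zero Q.ract_one\<close>)
  then show "act 0 z = z" by (simp flip: frag_expansion)
qed

text \<open>Induction along a word in the free generators. The support condition enters because
  \<open>act 0\<close> is the identity on supported combinations.\<close>

lemma equivariant_on_all:
  assumes \<phi>: "equivariant_on k m \<phi>" and supp: "\<And>x. x \<in> carrier (F k) \<Longrightarrow> Poly_Mapping.keys (\<phi> x) \<subseteq> supp m"
    and x: "x \<in> carrier (F k)"
  shows "\<phi> (x \<triangleleft>\<^bsub>F k\<^esub> s) - act s (\<phi> x) \<in> R m"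
proof -
  obtain d where d: "d s \<in> lists S" "sum_list (d s) = s"
    by (rule free_monoid_decomposition[OF free_S]) blast
  have "\<phi> (x \<triangleleft>\<^bsub>F k\<^esub> sum_list ss) - act (sum_list ss) (\<phi> x) \<in> R m" if "ss \<in> lists S" for ss
    using that x
  proof (induction ss arbitrary: x rule: list.induct)
    case Nil
    then show ?case by (simp add: nil_mod.ract_zero act_sum(1)[OF supp])
  next
    case (Cons a ss)
    then have a: "a \<in> S" and ss: "ss \<in> lists S" by auto
    have xa: "x \<triangleleft>\<^bsub>F k\<^esub> a \<in> carrier (F k)" using Cons.prems by simp
    have "\<phi> ((x \<triangleleft>\<^bsub>F k\<^esub> a) \<triangleleft>\<^bsub>F k\<^esub> sum_list ss) - act (sum_list ss) (\<phi> (x \<triangleleft>\<^bsub>F k\<^esub> a))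
      + act (sum_list ss) (\<phi> (x \<triangleleft>\<^bsub>F k\<^esub> a) - act a (\<phi> x)) \<in> R m"
      by (rule R_add[OF Cons.IH[OF ss xa] act_R[OF equivariant_onD(2)[OF \<phi> a Cons.prems(2)]]])
    then show ?case
      using Cons.prems(2) by (simp add: nil_mod.ract_add act_diff act_sum(2)[OF supp])
  qed
  from this[OF d(1)] show ?thesis by (simp only: d(2))
qed

text \<open>Converse of \<open>represents_equivariant\<close>. Modulo \<open>R m\<close> the
  function \<phi> is a homomorphism to an abelian group and factors through the abelianization. Both
  sides of the linearity condition are additive in the scalar, so the action of L decides
  it.\<close>

lemma represented_ex:
  assumes \<phi>: "equivariant_on k m \<phi>" and supp: "\<And>x. x \<in> carrier (F k) \<Longrightarrow> Poly_Mapping.keys (\<phi> x) \<subseteq> supp m"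
  shows "\<exists>h \<in> op_hom (q_ob k) (tens m). represents k m h \<phi>"
proof -
  interpret t: comm_group "tens m" by (rule Q.comm_group_tensor)
  let ?f = "\<lambda>x. Q.cl m (\<phi> x)"
  have f_mult: "?f (x \<otimes>\<^bsub>F k\<^esub> y) = ?f x \<otimes>\<^bsub>tens m\<^esub> ?f y" if "x \<in> carrier (F k)" "y \<in> carrier (F k)" for x y
    using additive_onD[OF equivariant_onD(1)[OF \<phi>] that] supp[OF that(1)] supp[OF that(2)]
    by (simp add: Q.cl_mult Q.cl_eq diff_diff_eq)
  have f_hom: "?f \<in> hom (F k) (tens m)"
    by (rule homI) (simp_all add: f_mult Q.cl_closed supp)
  interpret f: group_hom "F k" "tens m" ?f
    by (simp add: group_hom_def group_hom_axioms_def f_hom group_free_nil_module)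
  \<comment> \<open>The image of the derived subgroup is the derived subgroup of an image in an
    abelian group, hence trivial.\<close>
  have "derived (tens m) (?f ` carrier (F k)) = ?f ` commutator_subgroup (F k)" by (rule f.derived_img) simp
  moreover have "derived (tens m) (?f ` carrier (F k)) = {\<one>\<^bsub>tens m\<^esub>}"
    by (rule t.derived_eq_singleton) auto
  ultimately have f1: "?f n = \<one>\<^bsub>tens m\<^esub>" if "n \<in> commutator_subgroup (F k)" for n using that by blast
  have f_eq: "?f x = ?f y" if x: "x \<in> carrier (F k)" and y: "y \<in> carrier (F k)" and eq: "ab_class k x = ab_class k y" for x y
  proof -
    have "subgroup (commutator_subgroup (F k)) (F k)" by (rule nil_free.derived_is_subgroup) simp
    from nil_free.rcos_self[OF x this] have "x \<in> ab_class k y" using eq by simp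
    then obtain n where n: "n \<in> commutator_subgroup (F k)" "x = n \<otimes>\<^bsub>F k\<^esub> y" by (auto simp: r_coset_def)
    then have "n \<in> carrier (F k)" using nil_free.derived_in_carrier[of "carrier (F k)" k] by blast
    then show ?thesis using n f_mult[of n y] f1[OF n(1)] f.hom_closed[OF y] y by simp
  qed
  define h where "h = (\<lambda>U \<in> carrier (q_ob k). ?f (SOME x. x \<in> carrier (F k) \<and> U = ab_class k x))"
  have h: "h (ab_class k x) = ?f x" if x: "x \<in> carrier (F k)" for x
  proof -
    have "\<exists>y. y \<in> carrier (F k) \<and> ab_class k x = ab_class k y" using x by blast
    note y = someI_ex[OF this]
    have "?f (SOME y. y \<in> carrier (F k) \<and> ab_class k x = ab_class k y) = ?f x"
      by (rule f_eq[OF x conjunct1[OF y] conjunct2[OF y], symmetric])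
    then show ?thesis unfolding h_def restrict_apply'[OF ab_class_q_ob[OF x]] .
  qed
  have h_hom: "h \<in> hom (ad (F k)) (tens m)"
  proof (rule homI, unfold nil_mod.carrier_ad)
    fix U assume "U \<in> ab_class k ` carrier (F k)"
    then obtain x where x: "U = ab_class k x" "x \<in> carrier (F k)" by (elim imageE)
    show "h U \<in> carrier (tens m)" unfolding x(1) h[OF x(2)] by (rule f.hom_closed[OF x(2)])
    fix W assume "W \<in> ab_class k ` carrier (F k)"
    then obtain y where y: "W = ab_class k y" "y \<in> carrier (F k)" by (elim imageE)
    have xy: "x \<otimes>\<^bsub>F k\<^esub> y \<in> carrier (F k)" using x y by simp
    show "h (U \<otimes>\<^bsub>ad (F k)\<^esub> W) = h U \<otimes>\<^bsub>tens m\<^esub> h W"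
      unfolding x(1) y(1) nil_mod.ab_mult[OF x(2) y(2)] h[OF x(2)] h[OF y(2)] h[OF xy]
      by (rule f_mult[OF x(2) y(2)])
  qed
  have "h \<in> op_hom (q_ob k) (tens m)"
  proof (rule op_homI)
    show "h \<in> extensional (carrier (q_ob k))" by (simp add: h_def)
    fix U assume U: "U \<in> carrier (q_ob k :: ((nat \<times> 'l) word set set, 'l monoid_ring) op_group)"
    then obtain x where x: "U = ab_class k x" "x \<in> carrier (F k)" unfolding carrier_q_ob by (elim imageE)
    show "h U \<in> carrier (tens m)" using hom_in_carrier[OF h_hom] U by (simp add: q_ob_def)
    show "h (U \<otimes>\<^bsub>q_ob k\<^esub> W) = h U \<otimes>\<^bsub>tens m\<^esub> h W"
      if "W \<in> carrier (q_ob k :: ((nat \<times> 'l) word set set, 'l monoid_ring) op_group)" for W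
      using hom_mult[OF h_hom] U that by (simp add: q_ob_def)
    note sx = supp[OF x(2)]
    have k: "(\<lambda>r. Q.cl m (Q.tact r (\<phi> x))) \<in> hom (free_Abelian_group UNIV) (tens m)"
    proof (rule homI)
      show "Q.cl m (Q.tact r (\<phi> x)) \<in> carrier (tens m)" for r by (rule Q.cl_closed[OF Q.tact_keys[OF sx]])
      show "Q.cl m (Q.tact (r \<otimes>\<^bsub>free_Abelian_group UNIV\<^esub> r') (\<phi> x)) = Q.cl m (Q.tact r (\<phi> x)) \<otimes>\<^bsub>tens m\<^esub> Q.cl m (Q.tact r' (\<phi> x))"
        for r r'
        unfolding mult_free_Abelian_group Q.cl_mult[OF Q.tact_keys[OF sx] Q.tact_keys[OF sx]] Q.cl_eq
        by (rule Q.tact_add[OF sx])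
    qed
    have "h (ab_class k x \<triangleleft>\<^bsub>ad (F k)\<^esub> r) = Q.cl m (Q.tact r (\<phi> x))" for r
    proof (rule nil_mod.ad_hom_ract[OF t.is_group h_hom x(2) k])
      fix s
      have xs: "x \<triangleleft>\<^bsub>F k\<^esub> s \<in> carrier (F k)" using x by simp
      show "h (ab_class k (x \<triangleleft>\<^bsub>F k\<^esub> s)) = Q.cl m (Q.tact (frag_of s) (\<phi> x))"
        unfolding h[OF xs] Q.cl_eq act_on_supp[OF sx, symmetric] by (rule equivariant_on_all[OF \<phi> supp x(2)])
    qed
    then show "h (U \<triangleleft>\<^bsub>q_ob k\<^esub> r) = h U \<triangleleft>\<^bsub>tens m\<^esub> r" for r
      unfolding x(1) h[OF x(2)] Q.cl_ract[OF sx] by (simp add: q_ob_def)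
  qed
  then show ?thesis using h supp by (intro bexI[of _ h]) (simp_all add: represents_def)
qed

end

section \<open>Chains of length at most four\<close>

lemma chains_0: "(c, \<alpha>s, c') \<in> chains (mod_Q :: (nat, 'l::monoid_add mod_Q_arrow) cat) 0 \<longleftrightarrow> \<alpha>s = [] \<and> c' = c"
  by (auto simp: chains_def mod_Q_def)

lemma chains_Suc:
  fixes \<alpha>s :: "'l::monoid_add mod_Q_arrow list"
  shows "(c, \<alpha>s, c') \<in> chains mod_Q (Suc n) \<longleftrightarrow> (\<exists>\<alpha> \<beta>s d. \<alpha>s = \<alpha> # \<beta>s \<and> \<alpha> \<in> arrows c d \<and> (d, \<beta>s, c') \<in> chains mod_Q n)"
proof (cases \<alpha>s)
  case (Cons \<alpha> \<beta>s)
  have "(c, \<alpha> # \<beta>s, c') \<in> chains mod_Q (Suc n) \<longleftrightarrow> \<alpha> \<in> arrows c (Dom mod_Q \<alpha>) \<and> (Dom mod_Q \<alpha>, \<beta>s, c') \<in> chains mod_Q n"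
    unfolding chains_def arrows_iff by (simp; blast)
  also have "\<dots> \<longleftrightarrow> (\<exists>\<alpha>' \<beta>s' d. \<alpha> # \<beta>s = \<alpha>' # \<beta>s' \<and> \<alpha>' \<in> arrows c d \<and> (d, \<beta>s', c') \<in> chains mod_Q n)" (is "?l \<longleftrightarrow> ?r")
  proof
    assume ?l
    then show ?r by (intro exI[of _ \<alpha>] exI[of _ \<beta>s] exI[of _ "Dom mod_Q \<alpha>"]) simp
  next
    assume ?r
    then obtain \<alpha>' \<beta>s' d where "\<alpha> # \<beta>s = \<alpha>' # \<beta>s'" "\<alpha>' \<in> arrows c d" "(d, \<beta>s', c') \<in> chains mod_Q n"
      by (elim exE conjE)
    then show ?l using arrows_Dom[of \<alpha> c d] by simp
  qed
  finally show ?thesis unfolding Cons .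
qed (simp add: chains_def)

lemma chains_iff:
  fixes c :: nat and \<alpha>s :: "'l::monoid_add mod_Q_arrow list"
  shows "(c, \<alpha>s, c') \<in> chains mod_Q 1 \<longleftrightarrow> (\<exists>\<alpha>. \<alpha>s = [\<alpha>] \<and> \<alpha> \<in> arrows c c')"
    and "(c, \<alpha>s, c') \<in> chains mod_Q 2 \<longleftrightarrow> (\<exists>\<alpha> \<beta> n. \<alpha>s = [\<alpha>, \<beta>] \<and> \<alpha> \<in> arrows c n \<and> \<beta> \<in> arrows n c')"
    and "(c, \<alpha>s, c') \<in> chains mod_Q 3 \<longleftrightarrow>
      (\<exists>\<alpha> \<beta> \<gamma> n k. \<alpha>s = [\<alpha>, \<beta>, \<gamma>] \<and> \<alpha> \<in> arrows c n \<and> \<beta> \<in> arrows n k \<and> \<gamma> \<in> arrows k c')"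
    and "(c, \<alpha>s, c') \<in> chains mod_Q 4 \<longleftrightarrow>
      (\<exists>\<alpha> \<beta> \<gamma> \<delta> n k l. \<alpha>s = [\<alpha>, \<beta>, \<gamma>, \<delta>] \<and> \<alpha> \<in> arrows c n \<and> \<beta> \<in> arrows n k \<and> \<gamma> \<in> arrows k l \<and> \<delta> \<in> arrows l c')"
proof -
  show 1: "(c, \<alpha>s, c') \<in> chains mod_Q 1 \<longleftrightarrow> (\<exists>\<alpha>. \<alpha>s = [\<alpha>] \<and> \<alpha> \<in> arrows c c')"
    for c and \<alpha>s :: "'l mod_Q_arrow list"
    unfolding One_nat_def chains_Suc chains_0 by (auto simp del: split_paired_Ex split_paired_All)
  show 2: "(c, \<alpha>s, c') \<in> chains mod_Q 2 \<longleftrightarrow> (\<exists>\<alpha> \<beta> n. \<alpha>s = [\<alpha>, \<beta>] \<and> \<alpha> \<in> arrows c n \<and> \<beta> \<in> arrows n c')"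
    for c and \<alpha>s :: "'l mod_Q_arrow list"
    unfolding Suc_1[symmetric] chains_Suc[of _ _ _ 1] 1 by (auto simp del: split_paired_Ex split_paired_All)
  show 3: "(c, \<alpha>s, c') \<in> chains mod_Q 3 \<longleftrightarrow>
      (\<exists>\<alpha> \<beta> \<gamma> n k. \<alpha>s = [\<alpha>, \<beta>, \<gamma>] \<and> \<alpha> \<in> arrows c n \<and> \<beta> \<in> arrows n k \<and> \<gamma> \<in> arrows k c')"
    for c and \<alpha>s :: "'l mod_Q_arrow list"
  proof -
    have eq: "3 = Suc 2" by simp
    show ?thesis unfolding eq chains_Suc 2 by (rule iffI; elim exE conjE; hypsubst; intro exI conjI; (rule HOL.refl | assumption))
  qed
  show "(c, \<alpha>s, c') \<in> chains mod_Q 4 \<longleftrightarrow>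
      (\<exists>\<alpha> \<beta> \<gamma> \<delta> n k l. \<alpha>s = [\<alpha>, \<beta>, \<gamma>, \<delta>] \<and> \<alpha> \<in> arrows c n \<and> \<beta> \<in> arrows n k \<and> \<gamma> \<in> arrows k l \<and> \<delta> \<in> arrows l c')"
  proof -
    have eq: "4 = Suc 3" by simp
    show ?thesis unfolding eq chains_Suc 3 by (rule iffI; elim exE conjE; hypsubst; intro exI conjI; (rule HOL.refl | assumption))
  qed
qed

lemma chains_intros:
  fixes \<alpha> \<beta> \<gamma> \<delta> :: "'l::monoid_add mod_Q_arrow"
  shows "\<alpha> \<in> arrows m n \<Longrightarrow> (m, [\<alpha>], n) \<in> chains mod_Q 1"
    and "\<lbrakk>\<alpha> \<in> arrows m n; \<beta> \<in> arrows n k\<rbrakk> \<Longrightarrow> (m, [\<alpha>, \<beta>], k) \<in> chains mod_Q 2"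
    and "\<lbrakk>\<alpha> \<in> arrows m n; \<beta> \<in> arrows n k; \<gamma> \<in> arrows k l\<rbrakk> \<Longrightarrow> (m, [\<alpha>, \<beta>, \<gamma>], l) \<in> chains mod_Q 3"
    and "\<lbrakk>\<alpha> \<in> arrows m n; \<beta> \<in> arrows n k; \<gamma> \<in> arrows k l; \<delta> \<in> arrows l j\<rbrakk>
      \<Longrightarrow> (m, [\<alpha>, \<beta>, \<gamma>, \<delta>], j) \<in> chains mod_Q 4"
  unfolding chains_iff by (intro exI conjI; (rule HOL.refl | assumption))+

context mac_lane_coefficients
begin

abbreviation "\<C> \<equiv> mod_Q :: (nat, 'l mod_Q_arrow) cat"

lemma cochain_closed:
  assumes "f \<in> carrier (cochains \<C> D n)" "(m, \<alpha>s, k) \<in> chains \<C> n"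
  shows "f (m, \<alpha>s, k) \<in> op_hom (q_ob k) (tens m)"
  using assms by (force simp: cochains_def PiE_iff D_simps)

lemma coboundary_closed:
  "f \<in> carrier (cochains \<C> D n) \<Longrightarrow> coboundary \<C> D n f \<in> carrier (cochains \<C> D (Suc n))"
  using coboundary_hom by (auto simp: hom_def)

section \<open>Coboundaries in low degrees, computed on representatives\<close>

text \<open>A translation from the multiplicative coboundary formula in groups of homomorphisms to
  the additive formula that occurs in the vanishing lemmas.\<close>

lemma represents_coboundary_1:
  assumes f: "f \<in> carrier (cochains \<C> D 1)"
    and L: "\<And>\<alpha> m n. \<alpha> \<in> arrows m n \<Longrightarrow> represents n m (f (m, [\<alpha>], n)) (L \<alpha>)"
    and \<alpha>: "\<alpha> \<in> arrows m n" and \<beta>: "\<beta> \<in> arrows n k"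
  shows "represents k m (coboundary \<C> D 1 f (m, [\<alpha>, \<beta>], k))
    (\<lambda>x. T \<alpha> (L \<beta> x) - L (\<alpha> \<odot> \<beta>) x + L \<alpha> (app \<beta> x))"
proof -
  interpret V: comm_group "hom_group (q_ob k) (tens m)" by (rule val_group)
  have \<alpha>\<beta>: "\<alpha> \<odot> \<beta> \<in> arrows m k" by (rule comp_Q_arrows[OF \<alpha> \<beta>])
  have c: "f (c, [\<gamma>], d) \<in> op_hom (q_ob d) (tens c)" if "\<gamma> \<in> arrows c d" for \<gamma> c d
    by (rule cochain_closed[OF f chains_intros(1)[OF that]])
  have "(m, [\<alpha>, \<beta>], k) \<in> chains \<C> (Suc 1)" using chains_intros(2)[OF \<alpha> \<beta>] by (simp only: Suc_1)
  then have "coboundary \<C> D 1 f (m, [\<alpha>, \<beta>], k)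
     = push D k \<alpha> (f (n, [\<beta>], k)) \<otimes>\<^bsub>hom_group (q_ob k) (tens m)\<^esub>
       inv\<^bsub>hom_group (q_ob k) (tens m)\<^esub> f (m, [\<alpha> \<odot> \<beta>], k) \<otimes>\<^bsub>hom_group (q_ob k) (tens m)\<^esub>
       pull D \<beta> m (f (m, [\<alpha>], n))"
    using c[OF \<alpha>\<beta>] V.inv_closed[unfolded hom_group_simps(1), OF c[OF \<alpha>\<beta>]] pull_closed[OF \<beta> c[OF \<alpha>]] \<alpha> \<beta>
    by (simp add: coboundary_eq term_at_def D_simps(1) comp_at_def V.int_pow_minus_one
        del: hom_group_simps(2,3))
  then show ?thesis
    using represents_mult[OF represents_mult[OF represents_push[OF \<alpha> L[OF \<beta>]] represents_inv[OF c[OF \<alpha>\<beta>] L[OF \<alpha>\<beta>]]]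
        represents_pull[OF \<beta> L[OF \<alpha>]]]
    by simp
qed

lemma represents_coboundary_2:
  assumes f: "f \<in> carrier (cochains \<C> D 2)"
    and L: "\<And>\<alpha> \<beta> m n k. \<lbrakk>\<alpha> \<in> arrows m n; \<beta> \<in> arrows n k\<rbrakk> \<Longrightarrow> represents k m (f (m, [\<alpha>, \<beta>], k)) (L \<alpha> \<beta>)"
    and \<alpha>: "\<alpha> \<in> arrows m n" and \<beta>: "\<beta> \<in> arrows n k" and \<gamma>: "\<gamma> \<in> arrows k l"
  shows "represents l m (coboundary \<C> D 2 f (m, [\<alpha>, \<beta>, \<gamma>], l))
    (\<lambda>x. T \<alpha> (L \<beta> \<gamma> x) - L (\<alpha> \<odot> \<beta>) \<gamma> x + L \<alpha> (\<beta> \<odot> \<gamma>) x - L \<alpha> \<beta> (app \<gamma> x))"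
proof -
  interpret V: comm_group "hom_group (q_ob l) (tens m)" by (rule val_group)
  have \<alpha>\<beta>: "\<alpha> \<odot> \<beta> \<in> arrows m k" by (rule comp_Q_arrows[OF \<alpha> \<beta>])
  have \<beta>\<gamma>: "\<beta> \<odot> \<gamma> \<in> arrows n l" by (rule comp_Q_arrows[OF \<beta> \<gamma>])
  have c: "f (c, [\<epsilon>, \<delta>], e) \<in> op_hom (q_ob e) (tens c)" if "\<epsilon> \<in> arrows c d" "\<delta> \<in> arrows d e" for \<epsilon> \<delta> c d e
    by (rule cochain_closed[OF f chains_intros(2)[OF that]])
  note c1 = c[OF \<alpha>\<beta> \<gamma>] and c2 = c[OF \<alpha> \<beta>\<gamma>]
  note p = pull_closed[OF \<gamma> c[OF \<alpha> \<beta>]]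
  have "(m, [\<alpha>, \<beta>, \<gamma>], l) \<in> chains \<C> (Suc 2)" using chains_intros(3)[OF \<alpha> \<beta> \<gamma>] by simp
  then have "coboundary \<C> D 2 f (m, [\<alpha>, \<beta>, \<gamma>], l)
     = push D l \<alpha> (f (n, [\<beta>, \<gamma>], l)) \<otimes>\<^bsub>hom_group (q_ob l) (tens m)\<^esub>
       (inv\<^bsub>hom_group (q_ob l) (tens m)\<^esub> f (m, [\<alpha> \<odot> \<beta>, \<gamma>], l) \<otimes>\<^bsub>hom_group (q_ob l) (tens m)\<^esub> f (m, [\<alpha>, \<beta> \<odot> \<gamma>], l))
       \<otimes>\<^bsub>hom_group (q_ob l) (tens m)\<^esub> inv\<^bsub>hom_group (q_ob l) (tens m)\<^esub> pull D \<gamma> m (f (m, [\<alpha>, \<beta>], k))"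
    using c1 c2 p \<alpha> \<beta> \<gamma> V.inv_closed[unfolded hom_group_simps(1), OF c1]
    by (simp add: coboundary_eq term_at_def D_simps(1) V.finprod_upto(2)[unfolded One_nat_def] comp_at_def V.int_pow_minus_one
        del: hom_group_simps(2,3))
  then show ?thesis
    using represents_mult[OF represents_mult[OF represents_push[OF \<alpha> L[OF \<beta> \<gamma>]]
          represents_mult[OF represents_inv[OF c1 L[OF \<alpha>\<beta> \<gamma>]] L[OF \<alpha> \<beta>\<gamma>]]]
        represents_inv[OF p represents_pull[OF \<gamma> L[OF \<alpha> \<beta>]]]]
    by (simp add: algebra_simps)
qed

lemma represents_coboundary_3:
  assumes f: "f \<in> carrier (cochains \<C> D 3)"
    and L: "\<And>\<alpha> \<beta> \<gamma> m n k l. \<lbrakk>\<alpha> \<in> arrows m n; \<beta> \<in> arrows n k; \<gamma> \<in> arrows k l\<rbrakk>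
      \<Longrightarrow> represents l m (f (m, [\<alpha>, \<beta>, \<gamma>], l)) (L \<alpha> \<beta> \<gamma>)"
    and \<alpha>: "\<alpha> \<in> arrows m n" and \<beta>: "\<beta> \<in> arrows n k" and \<gamma>: "\<gamma> \<in> arrows k l" and \<delta>: "\<delta> \<in> arrows l j"
  shows "represents j m (coboundary \<C> D 3 f (m, [\<alpha>, \<beta>, \<gamma>, \<delta>], j))
    (\<lambda>x. T \<alpha> (L \<beta> \<gamma> \<delta> x) - L (\<alpha> \<odot> \<beta>) \<gamma> \<delta> x + L \<alpha> (\<beta> \<odot> \<gamma>) \<delta> x - L \<alpha> \<beta> (\<gamma> \<odot> \<delta>) x + L \<alpha> \<beta> \<gamma> (app \<delta> x))"
proof -
  interpret V: comm_group "hom_group (q_ob j) (tens m)" by (rule val_group)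
  have \<alpha>\<beta>: "\<alpha> \<odot> \<beta> \<in> arrows m k" by (rule comp_Q_arrows[OF \<alpha> \<beta>])
  have \<beta>\<gamma>: "\<beta> \<odot> \<gamma> \<in> arrows n l" by (rule comp_Q_arrows[OF \<beta> \<gamma>])
  have \<gamma>\<delta>: "\<gamma> \<odot> \<delta> \<in> arrows k j" by (rule comp_Q_arrows[OF \<gamma> \<delta>])
  have c: "f (c, [\<epsilon>, \<zeta>, \<eta>], e) \<in> op_hom (q_ob e) (tens c)"
    if "\<epsilon> \<in> arrows c d" "\<zeta> \<in> arrows d d'" "\<eta> \<in> arrows d' e" for \<epsilon> \<zeta> \<eta> c d d' e
    by (rule cochain_closed[OF f chains_intros(3)[OF that]])
  note c1 = c[OF \<alpha>\<beta> \<gamma> \<delta>] and c2 = c[OF \<alpha> \<beta>\<gamma> \<delta>] and c3 = c[OF \<alpha> \<beta> \<gamma>\<delta>]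
  note p = pull_closed[OF \<delta> c[OF \<alpha> \<beta> \<gamma>]]
  have "(m, [\<alpha>, \<beta>, \<gamma>, \<delta>], j) \<in> chains \<C> (Suc 3)" using chains_intros(4)[OF \<alpha> \<beta> \<gamma> \<delta>] by simp
  then have "coboundary \<C> D 3 f (m, [\<alpha>, \<beta>, \<gamma>, \<delta>], j)
     = push D j \<alpha> (f (n, [\<beta>, \<gamma>, \<delta>], j)) \<otimes>\<^bsub>hom_group (q_ob j) (tens m)\<^esub>
       (inv\<^bsub>hom_group (q_ob j) (tens m)\<^esub> f (m, [\<alpha> \<odot> \<beta>, \<gamma>, \<delta>], j) \<otimes>\<^bsub>hom_group (q_ob j) (tens m)\<^esub> f (m, [\<alpha>, \<beta> \<odot> \<gamma>, \<delta>], j)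
         \<otimes>\<^bsub>hom_group (q_ob j) (tens m)\<^esub> inv\<^bsub>hom_group (q_ob j) (tens m)\<^esub> f (m, [\<alpha>, \<beta>, \<gamma> \<odot> \<delta>], j))
       \<otimes>\<^bsub>hom_group (q_ob j) (tens m)\<^esub> pull D \<delta> m (f (m, [\<alpha>, \<beta>, \<gamma>], l))"
    using c1 c2 c3 p \<alpha> \<beta> \<gamma> \<delta> V.inv_closed[unfolded hom_group_simps(1), OF c1] V.inv_closed[unfolded hom_group_simps(1), OF c3]
    by (simp add: coboundary_eq term_at_def D_simps(1) V.finprod_upto(3)[unfolded One_nat_def] comp_at_def V.int_pow_minus_one
        del: hom_group_simps(2,3))
  then show ?thesis
    using represents_mult[OF represents_mult[OF represents_push[OF \<alpha> L[OF \<beta> \<gamma> \<delta>]]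
          represents_mult[OF represents_mult[OF represents_inv[OF c1 L[OF \<alpha>\<beta> \<gamma> \<delta>]] L[OF \<alpha> \<beta>\<gamma> \<delta>]]
            represents_inv[OF c3 L[OF \<alpha> \<beta> \<gamma>\<delta>]]]]
        represents_pull[OF \<delta> L[OF \<alpha> \<beta> \<gamma>]]]
    by (simp add: algebra_simps)
qed

lemma cochain_eqI:
  assumes "f \<in> carrier (cochains \<C> D n)" "g \<in> carrier (cochains \<C> D n)"
    and "\<And>m \<alpha>s k. (m, \<alpha>s, k) \<in> chains \<C> n \<Longrightarrow> f (m, \<alpha>s, k) = g (m, \<alpha>s, k)"
  shows "f = g"
proof (rule PiE_ext)
  show "f \<in> (\<Pi>\<^sub>E c\<in>chains \<C> n. carrier (case c of (c, \<alpha>s, c') \<Rightarrow> val D c' c))"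
    and "g \<in> (\<Pi>\<^sub>E c\<in>chains \<C> n. carrier (case c of (c, \<alpha>s, c') \<Rightarrow> val D c' c))"
    using assms(1,2) by (simp_all add: cochains_def)
  show "f c = g c" if "c \<in> chains \<C> n" for c
    using assms(3)[of "fst c" "fst (snd c)" "snd (snd c)"] that by simp
qed

lemma cochainI:
  assumes "f \<in> extensional (chains \<C> n)"
    and "\<And>m \<alpha>s k. (m, \<alpha>s, k) \<in> chains \<C> n \<Longrightarrow> f (m, \<alpha>s, k) \<in> op_hom (q_ob k) (tens m)"
  shows "f \<in> carrier (cochains \<C> D n)"
proof -
  have "f c \<in> carrier (case c of (c, \<alpha>s, c') \<Rightarrow> val D c' c)" if "c \<in> chains \<C> n" for c
    using assms(2)[of "fst c" "fst (snd c)" "snd (snd c)"] that by (simp add: D_simps case_prod_unfold)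
  then show ?thesis using assms(1) by (simp add: cochains_def PiE_iff)
qed

lemma one_cochain: "(m, \<alpha>s, k) \<in> chains \<C> n \<Longrightarrow> \<one>\<^bsub>cochains \<C> D n\<^esub> (m, \<alpha>s, k) = \<one>\<^bsub>hom_group (q_ob k) (tens m)\<^esub>"
  by (simp add: cochains_def D_simps)

lemma one_cochain_closed: "\<one>\<^bsub>cochains \<C> D n\<^esub> \<in> carrier (cochains \<C> D n)"
proof -
  interpret V: comm_group "hom_group (q_ob k) (tens m)" for k m by (rule val_group)
  show ?thesis
  proof (rule cochainI)
    show "\<one>\<^bsub>cochains \<C> D n\<^esub> \<in> extensional (chains \<C> n)" by (simp add: cochains_def)
  qed (use V.one_closed in \<open>simp only: one_cochain hom_group_simps(1)\<close>)
qed

definition lift where "lift k m h = (SOME \<phi>. represents k m h \<phi>)"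

lemma lift: "h \<in> op_hom (q_ob k) (tens m) \<Longrightarrow> represents k m h (lift k m h)"
  unfolding lift_def by (rule someI_ex[OF represents_ex])

abbreviation "lift1 f \<alpha> \<equiv> lift (Dom mod_Q \<alpha>) (Cod mod_Q \<alpha>) (f (Cod mod_Q \<alpha>, [\<alpha>], Dom mod_Q \<alpha>))"
abbreviation "lift2 f \<alpha> \<beta> \<equiv> lift (Dom mod_Q \<beta>) (Cod mod_Q \<alpha>) (f (Cod mod_Q \<alpha>, [\<alpha>, \<beta>], Dom mod_Q \<beta>))"
abbreviation "lift3 f \<alpha> \<beta> \<gamma> \<equiv> lift (Dom mod_Q \<gamma>) (Cod mod_Q \<alpha>) (f (Cod mod_Q \<alpha>, [\<alpha>, \<beta>, \<gamma>], Dom mod_Q \<gamma>))"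

lemma lift1: "\<lbrakk>f \<in> carrier (cochains \<C> D 1); \<alpha> \<in> arrows m n\<rbrakk> \<Longrightarrow> represents n m (f (m, [\<alpha>], n)) (lift1 f \<alpha>)"
  using lift[OF cochain_closed[OF _ chains_intros(1)]] by simp

lemma lift2: "\<lbrakk>f \<in> carrier (cochains \<C> D 2); \<alpha> \<in> arrows m n; \<beta> \<in> arrows n k\<rbrakk>
    \<Longrightarrow> represents k m (f (m, [\<alpha>, \<beta>], k)) (lift2 f \<alpha> \<beta>)"
  using lift[OF cochain_closed[OF _ chains_intros(2)]] by simp

lemma lift3: "\<lbrakk>f \<in> carrier (cochains \<C> D 3); \<alpha> \<in> arrows m n; \<beta> \<in> arrows n k; \<gamma> \<in> arrows k l\<rbrakk>
    \<Longrightarrow> represents l m (f (m, [\<alpha>, \<beta>, \<gamma>], l)) (lift3 f \<alpha> \<beta> \<gamma>)"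
  using lift[OF cochain_closed[OF _ chains_intros(3)]] by simp

lemma cochain_at_eqI:
  assumes "f \<in> carrier (cochains \<C> D n)" "g \<in> carrier (cochains \<C> D n)" "(m, \<alpha>s, k) \<in> chains \<C> n"
    and "represents k m (f (m, \<alpha>s, k)) \<phi>" "represents k m (g (m, \<alpha>s, k)) \<psi>"
    and "\<And>x. x \<in> carrier (F k) \<Longrightarrow> \<phi> x - \<psi> x \<in> R m"
  shows "f (m, \<alpha>s, k) = g (m, \<alpha>s, k)"
  by (rule represents_eqI[OF cochain_closed[OF assms(1,3)] cochain_closed[OF assms(2,3)] assms(4,5,6)])

lemma represents_one_cochain:
  "(m, \<alpha>s, k) \<in> chains \<C> n \<Longrightarrow> represents k m (\<one>\<^bsub>cochains \<C> D n\<^esub> (m, \<alpha>s, k)) (\<lambda>x. 0)"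
  by (simp only: one_cochain represents_one)

text \<open>On representatives the terms cancel exactly, because \<open>T\<close> is strictly
  functorial and composition is associative.\<close>

lemma coboundary_coboundary_1:
  assumes f: "f \<in> carrier (cochains \<C> D 1)"
  shows "coboundary \<C> D 2 (coboundary \<C> D 1 f) = \<one>\<^bsub>cochains \<C> D 3\<^esub>"
proof -
  have df: "coboundary \<C> D 1 f \<in> carrier (cochains \<C> D 2)"
    using coboundary_closed[OF f] by (simp only: Suc_1)
  have ddf: "coboundary \<C> D 2 (coboundary \<C> D 1 f) \<in> carrier (cochains \<C> D 3)"
    using coboundary_closed[OF df] by simp
  let ?L = "\<lambda>\<alpha> \<beta> x. T \<alpha> (lift1 f \<beta> x) - lift1 f (\<alpha> \<odot> \<beta>) x + lift1 f \<alpha> (app \<beta> x)"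
  show ?thesis
  proof (rule cochain_eqI[OF ddf one_cochain_closed])
    fix m \<alpha>s l assume c: "(m, \<alpha>s, l) \<in> chains \<C> 3"
    then obtain \<alpha> \<beta> \<gamma> n k where a: "\<alpha>s = [\<alpha>, \<beta>, \<gamma>]" and \<alpha>: "\<alpha> \<in> arrows m n" and \<beta>: "\<beta> \<in> arrows n k" and \<gamma>: "\<gamma> \<in> arrows k l"
      unfolding chains_iff by (elim exE conjE)
    have r: "represents l m (coboundary \<C> D 2 (coboundary \<C> D 1 f) (m, \<alpha>s, l))
        (\<lambda>x. T \<alpha> (?L \<beta> \<gamma> x) - ?L (\<alpha> \<odot> \<beta>) \<gamma> x + ?L \<alpha> (\<beta> \<odot> \<gamma>) x - ?L \<alpha> \<beta> (app \<gamma> x))"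
      unfolding a by (rule represents_coboundary_2[OF df represents_coboundary_1[OF f lift1[OF f]] \<alpha> \<beta> \<gamma>])
    show "coboundary \<C> D 2 (coboundary \<C> D 1 f) (m, \<alpha>s, l) = \<one>\<^bsub>cochains \<C> D 3\<^esub> (m, \<alpha>s, l)"
    proof (rule cochain_at_eqI[OF ddf one_cochain_closed c r represents_one_cochain[OF c]])
      fix x assume x: "x \<in> carrier (F l)"
      show "T \<alpha> (?L \<beta> \<gamma> x) - ?L (\<alpha> \<odot> \<beta>) \<gamma> x + ?L \<alpha> (\<beta> \<odot> \<gamma>) x - ?L \<alpha> \<beta> (app \<gamma> x) - 0 \<in> R m"
        unfolding T_add T_diff T_comp[OF \<alpha> \<beta>] comp_Q_assoc[OF \<alpha> \<beta> \<gamma>] app_comp[OF \<beta> \<gamma> x]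
        by simp
    qed
  qed
qed

lemma coboundary_coboundary_2:
  assumes f: "f \<in> carrier (cochains \<C> D 2)"
  shows "coboundary \<C> D 3 (coboundary \<C> D 2 f) = \<one>\<^bsub>cochains \<C> D 4\<^esub>"
proof -
  have df: "coboundary \<C> D 2 f \<in> carrier (cochains \<C> D 3)"
    using coboundary_closed[OF f] by simp
  have ddf: "coboundary \<C> D 3 (coboundary \<C> D 2 f) \<in> carrier (cochains \<C> D 4)"
    using coboundary_closed[OF df] by simp
  let ?L = "\<lambda>\<alpha> \<beta> \<gamma> x. T \<alpha> (lift2 f \<beta> \<gamma> x) - lift2 f (\<alpha> \<odot> \<beta>) \<gamma> x + lift2 f \<alpha> (\<beta> \<odot> \<gamma>) x - lift2 f \<alpha> \<beta> (app \<gamma> x)"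
  show ?thesis
  proof (rule cochain_eqI[OF ddf one_cochain_closed])
    fix m \<alpha>s j assume c: "(m, \<alpha>s, j) \<in> chains \<C> 4"
    then obtain \<alpha> \<beta> \<gamma> \<delta> n k l where a: "\<alpha>s = [\<alpha>, \<beta>, \<gamma>, \<delta>]"
      and \<alpha>: "\<alpha> \<in> arrows m n" and \<beta>: "\<beta> \<in> arrows n k" and \<gamma>: "\<gamma> \<in> arrows k l" and \<delta>: "\<delta> \<in> arrows l j"
      unfolding chains_iff by (elim exE conjE)
    have r: "represents j m (coboundary \<C> D 3 (coboundary \<C> D 2 f) (m, \<alpha>s, j))
        (\<lambda>x. T \<alpha> (?L \<beta> \<gamma> \<delta> x) - ?L (\<alpha> \<odot> \<beta>) \<gamma> \<delta> x + ?L \<alpha> (\<beta> \<odot> \<gamma>) \<delta> x - ?L \<alpha> \<beta> (\<gamma> \<odot> \<delta>) x + ?L \<alpha> \<beta> \<gamma> (app \<delta> x))"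
      unfolding a by (rule represents_coboundary_3[OF df represents_coboundary_2[OF f lift2[OF f]] \<alpha> \<beta> \<gamma> \<delta>])
    show "coboundary \<C> D 3 (coboundary \<C> D 2 f) (m, \<alpha>s, j) = \<one>\<^bsub>cochains \<C> D 4\<^esub> (m, \<alpha>s, j)"
    proof (rule cochain_at_eqI[OF ddf one_cochain_closed c r represents_one_cochain[OF c]])
      fix x assume x: "x \<in> carrier (F j)"
      show "T \<alpha> (?L \<beta> \<gamma> \<delta> x) - ?L (\<alpha> \<odot> \<beta>) \<gamma> \<delta> x + ?L \<alpha> (\<beta> \<odot> \<gamma>) \<delta> x - ?L \<alpha> \<beta> (\<gamma> \<odot> \<delta>) x + ?L \<alpha> \<beta> \<gamma> (app \<delta> x) - 0 \<in> R m"
        unfolding T_add T_diff T_comp[OF \<alpha> \<beta>] comp_Q_assoc[OF \<alpha> \<beta> \<gamma>] comp_Q_assoc[OF \<beta> \<gamma> \<delta>] app_comp[OF \<gamma> \<delta> x]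
        by simp
    qed
  qed
qed

text \<open>The vanishing lemmas produce values in the whole free abelian group, while a
  representative must be supported in \<open>supp m\<close>. Cutting off the rest is compatible with
  \<open>T\<close> and \<open>act\<close> and fixes \<open>R m\<close>, so all congruences
  survive.\<close>

definition res :: "nat \<Rightarrow> ((nat \<times> 'l) word set set \<times> 'b \<Rightarrow>\<^sub>0 int) \<Rightarrow> (nat \<times> 'l) word set set \<times> 'b \<Rightarrow>\<^sub>0 int"
  where "res m = frag_extend (\<lambda>p. if p \<in> supp m then frag_of p else 0)"

lemma keys_res: "Poly_Mapping.keys (res m z) \<subseteq> supp m"
  unfolding res_def by (rule keys_frag_extend_subset[of _ UNIV]) auto

lemma res_on_supp: assumes "Poly_Mapping.keys z \<subseteq> supp m" shows "res m z = z"
proof -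
  have "res m z = frag_extend frag_of z"
    unfolding res_def by (rule frag_extend_eq) (use assms in auto)
  then show ?thesis by (simp flip: frag_expansion)
qed

lemma res_diff: "res m (a - b) = res m a - res m b"
  by (simp add: res_def frag_extend_diff)

lemma res_add: "res m (a + b) = res m a + res m b"
  by (simp add: res_def frag_extend_add)

lemma res_R: "a \<in> R m \<Longrightarrow> res m a \<in> R m"
  by (simp add: res_on_supp Q.rels_Z)

lemma res_T: "\<alpha> \<in> arrows m n \<Longrightarrow> res m (T \<alpha> z) = T \<alpha> z"
  by (rule res_on_supp[OF T_supp])

lemma T_res: "\<alpha> \<in> arrows m n \<Longrightarrow> T \<alpha> (res n z) = T \<alpha> z"
  by (induction z rule: frag_univ_induct) (auto simp: T_def res_def frag_extend_diff split: if_splits)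

lemma res_act: "res m (act s z) = act s (res m z)"
  by (induction z rule: frag_univ_induct) (auto simp: act_def res_def frag_extend_diff Q.ract_closed split: if_splits)

lemma equivariant_on_res:
  assumes \<phi>: "equivariant_on k m \<phi>" shows "equivariant_on k m (\<lambda>x. res m (\<phi> x))"
  unfolding equivariant_on_def additive_on_def
proof (intro conjI ballI)
  show "res m (\<phi> (x \<otimes>\<^bsub>F k\<^esub> y)) - res m (\<phi> x) - res m (\<phi> y) \<in> R m" if "x \<in> carrier (F k)" "y \<in> carrier (F k)" for x y
    using res_R[OF additive_onD[OF equivariant_onD(1)[OF \<phi>] that]] by (simp only: res_diff)
  show "res m (\<phi> (x \<triangleleft>\<^bsub>F k\<^esub> s)) - act s (res m (\<phi> x)) \<in> R m" if "s \<in> S" "x \<in> carrier (F k)" for x s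
    using res_R[OF equivariant_onD(2)[OF \<phi> that]] by (simp only: res_diff res_act)
qed

definition unlift where "unlift k m \<phi> = (SOME h. h \<in> op_hom (q_ob k) (tens m) \<and> represents k m h (\<lambda>x. res m (\<phi> x)))"

lemma unlift:
  assumes "equivariant_on k m \<phi>"
  shows "unlift k m \<phi> \<in> op_hom (q_ob k) (tens m)" "represents k m (unlift k m \<phi>) (\<lambda>x. res m (\<phi> x))"
proof -
  have "\<exists>h. h \<in> op_hom (q_ob k) (tens m) \<and> represents k m h (\<lambda>x. res m (\<phi> x))"
    using represented_ex[OF equivariant_on_res[OF assms] keys_res] by blast
  from someI_ex[OF this] show "unlift k m \<phi> \<in> op_hom (q_ob k) (tens m)" "represents k m (unlift k m \<phi>) (\<lambda>x. res m (\<phi> x))"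
    unfolding unlift_def by blast+
qed

text \<open>The cocycle is lifted to representatives, where \<open>equivariant_vanishing_2\<close>
  supplies g. Equivariance of g is what makes it descend to homomorphisms by \<open>unlift\<close>,
  and these form the primitive.\<close>

lemma cocycle_2_coboundary:
  assumes f: "f \<in> carrier (cochains \<C> D 2)" and df: "coboundary \<C> D 2 f = \<one>\<^bsub>cochains \<C> D 3\<^esub>"
  shows "f \<in> coboundary \<C> D 1 ` carrier (cochains \<C> D 1)"
proof -
  have eqv: "equivariant_on k m (lift2 f \<alpha> \<beta>)" if "\<alpha> \<in> arrows m n" "\<beta> \<in> arrows n k" for \<alpha> \<beta> m n k
    by (rule represents_equivariant[OF cochain_closed[OF f chains_intros(2)[OF that]] lift2[OF f that]])
  have coc: "T \<alpha> (lift2 f \<beta> \<gamma> x) - lift2 f (\<alpha> \<odot> \<beta>) \<gamma> x + lift2 f \<alpha> (\<beta> \<odot> \<gamma>) x - lift2 f \<alpha> \<beta> (app \<gamma> x) \<in> R m"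
    if \<alpha>: "\<alpha> \<in> arrows m n" and \<beta>: "\<beta> \<in> arrows n k" and \<gamma>: "\<gamma> \<in> arrows k l" and x: "x \<in> carrier (F l)" for \<alpha> \<beta> \<gamma> m n k l x
    using represents_unique[OF represents_coboundary_2[OF f lift2[OF f] \<alpha> \<beta> \<gamma>, unfolded df]
        represents_one_cochain[OF chains_intros(3)[OF \<alpha> \<beta> \<gamma>]] x] by (simp only: diff_zero)
  have "\<exists>g. (\<forall>\<alpha> m n. \<alpha> \<in> arrows m n \<longrightarrow> equivariant_on n m (g \<alpha>)) \<and>
    (\<forall>\<alpha> \<beta> m n k x. \<alpha> \<in> arrows m n \<longrightarrow> \<beta> \<in> arrows n k \<longrightarrow> x \<in> carrier (F k) \<longrightarrow>
      T \<alpha> (g \<beta> x) - g (\<alpha> \<odot> \<beta>) x + g \<alpha> (app \<beta> x) - lift2 f \<alpha> \<beta> x \<in> R m)" (is "\<exists>g. ?P g \<and> ?Q g")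
    by (rule equivariant_vanishing_2; (rule eqv coc); assumption)
  then obtain g where g: "?P g" "?Q g" by (elim exE conjE)
  note ge = g(1)[rule_format] and gf = g(2)[rule_format]
  define G where "G = (\<lambda>(m, \<alpha>s, k) \<in> chains \<C> 1. unlift k m (g (hd \<alpha>s)))"
  have G: "G (m, [\<alpha>], n) = unlift n m (g \<alpha>)" if "\<alpha> \<in> arrows m n" for \<alpha> m n
    using chains_intros(1)[OF that] by (simp add: G_def)
  have Gc: "G \<in> carrier (cochains \<C> D 1)"
  proof (rule cochainI)
    show "G \<in> extensional (chains \<C> 1)" by (simp add: G_def)
    fix m \<alpha>s k assume "(m, \<alpha>s, k) \<in> chains \<C> 1"
    then obtain \<alpha> where a: "\<alpha>s = [\<alpha>]" "\<alpha> \<in> arrows m k" unfolding chains_iff by (elim exE conjE)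
    show "G (m, \<alpha>s, k) \<in> op_hom (q_ob k) (tens m)" unfolding a(1) G[OF a(2)] by (rule unlift(1)[OF ge[OF a(2)]])
  qed
  have Gr: "represents n m (G (m, [\<alpha>], n)) (\<lambda>x. res (Cod mod_Q \<alpha>) (g \<alpha> x))" if "\<alpha> \<in> arrows m n" for \<alpha> m n
    unfolding G[OF that] arrows_Cod[OF that] by (rule unlift(2)[OF ge[OF that]])
  have dG: "coboundary \<C> D 1 G \<in> carrier (cochains \<C> D 2)"
    using coboundary_closed[OF Gc] by (simp only: Suc_1)
  have "f = coboundary \<C> D 1 G"
  proof (rule cochain_eqI[OF f dG])
    fix m \<alpha>s k assume c: "(m, \<alpha>s, k) \<in> chains \<C> 2"
    then obtain \<alpha> \<beta> n where a: "\<alpha>s = [\<alpha>, \<beta>]" and \<alpha>: "\<alpha> \<in> arrows m n" and \<beta>: "\<beta> \<in> arrows n k"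
      unfolding chains_iff by (elim exE conjE)
    note rf = lift2[OF f \<alpha> \<beta>] and rG = represents_coboundary_1[OF Gc Gr \<alpha> \<beta>]
    show "f (m, \<alpha>s, k) = coboundary \<C> D 1 G (m, \<alpha>s, k)"
      unfolding a
    proof (rule cochain_at_eqI[OF f dG c[unfolded a] rf rG])
      fix x assume x: "x \<in> carrier (F k)"
      \<comment> \<open>The chosen representative of the cocycle is already supported, so applying
        \<open>res m\<close> to the congruence for g changes only the terms with g.\<close>
      have "res m (lift2 f \<alpha> \<beta> x) = lift2 f \<alpha> \<beta> x" by (rule res_on_supp[OF representsD(1)[OF rf x]])
      then have "T \<alpha> (g \<beta> x) - res m (g (\<alpha> \<odot> \<beta>) x) + res m (g \<alpha> (app \<beta> x)) - lift2 f \<alpha> \<beta> x \<in> R m"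
        using res_R[OF gf[OF \<alpha> \<beta> x]] by (simp only: res_diff res_add res_T[OF \<alpha>])
      from R_minus[OF this]
      show "lift2 f \<alpha> \<beta> x - (T \<alpha> (res (Cod mod_Q \<beta>) (g \<beta> x)) - res (Cod mod_Q (\<alpha> \<odot> \<beta>)) (g (\<alpha> \<odot> \<beta>) x)
          + res (Cod mod_Q \<alpha>) (g \<alpha> (app \<beta> x))) \<in> R m"
        by (simp only: arrows_Cod[OF \<alpha>] arrows_Cod[OF \<beta>] arrows_Cod[OF comp_Q_arrows[OF \<alpha> \<beta>]] T_res[OF \<alpha>] minus_diff_eq)
    qed
  qed
  then show ?thesis using Gc by (rule image_eqI)
qed

lemma cocycle_3_coboundary:
  assumes f: "f \<in> carrier (cochains \<C> D 3)" and df: "coboundary \<C> D 3 f = \<one>\<^bsub>cochains \<C> D 4\<^esub>"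
  shows "f \<in> coboundary \<C> D 2 ` carrier (cochains \<C> D 2)"
proof -
  have eqv: "equivariant_on l m (lift3 f \<alpha> \<beta> \<gamma>)"
    if "\<alpha> \<in> arrows m n" "\<beta> \<in> arrows n k" "\<gamma> \<in> arrows k l" for \<alpha> \<beta> \<gamma> m n k l
    by (rule represents_equivariant[OF cochain_closed[OF f chains_intros(3)[OF that]] lift3[OF f that]])
  have coc: "T \<alpha> (lift3 f \<beta> \<gamma> \<delta> x) - lift3 f (\<alpha> \<odot> \<beta>) \<gamma> \<delta> x + lift3 f \<alpha> (\<beta> \<odot> \<gamma>) \<delta> x
      - lift3 f \<alpha> \<beta> (\<gamma> \<odot> \<delta>) x + lift3 f \<alpha> \<beta> \<gamma> (app \<delta> x) \<in> R m"
    if \<alpha>: "\<alpha> \<in> arrows m n" and \<beta>: "\<beta> \<in> arrows n k" and \<gamma>: "\<gamma> \<in> arrows k l" and \<delta>: "\<delta> \<in> arrows l j"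
      and x: "x \<in> carrier (F j)" for \<alpha> \<beta> \<gamma> \<delta> m n k l j x
    using represents_unique[OF represents_coboundary_3[OF f lift3[OF f] \<alpha> \<beta> \<gamma> \<delta>, unfolded df]
        represents_one_cochain[OF chains_intros(4)[OF \<alpha> \<beta> \<gamma> \<delta>]] x] by (simp only: diff_zero)
  have "\<exists>g. (\<forall>\<alpha> \<beta> m n k. \<alpha> \<in> arrows m n \<longrightarrow> \<beta> \<in> arrows n k \<longrightarrow> equivariant_on k m (g \<alpha> \<beta>)) \<and>
    (\<forall>\<alpha> \<beta> \<gamma> m n k l x. \<alpha> \<in> arrows m n \<longrightarrow> \<beta> \<in> arrows n k \<longrightarrow> \<gamma> \<in> arrows k l \<longrightarrow> x \<in> carrier (F l) \<longrightarrow>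
      T \<alpha> (g \<beta> \<gamma> x) - g (\<alpha> \<odot> \<beta>) \<gamma> x + g \<alpha> (\<beta> \<odot> \<gamma>) x - g \<alpha> \<beta> (app \<gamma> x) - lift3 f \<alpha> \<beta> \<gamma> x \<in> R m)" (is "\<exists>g. ?P g \<and> ?Q g")
    by (rule equivariant_vanishing_3; (rule eqv coc); assumption)
  then obtain g where g: "?P g" "?Q g" by (elim exE conjE)
  note ge = g(1)[rule_format] and gf = g(2)[rule_format]
  define G where "G = (\<lambda>(m, \<alpha>s, k) \<in> chains \<C> 2. unlift k m (g (hd \<alpha>s) (last \<alpha>s)))"
  have G: "G (m, [\<alpha>, \<beta>], k) = unlift k m (g \<alpha> \<beta>)" if "\<alpha> \<in> arrows m n" "\<beta> \<in> arrows n k" for \<alpha> \<beta> m n k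
    using chains_intros(2)[OF that] by (simp add: G_def)
  have Gc: "G \<in> carrier (cochains \<C> D 2)"
  proof (rule cochainI)
    show "G \<in> extensional (chains \<C> 2)" by (simp add: G_def)
    fix m \<alpha>s k assume "(m, \<alpha>s, k) \<in> chains \<C> 2"
    then obtain \<alpha> \<beta> n where a: "\<alpha>s = [\<alpha>, \<beta>]" "\<alpha> \<in> arrows m n" "\<beta> \<in> arrows n k" unfolding chains_iff by (elim exE conjE)
    show "G (m, \<alpha>s, k) \<in> op_hom (q_ob k) (tens m)" unfolding a(1) G[OF a(2,3)] by (rule unlift(1)[OF ge[OF a(2,3)]])
  qed
  have Gr: "represents k m (G (m, [\<alpha>, \<beta>], k)) (\<lambda>x. res (Cod mod_Q \<alpha>) (g \<alpha> \<beta> x))"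
    if "\<alpha> \<in> arrows m n" "\<beta> \<in> arrows n k" for \<alpha> \<beta> m n k
    unfolding G[OF that] arrows_Cod[OF that(1)] by (rule unlift(2)[OF ge[OF that]])
  have dG: "coboundary \<C> D 2 G \<in> carrier (cochains \<C> D 3)"
    using coboundary_closed[OF Gc] by simp
  have "f = coboundary \<C> D 2 G"
  proof (rule cochain_eqI[OF f dG])
    fix m \<alpha>s l assume c: "(m, \<alpha>s, l) \<in> chains \<C> 3"
    then obtain \<alpha> \<beta> \<gamma> n k where a: "\<alpha>s = [\<alpha>, \<beta>, \<gamma>]"
      and \<alpha>: "\<alpha> \<in> arrows m n" and \<beta>: "\<beta> \<in> arrows n k" and \<gamma>: "\<gamma> \<in> arrows k l"
      unfolding chains_iff by (elim exE conjE)
    note rf = lift3[OF f \<alpha> \<beta> \<gamma>] and rG = represents_coboundary_2[OF Gc Gr \<alpha> \<beta> \<gamma>]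
    show "f (m, \<alpha>s, l) = coboundary \<C> D 2 G (m, \<alpha>s, l)"
      unfolding a
    proof (rule cochain_at_eqI[OF f dG c[unfolded a] rf rG])
      fix x assume x: "x \<in> carrier (F l)"
      have "res m (lift3 f \<alpha> \<beta> \<gamma> x) = lift3 f \<alpha> \<beta> \<gamma> x" by (rule res_on_supp[OF representsD(1)[OF rf x]])
      then have "T \<alpha> (g \<beta> \<gamma> x) - res m (g (\<alpha> \<odot> \<beta>) \<gamma> x) + res m (g \<alpha> (\<beta> \<odot> \<gamma>) x) - res m (g \<alpha> \<beta> (app \<gamma> x))
          - lift3 f \<alpha> \<beta> \<gamma> x \<in> R m"
        using res_R[OF gf[OF \<alpha> \<beta> \<gamma> x]] by (simp only: res_diff res_add res_T[OF \<alpha>])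
      from R_minus[OF this]
      show "lift3 f \<alpha> \<beta> \<gamma> x - (T \<alpha> (res (Cod mod_Q \<beta>) (g \<beta> \<gamma> x)) - res (Cod mod_Q (\<alpha> \<odot> \<beta>)) (g (\<alpha> \<odot> \<beta>) \<gamma> x)
          + res (Cod mod_Q \<alpha>) (g \<alpha> (\<beta> \<odot> \<gamma>) x) - res (Cod mod_Q \<alpha>) (g \<alpha> \<beta> (app \<gamma> x))) \<in> R m"
        by (simp only: arrows_Cod[OF \<alpha>] arrows_Cod[OF \<beta>] arrows_Cod[OF comp_Q_arrows[OF \<alpha> \<beta>]] T_res[OF \<alpha>] minus_diff_eq)
    qed
  qed
  then show ?thesis using Gc by (rule image_eqI)
qed

lemma coboundaries_2: "coboundaries \<C> D 2 = cocycles \<C> D 2"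
proof -
  have "coboundaries \<C> D 2 = coboundary \<C> D 1 ` carrier (cochains \<C> D 1)" unfolding numeral_2_eq_2 by simp
  moreover have "cocycles \<C> D 2 = {f \<in> carrier (cochains \<C> D 2). coboundary \<C> D 2 f = \<one>\<^bsub>cochains \<C> D 3\<^esub>}"
    by (simp add: cocycles_def kernel_def)
  moreover have "coboundary \<C> D 1 f \<in> carrier (cochains \<C> D 2)" if "f \<in> carrier (cochains \<C> D 1)" for f
    using coboundary_closed[OF that] by (simp only: Suc_1)
  ultimately show ?thesis using coboundary_coboundary_1 cocycle_2_coboundary by (auto simp del: One_nat_def)
qed

lemma coboundaries_3: "coboundaries \<C> D 3 = cocycles \<C> D 3"
proof -
  have "coboundaries \<C> D (Suc 2) = coboundary \<C> D 2 ` carrier (cochains \<C> D 2)" by (rule coboundaries.simps(2))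
  then have "coboundaries \<C> D 3 = coboundary \<C> D 2 ` carrier (cochains \<C> D 2)" by simp
  moreover have "cocycles \<C> D 3 = {f \<in> carrier (cochains \<C> D 3). coboundary \<C> D 3 f = \<one>\<^bsub>cochains \<C> D 4\<^esub>}"
    by (simp add: cocycles_def kernel_def)
  moreover have "coboundary \<C> D 2 f \<in> carrier (cochains \<C> D 3)" if "f \<in> carrier (cochains \<C> D 2)" for f
    using coboundary_closed[OF that] by simp
  ultimately show ?thesis using coboundary_coboundary_2 cocycle_3_coboundary by auto
qed

end

theorem theoremA0p1:
  fixes S :: "'l::monoid_add set"
    and B :: "('b, 'l monoid_ring) bi_op_group"
  assumes "free_monoid_on S"
    and "bimodule B"
  shows "trivial_group (HML 2 B) \<and> trivial_group (HML 3 B)"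
proof -
  interpret mac_lane_coefficients B S
    by (rule mac_lane_coefficients.intro[OF assms(2,1)])
  show ?thesis unfolding HML_def using trivial_cohomology[OF coboundaries_2] trivial_cohomology[OF coboundaries_3] ..
qed

end
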